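(* Let $B_t$ be $d$-dimensional Brownian motion with its natural filtration, and let $M_t=\int_0^tH_s\cdot dB_s$, $N_t=\int_0^tK_s\cdot dB_s$ with $H,K$ predictable $\mathbb{R}^d$-valued, $\mathbb{E}\int_0^t(|H_s|^2+|K_s|^2)ds<\infty$. Let $(A,B)$ be a $d\times d$ conformal pair with $\|A\|=\|B\|\le1$. Define $Z_t=X_t+iY_t=(A+iB)*(M_t+iN_t)$, where $X_t=A*M_t-B*N_t$ and $Y_t=A*N_t+B*M_t$. Then $Z$ is a conformal martingale and \[ \|(A+iB)*(M_t+iN_t)\|_p\le\frac{\sqrt2}{C_p(2)}(p^*-1)\|M_t+iN_t\|_p,\qquad 1<p<\infty. \]
   Context: Real $d\times d$ matrices $(A,B)$ form a conformal pair if $|Ax|=|Bx|$ and $\langle Ax,Bx\rangle=0$ for all $x\in\mathbb{R}^d$; $\|A\|$ is the Euclidean operator norm. For a real matrix $C$ and $M_t=\int_0^tH_s\cdot dB_s$, $C*M_t=\int_0^tCH_s\cdot dB_s$. $Z=X+iY$ is conformal if $\langle X\rangle=\langle Y\rangle$ and $\langle X,Y\rangle=0$. $\|\cdot\|_p$ is the $L^p(\mathbb{P})$ norm with the complex modulus; $p^*=\max\{p,p/(p-1)\}$; $C_p(2)=\Big(\frac{\Gamma(\frac{p+1}{2})}{\sqrt\pi\,\Gamma(\frac{p+2}{2})}\Big)^{1/p}$. *)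

theory Defs
  imports "HOL-Probability.Probability"
begin

definition nat_filt :: "'a measure \<Rightarrow> (real \<Rightarrow> 'a \<Rightarrow> real^'d) \<Rightarrow> real \<Rightarrow> 'a measure" where
  "nat_filt M W t = sigma (space M)
     {W s -` U \<inter> space M | s U. s \<in> {0..t} \<and> U \<in> sets borel}"

definition brownian_motion :: "'a measure \<Rightarrow> (real \<Rightarrow> 'a \<Rightarrow> real^'d::finite) \<Rightarrow> bool" where
  "brownian_motion M W \<longleftrightarrow>
     (\<forall>t. W t \<in> borel_measurable M) \<and>
     (AE \<omega> in M. W 0 \<omega> = 0 \<and> continuous_on {0..} (\<lambda>t. W t \<omega>)) \<and>
     (\<forall>(n::nat) (\<tau>::nat \<Rightarrow> real). \<tau> 0 = 0 \<and> (\<forall>i<n. \<tau> i < \<tau> (Suc i)) \<longrightarrow>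
        prob_space.indep_vars M (\<lambda>_. borel)
          (\<lambda>(i, j) \<omega>. (W (\<tau> (Suc i)) \<omega> - W (\<tau> i) \<omega>) $ j) ({..<n} \<times> (UNIV :: 'd set)) \<and>
        (\<forall>i<n. \<forall>j. distributed M lborel (\<lambda>\<omega>. (W (\<tau> (Suc i)) \<omega> - W (\<tau> i) \<omega>) $ j)
                 (\<lambda>x. ennreal (normal_density 0 (sqrt (\<tau> (Suc i) - \<tau> i)) x))))"

definition pred_sigma :: "'a measure \<Rightarrow> (real \<Rightarrow> 'a measure) \<Rightarrow> (real \<times> 'a) measure" where
  "pred_sigma M F = sigma ({0..} \<times> space M)
     ({{s<..t} \<times> A | s t A. 0 \<le> s \<and> s \<le> t \<and> A \<in> sets (F s)} \<union>
      {{0} \<times> A | A. A \<in> sets (F 0)})"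

definition predictable :: "'a measure \<Rightarrow> (real \<Rightarrow> 'a measure) \<Rightarrow> (real \<Rightarrow> 'a \<Rightarrow> 'b::topological_space) \<Rightarrow> bool" where
  "predictable M F H \<longleftrightarrow> (\<lambda>(t, \<omega>). H t \<omega>) \<in> pred_sigma M F \<rightarrow>\<^sub>M borel"

definition simple_pred :: "(real \<Rightarrow> 'a measure) \<Rightarrow> nat \<Rightarrow> (nat \<Rightarrow> real) \<Rightarrow> (nat \<Rightarrow> 'a \<Rightarrow> real^'d) \<Rightarrow> bool" where
  "simple_pred F n \<tau> \<xi> \<longleftrightarrow> 0 \<le> \<tau> 0 \<and> (\<forall>i<n. \<tau> i < \<tau> (Suc i)) \<and>
     (\<forall>i<n. \<xi> i \<in> borel_measurable (F (\<tau> i)) \<and> bounded (range (\<xi> i)))"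

definition simple_proc :: "nat \<Rightarrow> (nat \<Rightarrow> real) \<Rightarrow> (nat \<Rightarrow> 'a \<Rightarrow> real^'d) \<Rightarrow> real \<Rightarrow> 'a \<Rightarrow> real^'d" where
  "simple_proc n \<tau> \<xi> t \<omega> = (\<Sum>i<n. indicator {\<tau> i<..\<tau> (Suc i)} t *\<^sub>R \<xi> i \<omega>)"

definition simple_int :: "(real \<Rightarrow> 'a \<Rightarrow> real^'d) \<Rightarrow> nat \<Rightarrow> (nat \<Rightarrow> real) \<Rightarrow> (nat \<Rightarrow> 'a \<Rightarrow> real^'d) \<Rightarrow> real \<Rightarrow> 'a \<Rightarrow> real" where
  "simple_int W n \<tau> \<xi> t \<omega> =
     (\<Sum>i<n. \<xi> i \<omega> \<bullet> (W (min t (\<tau> (Suc i))) \<omega> - W (min t (\<tau> i)) \<omega>))"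

text \<open>Ito integral (int_0^t H_s . dW_s): the L^2(P)-limit of the integrals of simple predictable
  processes converging to H in L^2(ds x dP) on [0,t] (a version of it; unique a.s.).\<close>
definition ito_int :: "'a measure \<Rightarrow> (real \<Rightarrow> 'a measure) \<Rightarrow> (real \<Rightarrow> 'a \<Rightarrow> real^'d) \<Rightarrow>
    (real \<Rightarrow> 'a \<Rightarrow> real^'d) \<Rightarrow> real \<Rightarrow> 'a \<Rightarrow> real" where
  "ito_int M F W H t = (SOME X. X \<in> borel_measurable M \<and>
     (\<exists>ns \<tau>s \<xi>s. (\<forall>k. simple_pred F (ns k) (\<tau>s k) (\<xi>s k)) \<and>
       (\<lambda>k. \<integral>\<^sup>+\<omega>. (\<integral>\<^sup>+s\<in>{0..t}. ennreal ((norm (H s \<omega> - simple_proc (ns k) (\<tau>s k) (\<xi>s k) s \<omega>))\<^sup>2) \<partial>lborel) \<partial>M)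
          \<longlonglongrightarrow> 0 \<and>
       (\<lambda>k. \<integral>\<^sup>+\<omega>. ennreal ((simple_int W (ns k) (\<tau>s k) (\<xi>s k) t \<omega> - X \<omega>)\<^sup>2) \<partial>M) \<longlonglongrightarrow> 0))"

definition mat_ito :: "'a measure \<Rightarrow> (real \<Rightarrow> 'a measure) \<Rightarrow> (real \<Rightarrow> 'a \<Rightarrow> real^'d) \<Rightarrow>
    real^'d^'d \<Rightarrow> (real \<Rightarrow> 'a \<Rightarrow> real^'d) \<Rightarrow> real \<Rightarrow> 'a \<Rightarrow> real" where
  "mat_ito M F W C H = ito_int M F W (\<lambda>s \<omega>. C *v H s \<omega>)"

text \<open>Adaptedness up to null sets (i.e. w.r.t. the augmented filtration).\<close>
definition real_martingale :: "'a measure \<Rightarrow> (real \<Rightarrow> 'a measure) \<Rightarrow> (real \<Rightarrow> 'a \<Rightarrow> real) \<Rightarrow> bool" where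
  "real_martingale M F X \<longleftrightarrow>
     (\<forall>t\<ge>0. integrable M (X t) \<and>
        (\<exists>Y \<in> borel_measurable (F t). AE \<omega> in M. X t \<omega> = Y \<omega>)) \<and>
     (\<forall>s t. 0 \<le> s \<longrightarrow> s \<le> t \<longrightarrow> (AE \<omega> in M. real_cond_exp M (F s) (X t) \<omega> = X s \<omega>))"

definition complex_martingale :: "'a measure \<Rightarrow> (real \<Rightarrow> 'a measure) \<Rightarrow> (real \<Rightarrow> 'a \<Rightarrow> complex) \<Rightarrow> bool" where
  "complex_martingale M F Z \<longleftrightarrow>
     real_martingale M F (\<lambda>t \<omega>. Re (Z t \<omega>)) \<and> real_martingale M F (\<lambda>t \<omega>. Im (Z t \<omega>))"

definition conv_in_prob :: "'a measure \<Rightarrow> (nat \<Rightarrow> 'a \<Rightarrow> real) \<Rightarrow> ('a \<Rightarrow> real) \<Rightarrow> bool" where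
  "conv_in_prob M f g \<longleftrightarrow>
     (\<forall>\<epsilon>>0. (\<lambda>n. measure M {\<omega> \<in> space M. \<bar>f n \<omega> - g \<omega>\<bar> > \<epsilon>}) \<longlonglongrightarrow> 0)"

definition dyadic_cov :: "(real \<Rightarrow> 'a \<Rightarrow> real) \<Rightarrow> (real \<Rightarrow> 'a \<Rightarrow> real) \<Rightarrow> real \<Rightarrow> nat \<Rightarrow> 'a \<Rightarrow> real" where
  "dyadic_cov X Y t n \<omega> = (\<Sum>k<2^n.
     (X (t * real (Suc k) / 2^n) \<omega> - X (t * real k / 2^n) \<omega>) *
     (Y (t * real (Suc k) / 2^n) \<omega> - Y (t * real k / 2^n) \<omega>))"

definition conformal :: "'a measure \<Rightarrow> (real \<Rightarrow> 'a \<Rightarrow> complex) \<Rightarrow> bool" where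
  "conformal M Z \<longleftrightarrow> (\<forall>t\<ge>0.
     let X = (\<lambda>s \<omega>. Re (Z s \<omega>)); Y = (\<lambda>s \<omega>. Im (Z s \<omega>)) in
     \<exists>V \<in> borel_measurable M. conv_in_prob M (dyadic_cov X X t) V \<and>
        conv_in_prob M (dyadic_cov Y Y t) V \<and> conv_in_prob M (dyadic_cov X Y t) (\<lambda>_. 0))"

definition conformal_martingale :: "'a measure \<Rightarrow> (real \<Rightarrow> 'a measure) \<Rightarrow> (real \<Rightarrow> 'a \<Rightarrow> complex) \<Rightarrow> bool" where
  "conformal_martingale M F Z \<longleftrightarrow> complex_martingale M F Z \<and> conformal M Z"

definition conformal_pair :: "real^'d^'d \<Rightarrow> real^'d^'d \<Rightarrow> bool" where
  "conformal_pair A B \<longleftrightarrow> (\<forall>x. norm (A *v x) = norm (B *v x) \<and> (A *v x) \<bullet> (B *v x) = 0)"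

definition op_norm :: "real^'d^'d \<Rightarrow> real" where
  "op_norm A = onorm (\<lambda>x. A *v x)"

definition lp_norm :: "'a measure \<Rightarrow> real \<Rightarrow> ('a \<Rightarrow> complex) \<Rightarrow> ennreal" where
  "lp_norm M p f = (let I = (\<integral>\<^sup>+\<omega>. ennreal (cmod (f \<omega>) powr p) \<partial>M) in
     if I = \<infinity> then \<infinity> else ennreal (enn2real I powr (1 / p)))"

definition pstar :: "real \<Rightarrow> real" where
  "pstar p = max p (p / (p - 1))"

definition Cp2 :: "real \<Rightarrow> real" where
  "Cp2 p = (Gamma ((p + 1) / 2) / (sqrt pi * Gamma ((p + 2) / 2))) powr (1 / p)"

end

theory Submission
  imports Defs
begin

text \<open>For every angle \<open>\<theta>\<close>, \<open>cos \<theta> X + sin \<theta> Y\<close> is a real stochastic integral whose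
integrand has, by conformality, the norm of \<open>A H - B K\<close>, which is at most \<open>sqrt 2\<close> times that of
\<open>(H, K)\<close>. Burkholder's inequality for differentially subordinate integrals therefore bounds its
\<open>L\<^sup>p\<close> norm by \<open>sqrt 2 (p\<^sup>* - 1)\<close> times that of \<open>M + i N\<close>, and averaging
\<open>\<bar>cos \<theta> X + sin \<theta> Y\<bar>\<^sup>p\<close> over \<open>\<theta>\<close> gives \<open>C\<^sub>p(2)\<^sup>p \<bar>Z\<bar>\<^sup>p\<close> by a Beta integral.

Burkholder's inequality is obtained without Ito's formula, by following simple integrands along
dyadic grids. The function \<open>bw c x y\<close> is \<open>y\<^sup>2 - x\<^sup>2\<close> where \<open>\<bar>x\<bar> + \<bar>y\<bar> \<le> c\<close> and \<open>c\<^sup>2 - 2 c x\<close> elsewhere. It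
satisfies a one-step second-order inequality whose error, integrated over \<open>c\<close>, is at most the cube
of the increment, and so vanishes with the mesh of the grid. Integrating \<open>bw\<close>
against \<open>c powr (p - 3)\<close> then yields Burkholder's function for \<open>p < 2\<close>; for \<open>p > 2\<close> one integrates, up to a
truncation level, \<open>y\<^sup>2 - x\<^sup>2 + bw c y x\<close>.\<close>

section \<open>Brownian increments and the filtration\<close>

text \<open>Bounding \<open>Z\<close> in one stroke would cost |u|^2 + |v|^2 = 2 |u|^2 for the
  integrands u = A H - B K and v = A K + B H, hence the constant 2 (p* - 1). A single direction
  costs |u|^2; the price is 1 / C_p(2), where C_p(2) is the L^p norm of cos at a uniform angle. Both
  constants agree at p = 2, and the averaged one is smaller for p > 2. For one fixed
  \<open>c\<close>, a step across the edge of the diamond costs a squared overshoot, comparable to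
  the mesh. But a given step crosses the edge only for \<open>c\<close> in an interval no longer
  than the step, so integrating in \<open>c\<close> gains the missing factor. What remains is an
  inequality for almost every \<open>c\<close>, enough for anything that is an integral over
  \<open>c\<close>. For p > 2 the weight is not integrable at infinity; exchanging x and y and
  adding y^2 - x^2 makes each layer vanish for large \<open>c\<close>. Truncation enters because the
  transformed process is not known in advance to lie in L^p. Domination of the integrands must hold
  exactly for the approximants, so \<open>H\<close> and \<open>K\<close> are approximated on a
  common grid and all other integrands are linear images of these approximants.\<close>

lemma finite_set_strict_enumeration:
  fixes T :: "real set"
  assumes "finite T" "T \<noteq> {}"
  obtains m \<sigma> where "\<And>i. i < m \<Longrightarrow> \<sigma> i < \<sigma> (Suc i)" "\<sigma> ` {..m::nat} = T" "\<sigma> 0 = Min T" "\<sigma> m = Max T"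
proof -
  define l where "l = sorted_list_of_set T"
  define m where "m = card T - 1"
  have len: "length l = Suc m"
    using assms by (simp add: l_def m_def card_gt_0_iff)
  have sl: "sorted_wrt (<) l" by (simp add: l_def)
  have sd: "sorted l" by (simp add: l_def)
  have img: "(\<lambda>i. l ! i) ` {..m} = T"
  proof -
    have "set l = (\<lambda>i. l ! i) ` {..m}"
      unfolding set_conv_nth len by (auto simp: less_Suc_eq_le)
    then show ?thesis using assms by (simp add: l_def)
  qed
  have "l ! 0 = Min T"
  proof (rule Min_eqI[symmetric])
    show "finite T" by fact
    show "l ! 0 \<in> T" using img by auto
    fix y assume "y \<in> T"
    then obtain i where "i \<le> m" "y = l ! i" using img by auto
    then show "l ! 0 \<le> y" using sd len by (simp add: sorted_nth_mono)
  qed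
  moreover have "l ! m = Max T"
  proof (rule Max_eqI[symmetric])
    show "finite T" by fact
    show "l ! m \<in> T" using img by auto
    fix y assume "y \<in> T"
    then obtain i where "i \<le> m" "y = l ! i" using img by auto
    then show "y \<le> l ! m" using sd len by (simp add: sorted_nth_mono)
  qed
  moreover have "l ! i < l ! Suc i" if "i < m" for i
    using sl len that by (simp add: sorted_wrt_iff_nth_less)
  ultimately show ?thesis using img by (intro that[where \<sigma>="\<lambda>i. l ! i" and m=m])
qed

lemma strict_chain_less:
  fixes \<sigma> :: "nat \<Rightarrow> real"
  assumes "\<And>i. i < m \<Longrightarrow> \<sigma> i < \<sigma> (Suc i)" "i < j" "j \<le> m"
  shows "\<sigma> i < \<sigma> j"
  using assms(2,3)
proof (induction j)
  case (Suc j)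
  then show ?case using assms(1)[of j] by (cases "i = j") auto
qed simp

lemma strict_chain_le_iff:
  fixes \<sigma> :: "nat \<Rightarrow> real"
  assumes "\<And>i. i < m \<Longrightarrow> \<sigma> i < \<sigma> (Suc i)" "i \<le> m" "j \<le> m"
  shows "\<sigma> i \<le> \<sigma> j \<longleftrightarrow> i \<le> j"
  using strict_chain_less[of m \<sigma> i j, OF assms(1)] strict_chain_less[of m \<sigma> j i, OF assms(1)] assms(2,3)
  by (cases i j rule: linorder_cases) auto

lemma telescope_sum:
  fixes f :: "nat \<Rightarrow> 'b::ab_group_add"
  assumes "a \<le> b"
  shows "(\<Sum>k\<in>{a..<b}. f (Suc k) - f k) = f b - f a"
  using assms by (rule sum_Suc_diff')

lemma borel_measurable_vec:
  fixes f :: "'b \<Rightarrow> real^'d::finite"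
  assumes "\<And>j. (\<lambda>x. f x $ j) \<in> borel_measurable N"
  shows "f \<in> borel_measurable N"
  unfolding borel_measurable_euclidean_space[where f=f]
  using assms by (auto simp: Basis_vec_def inner_axis)

section \<open>Increments relative to the natural filtration: independence and Gaussian
  moments\<close>

locale brownian = prob_space M for M :: "'a measure" +
  fixes W :: "real \<Rightarrow> 'a \<Rightarrow> real^'d::finite"
  assumes bm: "brownian_motion M W"
begin

abbreviation "F \<equiv> nat_filt M W"

lemma W_measurable [measurable]: "W t \<in> borel_measurable M"
  using bm by (simp add: brownian_motion_def)

lemma W_0: "AE \<omega> in M. W 0 \<omega> = 0"
  using bm by (auto simp: brownian_motion_def)

lemma space_F [simp]: "space (F t) = space M"
  by (simp add: nat_filt_def space_measure_of_conv)

lemma sets_F: "sets (F t) = sigma_sets (space M) {W s -` U \<inter> space M | s U. s \<in> {0..t} \<and> U \<in> sets borel}"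
  unfolding nat_filt_def by (rule sets_measure_of) auto

lemma sets_F_le: "sets (F t) \<subseteq> sets M"
  unfolding sets_F by (rule sets.sigma_sets_subset) auto

lemma subalgebra_F: "subalgebra M (F t)"
  by (simp add: subalgebra_def sets_F_le)

lemma subalgebra_F_mono: "s \<le> t \<Longrightarrow> subalgebra (F t) (F s)"
  unfolding subalgebra_def sets_F by (auto intro!: sigma_sets_subseteq) (use order_trans in blast)

lemma sigma_finite_subalgebra_F: "sigma_finite_subalgebra M (F t)"
proof -
  interpret finite_measure_subalgebra M "F t"
    by unfold_locales (rule subalgebra_F)
  show ?thesis by unfold_locales
qed

lemma measurable_F_mono: "f \<in> measurable (F s) N \<Longrightarrow> s \<le> t \<Longrightarrow> f \<in> measurable (F t) N"
  using measurable_from_subalg subalgebra_F_mono by blast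

lemma measurable_F_M: "f \<in> measurable (F s) N \<Longrightarrow> f \<in> measurable M N"
  using measurable_from_subalg subalgebra_F by blast

lemma W_measurable_F: "0 \<le> s \<Longrightarrow> s \<le> t \<Longrightarrow> W s \<in> borel_measurable (F t)"
  by (rule measurableI) (auto simp: sets_F intro!: sigma_sets.Basic)

lemma brownian_grid:
  assumes "\<tau> 0 = 0" "\<And>i. i < n \<Longrightarrow> \<tau> i < \<tau> (Suc i)"
  shows "indep_vars (\<lambda>_. borel) (\<lambda>(i, j) \<omega>. (W (\<tau> (Suc i)) \<omega> - W (\<tau> i) \<omega>) $ j) ({..<n} \<times> (UNIV :: 'd set))"
    and "\<And>i j. i < n \<Longrightarrow> distributed M lborel (\<lambda>\<omega>. (W (\<tau> (Suc i)) \<omega> - W (\<tau> i) \<omega>) $ j)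
                 (\<lambda>x. ennreal (normal_density 0 (sqrt (\<tau> (Suc i) - \<tau> i)) x))"
  using bm assms unfolding brownian_motion_def by blast+

text \<open>The only independence granted by \<open>brownian_motion\<close> is that of increments
  along a grid starting at 0. Telescoping writes the values at times up to s through increments
  preceding s, so a cylinder event and the next increment depend on disjoint groups of
  coordinates.\<close>

lemma cylinder_indep:
  assumes J: "finite J" "J \<subseteq> {0..s}" and s: "0 \<le> s" "s < u"
    and U [measurable]: "\<And>r. U r \<in> sets borel" and V [measurable]: "V \<in> sets borel"
  shows "prob ({\<omega>\<in>space M. \<forall>r\<in>J. W r \<omega> \<in> U r} \<inter> {\<omega>\<in>space M. W u \<omega> - W s \<omega> \<in> V}) =
    prob {\<omega>\<in>space M. \<forall>r\<in>J. W r \<omega> \<in> U r} * prob {\<omega>\<in>space M. W u \<omega> - W s \<omega> \<in> V}"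
proof -
  have fT: "finite (J \<union> {0, s})" using J by simp
  obtain m \<sigma> where \<sigma>: "\<And>i. i < m \<Longrightarrow> \<sigma> i < \<sigma> (Suc i)" "\<sigma> ` {..m::nat} = J \<union> {0, s}"
    "\<sigma> 0 = Min (J \<union> {0, s})" "\<sigma> m = Max (J \<union> {0, s})"
    using finite_set_strict_enumeration[of "J \<union> {0, s}"] fT by auto
  have \<sigma>0: "\<sigma> 0 = 0" unfolding \<sigma>(3) using J s by (intro Min_eqI) auto
  have \<sigma>m: "\<sigma> m = s" unfolding \<sigma>(4) using J s by (intro Max_eqI) auto
  \<comment> \<open>The enumeration of \<open>J\<close> together with 0 and s, prolonged by u: the
    increment of interest has index \<open>m\<close>.\<close>
  define \<tau> where "\<tau> i = (if i \<le> m then \<sigma> i else u)" for i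
  define X where "X = (\<lambda>(i, j) \<omega>. (W (\<tau> (Suc i)) \<omega> - W (\<tau> i) \<omega>) $ j)"
  have ind: "indep_vars (\<lambda>_. borel) X ({..<Suc m} \<times> (UNIV :: 'd set))"
    unfolding X_def
  proof (rule brownian_grid(1))
    show "\<tau> 0 = 0" by (simp add: \<tau>_def \<sigma>0)
    show "\<tau> i < \<tau> (Suc i)" if "i < Suc m" for i
    proof (cases "i < m")
      case True then show ?thesis using \<sigma>(1)[of i] by (simp add: \<tau>_def)
    next
      case False
      then have "i = m" using that by simp
      then show ?thesis using \<sigma>m s by (simp add: \<tau>_def)
    qed
  qed
  let ?A = "{..<m} \<times> (UNIV :: 'd set)" and ?B = "{m} \<times> (UNIV :: 'd set)"
  define R0 where "R0 = (\<lambda>\<omega>. restrict (\<lambda>i. X i \<omega>) ?A)"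
  define R1 where "R1 = (\<lambda>\<omega>. restrict (\<lambda>i. X i \<omega>) ?B)"
  have iv: "indep_var (PiM ?A (\<lambda>_. borel)) R0 (PiM ?B (\<lambda>_. borel)) R1"
    unfolding R0_def R1_def using ind by (rule indep_var_restrict) auto
  have [measurable]: "R0 \<in> M \<rightarrow>\<^sub>M PiM ?A (\<lambda>_. borel)" "R1 \<in> M \<rightarrow>\<^sub>M PiM ?B (\<lambda>_. borel)"
    using iv by (auto simp: indep_var_eq)
  \<comment> \<open>\<open>f k\<close> rebuilds \<open>W (\<sigma> k) - W 0\<close> from the earlier
    increments; \<open>g\<close> reads off the last one.\<close>
  define f where "f = (\<lambda>k (x :: nat \<times> 'd \<Rightarrow> real). (\<chi> j. \<Sum>i<k. x (i, j)))"
  define g where "g = (\<lambda>(x :: nat \<times> 'd \<Rightarrow> real). (\<chi> j. x (m, j)))"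
  have f[measurable]: "f k \<in> borel_measurable (PiM ?A (\<lambda>_. borel))" if "k \<le> m" for k
    unfolding f_def using that
    by (intro borel_measurable_vec) (auto intro!: borel_measurable_sum measurable_component_singleton)
  have g[measurable]: "g \<in> borel_measurable (PiM ?B (\<lambda>_. borel))"
    unfolding g_def
    by (intro borel_measurable_vec) (auto intro!: measurable_component_singleton)
  have fR: "f k (R0 \<omega>) = W (\<sigma> k) \<omega> - W 0 \<omega>" if "k \<le> m" for k \<omega>
  proof (rule vec_eq_iff[THEN iffD2, rule_format])
    fix j
    have "f k (R0 \<omega>) $ j = (\<Sum>i<k. W (\<sigma> (Suc i)) \<omega> $ j - W (\<sigma> i) \<omega> $ j)"
      unfolding f_def R0_def X_def using that by (auto simp: \<tau>_def intro!: sum.cong)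
    also have "\<dots> = (W (\<sigma> k) \<omega> - W 0 \<omega>) $ j"
      by (subst sum_lessThan_telescope) (simp add: \<sigma>0)
    finally show "f k (R0 \<omega>) $ j = (W (\<sigma> k) \<omega> - W 0 \<omega>) $ j" .
  qed
  have gR: "g (R1 \<omega>) = W u \<omega> - W s \<omega>" for \<omega>
    unfolding g_def R1_def X_def by (simp add: vec_eq_iff \<tau>_def \<sigma>m)
  have "\<forall>r\<in>J. \<exists>k\<le>m. \<sigma> k = r" using \<sigma>(2) by (metis UnI1 atMost_iff imageE)
  then obtain K where K: "\<And>r. r \<in> J \<Longrightarrow> K r \<le> m \<and> \<sigma> (K r) = r" by metis
  define S0 where "S0 = {x \<in> space (PiM ?A (\<lambda>_. borel)). \<forall>r\<in>J. f (K r) x \<in> U r}"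
  have S0: "S0 \<in> sets (PiM ?A (\<lambda>_. borel))"
    unfolding S0_def
  proof (rule sets.sets_Collect_finite_All[OF _ J(1)])
    show "{x \<in> space (PiM ?A (\<lambda>_. borel)). f (K r) x \<in> U r} \<in> sets (PiM ?A (\<lambda>_. borel))" if "r \<in> J" for r
    proof -
      have [measurable]: "f (K r) \<in> borel_measurable (PiM ?A (\<lambda>_. borel))" using K[OF that] f by blast
      show ?thesis by measurable
    qed
  qed
  define S1 where "S1 = {x \<in> space (PiM ?B (\<lambda>_. borel)). g x \<in> V}"
  have S1: "S1 \<in> sets (PiM ?B (\<lambda>_. borel))"
    unfolding S1_def by measurable
  have "prob (R0 -` S0 \<inter> space M \<inter> (R1 -` S1 \<inter> space M)) = prob (R0 -` S0 \<inter> space M) * prob (R1 -` S1 \<inter> space M)"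
    using iv S0 S1 unfolding indep_var_eq
    by (intro indep_setD[where A="sigma_sets (space M) {R0 -` A \<inter> space M | A. A \<in> sets (PiM ?A (\<lambda>_. borel))}"
        and B="sigma_sets (space M) {R1 -` A \<inter> space M | A. A \<in> sets (PiM ?B (\<lambda>_. borel))}"])
      (auto intro!: sigma_sets.Basic)
  moreover have "R1 -` S1 \<inter> space M = {\<omega>\<in>space M. W u \<omega> - W s \<omega> \<in> V}"
    using measurable_space[of R1 M "PiM ?B (\<lambda>_. borel)"] by (auto simp: S1_def gR)
  moreover have R0e: "R0 -` S0 \<inter> space M = {\<omega>\<in>space M. \<forall>r\<in>J. W r \<omega> - W 0 \<omega> \<in> U r}"
    using measurable_space[of R0 M "PiM ?A (\<lambda>_. borel)"] K by (auto simp: S0_def fR)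
  \<comment> \<open>The grid sees only \<open>W r - W 0\<close>. Since \<open>W 0 = 0\<close> holds
    just almost surely, replacing it by \<open>W r\<close> changes the events by a null set.\<close>
  moreover have "prob ({\<omega>\<in>space M. \<forall>r\<in>J. W r \<omega> - W 0 \<omega> \<in> U r} \<inter> {\<omega>\<in>space M. W u \<omega> - W s \<omega> \<in> V}) =
     prob ({\<omega>\<in>space M. \<forall>r\<in>J. W r \<omega> \<in> U r} \<inter> {\<omega>\<in>space M. W u \<omega> - W s \<omega> \<in> V})"
    by (rule finite_measure_eq_AE) (use W_0 J(1) in \<open>auto intro!: sets.Int sets.sets_Collect_finite_All\<close>)
  moreover have "prob {\<omega>\<in>space M. \<forall>r\<in>J. W r \<omega> - W 0 \<omega> \<in> U r} = prob {\<omega>\<in>space M. \<forall>r\<in>J. W r \<omega> \<in> U r}"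
    by (rule finite_measure_eq_AE) (use W_0 J(1) in \<open>auto intro!: sets.sets_Collect_finite_All\<close>)
  ultimately show ?thesis by simp
qed

text \<open>Cylinder events form an intersection-stable generator of \<open>F s\<close>, and so do
  the events determined by the increment; independence therefore extends from cylinders to the
  generated sigma-algebras.\<close>

lemma increment_indep_F:
  assumes s: "0 \<le> s" "s < u"
  shows "indep_set (sets (F s)) {(\<lambda>\<omega>. W u \<omega> - W s \<omega>) -` V \<inter> space M | V. V \<in> sets borel}"
proof -
  define G where "G = {{\<omega>\<in>space M. \<forall>r\<in>J. W r \<omega> \<in> U r} | J U. finite J \<and> J \<subseteq> {0..s} \<and> (\<forall>r. U r \<in> sets borel)}"
  define D where "D = {(\<lambda>\<omega>. W u \<omega> - W s \<omega>) -` V \<inter> space M | V. V \<in> sets borel}"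
  have Gsub: "G \<subseteq> events"
  proof
    fix a assume "a \<in> G"
    then obtain J U where *: "a = {\<omega>\<in>space M. \<forall>r\<in>J. W r \<omega> \<in> U r}" "finite J" "\<And>r. U r \<in> sets borel"
      unfolding G_def by blast
    note [measurable] = *(3)
    show "a \<in> events" unfolding *(1) by (rule sets.sets_Collect_finite_All[OF _ *(2)]) measurable
  qed
  have Dsub: "D \<subseteq> events"
    unfolding D_def by auto
  have "indep_set G D"
  proof (rule indep_setI[OF Gsub Dsub])
    fix a b assume "a \<in> G" "b \<in> D"
    then obtain J U V where *: "a = {\<omega>\<in>space M. \<forall>r\<in>J. W r \<omega> \<in> U r}" "finite J" "J \<subseteq> {0..s}"
      "\<And>r. U r \<in> sets borel" "b = (\<lambda>\<omega>. W u \<omega> - W s \<omega>) -` V \<inter> space M" "V \<in> sets borel"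
      unfolding G_def D_def by blast
    have "b = {\<omega>\<in>space M. W u \<omega> - W s \<omega> \<in> V}" using * by auto
    then show "prob (a \<inter> b) = prob a * prob b"
      using cylinder_indep[OF *(2,3) s *(4,6)] * by simp
  qed
  moreover have "Int_stable G"
  proof (rule Int_stableI)
    fix a b assume "a \<in> G" "b \<in> G"
    then obtain J U J' U' where *: "a = {\<omega>\<in>space M. \<forall>r\<in>J. W r \<omega> \<in> U r}" "finite J" "J \<subseteq> {0..s}"
      "\<And>r. U r \<in> sets borel" "b = {\<omega>\<in>space M. \<forall>r\<in>J'. W r \<omega> \<in> U' r}" "finite J'" "J' \<subseteq> {0..s}"
      "\<And>r. U' r \<in> sets borel"
      unfolding G_def by blast
    \<comment> \<open>A time constrained by only one of the two cylinders receives the whole space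
      from the other.\<close>
    define U'' where "U'' r = (if r \<in> J then U r else UNIV) \<inter> (if r \<in> J' then U' r else UNIV)" for r
    have "a \<inter> b = {\<omega>\<in>space M. \<forall>r\<in>J \<union> J'. W r \<omega> \<in> U'' r}"
      unfolding * U''_def by auto
    moreover have "U'' r \<in> sets borel" for r using * by (auto simp: U''_def)
    ultimately show "a \<inter> b \<in> G" unfolding G_def using *
      by (intro CollectI exI[of _ "J \<union> J'"] exI[of _ U'']) auto
  qed
  moreover have "Int_stable D"
  proof (rule Int_stableI)
    fix a b assume "a \<in> D" "b \<in> D"
    then obtain V V' where *: "a = (\<lambda>\<omega>. W u \<omega> - W s \<omega>) -` V \<inter> space M" "V \<in> sets borel"
      "b = (\<lambda>\<omega>. W u \<omega> - W s \<omega>) -` V' \<inter> space M" "V' \<in> sets borel"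
      unfolding D_def by blast
    then show "a \<inter> b \<in> D"
      unfolding D_def by (intro CollectI exI[of _ "V \<inter> V'"]) auto
  qed
  ultimately have "indep_set (sigma_sets (space M) G) (sigma_sets (space M) D)"
    by (rule indep_set_sigma_sets)
  moreover have "sets (F s) \<subseteq> sigma_sets (space M) G"
    unfolding sets_F
  proof (rule sigma_sets_mono, safe)
    fix r and U :: "(real^'d) set" assume "r \<in> {0..s}" "U \<in> sets borel"
    then have "W r -` U \<inter> space M \<in> G"
      unfolding G_def by (intro CollectI exI[of _ "{r}"] exI[of _ "\<lambda>_. U"]) auto
    then show "W r -` U \<inter> space M \<in> sigma_sets (space M) G" by (rule sigma_sets.Basic)
  qed
  moreover have "D \<subseteq> sigma_sets (space M) D" by (auto intro: sigma_sets.Basic)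
  ultimately show ?thesis
    unfolding D_def[symmetric] indep_set_def
    by (elim indep_sets_mono_sets) (auto split: bool.split)
qed

lemma increment_indep_var:
  fixes g :: "'a \<Rightarrow> real" and \<phi> :: "real^'d \<Rightarrow> real"
  assumes s: "0 \<le> s" "s < u" and g: "g \<in> borel_measurable (F s)" and \<phi>: "\<phi> \<in> borel_measurable borel"
  shows "indep_var borel g borel (\<lambda>\<omega>. \<phi> (W u \<omega> - W s \<omega>))"
proof -
  note [measurable] = measurable_F_M[OF g] \<phi>
  have 1: "sigma_sets (space M) {g -` A \<inter> space M |A. A \<in> sets borel} \<subseteq> sets (F s)"
  proof -
    have "{g -` A \<inter> space M |A. A \<in> sets borel} \<subseteq> sets (F s)"
      using measurable_sets[OF g] by auto
    from sets.sigma_sets_subset[OF this] show ?thesis by simp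
  qed
  define D where "D = {(\<lambda>\<omega>. W u \<omega> - W s \<omega>) -` V \<inter> space M | V. V \<in> sets borel}"
  have 2: "sigma_sets (space M) {(\<lambda>\<omega>. \<phi> (W u \<omega> - W s \<omega>)) -` A \<inter> space M |A. A \<in> sets borel} \<subseteq> D"
  proof -
    have D: "D = sets (vimage_algebra (space M) (\<lambda>\<omega>. W u \<omega> - W s \<omega>) borel)"
      unfolding D_def by (rule sets_vimage_algebra2[symmetric]) simp
    have "{(\<lambda>\<omega>. \<phi> (W u \<omega> - W s \<omega>)) -` A \<inter> space M |A. A \<in> sets borel} \<subseteq> D"
    proof safe
      fix A :: "real set" assume "A \<in> sets borel"
      then have "\<phi> -` A \<in> sets borel" using measurable_sets[OF \<phi>] by simp
      moreover have "(\<lambda>\<omega>. \<phi> (W u \<omega> - W s \<omega>)) -` A \<inter> space M = (\<lambda>\<omega>. W u \<omega> - W s \<omega>) -` (\<phi> -` A) \<inter> space M"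
        by auto
      ultimately show "(\<lambda>\<omega>. \<phi> (W u \<omega> - W s \<omega>)) -` A \<inter> space M \<in> D"
        unfolding D_def by blast
    qed
    then show ?thesis unfolding D
      using sets.sigma_sets_subset[of _ "vimage_algebra (space M) (\<lambda>\<omega>. W u \<omega> - W s \<omega>) borel"] by simp
  qed
  have "indep_set (sets (F s)) D" unfolding D_def by (rule increment_indep_F[OF s])
  then show ?thesis
    unfolding indep_var_eq indep_set_def
  proof (intro conjI, goal_cases)
    case 3
    show ?case
      by (rule indep_sets_mono_sets[OF 3(1)]) (use 1 2 in \<open>simp split: bool.split\<close>)
  qed simp_all
qed

lemma increment_facts:
  assumes s: "0 \<le> s" "s < u"
  shows "distributed M lborel (\<lambda>\<omega>. (W u \<omega> - W s \<omega>) $ j) (\<lambda>x. ennreal (normal_density 0 (sqrt (u - s)) x))" (is ?D)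
    and "i \<noteq> j \<Longrightarrow> indep_var borel (\<lambda>\<omega>. (W u \<omega> - W s \<omega>) $ i) borel (\<lambda>\<omega>. (W u \<omega> - W s \<omega>) $ j)"
proof -
  \<comment> \<open>The defining property concerns strictly increasing grids that start at 0. The
    grid is 0, u if s = 0 and 0, s, u otherwise; \<open>m\<close> is the index of the cell from s to
    u.\<close>
  define \<tau> where "\<tau> = (\<lambda>k::nat. if s = 0 then real k * u else if k = 0 then 0 else if k = 1 then s else u)"
  define m :: nat where "m = (if s = 0 then 0 else 1)"
  have \<tau>: "\<tau> 0 = 0" "\<And>i. i < Suc m \<Longrightarrow> \<tau> i < \<tau> (Suc i)" "\<tau> (Suc m) = u" "\<tau> m = s"
    using s by (auto simp: \<tau>_def m_def less_Suc_eq split: if_splits)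
  show ?D using brownian_grid(2)[OF \<tau>(1,2), of "Suc m" m] \<tau> by simp
  assume ij: "i \<noteq> j"
  define X where "X = (\<lambda>(i, j) \<omega>. (W (\<tau> (Suc i)) \<omega> - W (\<tau> i) \<omega>) $ j)"
  have ind: "indep_vars (\<lambda>_. borel) X ({..<Suc m} \<times> (UNIV :: 'd set))"
    unfolding X_def by (rule brownian_grid(1)[OF \<tau>(1,2)])
  have "indep_var borel ((\<lambda>f. f (m, i)) \<circ> (\<lambda>\<omega>. restrict (\<lambda>k. X k \<omega>) {(m, i)})) borel
      ((\<lambda>f. f (m, j)) \<circ> (\<lambda>\<omega>. restrict (\<lambda>k. X k \<omega>) {(m, j)}))"
    by (rule indep_var_compose[OF indep_var_restrict[OF ind]]) (use ij in \<open>auto intro: measurable_component_singleton\<close>)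
  then show "indep_var borel (\<lambda>\<omega>. (W u \<omega> - W s \<omega>) $ i) borel (\<lambda>\<omega>. (W u \<omega> - W s \<omega>) $ j)"
    by (simp add: o_def X_def \<tau>)
qed

lemma increment_moment:
  assumes s: "0 \<le> s" "s \<le> u"
  shows "integrable M (\<lambda>\<omega>. ((W u \<omega> - W s \<omega>) $ j) ^ k)"
    and "expectation (\<lambda>\<omega>. (W u \<omega> - W s \<omega>) $ j) = 0"
    and "expectation (\<lambda>\<omega>. ((W u \<omega> - W s \<omega>) $ j)\<^sup>2) = u - s"
    and "expectation (\<lambda>\<omega>. ((W u \<omega> - W s \<omega>) $ j) ^ 4) = 3 * (u - s)\<^sup>2"
proof -
  show "integrable M (\<lambda>\<omega>. ((W u \<omega> - W s \<omega>) $ j) ^ k)"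
  proof (cases "s = u")
    case False
    then have su: "s < u" using s by simp
    then show ?thesis
      using distributed_integrable[OF increment_facts(1)[OF s(1) su], of "\<lambda>x. x ^ k" j]
        integrable_normal_moment[of "sqrt (u - s)" 0 k] by simp
  qed simp
  show "expectation (\<lambda>\<omega>. (W u \<omega> - W s \<omega>) $ j) = 0"
  proof (cases "s = u")
    case False
    then have su: "s < u" using s by simp
    then show ?thesis
      using distributed_integral[OF increment_facts(1)[OF s(1) su], of "\<lambda>x. x" j]
        integral_normal_moment_odd[of "sqrt (u - s)" 0 0] by simp
  qed simp
  show "expectation (\<lambda>\<omega>. ((W u \<omega> - W s \<omega>) $ j)\<^sup>2) = u - s"
  proof (cases "s = u")
    case False
    then have su: "s < u" using s by simp
    then show ?thesis
      using distributed_integral[OF increment_facts(1)[OF s(1) su], of "\<lambda>x. x\<^sup>2" j]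
        integral_normal_moment_even[of "sqrt (u - s)" 0 1] by simp
  qed simp
  show "expectation (\<lambda>\<omega>. ((W u \<omega> - W s \<omega>) $ j) ^ 4) = 3 * (u - s)\<^sup>2"
  proof (cases "s = u")
    case False
    then have su: "s < u" using s by simp
    then show ?thesis
      using distributed_integral[OF increment_facts(1)[OF s(1) su], of "\<lambda>x. x ^ 4" j]
        integral_normal_moment_even[of "sqrt (u - s)" 0 2]
      by (simp add: fact_numeral power2_eq_square field_simps)
  qed simp
qed

lemma increment_cross_moment:
  assumes s: "0 \<le> s" "s \<le> u"
  shows "integrable M (\<lambda>\<omega>. (W u \<omega> - W s \<omega>) $ i * (W u \<omega> - W s \<omega>) $ j)"
    and "expectation (\<lambda>\<omega>. (W u \<omega> - W s \<omega>) $ i * (W u \<omega> - W s \<omega>) $ j) = (if i = j then u - s else 0)"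
proof -
  have "integrable M (\<lambda>\<omega>. (W u \<omega> - W s \<omega>) $ i * (W u \<omega> - W s \<omega>) $ j) \<and>
    expectation (\<lambda>\<omega>. (W u \<omega> - W s \<omega>) $ i * (W u \<omega> - W s \<omega>) $ j) = (if i = j then u - s else 0)"
  proof (cases "s = u \<or> i = j")
    case True
    then show ?thesis using increment_moment[OF s, where j=j] increment_moment(1)[OF s, where j=j and k=2]
      by (auto simp: power2_eq_square)
  next
    case False
    then have su: "s < u" using s by simp
    have iv: "indep_var borel (\<lambda>\<omega>. (W u \<omega> - W s \<omega>) $ i) borel (\<lambda>\<omega>. (W u \<omega> - W s \<omega>) $ j)"
      using increment_facts(2)[OF s(1) su] False by simp
    show ?thesis
      using indep_var_integrable[OF iv] indep_var_lebesgue_integral[OF iv]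
        increment_moment(1)[OF s, where k=1] increment_moment(2)[OF s] False by simp
  qed
  then show "integrable M (\<lambda>\<omega>. (W u \<omega> - W s \<omega>) $ i * (W u \<omega> - W s \<omega>) $ j)"
    "expectation (\<lambda>\<omega>. (W u \<omega> - W s \<omega>) $ i * (W u \<omega> - W s \<omega>) $ j) = (if i = j then u - s else 0)"
    by auto
qed

lemma increment_mult_expectation:
  fixes g :: "'a \<Rightarrow> real" and \<phi> :: "real^'d \<Rightarrow> real"
  assumes s: "0 \<le> s" "s \<le> u" and g: "g \<in> borel_measurable (F s)" "integrable M g"
    and \<phi>: "\<phi> \<in> borel_measurable borel" "integrable M (\<lambda>\<omega>. \<phi> (W u \<omega> - W s \<omega>))"
  shows "integrable M (\<lambda>\<omega>. g \<omega> * \<phi> (W u \<omega> - W s \<omega>))"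
    and "expectation (\<lambda>\<omega>. g \<omega> * \<phi> (W u \<omega> - W s \<omega>)) = expectation g * expectation (\<lambda>\<omega>. \<phi> (W u \<omega> - W s \<omega>))"
proof -
  have "integrable M (\<lambda>\<omega>. g \<omega> * \<phi> (W u \<omega> - W s \<omega>)) \<and>
    expectation (\<lambda>\<omega>. g \<omega> * \<phi> (W u \<omega> - W s \<omega>)) = expectation g * expectation (\<lambda>\<omega>. \<phi> (W u \<omega> - W s \<omega>))"
  proof (cases "s = u")
    case True then show ?thesis using g by (simp add: prob_space)
  next
    case False
    then have su: "s < u" using s by simp
    show ?thesis
      using indep_var_integrable[OF increment_indep_var[OF s(1) su g(1) \<phi>(1)] g(2) \<phi>(2)]
        indep_var_lebesgue_integral[OF increment_indep_var[OF s(1) su g(1) \<phi>(1)] g(2) \<phi>(2)] by simp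
  qed
  then show "integrable M (\<lambda>\<omega>. g \<omega> * \<phi> (W u \<omega> - W s \<omega>))"
    "expectation (\<lambda>\<omega>. g \<omega> * \<phi> (W u \<omega> - W s \<omega>)) = expectation g * expectation (\<lambda>\<omega>. \<phi> (W u \<omega> - W s \<omega>))"
    by auto
qed

end

section \<open>Simple predictable processes\<close>

lemma integrable_mult_bounded:
  fixes f g :: "'a \<Rightarrow> real"
  assumes "integrable M g" and [measurable]: "f \<in> borel_measurable M" and "\<And>x. \<bar>f x\<bar> \<le> B"
  shows "integrable M (\<lambda>x. g x * f x)"
proof (rule Bochner_Integration.integrable_bound[where f="\<lambda>x. B * \<bar>g x\<bar>"])
  show "integrable M (\<lambda>x. B * \<bar>g x\<bar>)" using assms(1) by simp
  show "(\<lambda>x. g x * f x) \<in> borel_measurable M" using assms(1) by measurable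
  have "\<bar>g x\<bar> * \<bar>f x\<bar> \<le> B * \<bar>g x\<bar>" for x
    using mult_left_mono[OF assms(3)[of x] abs_ge_zero[of "g x"]] by (simp add: mult.commute)
  moreover have "0 \<le> B" using assms(3)[of undefined] by linarith
  ultimately show "AE x in M. norm (g x * f x) \<le> norm (B * \<bar>g x\<bar>)" by (simp add: abs_mult)
qed

lemma borel_measurable_vec_nth' [measurable (raw)]:
  fixes f :: "'b \<Rightarrow> real^'d::finite"
  assumes [measurable]: "f \<in> borel_measurable N"
  shows "(\<lambda>x. f x $ j) \<in> borel_measurable N"
  using borel_measurable_inner[OF assms borel_measurable_const[of "axis j 1"]] by (simp add: inner_axis)

definition sq_integrable :: "'a measure \<Rightarrow> ('a \<Rightarrow> real) \<Rightarrow> bool" where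
  "sq_integrable M f \<longleftrightarrow> f \<in> borel_measurable M \<and> integrable M (\<lambda>x. (f x)\<^sup>2)"

lemma sq_integrableD: "sq_integrable M f \<Longrightarrow> f \<in> borel_measurable M" "sq_integrable M f \<Longrightarrow> integrable M (\<lambda>x. (f x)\<^sup>2)"
  by (auto simp: sq_integrable_def)

lemma sq_integrable_mult:
  assumes "sq_integrable M f" "sq_integrable M g"
  shows "integrable M (\<lambda>x. f x * g x)"
proof (rule Bochner_Integration.integrable_bound[where f="\<lambda>x. (f x)\<^sup>2 + (g x)\<^sup>2"])
  note [measurable] = sq_integrableD(1)[OF assms(1)] sq_integrableD(1)[OF assms(2)]
  show "integrable M (\<lambda>x. (f x)\<^sup>2 + (g x)\<^sup>2)" using assms by (auto simp: sq_integrable_def)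
  show "(\<lambda>x. f x * g x) \<in> borel_measurable M" by measurable
  have "\<bar>a * b\<bar> \<le> a\<^sup>2 + b\<^sup>2" for a b :: real
  proof -
    have "0 \<le> (\<bar>a\<bar> - \<bar>b\<bar>)\<^sup>2" by simp
    then have "2 * (\<bar>a\<bar> * \<bar>b\<bar>) \<le> a\<^sup>2 + b\<^sup>2" by (simp add: power2_diff)
    moreover have "0 \<le> \<bar>a\<bar> * \<bar>b\<bar>" by simp
    ultimately show ?thesis unfolding abs_mult by linarith
  qed
  then show "AE x in M. norm (f x * g x) \<le> norm ((f x)\<^sup>2 + (g x)\<^sup>2)" by simp
qed

lemma sq_integrable_0 [simp]: "sq_integrable M (\<lambda>x. 0)"
  by (simp add: sq_integrable_def)

lemma sq_integrable_cmult: "sq_integrable M f \<Longrightarrow> sq_integrable M (\<lambda>x. c * f x)"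
  by (auto simp: sq_integrable_def power_mult_distrib)

lemma sq_integrable_add:
  assumes "sq_integrable M f" "sq_integrable M g"
  shows "sq_integrable M (\<lambda>x. f x + g x)"
proof -
  note [measurable] = sq_integrableD(1)[OF assms(1)] sq_integrableD(1)[OF assms(2)]
  have "integrable M (\<lambda>x. (f x)\<^sup>2 + (g x)\<^sup>2 + 2 * (f x * g x))"
    using sq_integrable_mult[OF assms] assms by (auto simp: sq_integrable_def)
  then show ?thesis by (simp add: sq_integrable_def power2_sum mult.assoc)
qed

lemma sq_integrable_diff:
  "sq_integrable M f \<Longrightarrow> sq_integrable M g \<Longrightarrow> sq_integrable M (\<lambda>x. f x - g x)"
  using sq_integrable_add[of M f "\<lambda>x. - 1 * g x"] sq_integrable_cmult[of M g "-1"] by simp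

lemma sq_integrable_sum:
  "(\<And>i. i \<in> I \<Longrightarrow> sq_integrable M (f i)) \<Longrightarrow> sq_integrable M (\<lambda>x. \<Sum>i\<in>I. f i x)"
  by (induction I rule: infinite_finite_induct) (auto intro!: sq_integrable_add)

lemma (in finite_measure) sq_integrable_const: "sq_integrable M (\<lambda>x. c)"
  by (simp add: sq_integrable_def)

lemma (in finite_measure) sq_integrable_integrable: "sq_integrable M f \<Longrightarrow> integrable M f"
  using sq_integrable_mult[OF _ sq_integrable_const[of 1], of f] by simp

section \<open>Partitions into half-open cells\<close>

lemma cell_unique:
  fixes \<tau> :: "nat \<Rightarrow> real"
  assumes "\<And>i. i < n \<Longrightarrow> \<tau> i < \<tau> (Suc i)" "i < n" "j < n"
    "v \<in> {\<tau> i<..\<tau> (Suc i)}" "v \<in> {\<tau> j<..\<tau> (Suc j)}"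
  shows "i = j"
proof (rule ccontr)
  assume "i \<noteq> j"
  then consider "Suc i \<le> j" | "Suc j \<le> i" by linarith
  then show False
  proof cases
    case 1
    then have "\<tau> (Suc i) \<le> \<tau> j" using strict_chain_le_iff[of n \<tau> "Suc i" j, OF assms(1)] assms(2,3) by simp
    then show False using assms(4,5) by simp
  next
    case 2
    then have "\<tau> (Suc j) \<le> \<tau> i" using strict_chain_le_iff[of n \<tau> "Suc j" i, OF assms(1)] assms(2,3) by simp
    then show False using assms(4,5) by simp
  qed
qed

lemma simple_proc_cell:
  assumes "\<And>i. i < n \<Longrightarrow> \<tau> i < \<tau> (Suc i)" "i < n" "v \<in> {\<tau> i<..\<tau> (Suc i)}"
  shows "simple_proc n \<tau> \<xi> v \<omega> = \<xi> i \<omega>"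
proof -
  have "simple_proc n \<tau> \<xi> v \<omega> = (\<Sum>k<n. if k = i then \<xi> i \<omega> else 0)"
    unfolding simple_proc_def
  proof (rule sum.cong[OF refl])
    fix k assume "k \<in> {..<n}"
    then have "v \<in> {\<tau> k<..\<tau> (Suc k)} \<longleftrightarrow> k = i"
      using cell_unique[of n \<tau> k i v, OF assms(1)] assms(2,3) by (metis lessThan_iff)
    then show "indicator {\<tau> k<..\<tau> (Suc k)} v *\<^sub>R \<xi> k \<omega> = (if k = i then \<xi> i \<omega> else 0)"
      by (simp add: indicator_def)
  qed
  then show ?thesis using assms(2) by simp
qed

lemma simple_proc_no_cell:
  assumes "\<And>i. i < n \<Longrightarrow> v \<notin> {\<tau> i<..\<tau> (Suc i)}"
  shows "simple_proc n \<tau> \<xi> v \<omega> = 0"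
  unfolding simple_proc_def using assms by (intro sum.neutral) (auto simp: indicator_def)

lemma cell_exists:
  fixes \<sigma> :: "nat \<Rightarrow> real"
  assumes "a \<le> b" "\<sigma> a < v" "v \<le> \<sigma> b"
  obtains k where "a \<le> k" "k < b" "v \<in> {\<sigma> k<..\<sigma> (Suc k)}"
proof -
  define k where "k = (LEAST k. a \<le> k \<and> v \<le> \<sigma> k)"
  have k: "a \<le> k" "v \<le> \<sigma> k" "k \<le> b"
    using LeastI[of "\<lambda>k. a \<le> k \<and> v \<le> \<sigma> k" b] Least_le[of "\<lambda>k. a \<le> k \<and> v \<le> \<sigma> k" b] assms by (auto simp: k_def)
  then have "k \<noteq> a" using assms(2) by auto
  then obtain k' where k': "k = Suc k'" "a \<le> k'" using k(1) by (cases k) auto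
  have "\<not> v \<le> \<sigma> k'" using not_less_Least[of k' "\<lambda>k. a \<le> k \<and> v \<le> \<sigma> k"] k' by (auto simp: k_def[symmetric])
  then show ?thesis using k k' by (intro that[of k']) auto
qed

lemma simple_int_linear:
  "simple_int W n \<tau> (\<lambda>k \<omega>. a *\<^sub>R \<xi> k \<omega> + b *\<^sub>R \<xi>' k \<omega>) t \<omega> = a * simple_int W n \<tau> \<xi> t \<omega> + b * simple_int W n \<tau> \<xi>' t \<omega>"
  by (simp add: simple_int_def inner_add_left sum.distrib sum_distrib_left)

lemma simple_proc_linear:
  assumes "linear f" "linear g"
  shows "simple_proc n \<tau> (\<lambda>k \<omega>. f (\<xi> k \<omega>) + g (\<xi>' k \<omega>)) s \<omega> = f (simple_proc n \<tau> \<xi> s \<omega>) + g (simple_proc n \<tau> \<xi>' s \<omega>)"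
  using assms by (simp add: simple_proc_def linear_sum linear_scale scaleR_add_right sum.distrib)

section \<open>Refinement of simple integrands and the Ito isometry\<close>

context brownian
begin

lemma simple_pred_linear:
  assumes fg: "linear f" "linear g" and "simple_pred F n \<tau> \<xi>" "simple_pred F n \<tau> \<xi>'"
  shows "simple_pred F n \<tau> (\<lambda>k \<omega>. f (\<xi> k \<omega>) + g (\<xi>' k \<omega>))"
  unfolding simple_pred_def
proof (intro conjI allI impI)
  show "0 \<le> \<tau> 0" "\<And>i. i < n \<Longrightarrow> \<tau> i < \<tau> (Suc i)" using assms by (auto simp: simple_pred_def)
  fix i assume "i < n"
  then have *: "\<xi> i \<in> borel_measurable (F (\<tau> i))" "\<xi>' i \<in> borel_measurable (F (\<tau> i))"
    "bounded (range (\<xi> i))" "bounded (range (\<xi>' i))"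
    using assms by (auto simp: simple_pred_def)
  note [measurable] = *(1,2) borel_measurable_continuous_onI[OF linear_continuous_on[OF fg(1)[unfolded linear_conv_bounded_linear]]]
    borel_measurable_continuous_onI[OF linear_continuous_on[OF fg(2)[unfolded linear_conv_bounded_linear]]]
  show "(\<lambda>\<omega>. f (\<xi> i \<omega>) + g (\<xi>' i \<omega>)) \<in> borel_measurable (F (\<tau> i))" by measurable
  have "bounded (f ` range (\<xi> i))" "bounded (g ` range (\<xi>' i))"
    using * fg by (auto intro!: bounded_linear_image simp: linear_conv_bounded_linear)
  then show "bounded (range (\<lambda>\<omega>. f (\<xi> i \<omega>) + g (\<xi>' i \<omega>)))"
    by (intro bounded_plus_comp) (simp_all add: image_image)
qed

text \<open>Cells are open on the left and closed on the right, so the value of the process at the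
  right end of a fine cell is its value on the whole of that cell. It is nevertheless known at the
  left end, because the coarse cell containing it starts no later than that.\<close>

lemma simple_refine:
  fixes \<xi> :: "nat \<Rightarrow> 'a \<Rightarrow> real^'d"
  assumes sp: "simple_pred F n \<tau> \<xi>" and \<sigma>: "\<And>k. k < m \<Longrightarrow> \<sigma> k < \<sigma> (Suc k)" "0 \<le> \<sigma> 0"
    and sub: "\<tau> ` {..n} \<subseteq> \<sigma> ` {..m}"
  defines "\<eta> \<equiv> \<lambda>k \<omega>. simple_proc n \<tau> \<xi> (\<sigma> (Suc k)) \<omega>"
  shows "simple_pred F m \<sigma> \<eta>"
    and "simple_proc m \<sigma> \<eta> v \<omega> = simple_proc n \<tau> \<xi> v \<omega>"
    and "simple_int W m \<sigma> \<eta> t \<omega> = simple_int W n \<tau> \<xi> t \<omega>"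
proof -
  have \<tau>: "\<And>i. i < n \<Longrightarrow> \<tau> i < \<tau> (Suc i)" "0 \<le> \<tau> 0"
    and \<xi>: "\<And>i. i < n \<Longrightarrow> \<xi> i \<in> borel_measurable (F (\<tau> i))" "\<And>i. i < n \<Longrightarrow> bounded (range (\<xi> i))"
    using sp by (auto simp: simple_pred_def)
  have "\<forall>i\<le>n. \<exists>k\<le>m. \<sigma> k = \<tau> i"
  proof (intro allI impI)
    fix i assume "i \<le> n"
    then have "\<tau> i \<in> \<sigma> ` {..m}" using sub by auto
    then show "\<exists>k\<le>m. \<sigma> k = \<tau> i" by auto
  qed
  \<comment> \<open>\<open>a i\<close> is the position of the coarse point \<open>\<tau> i\<close>
    in the fine grid.\<close>
  then obtain a where a: "\<And>i. i \<le> n \<Longrightarrow> a i \<le> m \<and> \<sigma> (a i) = \<tau> i" by metis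
  have \<sigma>le: "\<sigma> i \<le> \<sigma> j \<longleftrightarrow> i \<le> j" if "i \<le> m" "j \<le> m" for i j
    by (rule strict_chain_le_iff[of m \<sigma>, OF \<sigma>(1)]) (use that in auto)
  have am: "a i < a (Suc i)" if "i < n" for i
    using \<tau>(1)[OF that] a[of i] a[of "Suc i"] that \<sigma>le[of "a (Suc i)" "a i"] by force
  \<comment> \<open>No coarse point lies strictly inside a fine cell. This is what makes the
    coefficient of a fine cell measurable at its left end.\<close>
  have left: "\<tau> i \<le> \<sigma> k" if "i \<le> n" "k < m" "\<tau> i < \<sigma> (Suc k)" for i k
    using a[OF that(1)] that(2,3) \<sigma>le[of "Suc k" "a i"] \<sigma>le[of "a i" k] by force
  have \<eta>1: "\<eta> k = \<xi> i" if "i < n" "\<sigma> (Suc k) \<in> {\<tau> i<..\<tau> (Suc i)}" for i k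
    using simple_proc_cell[of n \<tau> i _ \<xi>, OF \<tau>(1) that] by (simp add: \<eta>_def fun_eq_iff)
  have \<eta>0: "\<eta> k = (\<lambda>_. 0)" if "\<And>i. i < n \<Longrightarrow> \<sigma> (Suc k) \<notin> {\<tau> i<..\<tau> (Suc i)}" for k
    using simple_proc_no_cell[of n _ \<tau> \<xi>, OF that] by (simp add: \<eta>_def fun_eq_iff)
  show "simple_pred F m \<sigma> \<eta>"
    unfolding simple_pred_def
  proof (intro conjI allI impI)
    fix k assume k: "k < m"
    have "\<eta> k \<in> borel_measurable (F (\<sigma> k)) \<and> bounded (range (\<eta> k))"
    proof (cases "\<exists>i<n. \<sigma> (Suc k) \<in> {\<tau> i<..\<tau> (Suc i)}")
      case True
      then obtain i where i: "i < n" "\<sigma> (Suc k) \<in> {\<tau> i<..\<tau> (Suc i)}" by auto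
      then have "\<tau> i \<le> \<sigma> k" using left[of i k] k by simp
      then show ?thesis using \<eta>1[OF i] \<xi>[OF i(1)] measurable_F_mono by auto
    next
      case False
      then have "\<eta> k = (\<lambda>_. 0)" by (intro \<eta>0) auto
      then show ?thesis by simp
    qed
    then show "\<eta> k \<in> borel_measurable (F (\<sigma> k))" "bounded (range (\<eta> k))" by auto
  qed (use \<sigma> in auto)
  show "simple_proc m \<sigma> \<eta> v \<omega> = simple_proc n \<tau> \<xi> v \<omega>"
  proof (cases "\<exists>i<n. v \<in> {\<tau> i<..\<tau> (Suc i)}")
    case True
    then obtain i where i: "i < n" "v \<in> {\<tau> i<..\<tau> (Suc i)}" by auto
    have *: "\<sigma> (a i) < v" "v \<le> \<sigma> (a (Suc i))" "a i \<le> a (Suc i)" "a (Suc i) \<le> m"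
      using i a[of i] a[of "Suc i"] am[of i] by auto
    obtain k where k: "a i \<le> k" "k < a (Suc i)" "v \<in> {\<sigma> k<..\<sigma> (Suc k)}"
      using cell_exists[OF *(3,1,2)] by blast
    have "\<sigma> (Suc k) \<le> \<tau> (Suc i)" using \<sigma>le[of "Suc k" "a (Suc i)"] a[of "Suc i"] i k by simp
    then have "\<eta> k = \<xi> i" using \<eta>1[OF i(1), of k] i k by simp
    then show ?thesis
      using simple_proc_cell[of m \<sigma> k v \<eta> \<omega>, OF \<sigma>(1) _ k(3)] simple_proc_cell[of n \<tau> i v \<xi> \<omega>, OF \<tau>(1) i] k *(4) by simp
  next
    case False
    then have 0: "simple_proc n \<tau> \<xi> v \<omega> = 0" by (intro simple_proc_no_cell) auto
    show ?thesis
    proof (cases "\<exists>k<m. v \<in> {\<sigma> k<..\<sigma> (Suc k)}")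
      case True
      then obtain k where k: "k < m" "v \<in> {\<sigma> k<..\<sigma> (Suc k)}" by auto
      have "\<eta> k = (\<lambda>_. 0)"
      proof (rule \<eta>0)
        fix i assume i: "i < n"
        show "\<sigma> (Suc k) \<notin> {\<tau> i<..\<tau> (Suc i)}"
        proof
          assume *: "\<sigma> (Suc k) \<in> {\<tau> i<..\<tau> (Suc i)}"
          then have "\<tau> i \<le> \<sigma> k" using left[of i k] i k by simp
          then have "v \<in> {\<tau> i<..\<tau> (Suc i)}" using * k by simp
          then show False using \<open>\<not> (\<exists>i<n. v \<in> {\<tau> i<..\<tau> (Suc i)})\<close> i by auto
        qed
      qed
      then show ?thesis using simple_proc_cell[of m \<sigma> k v \<eta> \<omega>, OF \<sigma>(1) k] 0 by simp
    next
      case False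
      then have "simple_proc m \<sigma> \<eta> v \<omega> = 0" by (intro simple_proc_no_cell) auto
      then show ?thesis using 0 by simp
    qed
  qed
  define w where "w x = W (min t x) \<omega>" for x
  define d where "d k = \<eta> k \<omega> \<bullet> (w (\<sigma> (Suc k)) - w (\<sigma> k))" for k
  have cell: "(\<Sum>k\<in>{a i..<a (Suc i)}. d k) = \<xi> i \<omega> \<bullet> (w (\<tau> (Suc i)) - w (\<tau> i))" if i: "i < n" for i
  proof -
    have "(\<Sum>k\<in>{a i..<a (Suc i)}. d k) = (\<Sum>k\<in>{a i..<a (Suc i)}. \<xi> i \<omega> \<bullet> (w (\<sigma> (Suc k)) - w (\<sigma> k)))"
    proof (rule sum.cong[OF refl])
      fix k assume k: "k \<in> {a i..<a (Suc i)}"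
      have "\<tau> i < \<sigma> (Suc k)" "\<sigma> (Suc k) \<le> \<tau> (Suc i)"
        using k a[of i] a[of "Suc i"] i \<sigma>le[of "a i" k] \<sigma>(1)[of k] \<sigma>le[of "Suc k" "a (Suc i)"] by auto
      then show "d k = \<xi> i \<omega> \<bullet> (w (\<sigma> (Suc k)) - w (\<sigma> k))" using \<eta>1[OF i, of k] by (simp add: d_def)
    qed
    also have "\<dots> = \<xi> i \<omega> \<bullet> (w (\<sigma> (a (Suc i))) - w (\<sigma> (a i)))"
      unfolding inner_sum_right[symmetric] using am[OF i] by (subst telescope_sum) auto
    finally show ?thesis using a[of i] a[of "Suc i"] i by simp
  qed
  \<comment> \<open>The fine cells are collected coarse cell by coarse cell, the block of index i
    running from \<open>a i\<close> to \<open>a (Suc i)\<close>.\<close>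
  have conc: "(\<Sum>k\<in>{a 0..<a j}. d k) = (\<Sum>i<j. \<xi> i \<omega> \<bullet> (w (\<tau> (Suc i)) - w (\<tau> i))) \<and> a 0 \<le> a j" if "j \<le> n" for j
    using that
  proof (induction j)
    case (Suc j)
    then have IH: "(\<Sum>k\<in>{a 0..<a j}. d k) = (\<Sum>i<j. \<xi> i \<omega> \<bullet> (w (\<tau> (Suc i)) - w (\<tau> i)))" "a 0 \<le> a j" by auto
    have "(\<Sum>k\<in>{a 0..<a (Suc j)}. d k) = (\<Sum>k\<in>{a 0..<a j}. d k) + (\<Sum>k\<in>{a j..<a (Suc j)}. d k)"
      using IH(2) am[of j] Suc.prems by (simp add: sum.atLeastLessThan_concat)
    then show ?case using IH cell[of j] Suc.prems am[of j] by simp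
  qed simp
  have "simple_int W m \<sigma> \<eta> t \<omega> = (\<Sum>k<m. d k)"
    by (simp add: simple_int_def d_def w_def)
  \<comment> \<open>The fine grid may reach beyond the coarse one on both sides; the process
    vanishes there, hence so do the coefficients.\<close>
  also have "\<dots> = (\<Sum>k\<in>{a 0..<a n}. d k)"
  proof (rule sum.mono_neutral_right)
    show "{a 0..<a n} \<subseteq> {..<m}" using a[of n] by auto
    show "\<forall>k\<in>{..<m} - {a 0..<a n}. d k = 0"
    proof
      fix k assume k: "k \<in> {..<m} - {a 0..<a n}"
      have "\<sigma> (Suc k) \<notin> {\<tau> i<..\<tau> (Suc i)}" if i: "i < n" for i
      proof
        assume *: "\<sigma> (Suc k) \<in> {\<tau> i<..\<tau> (Suc i)}"
        have "\<tau> 0 \<le> \<tau> i" "\<tau> (Suc i) \<le> \<tau> n"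
          using strict_chain_le_iff[of n \<tau> 0 i, OF \<tau>(1)] strict_chain_le_iff[of n \<tau> "Suc i" n, OF \<tau>(1)] i by auto
        then have "\<sigma> (a 0) < \<sigma> (Suc k)" "\<sigma> (Suc k) \<le> \<sigma> (a n)" using * a[of 0] a[of n] by auto
        then have "a 0 < Suc k" "Suc k \<le> a n"
          using \<sigma>le[of "Suc k" "a n"] \<sigma>le[of "Suc k" "a 0"] a[of 0] a[of n] k by auto
        then show False using k by auto
      qed
      then have "\<eta> k = (\<lambda>_. 0)" by (rule \<eta>0)
      then show "d k = 0" by (simp add: d_def)
    qed
  qed simp
  also have "\<dots> = simple_int W n \<tau> \<xi> t \<omega>"
    using conc[of n] by (simp add: simple_int_def w_def)
  finally show "simple_int W m \<sigma> \<eta> t \<omega> = simple_int W n \<tau> \<xi> t \<omega>" .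
qed

text \<open>With the union of the two sets of partition points as grid, differences of simple
  processes can be formed cell by cell.\<close>

lemma simple_common_refinement:
  fixes \<xi> \<xi>' :: "nat \<Rightarrow> 'a \<Rightarrow> real^'d"
  assumes sp: "simple_pred F n \<tau> \<xi>" "simple_pred F n' \<tau>' \<xi>'"
  obtains m \<sigma> \<eta> \<eta>' where "simple_pred F m \<sigma> \<eta>" "simple_pred F m \<sigma> \<eta>'"
    "simple_proc m \<sigma> \<eta> = simple_proc n \<tau> \<xi>" "simple_proc m \<sigma> \<eta>' = simple_proc n' \<tau>' \<xi>'"
    "simple_int W m \<sigma> \<eta> = simple_int W n \<tau> \<xi>" "simple_int W m \<sigma> \<eta>' = simple_int W n' \<tau>' \<xi>'"
proof -
  define T where "T = \<tau> ` {..n} \<union> \<tau>' ` {..n'}"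
  have T: "finite T" "T \<noteq> {}" by (auto simp: T_def)
  obtain m \<sigma> where \<sigma>: "\<And>i. i < m \<Longrightarrow> \<sigma> i < \<sigma> (Suc i)" "\<sigma> ` {..m::nat} = T" "\<sigma> 0 = Min T"
    using finite_set_strict_enumeration[OF T] by metis
  have nn: "0 \<le> \<tau> i" if "simple_pred F n \<tau> \<xi>" "i \<le> n" for n \<tau> i and \<xi> :: "nat \<Rightarrow> 'a \<Rightarrow> real^'d"
    using strict_chain_le_iff[of n \<tau> 0 i] that by (force simp: simple_pred_def)
  have 0: "0 \<le> \<sigma> 0"
    unfolding \<sigma>(3) using T nn[OF sp(1)] nn[OF sp(2)] by (auto simp: T_def)
  have s1: "\<tau> ` {..n} \<subseteq> \<sigma> ` {..m}" "\<tau>' ` {..n'} \<subseteq> \<sigma> ` {..m}" unfolding \<sigma> by (auto simp: T_def)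
  note r1 = simple_refine[OF sp(1) \<sigma>(1) 0 s1(1)] and r2 = simple_refine[OF sp(2) \<sigma>(1) 0 s1(2)]
  show ?thesis by (rule that[OF r1(1) r2(1)]) (use r1 r2 in \<open>auto intro!: ext\<close>)
qed

text \<open>In coordinates every term is a factor known at time s times a monomial in the increment,
  so expectations factor. First moments and mixed second moments of the coordinates vanish, and each
  diagonal term contributes u - s. All later orthogonality arguments go through these four
  facts.\<close>

lemma inner_increment:
  fixes g :: "'a \<Rightarrow> real" and \<xi> \<xi>' :: "'a \<Rightarrow> real^'d"
  assumes s: "0 \<le> s" "s \<le> u" and g: "g \<in> borel_measurable (F s)" "integrable M g"
    and \<xi>: "\<xi> \<in> borel_measurable (F s)" "bounded (range \<xi>)" and \<xi>': "\<xi>' \<in> borel_measurable (F s)" "bounded (range \<xi>')"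
  shows "integrable M (\<lambda>\<omega>. g \<omega> * (\<xi> \<omega> \<bullet> (W u \<omega> - W s \<omega>)))"
    and "expectation (\<lambda>\<omega>. g \<omega> * (\<xi> \<omega> \<bullet> (W u \<omega> - W s \<omega>))) = 0"
    and "integrable M (\<lambda>\<omega>. g \<omega> * ((\<xi> \<omega> \<bullet> (W u \<omega> - W s \<omega>)) * (\<xi>' \<omega> \<bullet> (W u \<omega> - W s \<omega>))))"
    and "expectation (\<lambda>\<omega>. g \<omega> * ((\<xi> \<omega> \<bullet> (W u \<omega> - W s \<omega>)) * (\<xi>' \<omega> \<bullet> (W u \<omega> - W s \<omega>)))) = (u - s) * expectation (\<lambda>\<omega>. g \<omega> * (\<xi> \<omega> \<bullet> \<xi>' \<omega>))"
proof -
  note [measurable] = g(1) \<xi>(1) \<xi>'(1)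
  note m = measurable_F_M[OF \<xi>(1), measurable] measurable_F_M[OF \<xi>'(1), measurable]
  obtain R R' where R: "\<And>\<omega>. norm (\<xi> \<omega>) \<le> R" "\<And>\<omega>. norm (\<xi>' \<omega>) \<le> R'"
    using \<xi>(2) \<xi>'(2) by (auto simp: bounded_iff)
  have Rj: "\<bar>\<xi> \<omega> $ j\<bar> \<le> R" "\<bar>\<xi>' \<omega> $ j\<bar> \<le> R'" for \<omega> j
    using R[of \<omega>] component_le_norm_cart[of "\<xi> \<omega>" j] component_le_norm_cart[of "\<xi>' \<omega>" j] by linarith+
  define D where "D \<omega> = W u \<omega> - W s \<omega>" for \<omega>
  have ig: "integrable M (\<lambda>\<omega>. g \<omega> * \<xi> \<omega> $ j)" for j
    by (rule integrable_mult_bounded[OF g(2) _ Rj(1)]) measurable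
  have igg: "integrable M (\<lambda>\<omega>. g \<omega> * \<xi> \<omega> $ i * \<xi>' \<omega> $ j)" for i j
    by (rule integrable_mult_bounded[OF ig _ Rj(2)]) measurable
  have 1: "integrable M (\<lambda>\<omega>. (g \<omega> * \<xi> \<omega> $ j) * D \<omega> $ j)" "expectation (\<lambda>\<omega>. (g \<omega> * \<xi> \<omega> $ j) * D \<omega> $ j) = 0" for j
    using increment_mult_expectation[OF s _ ig[of j], of "\<lambda>x. x $ j"] increment_moment(1)[OF s, of j 1]
      increment_moment(2)[OF s, of j] unfolding D_def by simp_all
  have 2: "integrable M (\<lambda>\<omega>. (g \<omega> * \<xi> \<omega> $ i * \<xi>' \<omega> $ j) * (D \<omega> $ i * D \<omega> $ j))"
    "expectation (\<lambda>\<omega>. (g \<omega> * \<xi> \<omega> $ i * \<xi>' \<omega> $ j) * (D \<omega> $ i * D \<omega> $ j)) = (if i = j then (u - s) * expectation (\<lambda>\<omega>. g \<omega> * \<xi> \<omega> $ i * \<xi>' \<omega> $ j) else 0)" for i j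
    using increment_mult_expectation[OF s _ igg[of i j], of "\<lambda>x. x $ i * x $ j"] increment_cross_moment[OF s, of i j]
    unfolding D_def by simp_all
  have e1: "g \<omega> * (\<xi> \<omega> \<bullet> D \<omega>) = (\<Sum>j\<in>UNIV. (g \<omega> * \<xi> \<omega> $ j) * D \<omega> $ j)" for \<omega>
    by (simp add: inner_vec_def sum_distrib_left mult.assoc)
  have e2: "g \<omega> * ((\<xi> \<omega> \<bullet> D \<omega>) * (\<xi>' \<omega> \<bullet> D \<omega>)) = (\<Sum>i\<in>UNIV. \<Sum>j\<in>UNIV. (g \<omega> * \<xi> \<omega> $ i * \<xi>' \<omega> $ j) * (D \<omega> $ i * D \<omega> $ j))" for \<omega>
    unfolding inner_vec_def inner_real_def sum_product by (simp add: sum_distrib_left mult_ac)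
  show "integrable M (\<lambda>\<omega>. g \<omega> * (\<xi> \<omega> \<bullet> (W u \<omega> - W s \<omega>)))"
    unfolding D_def[symmetric] e1 using 1 by (intro Bochner_Integration.integrable_sum) auto
  show "expectation (\<lambda>\<omega>. g \<omega> * (\<xi> \<omega> \<bullet> (W u \<omega> - W s \<omega>))) = 0"
    unfolding D_def[symmetric] e1 using 1 by (subst Bochner_Integration.integral_sum) auto
  show "integrable M (\<lambda>\<omega>. g \<omega> * ((\<xi> \<omega> \<bullet> (W u \<omega> - W s \<omega>)) * (\<xi>' \<omega> \<bullet> (W u \<omega> - W s \<omega>))))"
    unfolding D_def[symmetric] e2 using 2 by (intro Bochner_Integration.integrable_sum) auto
  have "expectation (\<lambda>\<omega>. g \<omega> * ((\<xi> \<omega> \<bullet> D \<omega>) * (\<xi>' \<omega> \<bullet> D \<omega>))) =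
      (\<Sum>i\<in>UNIV. \<Sum>j\<in>UNIV. if i = j then (u - s) * expectation (\<lambda>\<omega>. g \<omega> * \<xi> \<omega> $ i * \<xi>' \<omega> $ j) else 0)"
    unfolding e2 using 2 by (subst Bochner_Integration.integral_sum | simp)+
  also have "\<dots> = (u - s) * (\<Sum>i\<in>UNIV. expectation (\<lambda>\<omega>. g \<omega> * \<xi> \<omega> $ i * \<xi>' \<omega> $ i))"
    by (simp add: sum_distrib_left)
  also have "(\<Sum>i\<in>UNIV. expectation (\<lambda>\<omega>. g \<omega> * \<xi> \<omega> $ i * \<xi>' \<omega> $ i)) = expectation (\<lambda>\<omega>. g \<omega> * (\<xi> \<omega> \<bullet> \<xi>' \<omega>))"
    using igg by (subst Bochner_Integration.integral_sum[symmetric]) (auto simp: inner_vec_def sum_distrib_left mult.assoc)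
  finally show "expectation (\<lambda>\<omega>. g \<omega> * ((\<xi> \<omega> \<bullet> (W u \<omega> - W s \<omega>)) * (\<xi>' \<omega> \<bullet> (W u \<omega> - W s \<omega>)))) = (u - s) * expectation (\<lambda>\<omega>. g \<omega> * (\<xi> \<omega> \<bullet> \<xi>' \<omega>))"
    unfolding D_def .
qed

text \<open>Cauchy-Schwarz over the d coordinates bounds the fourth power of the norm by d times the
  sum of the d coordinate fourth powers, each with mean 3 (u - s)^2; hence 3 d^2.\<close>

lemma increment_norm_4:
  assumes s: "0 \<le> s" "s \<le> u"
  shows "integrable M (\<lambda>\<omega>. norm (W u \<omega> - W s \<omega>) ^ 4)"
    and "expectation (\<lambda>\<omega>. norm (W u \<omega> - W s \<omega>) ^ 4) \<le> 3 * (real CARD('d))\<^sup>2 * (u - s)\<^sup>2"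
proof -
  define D where "D \<omega> = W u \<omega> - W s \<omega>" for \<omega>
  have le: "norm (D \<omega>) ^ 4 \<le> (\<Sum>j\<in>UNIV. (D \<omega> $ j) ^ 4) * real CARD('d)" for \<omega>
  proof -
    have "norm (D \<omega>) ^ 4 = ((norm (D \<omega>))\<^sup>2)\<^sup>2" by simp
    also have "\<dots> = (\<Sum>j\<in>UNIV. (D \<omega> $ j)\<^sup>2)\<^sup>2"
      unfolding power2_norm_eq_inner inner_vec_def by (simp add: power2_eq_square)
    also have "\<dots> \<le> (\<Sum>j\<in>UNIV. ((D \<omega> $ j)\<^sup>2)\<^sup>2) * real CARD('d)"
      by (rule sum_squared_le_sum_of_squares)
    finally show ?thesis by simp
  qed
  have i4: "integrable M (\<lambda>\<omega>. (\<Sum>j\<in>UNIV. (D \<omega> $ j) ^ 4) * real CARD('d))"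
    unfolding D_def using increment_moment(1)[OF s] by (intro integrable_mult_left Bochner_Integration.integrable_sum) auto
  show i: "integrable M (\<lambda>\<omega>. norm (W u \<omega> - W s \<omega>) ^ 4)"
    by (rule Bochner_Integration.integrable_bound[OF i4]) (use le in \<open>auto simp: D_def intro: order_trans[OF _ abs_ge_self]\<close>)
  have "expectation (\<lambda>\<omega>. norm (D \<omega>) ^ 4) \<le> expectation (\<lambda>\<omega>. (\<Sum>j\<in>UNIV. (D \<omega> $ j) ^ 4) * real CARD('d))"
    using i i4 le by (intro integral_mono) (auto simp: D_def)
  also have "\<dots> = 3 * (real CARD('d))\<^sup>2 * (u - s)\<^sup>2"
    unfolding D_def using increment_moment(1)[OF s] increment_moment(4)[OF s]
    by (simp add: Bochner_Integration.integral_sum power2_eq_square)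
  finally show "expectation (\<lambda>\<omega>. norm (W u \<omega> - W s \<omega>) ^ 4) \<le> 3 * (real CARD('d))\<^sup>2 * (u - s)\<^sup>2"
    by (simp add: D_def)
qed

text \<open>Unlike in \<open>simple_pred\<close>, grid points may coincide. Clamping a partition at
  a time t thus stays inside the class, the cells beyond t becoming empty.\<close>

definition adapted_grid :: "nat \<Rightarrow> (nat \<Rightarrow> real) \<Rightarrow> (nat \<Rightarrow> 'a \<Rightarrow> real^'d) \<Rightarrow> bool" where
  "adapted_grid n s \<xi> \<longleftrightarrow> 0 \<le> s 0 \<and> (\<forall>k<n. s k \<le> s (Suc k)) \<and>
     (\<forall>k<n. \<xi> k \<in> borel_measurable (F (s k)) \<and> bounded (range (\<xi> k)))"

definition grid_sum :: "nat \<Rightarrow> (nat \<Rightarrow> real) \<Rightarrow> (nat \<Rightarrow> 'a \<Rightarrow> real^'d) \<Rightarrow> 'a \<Rightarrow> real" where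
  "grid_sum n s \<xi> \<omega> = (\<Sum>k<n. \<xi> k \<omega> \<bullet> (W (s (Suc k)) \<omega> - W (s k) \<omega>))"

lemma grid_sum_simps [simp]:
  "grid_sum 0 s \<xi> \<omega> = 0"
  "grid_sum (Suc k) s \<xi> \<omega> = grid_sum k s \<xi> \<omega> + \<xi> k \<omega> \<bullet> (W (s (Suc k)) \<omega> - W (s k) \<omega>)"
  by (simp_all add: grid_sum_def)

lemma adapted_gridD:
  assumes "adapted_grid n s \<xi>"
  shows "k < n \<Longrightarrow> s k \<le> s (Suc k)" "k \<le> n \<Longrightarrow> 0 \<le> s k" "k < n \<Longrightarrow> \<xi> k \<in> borel_measurable (F (s k))"
    "k < n \<Longrightarrow> bounded (range (\<xi> k))" "i \<le> k \<Longrightarrow> k \<le> n \<Longrightarrow> s i \<le> s k"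
proof -
  show *: "s i \<le> s k" if "i \<le> k" "k \<le> n" for i k
    using that
  proof (induction k)
    case (Suc k)
    then show ?case using assms unfolding adapted_grid_def by (cases "i = Suc k") (auto intro: order_trans)
  qed simp
  show "k \<le> n \<Longrightarrow> 0 \<le> s k" using *[of 0 k] assms by (auto simp: adapted_grid_def)
qed (use assms in \<open>auto simp: adapted_grid_def\<close>)

lemma grid_sum_measurable_F:
  assumes "adapted_grid n s \<xi>" "j \<le> n"
  shows "grid_sum j s \<xi> \<in> borel_measurable (F (s j))"
  unfolding grid_sum_def
proof (rule borel_measurable_sum)
  fix k assume "k \<in> {..<j}"
  then have k: "k < n" "Suc k \<le> j" "k \<le> j" using assms(2) by auto
  note [measurable] = measurable_F_mono[OF adapted_gridD(3)[OF assms(1) k(1)] adapted_gridD(5)[OF assms(1) k(3) assms(2)]]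
  have [measurable]: "W (s (Suc k)) \<in> borel_measurable (F (s j))" "W (s k) \<in> borel_measurable (F (s j))"
    using k adapted_gridD[OF assms(1)] assms(2) by (auto intro!: W_measurable_F)
  show "(\<lambda>\<omega>. \<xi> k \<omega> \<bullet> (W (s (Suc k)) \<omega> - W (s k) \<omega>)) \<in> borel_measurable (F (s j))" by measurable
qed

lemma sq_integrable_inner_increment:
  assumes s: "0 \<le> s" "s \<le> u" and \<xi>: "\<xi> \<in> borel_measurable (F s)" "bounded (range \<xi>)"
  shows "sq_integrable M (\<lambda>\<omega>. \<xi> \<omega> \<bullet> (W u \<omega> - W s \<omega>))"
proof -
  note [measurable] = measurable_F_M[OF \<xi>(1)]
  show ?thesis
    using inner_increment(3)[OF s borel_measurable_const integrable_const \<xi> \<xi>, of 1]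
    unfolding sq_integrable_def power2_eq_square mult_1 by simp
qed

lemma sq_integrable_grid_sum:
  assumes "adapted_grid n s \<xi>" "j \<le> n"
  shows "sq_integrable M (grid_sum j s \<xi>)"
proof -
  have "sq_integrable M (\<lambda>\<omega>. grid_sum j s \<xi> \<omega>)"
    unfolding grid_sum_def
    using adapted_gridD[OF assms(1)] assms(2) by (intro sq_integrable_sum sq_integrable_inner_increment) auto
  then show ?thesis by simp
qed

text \<open>The sum over the first j cells is known at time \<open>s j\<close>, hence orthogonal to
  the next increment, and second moments simply add.\<close>

lemma grid_isometry:
  assumes "adapted_grid n s \<xi>" "j \<le> n"
  shows "expectation (\<lambda>\<omega>. (grid_sum j s \<xi> \<omega>)\<^sup>2) = (\<Sum>k<j. (s (Suc k) - s k) * expectation (\<lambda>\<omega>. (norm (\<xi> k \<omega>))\<^sup>2))"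
  using assms(2)
proof (induction j)
  case (Suc j)
  then have j: "j < n" "j \<le> n" by auto
  note g = adapted_gridD[OF assms(1)]
  note sG = sq_integrable_grid_sum[OF assms(1) j(2)]
  note sD = sq_integrable_inner_increment[OF g(2)[OF j(2)] g(1)[OF j(1)] g(3)[OF j(1)] g(4)[OF j(1)]]
  let ?d = "\<lambda>\<omega>. \<xi> j \<omega> \<bullet> (W (s (Suc j)) \<omega> - W (s j) \<omega>)"
  \<comment> \<open>The factor 1 in the last term is the multiplier \<open>g\<close> of
    \<open>inner_increment\<close>.\<close>
  have "expectation (\<lambda>\<omega>. (grid_sum (Suc j) s \<xi> \<omega>)\<^sup>2) =
     expectation (\<lambda>\<omega>. (grid_sum j s \<xi> \<omega>)\<^sup>2 + 2 * (grid_sum j s \<xi> \<omega> * ?d \<omega>) + 1 * (?d \<omega> * ?d \<omega>))"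
    by (simp add: power2_sum algebra_simps power2_eq_square)
  also have "\<dots> = expectation (\<lambda>\<omega>. (grid_sum j s \<xi> \<omega>)\<^sup>2) + 2 * expectation (\<lambda>\<omega>. grid_sum j s \<xi> \<omega> * ?d \<omega>) + expectation (\<lambda>\<omega>. 1 * (?d \<omega> * ?d \<omega>))"
    using sG sD sq_integrable_mult[OF sG sD] sq_integrable_mult[OF sD sD]
    by (subst Bochner_Integration.integral_add | simp add: sq_integrable_def)+
  also have "expectation (\<lambda>\<omega>. grid_sum j s \<xi> \<omega> * ?d \<omega>) = 0"
    by (rule inner_increment(2)[OF g(2)[OF j(2)] g(1)[OF j(1)] grid_sum_measurable_F[OF assms(1) j(2)] sq_integrable_integrable[OF sG]])
      (use g(3,4)[OF j(1)] in auto)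
  also have "expectation (\<lambda>\<omega>. 1 * (?d \<omega> * ?d \<omega>)) = (s (Suc j) - s j) * expectation (\<lambda>\<omega>. (norm (\<xi> j \<omega>))\<^sup>2)"
    unfolding power2_norm_eq_inner
    using inner_increment(4)[OF g(2)[OF j(2)] g(1)[OF j(1)] borel_measurable_const integrable_const
        g(3)[OF j(1)] g(4)[OF j(1)] g(3)[OF j(1)] g(4)[OF j(1)], of 1]
    unfolding mult_1 .
  finally show ?case using Suc by simp
qed simp

text \<open>Beyond time t the clamped cells are empty, but the coefficients \<open>\<xi> k\<close>
  are not yet known at time t. Replacing them by 0 restores adaptedness without changing the
  sum.\<close>

lemma simple_adapted_grid:
  assumes sp: "simple_pred F n \<tau> \<xi>" and t: "0 \<le> t"
  defines "s \<equiv> \<lambda>k. min t (\<tau> k)" and "\<eta> \<equiv> \<lambda>k \<omega>. if \<tau> k \<le> t then \<xi> k \<omega> else 0"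
  shows "adapted_grid n s \<eta>" and "simple_int W n \<tau> \<xi> t \<omega> = grid_sum n s \<eta> \<omega>"
proof -
  have \<tau>: "\<And>i. i < n \<Longrightarrow> \<tau> i < \<tau> (Suc i)" "0 \<le> \<tau> 0"
    and \<xi>: "\<And>i. i < n \<Longrightarrow> \<xi> i \<in> borel_measurable (F (\<tau> i))" "\<And>i. i < n \<Longrightarrow> bounded (range (\<xi> i))"
    using sp by (auto simp: simple_pred_def)
  show "adapted_grid n s \<eta>"
    unfolding adapted_grid_def
  proof (intro conjI allI impI)
    show "0 \<le> s 0" using t \<tau> by (simp add: s_def)
    fix k assume k: "k < n"
    show "s k \<le> s (Suc k)" using \<tau>(1)[OF k] by (simp add: s_def min_def)
    show "\<eta> k \<in> borel_measurable (F (s k))" using \<xi>(1)[OF k] by (cases "\<tau> k \<le> t") (simp_all add: \<eta>_def s_def min_absorb2)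
    show "bounded (range (\<eta> k))" using \<xi>(2)[OF k] by (cases "\<tau> k \<le> t") (simp_all add: \<eta>_def)
  qed
  show "simple_int W n \<tau> \<xi> t \<omega> = grid_sum n s \<eta> \<omega>"
    unfolding simple_int_def grid_sum_def
  proof (rule sum.cong[OF refl])
    fix k assume "k \<in> {..<n}"
    then have "\<tau> k < \<tau> (Suc k)" using \<tau> by simp
    then show "\<xi> k \<omega> \<bullet> (W (min t (\<tau> (Suc k))) \<omega> - W (min t (\<tau> k)) \<omega>) = \<eta> k \<omega> \<bullet> (W (s (Suc k)) \<omega> - W (s k) \<omega>)"
      by (auto simp: s_def \<eta>_def)
  qed
qed

lemma simple_proc_norm_integral:
  fixes \<xi> :: "nat \<Rightarrow> 'a \<Rightarrow> real^'d"
  assumes sp: "simple_pred F n \<tau> \<xi>" and t: "0 \<le> t"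
  defines "s \<equiv> \<lambda>k. min t (\<tau> k)" and "\<eta> \<equiv> \<lambda>k \<omega>. if \<tau> k \<le> t then \<xi> k \<omega> else 0"
  shows "(\<integral>\<^sup>+v\<in>{0..t}. ennreal ((norm (simple_proc n \<tau> \<xi> v \<omega>))\<^sup>2) \<partial>lborel) =
    ennreal (\<Sum>k<n. (s (Suc k) - s k) * (norm (\<eta> k \<omega>))\<^sup>2)"
proof -
  have \<tau>: "\<And>i. i < n \<Longrightarrow> \<tau> i < \<tau> (Suc i)" "0 \<le> \<tau> 0"
    using sp by (auto simp: simple_pred_def)
  have \<tau>nn: "0 \<le> \<tau> i" if "i \<le> n" for i
    using strict_chain_le_iff[of n \<tau> 0 i, OF \<tau>(1)] \<tau>(2) that by force
  have "ennreal ((norm (simple_proc n \<tau> \<xi> v \<omega>))\<^sup>2) * indicator {0..t} v =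
      (\<Sum>k<n. ennreal ((norm (\<eta> k \<omega>))\<^sup>2) * indicator {s k<..s (Suc k)} v)" for v
  proof (cases "v \<in> {0..t} \<and> (\<exists>i<n. v \<in> {\<tau> i<..\<tau> (Suc i)})")
    case True
    then obtain i where i: "i < n" "v \<in> {\<tau> i<..\<tau> (Suc i)}" and v: "v \<in> {0..t}" by auto
    have "(\<Sum>k<n. ennreal ((norm (\<eta> k \<omega>))\<^sup>2) * indicator {s k<..s (Suc k)} v) =
        (\<Sum>k<n. if k = i then ennreal ((norm (\<xi> i \<omega>))\<^sup>2) else 0)"
    proof (rule sum.cong[OF refl])
      fix k assume "k \<in> {..<n}"
      then have k: "k < n" by simp
      show "ennreal ((norm (\<eta> k \<omega>))\<^sup>2) * indicator {s k<..s (Suc k)} v = (if k = i then ennreal ((norm (\<xi> i \<omega>))\<^sup>2) else 0)"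
      proof (cases "k = i")
        case True
        moreover have "v \<in> {s i<..s (Suc i)}" "\<tau> i \<le> t" using i v by (auto simp: s_def)
        ultimately show ?thesis by (simp add: \<eta>_def)
      next
        case False
        then have "v \<notin> {\<tau> k<..\<tau> (Suc k)}" using cell_unique[of n \<tau> k i v, OF \<tau>(1) k i(1) _ i(2)] by blast
        then have "v \<notin> {s k<..s (Suc k)}" using v by (auto simp: s_def)
        then show ?thesis using False by simp
      qed
    qed
    then show ?thesis using simple_proc_cell[of n \<tau> i v \<xi> \<omega>, OF \<tau>(1) i] v i by simp
  next
    case False
    have "(\<Sum>k<n. ennreal ((norm (\<eta> k \<omega>))\<^sup>2) * indicator {s k<..s (Suc k)} v) = 0"
    proof (intro sum.neutral ballI)
      fix k assume k: "k \<in> {..<n}"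
      then have "0 \<le> \<tau> k" using \<tau>nn by simp
      moreover have "\<not> (v \<in> {0..t} \<and> v \<in> {\<tau> k<..\<tau> (Suc k)})" using False k by auto
      ultimately have "v \<notin> {s k<..s (Suc k)}" using t by (auto simp: s_def min_def split: if_splits)
      then show "ennreal ((norm (\<eta> k \<omega>))\<^sup>2) * indicator {s k<..s (Suc k)} v = 0" by simp
    qed
    moreover have "ennreal ((norm (simple_proc n \<tau> \<xi> v \<omega>))\<^sup>2) * indicator {0..t} v = 0"
    proof (cases "v \<in> {0..t}")
      case True
      then have "simple_proc n \<tau> \<xi> v \<omega> = 0" using False by (intro simple_proc_no_cell) auto
      then show ?thesis by simp
    qed simp
    ultimately show ?thesis by simp
  qed
  then have "(\<integral>\<^sup>+v\<in>{0..t}. ennreal ((norm (simple_proc n \<tau> \<xi> v \<omega>))\<^sup>2) \<partial>lborel) =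
     (\<integral>\<^sup>+v. (\<Sum>k<n. ennreal ((norm (\<eta> k \<omega>))\<^sup>2) * indicator {s k<..s (Suc k)} v) \<partial>lborel)" by simp
  also have "\<dots> = (\<Sum>k<n. ennreal ((norm (\<eta> k \<omega>))\<^sup>2) * emeasure lborel {s k<..s (Suc k)})"
    by (subst nn_integral_sum) (auto simp: nn_integral_cmult_indicator)
  also have "\<dots> = (\<Sum>k<n. ennreal ((s (Suc k) - s k) * (norm (\<eta> k \<omega>))\<^sup>2))"
  proof (rule sum.cong[OF refl])
    fix k assume "k \<in> {..<n}"
    then have "s k \<le> s (Suc k)" using \<tau>(1)[of k] by (auto simp: s_def min_def)
    then show "ennreal ((norm (\<eta> k \<omega>))\<^sup>2) * emeasure lborel {s k<..s (Suc k)} = ennreal ((s (Suc k) - s k) * (norm (\<eta> k \<omega>))\<^sup>2)"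
      by (simp add: ennreal_mult[symmetric] mult.commute)
  qed
  also have "\<dots> = ennreal (\<Sum>k<n. (s (Suc k) - s k) * (norm (\<eta> k \<omega>))\<^sup>2)"
  proof (intro sum_ennreal mult_nonneg_nonneg)
    fix k assume "k \<in> {..<n}"
    then show "0 \<le> s (Suc k) - s k" using \<tau>(1)[of k] by (auto simp: s_def min_def)
  qed simp
  finally show ?thesis .
qed

text \<open>On the clamped grid the pathwise time integral of the squared norm is a finite sum,
  whose expectation is the right side of \<open>grid_isometry\<close>.\<close>

lemma simple_isometry:
  fixes \<xi> :: "nat \<Rightarrow> 'a \<Rightarrow> real^'d"
  assumes sp: "simple_pred F n \<tau> \<xi>" and t: "0 \<le> t"
  shows "(\<integral>\<^sup>+\<omega>. ennreal ((simple_int W n \<tau> \<xi> t \<omega>)\<^sup>2) \<partial>M) =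
    (\<integral>\<^sup>+\<omega>. (\<integral>\<^sup>+v\<in>{0..t}. ennreal ((norm (simple_proc n \<tau> \<xi> v \<omega>))\<^sup>2) \<partial>lborel) \<partial>M)"
proof -
  define s where "s = (\<lambda>k. min t (\<tau> k))"
  define \<eta> where "\<eta> = (\<lambda>k \<omega>. if \<tau> k \<le> t then \<xi> k \<omega> else 0)"
  note ag = simple_adapted_grid[OF sp t, folded s_def \<eta>_def]
  note g = adapted_gridD[OF ag(1)]
  have i: "integrable M (\<lambda>\<omega>. (norm (\<eta> k \<omega>))\<^sup>2)" if k: "k < n" for k
  proof -
    obtain R where R: "\<And>\<omega>. norm (\<eta> k \<omega>) \<le> R" using g(4)[of k] \<open>k < n\<close> by (auto simp: bounded_iff)
    note [measurable] = measurable_F_M[OF g(3)[OF k]]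
    show ?thesis
      by (rule integrable_const_bound[where B="R\<^sup>2"]) (use R in \<open>auto intro!: power_mono\<close>)
  qed
  have "(\<integral>\<^sup>+\<omega>. ennreal ((simple_int W n \<tau> \<xi> t \<omega>)\<^sup>2) \<partial>M) = ennreal (expectation (\<lambda>\<omega>. (grid_sum n s \<eta> \<omega>)\<^sup>2))"
    unfolding ag(2) using sq_integrable_grid_sum[OF ag(1)] by (intro nn_integral_eq_integral) (auto simp: sq_integrable_def)
  also have "expectation (\<lambda>\<omega>. (grid_sum n s \<eta> \<omega>)\<^sup>2) = expectation (\<lambda>\<omega>. \<Sum>k<n. (s (Suc k) - s k) * (norm (\<eta> k \<omega>))\<^sup>2)"
    using i by (simp add: grid_isometry[OF ag(1)] Bochner_Integration.integral_sum)
  also have "ennreal \<dots> = (\<integral>\<^sup>+\<omega>. ennreal (\<Sum>k<n. (s (Suc k) - s k) * (norm (\<eta> k \<omega>))\<^sup>2) \<partial>M)"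
    using i g(1) by (intro nn_integral_eq_integral[symmetric]) (auto intro!: sum_nonneg)
  finally show ?thesis
    unfolding simple_proc_norm_integral[OF sp t] s_def \<eta>_def .
qed

end

section \<open>Density of dyadic simple processes\<close>

lemma norm_add_sq_le: "(norm (a + b :: 'b::real_normed_vector))\<^sup>2 \<le> 2 * (norm a)\<^sup>2 + 2 * (norm b)\<^sup>2"
proof -
  have "(norm (a + b))\<^sup>2 \<le> (norm a + norm b)\<^sup>2" by (intro power_mono norm_triangle_ineq) simp
  also have "\<dots> \<le> 2 * (norm a)\<^sup>2 + 2 * (norm b)\<^sup>2"
    using sum_squares_bound[of "norm a" "norm b"] by (simp add: power2_sum)
  finally show ?thesis .
qed

lemma nn_integral_sq_add_le:
  fixes f g :: "'b \<Rightarrow> 'c::{real_normed_vector, second_countable_topology}"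
  assumes [measurable]: "f \<in> borel_measurable N" "g \<in> borel_measurable N"
  shows "(\<integral>\<^sup>+z. ennreal ((norm (f z + g z))\<^sup>2) \<partial>N) \<le>
    2 * (\<integral>\<^sup>+z. ennreal ((norm (f z))\<^sup>2) \<partial>N) + 2 * (\<integral>\<^sup>+z. ennreal ((norm (g z))\<^sup>2) \<partial>N)"
proof -
  have "(\<integral>\<^sup>+z. ennreal ((norm (f z + g z))\<^sup>2) \<partial>N) \<le> (\<integral>\<^sup>+z. 2 * ennreal ((norm (f z))\<^sup>2) + 2 * ennreal ((norm (g z))\<^sup>2) \<partial>N)"
  proof (rule nn_integral_mono)
    fix z
    have "ennreal ((norm (f z + g z))\<^sup>2) \<le> ennreal (2 * (norm (f z))\<^sup>2 + 2 * (norm (g z))\<^sup>2)"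
      by (rule ennreal_leI[OF norm_add_sq_le])
    then show "ennreal ((norm (f z + g z))\<^sup>2) \<le> 2 * ennreal ((norm (f z))\<^sup>2) + 2 * ennreal ((norm (g z))\<^sup>2)"
      by (simp add: ennreal_mult)
  qed
  also have "\<dots> = 2 * (\<integral>\<^sup>+z. ennreal ((norm (f z))\<^sup>2) \<partial>N) + 2 * (\<integral>\<^sup>+z. ennreal ((norm (g z))\<^sup>2) \<partial>N)"
    by (subst nn_integral_add) (simp_all add: nn_integral_cmult)
  finally show ?thesis .
qed

lemma ennreal_double_sum_less:
  assumes "a < ennreal (e / 4)" "b < ennreal (e / 4)" "0 < e"
  shows "2 * a + 2 * b < ennreal e"
proof -
  obtain x where x: "a = ennreal x" "0 \<le> x" using assms(1) by (cases a) auto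
  obtain y where y: "b = ennreal y" "0 \<le> y" using assms(2) by (cases b) auto
  have "x < e / 4" "y < e / 4" using assms x y by (auto simp: ennreal_less_iff)
  then have "ennreal (2 * x + 2 * y) < ennreal e" using assms(3) x y by (intro ennreal_lessI) auto
  then show ?thesis using x y by (simp add: ennreal_mult)
qed

text \<open>All approximants live on these grids: of two such grids the finer one refines the other,
  and \<open>dyadic_cov\<close> samples exactly these points.\<close>

definition dyadic :: "real \<Rightarrow> nat \<Rightarrow> nat \<Rightarrow> real" where
  "dyadic T m i = T * real i / 2 ^ m"

lemma dyadic_simps [simp]: "dyadic T m 0 = 0" "dyadic T m (2 ^ m) = T"
  by (simp_all add: dyadic_def)

lemma dyadic_Suc: "dyadic T m (Suc i) = dyadic T m i + T / 2 ^ m"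
  by (simp add: dyadic_def field_simps)

lemma dyadic_less: "0 < T \<Longrightarrow> dyadic T m i < dyadic T m (Suc i)"
  by (simp add: dyadic_Suc)

lemma dyadic_refines:
  assumes "m \<le> N"
  shows "dyadic T m ` {..2 ^ m} \<subseteq> dyadic T N ` {..2 ^ N}"
proof
  fix x assume "x \<in> dyadic T m ` {..2 ^ m}"
  then obtain i where i: "i \<le> 2 ^ m" "x = dyadic T m i" by auto
  have p: "(2::nat) ^ N = 2 ^ m * 2 ^ (N - m)" "(2::real) ^ N = 2 ^ m * 2 ^ (N - m)"
    using assms by (simp_all add: power_add[symmetric])
  have "x = dyadic T N (i * 2 ^ (N - m))" by (simp add: i dyadic_def p)
  moreover have "i * 2 ^ (N - m) \<le> 2 ^ N" using i unfolding p by (intro mult_right_mono) auto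
  ultimately show "x \<in> dyadic T N ` {..2 ^ N}" by auto
qed

section \<open>Approximation of predictable processes in L^2 of time and probability\<close>

context brownian
begin

lemma dyadic_refine:
  fixes \<xi> :: "nat \<Rightarrow> 'a \<Rightarrow> real^'d"
  assumes "simple_pred F (2 ^ m) (dyadic T m) \<xi>" "m \<le> N" "0 < T"
  defines "\<eta> \<equiv> \<lambda>k. simple_proc (2 ^ m) (dyadic T m) \<xi> (dyadic T N (Suc k))"
  shows "simple_pred F (2 ^ N) (dyadic T N) \<eta>"
    and "simple_proc (2 ^ N) (dyadic T N) \<eta> = simple_proc (2 ^ m) (dyadic T m) \<xi>"
    and "simple_int W (2 ^ N) (dyadic T N) \<eta> = simple_int W (2 ^ m) (dyadic T m) \<xi>"
  using simple_refine[OF assms(1) dyadic_less[OF assms(3)] _ dyadic_refines[OF assms(2), of T]]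
  unfolding \<eta>_def by (auto intro!: ext)

definition prod_meas :: "real \<Rightarrow> (real \<times> 'a) measure" where
  "prod_meas T = restrict_space lborel {0..T} \<Otimes>\<^sub>M M"

lemma space_prod_meas: "space (prod_meas T) = {0..T} \<times> space M"
  by (simp add: prod_meas_def space_pair_measure space_restrict_space)

lemma pair_sigma_finite_prod_meas: "pair_sigma_finite (restrict_space lborel {0..T::real}) M"
proof -
  interpret L: finite_measure "restrict_space lborel {0..T::real}"
    by (rule finite_measureI) (simp add: emeasure_restrict_space space_restrict_space emeasure_lborel_Icc_eq)
  show ?thesis by unfold_locales
qed

lemma nn_integral_prod_meas:
  assumes "f \<in> borel_measurable (prod_meas T)"
  shows "(\<integral>\<^sup>+z. f z \<partial>prod_meas T) = (\<integral>\<^sup>+\<omega>. (\<integral>\<^sup>+v\<in>{0..T}. f (v, \<omega>) \<partial>lborel) \<partial>M)"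
proof -
  interpret pair_sigma_finite "restrict_space lborel {0..T}" M by (rule pair_sigma_finite_prod_meas)
  show ?thesis
    using nn_integral_snd[OF assms[unfolded prod_meas_def]] unfolding prod_meas_def
    by (simp add: nn_integral_restrict_space)
qed

lemma sets_pred_sigma: "sets (pred_sigma M F) = sigma_sets ({0..} \<times> space M)
     ({{s<..t} \<times> A | s t A. 0 \<le> s \<and> s \<le> t \<and> A \<in> sets (F s)} \<union> {{0} \<times> A | A. A \<in> sets (F 0)})"
  unfolding pred_sigma_def using sets.sets_into_space[of _ "F _"] by (intro sets_measure_of) fastforce

lemma space_pred_sigma: "space (pred_sigma M F) = {0..} \<times> space M"
  unfolding pred_sigma_def by (simp add: space_measure_of_conv)

lemma sets_prod_meas_Times:
  assumes "B \<in> sets borel" "A \<in> sets M"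
  shows "(B \<times> A) \<inter> space (prod_meas T) \<in> sets (prod_meas T)"
proof -
  have "(B \<times> A) \<inter> space (prod_meas T) = (B \<inter> {0..T}) \<times> A"
    using sets.sets_into_space[OF assms(2)] by (auto simp: space_prod_meas)
  moreover have "B \<inter> {0..T} \<in> sets (restrict_space lborel {0..T})"
    using assms(1) by (auto simp: sets_restrict_space)
  ultimately show ?thesis unfolding prod_meas_def using assms(2) by simp
qed

text \<open>Every generator of the predictable sigma-algebra is a rectangle, so predictable
  functions are jointly measurable on the strip up to time T. Measurability of the identity
  expresses this inclusion and lets it be used by composition.\<close>

lemma measurable_ident_pred: "(\<lambda>z. z) \<in> prod_meas T \<rightarrow>\<^sub>M pred_sigma M F"
proof (rule measurable_sigma_sets[OF sets_pred_sigma])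
  show "{{s<..t} \<times> A | s t A. 0 \<le> s \<and> s \<le> t \<and> A \<in> sets (F s)} \<union> {{0} \<times> A | A. A \<in> sets (F 0)}
     \<subseteq> Pow ({0..} \<times> space M)"
    using sets.sets_into_space[of _ "F _"] by fastforce
  show "(\<lambda>z. z) \<in> space (prod_meas T) \<rightarrow> {0..} \<times> space M" by (auto simp: space_prod_meas)
  fix y assume "y \<in> {{s<..t} \<times> A | s t A. 0 \<le> s \<and> s \<le> t \<and> A \<in> sets (F s)} \<union> {{0} \<times> A | A. A \<in> sets (F 0)}"
  then have "\<exists>B A. y = B \<times> A \<and> B \<in> sets borel \<and> A \<in> sets M"
  proof (elim UnE CollectE exE conjE)
    fix s t A assume "y = {s<..t} \<times> A" "A \<in> sets (F s)"
    then show ?thesis using sets_F_le by (intro exI[of _ "{s<..t}"] exI[of _ A]) auto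
  next
    fix A assume "y = {0} \<times> A" "A \<in> sets (F 0)"
    then show ?thesis using sets_F_le by (intro exI[of _ "{0}"] exI[of _ A]) auto
  qed
  then obtain B A where "y = B \<times> A" "B \<in> sets borel" "A \<in> sets M" by blast
  then show "(\<lambda>z. z) -` y \<inter> space (prod_meas T) \<in> sets (prod_meas T)"
    using sets_prod_meas_Times by simp
qed

lemma measurable_pred_prod: "f \<in> measurable (pred_sigma M F) N \<Longrightarrow> f \<in> measurable (prod_meas T) N"
  by (rule measurable_compose[OF measurable_ident_pred])

lemma predictable_measurable:
  "predictable M F H \<Longrightarrow> (\<lambda>z. H (fst z) (snd z)) \<in> measurable (prod_meas T) borel"
  unfolding predictable_def by (drule measurable_pred_prod) (simp add: case_prod_beta')

lemma fst_measurable_prod [measurable]: "fst \<in> borel_measurable (prod_meas T)"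
proof -
  have "(\<lambda>x. x) \<in> borel_measurable (restrict_space lborel {0..T})"
    by (rule measurable_restrict_space1) simp
  from measurable_compose[OF measurable_fst this] show ?thesis unfolding prod_meas_def .
qed

lemma snd_measurable_prod [measurable]: "snd \<in> prod_meas T \<rightarrow>\<^sub>M M"
  unfolding prod_meas_def by simp

lemma simple_proc_measurable:
  assumes "simple_pred F n \<tau> \<xi>"
  shows "(\<lambda>z. simple_proc n \<tau> \<xi> (fst z) (snd z)) \<in> borel_measurable (prod_meas T)"
  unfolding simple_proc_def
proof (rule borel_measurable_sum)
  fix i assume "i \<in> {..<n}"
  then have "\<xi> i \<in> borel_measurable (F (\<tau> i))" using assms by (auto simp: simple_pred_def)
  note [measurable] = measurable_F_M[OF this]
  show "(\<lambda>z. indicator {\<tau> i<..\<tau> (Suc i)} (fst z) *\<^sub>R \<xi> i (snd z)) \<in> borel_measurable (prod_meas T)"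
    by measurable
qed

text \<open>Membership in the L^2 closure of the dyadic simple processes. The class is closed under
  sums and L^2 limits, which is what passing from rectangles to predictable sets and then to
  functions requires.\<close>

definition approximable :: "real \<Rightarrow> (real \<times> 'a \<Rightarrow> real^'d) \<Rightarrow> bool" where
  "approximable T f \<longleftrightarrow> (\<forall>e>0. \<exists>m \<xi>. simple_pred F (2 ^ m) (dyadic T m) \<xi> \<and>
     (\<integral>\<^sup>+z. ennreal ((norm (f z - simple_proc (2 ^ m) (dyadic T m) \<xi> (fst z) (snd z)))\<^sup>2) \<partial>prod_meas T) < ennreal e)"

lemma approximable_cong_AE:
  assumes "AE z in prod_meas T. f z = g z" "approximable T f"
  shows "approximable T g"
proof -
  have "(\<integral>\<^sup>+z. ennreal ((norm (f z - h z))\<^sup>2) \<partial>prod_meas T) = (\<integral>\<^sup>+z. ennreal ((norm (g z - h z))\<^sup>2) \<partial>prod_meas T)" for h :: "_ \<Rightarrow> real^'d"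
    by (rule nn_integral_cong_AE) (use assms(1) in auto)
  then show ?thesis using assms(2) by (simp add: approximable_def)
qed

lemma approximable_add:
  assumes T: "0 < T" and [measurable]: "f \<in> borel_measurable (prod_meas T)" "g \<in> borel_measurable (prod_meas T)"
    and "approximable T f" "approximable T g"
  shows "approximable T (\<lambda>z. f z + g z)"
  unfolding approximable_def
proof (intro allI impI)
  fix e :: real assume "0 < e"
  \<comment> \<open>A squared sum is bounded by 2 a + 2 b, which leaves e / 4 for each of the two
    errors.\<close>
  then have e: "0 < e / 4" by simp
  obtain m \<xi> where 1: "simple_pred F (2 ^ m) (dyadic T m) \<xi>"
    "(\<integral>\<^sup>+z. ennreal ((norm (f z - simple_proc (2 ^ m) (dyadic T m) \<xi> (fst z) (snd z)))\<^sup>2) \<partial>prod_meas T) < ennreal (e / 4)"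
    using assms(4) e unfolding approximable_def by blast
  obtain m' \<xi>' where 2: "simple_pred F (2 ^ m') (dyadic T m') \<xi>'"
    "(\<integral>\<^sup>+z. ennreal ((norm (g z - simple_proc (2 ^ m') (dyadic T m') \<xi>' (fst z) (snd z)))\<^sup>2) \<partial>prod_meas T) < ennreal (e / 4)"
    using assms(5) e unfolding approximable_def by blast
  define N where "N = max m m'"
  have N: "m \<le> N" "m' \<le> N" by (auto simp: N_def)
  define \<eta> where "\<eta> = (\<lambda>k. simple_proc (2 ^ m) (dyadic T m) \<xi> (dyadic T N (Suc k)))"
  define \<eta>' where "\<eta>' = (\<lambda>k. simple_proc (2 ^ m') (dyadic T m') \<xi>' (dyadic T N (Suc k)))"
  note r1 = dyadic_refine[OF 1(1) N(1) T, folded \<eta>_def]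
  note r2 = dyadic_refine[OF 2(1) N(2) T, folded \<eta>'_def]
  define \<zeta> where "\<zeta> = (\<lambda>k \<omega>. \<eta> k \<omega> + \<eta>' k \<omega>)"
  have sp: "simple_pred F (2 ^ N) (dyadic T N) \<zeta>"
    unfolding \<zeta>_def by (rule simple_pred_linear[where f="\<lambda>x. x" and g="\<lambda>x. x"]) (auto simp: r1 r2 linear_ident)
  have pr: "simple_proc (2 ^ N) (dyadic T N) \<zeta> v \<omega> =
      simple_proc (2 ^ m) (dyadic T m) \<xi> v \<omega> + simple_proc (2 ^ m') (dyadic T m') \<xi>' v \<omega>" for v \<omega>
    unfolding \<zeta>_def by (simp add: simple_proc_linear[of "\<lambda>x::real^'d. x" "\<lambda>x. x", OF linear_ident linear_ident] r1 r2)
  note [measurable] = simple_proc_measurable[OF 1(1)] simple_proc_measurable[OF 2(1)]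
  have "(\<integral>\<^sup>+z. ennreal ((norm (f z + g z - simple_proc (2 ^ N) (dyadic T N) \<zeta> (fst z) (snd z)))\<^sup>2) \<partial>prod_meas T) =
     (\<integral>\<^sup>+z. ennreal ((norm ((f z - simple_proc (2 ^ m) (dyadic T m) \<xi> (fst z) (snd z)) + (g z - simple_proc (2 ^ m') (dyadic T m') \<xi>' (fst z) (snd z))))\<^sup>2) \<partial>prod_meas T)"
    unfolding pr by (simp add: algebra_simps)
  also have "\<dots> \<le> 2 * (\<integral>\<^sup>+z. ennreal ((norm (f z - simple_proc (2 ^ m) (dyadic T m) \<xi> (fst z) (snd z)))\<^sup>2) \<partial>prod_meas T) +
      2 * (\<integral>\<^sup>+z. ennreal ((norm (g z - simple_proc (2 ^ m') (dyadic T m') \<xi>' (fst z) (snd z)))\<^sup>2) \<partial>prod_meas T)"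
    by (rule nn_integral_sq_add_le) measurable
  also have "\<dots> < ennreal e"
    by (rule ennreal_double_sum_less) (use 1(2) 2(2) \<open>0 < e\<close> in auto)
  finally show "\<exists>m \<xi>. simple_pred F (2 ^ m) (dyadic T m) \<xi> \<and>
     (\<integral>\<^sup>+z. ennreal ((norm (f z + g z - simple_proc (2 ^ m) (dyadic T m) \<xi> (fst z) (snd z)))\<^sup>2) \<partial>prod_meas T) < ennreal e"
    using sp by blast
qed

lemma approximable_0: "0 < T \<Longrightarrow> approximable T (\<lambda>z. 0)"
  unfolding approximable_def
proof (intro allI impI exI conjI)
  assume T: "0 < T"
  show "simple_pred F (2 ^ 0) (dyadic T 0) (\<lambda>_ _. 0)"
    using dyadic_less[OF T, of 0 0] by (simp add: simple_pred_def)
qed (simp add: simple_proc_def)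

lemma approximable_sum:
  assumes "0 < T" "\<And>i. i \<in> I \<Longrightarrow> f i \<in> borel_measurable (prod_meas T)" "\<And>i. i \<in> I \<Longrightarrow> approximable T (f i)"
  shows "approximable T (\<lambda>z. \<Sum>i\<in>I. f i z)"
  using assms(2,3)
  by (induction I rule: infinite_finite_induct) (auto simp: approximable_0[OF assms(1)] intro!: approximable_add[OF assms(1)])

lemma approximable_lim:
  assumes [measurable]: "f \<in> borel_measurable (prod_meas T)" "\<And>k. g k \<in> borel_measurable (prod_meas T)"
    and "\<And>k::nat. approximable T (g k)"
    and lim: "(\<lambda>k. \<integral>\<^sup>+z. ennreal ((norm (f z - g k z))\<^sup>2) \<partial>prod_meas T) \<longlonglongrightarrow> 0"
  shows "approximable T f"
  unfolding approximable_def
proof (intro allI impI)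
  fix e :: real assume "0 < e"
  then have e: "0 < e / 4" by simp
  then have "\<forall>\<^sub>F k in sequentially. (\<integral>\<^sup>+z. ennreal ((norm (f z - g k z))\<^sup>2) \<partial>prod_meas T) < ennreal (e / 4)"
    using order_tendstoD(2)[OF lim] by simp
  then obtain k where k: "(\<integral>\<^sup>+z. ennreal ((norm (f z - g k z))\<^sup>2) \<partial>prod_meas T) < ennreal (e / 4)"
    by (auto simp: eventually_sequentially)
  obtain m \<xi> where 1: "simple_pred F (2 ^ m) (dyadic T m) \<xi>"
    "(\<integral>\<^sup>+z. ennreal ((norm (g k z - simple_proc (2 ^ m) (dyadic T m) \<xi> (fst z) (snd z)))\<^sup>2) \<partial>prod_meas T) < ennreal (e / 4)"
    using assms(3)[of k] e unfolding approximable_def by blast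
  note [measurable] = simple_proc_measurable[OF 1(1)]
  have "(\<integral>\<^sup>+z. ennreal ((norm (f z - simple_proc (2 ^ m) (dyadic T m) \<xi> (fst z) (snd z)))\<^sup>2) \<partial>prod_meas T) =
     (\<integral>\<^sup>+z. ennreal ((norm ((f z - g k z) + (g k z - simple_proc (2 ^ m) (dyadic T m) \<xi> (fst z) (snd z))))\<^sup>2) \<partial>prod_meas T)"
    by simp
  also have "\<dots> \<le> 2 * (\<integral>\<^sup>+z. ennreal ((norm (f z - g k z))\<^sup>2) \<partial>prod_meas T) +
      2 * (\<integral>\<^sup>+z. ennreal ((norm (g k z - simple_proc (2 ^ m) (dyadic T m) \<xi> (fst z) (snd z)))\<^sup>2) \<partial>prod_meas T)"
    by (rule nn_integral_sq_add_le) measurable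
  also have "\<dots> < ennreal e"
    by (rule ennreal_double_sum_less) (use k 1(2) \<open>0 < e\<close> in auto)
  finally show "\<exists>m \<xi>. simple_pred F (2 ^ m) (dyadic T m) \<xi> \<and>
     (\<integral>\<^sup>+z. ennreal ((norm (f z - simple_proc (2 ^ m) (dyadic T m) \<xi> (fst z) (snd z)))\<^sup>2) \<partial>prod_meas T) < ennreal e"
    using 1(1) by blast
qed

text \<open>Rounding the ends s and u to the dyadic grid of mesh h changes the process only within
  distance h of s or of u, a set of times of length at most 4 h.\<close>

lemma approximable_rectangle:
  assumes T: "0 < T" and s: "0 \<le> s" and A: "A \<in> sets (F s)"
  shows "approximable T (\<lambda>z. indicator ({s<..u} \<times> A) z *\<^sub>R c)"
  unfolding approximable_def
proof (intro allI impI)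
  fix e :: real assume e: "0 < e"
  \<comment> \<open>The aim is 4 h |c|^2 < e with h = T / 2^m; the summand 1 keeps \<open>q\<close>
    positive when c = 0.\<close>
  define q where "q = 4 * T * (norm c)\<^sup>2 + 1"
  have q: "0 < q" using T by (auto simp: q_def intro!: add_nonneg_pos)
  obtain m where m: "(1 / 2 :: real) ^ m < e / q" using real_arch_pow_inv[of "e / q" "1/2"] e q by auto
  define h where "h = T / 2 ^ m"
  have h: "0 < h" using T by (simp add: h_def)
  have eh: "4 * h * (norm c)\<^sup>2 < e"
  proof -
    have "4 * h * (norm c)\<^sup>2 \<le> q * (1 / 2) ^ m" by (simp add: q_def h_def power_one_over field_simps)
    also have "\<dots> < e" using m q by (simp add: field_simps)
    finally show ?thesis .
  qed
  \<comment> \<open>A cell is switched on according to its left end. If that end is at least s then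
    \<open>A\<close> is already known there, so the coefficient is adapted.\<close>
  define \<xi> where "\<xi> = (\<lambda>i \<omega>. if s \<le> dyadic T m i \<and> dyadic T m i < u then indicator A \<omega> *\<^sub>R c else 0)"
  have sp: "simple_pred F (2 ^ m) (dyadic T m) \<xi>"
    unfolding simple_pred_def
  proof (intro conjI allI impI)
    fix i
    show "dyadic T m i < dyadic T m (Suc i)" by (rule dyadic_less[OF T])
    show "\<xi> i \<in> borel_measurable (F (dyadic T m i))"
    proof (cases "s \<le> dyadic T m i \<and> dyadic T m i < u")
      case True
      then have [measurable]: "A \<in> sets (F (dyadic T m i))" using A subalgebra_F_mono[of s "dyadic T m i"] by (auto simp: subalgebra_def)
      show ?thesis using True unfolding \<xi>_def by simp
    next
      case False
      then have "\<xi> i = (\<lambda>_. 0)" by (auto simp: \<xi>_def fun_eq_iff)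
      then show ?thesis by simp
    qed
    show "bounded (range (\<xi> i))"
      unfolding bounded_iff by (rule exI[of _ "norm c"]) (auto simp: \<xi>_def indicator_def)
  qed simp
  let ?g = "\<lambda>v \<omega>. indicator ({s<..u} \<times> A) (v, \<omega>) *\<^sub>R c - simple_proc (2 ^ m) (dyadic T m) \<xi> v \<omega>"
  let ?I = "\<lambda>x. {x - h..x + h}"
  \<comment> \<open>Away from s and u by more than h, the point v and the left end of its cell fall
    on the same side of both. Time 0 belongs to no cell and to no rectangle, so both processes
    vanish there.\<close>
  have bound: "(norm (?g v \<omega>))\<^sup>2 \<le> (norm c)\<^sup>2 * (indicator (?I s) v + indicator (?I u) v)" if v: "v \<in> {0..T}" for v \<omega>
  proof (cases "v = 0")
    case True
    have "simple_proc (2 ^ m) (dyadic T m) \<xi> v \<omega> = 0"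
      using T by (intro simple_proc_no_cell) (auto simp: True dyadic_def not_less field_simps)
    then have "?g v \<omega> = 0" using s True by (simp add: indicator_def)
    then show ?thesis by simp
  next
    case False
    have "dyadic T m 0 < v" "v \<le> dyadic T m (2 ^ m)" using v False by auto
    then obtain i where i: "i < 2 ^ m" "v \<in> {dyadic T m i<..dyadic T m (Suc i)}"
      using cell_exists[of 0 "2 ^ m" "dyadic T m" v] by auto
    have pv: "simple_proc (2 ^ m) (dyadic T m) \<xi> v \<omega> = \<xi> i \<omega>"
      by (rule simple_proc_cell[OF dyadic_less[OF T] i])
    have iv: "dyadic T m i < v" "v \<le> dyadic T m i + h" using i by (auto simp: dyadic_Suc h_def)
    show ?thesis
    proof (cases "v \<in> ?I s \<or> v \<in> ?I u")
      case True
      have "norm (?g v \<omega>) \<le> norm c" unfolding pv by (auto simp: \<xi>_def indicator_def)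
      then have "(norm (?g v \<omega>))\<^sup>2 \<le> (norm c)\<^sup>2 * 1" by (simp add: power_mono)
      also have "\<dots> \<le> (norm c)\<^sup>2 * (indicator (?I s) v + indicator (?I u) v)"
        using True by (intro mult_left_mono) (auto simp: indicator_def)
      finally show ?thesis .
    next
      case False
      then have "(s < v \<and> v \<le> u) \<longleftrightarrow> (s \<le> dyadic T m i \<and> dyadic T m i < u)"
        using iv by auto
      then have "?g v \<omega> = 0" unfolding pv by (auto simp: \<xi>_def indicator_def)
      then show ?thesis by simp
    qed
  qed
  have [measurable]: "A \<in> sets M" using A sets_F_le by auto
  note [measurable] = simple_proc_measurable[OF sp]
  have "(\<lambda>z. indicator ({s<..u} \<times> A) z :: real) \<in> borel_measurable (prod_meas T)"
  proof -
    have "(\<lambda>z. indicator {s<..u} (fst z) * indicator A (snd z) :: real) \<in> borel_measurable (prod_meas T)" by measurable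
    also have "(\<lambda>z. indicator {s<..u} (fst z) * indicator A (snd z) :: real) = (\<lambda>z. indicator ({s<..u} \<times> A) z)"
      by (auto simp: indicator_def fun_eq_iff)
    finally show ?thesis .
  qed
  note [measurable] = this
  have "(\<integral>\<^sup>+z. ennreal ((norm (indicator ({s<..u} \<times> A) z *\<^sub>R c - simple_proc (2 ^ m) (dyadic T m) \<xi> (fst z) (snd z)))\<^sup>2) \<partial>prod_meas T)
     = (\<integral>\<^sup>+\<omega>. (\<integral>\<^sup>+v\<in>{0..T}. ennreal ((norm (?g v \<omega>))\<^sup>2) \<partial>lborel) \<partial>M)"
    by (subst nn_integral_prod_meas) simp_all
  also have "\<dots> \<le> (\<integral>\<^sup>+\<omega>. ennreal (4 * h * (norm c)\<^sup>2) \<partial>M)"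
  proof (rule nn_integral_mono)
    fix \<omega>
    have "(\<integral>\<^sup>+v\<in>{0..T}. ennreal ((norm (?g v \<omega>))\<^sup>2) \<partial>lborel) \<le>
       (\<integral>\<^sup>+v. ennreal ((norm c)\<^sup>2) * indicator (?I s) v + ennreal ((norm c)\<^sup>2) * indicator (?I u) v \<partial>lborel)"
    proof (rule nn_integral_mono)
      fix v
      show "ennreal ((norm (?g v \<omega>))\<^sup>2) * indicator {0..T} v \<le> ennreal ((norm c)\<^sup>2) * indicator (?I s) v + ennreal ((norm c)\<^sup>2) * indicator (?I u) v"
      proof (cases "v \<in> {0..T}")
        case True
        have "ennreal ((norm (?g v \<omega>))\<^sup>2) \<le> ennreal ((norm c)\<^sup>2 * (indicator (?I s) v + indicator (?I u) v))"
          by (rule ennreal_leI[OF bound[OF True]])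
        also have "\<dots> = ennreal ((norm c)\<^sup>2) * indicator (?I s) v + ennreal ((norm c)\<^sup>2) * indicator (?I u) v"
          by (simp add: ennreal_mult distrib_left ennreal_indicator)
        finally show ?thesis using True by simp
      qed simp
    qed
    also have "\<dots> = ennreal ((norm c)\<^sup>2) * ennreal (2 * h) + ennreal ((norm c)\<^sup>2) * ennreal (2 * h)"
      using h by (subst nn_integral_add) (simp_all add: nn_integral_cmult_indicator)
    also have "\<dots> = ennreal (4 * h * (norm c)\<^sup>2)"
      using h by (simp add: ennreal_mult[symmetric] ennreal_plus[symmetric] del: ennreal_plus)
    finally show "(\<integral>\<^sup>+v\<in>{0..T}. ennreal ((norm (?g v \<omega>))\<^sup>2) \<partial>lborel) \<le> ennreal (4 * h * (norm c)\<^sup>2)" .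
  qed
  also have "\<dots> = ennreal (4 * h * (norm c)\<^sup>2)" by (simp add: emeasure_space_1)
  also have "\<dots> < ennreal e" using eh h by (intro ennreal_lessI) (use e in auto)
  finally show "\<exists>m \<xi>. simple_pred F (2 ^ m) (dyadic T m) \<xi> \<and>
     (\<integral>\<^sup>+z. ennreal ((norm (indicator ({s<..u} \<times> A) z *\<^sub>R c - simple_proc (2 ^ m) (dyadic T m) \<xi> (fst z) (snd z)))\<^sup>2) \<partial>prod_meas T) < ennreal e"
    using sp by blast
qed

text \<open>Simple processes vanish at time 0, whereas the predictable sigma-algebra has generators
  {0} x A. These are invisible in L^2 because a single time is null.\<close>

lemma AE_prod_meas_nonzero: "AE z in prod_meas T. fst z \<noteq> 0"
proof -
  have "({0} \<inter> {0..T}) \<times> space M \<in> null_sets (restrict_space lborel {0..T} \<Otimes>\<^sub>M M)"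
  proof (rule null_setsI)
    have 1: "{0} \<inter> {0..T} \<in> sets (restrict_space lborel {0..T})"
      by (subst sets_restrict_space_iff) simp_all
    show "({0} \<inter> {0..T}) \<times> space M \<in> sets (restrict_space lborel {0..T} \<Otimes>\<^sub>M M)" using 1 by simp
    have "emeasure (restrict_space lborel {0..T}) ({0} \<inter> {0..T}) = emeasure lborel ({0} \<inter> {0..T})"
      by (rule emeasure_restrict_space) auto
    also have "\<dots> = 0" using emeasure_lborel_countable[of "{0} \<inter> {0..T}"] by simp
    finally show "emeasure (restrict_space lborel {0..T} \<Otimes>\<^sub>M M) (({0} \<inter> {0..T}) \<times> space M) = 0"
      using 1 by (subst emeasure_pair_measure_Times) simp_all
  qed
  from AE_not_in[OF this] show ?thesis
    unfolding prod_meas_def[symmetric]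
    by (rule AE_mp) (rule AE_I2, auto simp: space_prod_meas)
qed

lemma indicator_pred_measurable:
  "S \<in> sets (pred_sigma M F) \<Longrightarrow> (\<lambda>z. indicator S z *\<^sub>R (c :: real^'d)) \<in> borel_measurable (prod_meas T)"
  by (rule measurable_pred_prod) (intro borel_measurable_scaleR borel_measurable_indicator borel_measurable_const)

text \<open>A pi-lambda argument: the generating rectangles are stable under intersection,
  complements cost a difference, and countable disjoint unions are L^2 limits of finite
  ones.\<close>

lemma approximable_indicator:
  assumes T: "0 < T" and S: "S \<in> sets (pred_sigma M F)"
  shows "approximable T (\<lambda>z. indicator S z *\<^sub>R c)"
proof -
  let ?G = "{{s<..t} \<times> A | s t A. 0 \<le> s \<and> s \<le> t \<and> A \<in> sets (F s)} \<union> {{0} \<times> A | A. A \<in> sets (F 0)}"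
  let ?O = "{0::real..} \<times> space M"
  have Int: "Int_stable ?G"
  proof (rule Int_stableI)
    fix a b assume ab: "a \<in> ?G" "b \<in> ?G"
    have e: "{} \<in> ?G" by (rule UnI2, rule CollectI, rule exI[of _ "{}"]) simp
    show "a \<inter> b \<in> ?G"
    proof (cases "a \<inter> b = {}")
      case True then show ?thesis using e by (simp only:)
    next
      case ne: False
      consider s t A s' t' A' where "a = {s<..t} \<times> A" "0 \<le> s" "s \<le> t" "A \<in> sets (F s)"
          "b = {s'<..t'} \<times> A'" "0 \<le> s'" "s' \<le> t'" "A' \<in> sets (F s')"
        | s t A A' where "a = {s<..t} \<times> A" "0 \<le> s" "b = {0} \<times> A'"
        | s t A A' where "b = {s<..t} \<times> A" "0 \<le> s" "a = {0} \<times> A'"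
        | A A' where "a = {0} \<times> A" "A \<in> sets (F 0)" "b = {0} \<times> A'" "A' \<in> sets (F 0)"
        using ab by blast
      then show ?thesis
      proof cases
        case 1
        let ?s = "max s s'" and ?t = "min t t'"
        have "a \<inter> b = {?s<..?t} \<times> (A \<inter> A')" using 1 by auto
        moreover have "?s \<le> ?t" using ne 1 by auto
        moreover have "A \<in> sets (F ?s)" "A' \<in> sets (F ?s)"
          using 1 subalgebra_F_mono[of s ?s] subalgebra_F_mono[of s' ?s] by (auto simp: subalgebra_def)
        ultimately show ?thesis using 1
          by (intro UnI1 CollectI exI[of _ ?s] exI[of _ ?t] exI[of _ "A \<inter> A'"]) auto
      next
        case 2 then have "a \<inter> b = {}" by auto
        then show ?thesis using ne by simp
      next
        case 3 then have "a \<inter> b = {}" by auto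
        then show ?thesis using ne by simp
      next
        case 4
        then have "a \<inter> b = {0} \<times> (A \<inter> A')" by auto
        then show ?thesis using 4 by (intro UnI2 CollectI exI[of _ "A \<inter> A'"]) auto
      qed
    qed
  qed
  have Gsub: "?G \<subseteq> Pow ?O" using sets.sets_into_space[of _ "F _"] by fastforce
  have "S \<in> sigma_sets ?O ?G" using S by (simp add: sets_pred_sigma)
  \<comment> \<open>All vectors \<open>c\<close> are treated at once because the complement uses the
    approximation for - c.\<close>
  define P where "P S \<longleftrightarrow> (\<forall>c. approximable T (\<lambda>z. indicator S z *\<^sub>R c))" for S
  have "P S"
    using Int Gsub \<open>S \<in> sigma_sets ?O ?G\<close>
  proof (induction S rule: sigma_sets_induct_disjoint)
    case (basic A)
    then consider s t B where "A = {s<..t} \<times> B" "0 \<le> s" "B \<in> sets (F s)" | B where "A = {0} \<times> B" by blast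
    then show ?case
    proof cases
      case 1 then show ?thesis using approximable_rectangle[OF T] by (simp add: P_def)
    next
      case 2
      show ?thesis unfolding P_def
      proof
        fix c show "approximable T (\<lambda>z. indicator A z *\<^sub>R c)"
          by (rule approximable_cong_AE[OF _ approximable_0[OF T]], rule AE_mp[OF AE_prod_meas_nonzero])
            (auto simp: 2 indicator_def)
      qed
    qed
  next
    case empty show ?case unfolding P_def using approximable_0[OF T] by simp
  next
    case (compl A)
    show ?case unfolding P_def
    proof
      fix c
      have A: "A \<in> sets (pred_sigma M F)" using compl by (simp add: sets_pred_sigma)
      have sM: "space M \<in> sets (F 0)" using sets.top[of "F 0"] by simp
      have R: "{0<..T} \<times> space M \<in> sets (pred_sigma M F)"
        unfolding sets_pred_sigma using sM T
        by (intro sigma_sets.Basic UnI1 CollectI exI[of _ 0] exI[of _ T] exI[of _ "space M"]) simp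
      \<comment> \<open>Up to time T and off time 0, the indicator of the complement is that of the
        full strip minus that of \<open>A\<close>. Time 0 is null and times beyond T lie outside
        \<open>prod_meas T\<close>.\<close>
      have "approximable T (\<lambda>z. indicator ({0<..T} \<times> space M) z *\<^sub>R c + indicator A z *\<^sub>R (- c))"
      proof (rule approximable_add[where f="\<lambda>z. indicator ({0<..T} \<times> space M) z *\<^sub>R c" and g="\<lambda>z. indicator A z *\<^sub>R (- c)", OF T])
        show "approximable T (\<lambda>z. indicator A z *\<^sub>R (- c))" using compl(2) unfolding P_def by blast
        show "approximable T (\<lambda>z. indicator ({0<..T} \<times> space M) z *\<^sub>R c)"
          by (rule approximable_rectangle[OF T order_refl sM])
      qed (rule indicator_pred_measurable[OF R] indicator_pred_measurable[OF A])+
      moreover have "AE z in prod_meas T. indicator ({0<..T} \<times> space M) z *\<^sub>R c + indicator A z *\<^sub>R (- c) = indicator (?O - A) z *\<^sub>R c"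
        using AE_prod_meas_nonzero
      proof (rule AE_mp, intro AE_I2 impI)
        fix z assume "z \<in> space (prod_meas T)" "fst z \<noteq> 0"
        then have "z \<in> {0<..T} \<times> space M" "z \<in> ?O" by (auto simp: space_prod_meas)
        then show "indicator ({0<..T} \<times> space M) z *\<^sub>R c + indicator A z *\<^sub>R (- c) = indicator (?O - A) z *\<^sub>R c"
          by (cases "z \<in> A") simp_all
      qed
      ultimately show "approximable T (\<lambda>z. indicator (?O - A) z *\<^sub>R c)"
        by (rule approximable_cong_AE[rotated])
    qed
  next
    case (union A)
    show ?case unfolding P_def
    proof
      fix c
      have Am: "A i \<in> sets (pred_sigma M F)" for i using union by (auto simp: sets_pred_sigma)
      define B where "B k = (\<Union>i<k. A i)" for k
      have Bm: "B k \<in> sets (pred_sigma M F)" for k unfolding B_def using Am by auto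
      have Um: "(\<Union>i. A i) \<in> sets (pred_sigma M F)" using Am by auto
      have "approximable T (\<lambda>z. \<Sum>i<k. indicator (A i) z *\<^sub>R c)" for k
        using union(3) unfolding P_def by (intro approximable_sum[OF T] indicator_pred_measurable Am) auto
      moreover have "(\<Sum>i<k. indicator (A i) z *\<^sub>R c) = indicator (B k) z *\<^sub>R c" for k z
      proof -
        have "indicator (B k) z = (\<Sum>i<k. indicator (A i) z :: real)"
          unfolding B_def by (rule indicator_UN_disjoint) (use union(1) in \<open>auto simp: disjoint_family_on_def\<close>)
        then show ?thesis by (simp only: scaleR_sum_left)
      qed
      ultimately have ap: "approximable T (\<lambda>z. indicator (B k) z *\<^sub>R c)" for k by simp
      show "approximable T (\<lambda>z. indicator (\<Union>i. A i) z *\<^sub>R c)"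
      proof (rule approximable_lim[where g="\<lambda>k z. indicator (B k) z *\<^sub>R c", OF indicator_pred_measurable[OF Um] indicator_pred_measurable[OF Bm] ap])
        let ?u = "\<lambda>k z. ennreal ((norm (indicator (\<Union>i. A i) z *\<^sub>R c - indicator (B k) z *\<^sub>R c))\<^sup>2)"
        \<comment> \<open>At each point the partial unions are eventually constant, and all errors
          are bounded by the constant |c|^2 on a finite measure space.\<close>
        have "(\<lambda>k. \<integral>\<^sup>+z. ?u k z \<partial>prod_meas T) \<longlonglongrightarrow> (\<integral>\<^sup>+z. 0 \<partial>prod_meas T)"
        proof (rule nn_integral_dominated_convergence[where w="\<lambda>z. ennreal ((norm c)\<^sup>2)"])
          note [measurable] = indicator_pred_measurable[OF Um] indicator_pred_measurable[OF Bm]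
          show "?u k \<in> borel_measurable (prod_meas T)" for k by measurable
          show "AE z in prod_meas T. ?u k z \<le> ennreal ((norm c)\<^sup>2)" for k
            by (intro AE_I2 ennreal_leI power_mono) (auto simp: indicator_def B_def)
          have "(\<integral>\<^sup>+z. ennreal ((norm c)\<^sup>2) \<partial>prod_meas T) = (\<integral>\<^sup>+\<omega>. (\<integral>\<^sup>+v\<in>{0..T}. ennreal ((norm c)\<^sup>2) \<partial>lborel) \<partial>M)"
            by (rule nn_integral_prod_meas) simp
          also have "\<dots> < \<infinity>"
            using T by (simp add: nn_integral_cmult_indicator emeasure_space_1 ennreal_mult[symmetric] less_top[symmetric])
          finally show "(\<integral>\<^sup>+z. ennreal ((norm c)\<^sup>2) \<partial>prod_meas T) < \<infinity>" .
          show "AE z in prod_meas T. (\<lambda>k. ?u k z) \<longlonglongrightarrow> 0"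
          proof (intro AE_I2 tendsto_eventually)
            fix z
            show "\<forall>\<^sub>F k in sequentially. ?u k z = 0"
            proof (cases "z \<in> (\<Union>i. A i)")
              case True
              then obtain i where i: "z \<in> A i" by auto
              show ?thesis
                by (rule eventually_sequentiallyI[of "Suc i"]) (use i True in \<open>auto simp: B_def indicator_def intro: Suc_le_lessD\<close>)
            next
              case False
              then show ?thesis by (auto simp: B_def indicator_def)
            qed
          qed
        qed simp_all
        then show "(\<lambda>k. \<integral>\<^sup>+z. ?u k z \<partial>prod_meas T) \<longlonglongrightarrow> 0" by simp
      qed
    qed
  qed
  then show ?thesis by (simp add: P_def)
qed

text \<open>A measurable function is a pointwise limit of simple functions of norm at most twice its
  own; dominated convergence turns this into an L^2 limit of finite sums of predictable
  indicators.\<close>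

lemma approximable_predictable:
  assumes T: "0 < T" and f: "f \<in> borel_measurable (pred_sigma M F)"
    and fin: "(\<integral>\<^sup>+z. ennreal ((norm (f z))\<^sup>2) \<partial>prod_meas T) < \<infinity>"
  shows "approximable T f"
proof -
  let ?N = "pred_sigma M F"
  obtain S where S: "\<And>i. simple_function ?N (S i)" "\<And>x. x \<in> space ?N \<Longrightarrow> (\<lambda>i. S i x) \<longlonglongrightarrow> f x"
    "\<And>i x. x \<in> space ?N \<Longrightarrow> norm (S i x) \<le> 2 * norm (f x)"
    using borel_measurable_implies_sequence_metric[OF f, of 0] unfolding dist_norm diff_zero by metis
  have spsub: "x \<in> space ?N" if "x \<in> space (prod_meas T)" for x
    using that by (auto simp: space_prod_meas space_pred_sigma)
  have fin_im: "finite (S i ` space ?N)" for i using S(1)[of i] by (simp add: simple_function_def)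
  have Sm: "S i \<in> borel_measurable ?N" for i by (rule borel_measurable_simple_function[OF S(1)])
  have ap: "approximable T (S i)" for i
  proof -
    have ms: "S i -` {y} \<inter> space ?N \<in> sets ?N" for y using measurable_sets[OF Sm[of i], of "{y}"] by simp
    have "approximable T (\<lambda>z. \<Sum>y\<in>S i ` space ?N. indicator (S i -` {y} \<inter> space ?N) z *\<^sub>R y)"
      by (intro approximable_sum[OF T] approximable_indicator[OF T] indicator_pred_measurable ms)
    then show ?thesis
    proof (rule approximable_cong_AE[rotated], intro AE_I2)
      fix z assume "z \<in> space (prod_meas T)"
      then have z: "z \<in> space ?N" by (rule spsub)
      have "(\<Sum>y\<in>S i ` space ?N. indicator (S i -` {y} \<inter> space ?N) z *\<^sub>R y) = (\<Sum>y\<in>S i ` space ?N. if y = S i z then y else 0)"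
        using z by (intro sum.cong) (auto simp: indicator_def)
      then show "(\<Sum>y\<in>S i ` space ?N. indicator (S i -` {y} \<inter> space ?N) z *\<^sub>R y) = S i z"
        using z fin_im[of i] by simp
    qed
  qed
  note [measurable] = measurable_pred_prod[OF f] measurable_pred_prod[OF Sm]
  show ?thesis
  proof (rule approximable_lim[OF measurable_pred_prod[OF f] measurable_pred_prod[OF Sm] ap])
    have "(\<lambda>k. \<integral>\<^sup>+z. ennreal ((norm (f z - S k z))\<^sup>2) \<partial>prod_meas T) \<longlonglongrightarrow> (\<integral>\<^sup>+z. 0 \<partial>prod_meas T)"
    \<comment> \<open>From |S k z| \<le> 2 |f z| follows |f z - S k z| \<le> 3 |f z|, hence the
      factor 9.\<close>
    proof (rule nn_integral_dominated_convergence[where w="\<lambda>z. 9 * ennreal ((norm (f z))\<^sup>2)"])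
      show "AE z in prod_meas T. ennreal ((norm (f z - S k z))\<^sup>2) \<le> 9 * ennreal ((norm (f z))\<^sup>2)" for k
      proof (rule AE_I2)
        fix z assume "z \<in> space (prod_meas T)"
        then have "norm (S k z) \<le> 2 * norm (f z)" using S(3) spsub by blast
        then have "norm (f z - S k z) \<le> 3 * norm (f z)" using norm_triangle_ineq4[of "f z" "S k z"] by linarith
        then have "(norm (f z - S k z))\<^sup>2 \<le> (3 * norm (f z))\<^sup>2" by (intro power_mono) auto
        then have "ennreal ((norm (f z - S k z))\<^sup>2) \<le> ennreal (9 * (norm (f z))\<^sup>2)"
          by (intro ennreal_leI) (simp add: power_mult_distrib)
        then show "ennreal ((norm (f z - S k z))\<^sup>2) \<le> 9 * ennreal ((norm (f z))\<^sup>2)"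
          by (simp add: ennreal_mult)
      qed
      show "(\<integral>\<^sup>+z. 9 * ennreal ((norm (f z))\<^sup>2) \<partial>prod_meas T) < \<infinity>"
        using fin by (simp add: nn_integral_cmult ennreal_mult_less_top)
      show "AE z in prod_meas T. (\<lambda>k. ennreal ((norm (f z - S k z))\<^sup>2)) \<longlonglongrightarrow> 0"
      proof (rule AE_I2)
        fix z assume "z \<in> space (prod_meas T)"
        then have "(\<lambda>k. S k z) \<longlonglongrightarrow> f z" using S(2) spsub by blast
        then have "(\<lambda>k. (norm (f z - S k z))\<^sup>2) \<longlonglongrightarrow> (norm (f z - f z))\<^sup>2"
          by (intro tendsto_intros)
        from tendsto_ennrealI[OF this] show "(\<lambda>k. ennreal ((norm (f z - S k z))\<^sup>2)) \<longlonglongrightarrow> 0"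
          by simp
      qed
      show "(\<lambda>z. ennreal ((norm (f z - S k z))\<^sup>2)) \<in> borel_measurable (prod_meas T)" for k by measurable
      show "(\<lambda>z. 9 * ennreal ((norm (f z))\<^sup>2)) \<in> borel_measurable (prod_meas T)" by measurable
    qed simp
    then show "(\<lambda>k. \<integral>\<^sup>+z. ennreal ((norm (f z - S k z))\<^sup>2) \<partial>prod_meas T) \<longlonglongrightarrow> 0" by simp
  qed
qed

text \<open>This is the square of the distance, written as an iterated integral so that it coincides
  literally with the convergence condition inside \<open>ito_int\<close>.\<close>

definition l2_dist :: "real \<Rightarrow> (real \<Rightarrow> 'a \<Rightarrow> real^'d) \<Rightarrow> (real \<Rightarrow> 'a \<Rightarrow> real^'d) \<Rightarrow> ennreal" where
  "l2_dist t f g = (\<integral>\<^sup>+\<omega>. (\<integral>\<^sup>+v\<in>{0..t}. ennreal ((norm (f v \<omega> - g v \<omega>))\<^sup>2) \<partial>lborel) \<partial>M)"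

lemma l2_dist_eq:
  assumes [measurable]: "(\<lambda>z. f (fst z) (snd z)) \<in> borel_measurable (prod_meas t)" "(\<lambda>z. g (fst z) (snd z)) \<in> borel_measurable (prod_meas t)"
  shows "l2_dist t f g = (\<integral>\<^sup>+z. ennreal ((norm (f (fst z) (snd z) - g (fst z) (snd z)))\<^sup>2) \<partial>prod_meas t)"
  unfolding l2_dist_def by (subst nn_integral_prod_meas) simp_all

theorem dyadic_simple_dense:
  assumes T: "0 < T" and H: "predictable M F H"
    and fin: "(\<integral>\<^sup>+\<omega>. (\<integral>\<^sup>+s\<in>{0..T}. ennreal ((norm (H s \<omega>))\<^sup>2) \<partial>lborel) \<partial>M) < \<infinity>"
  obtains m \<xi> where "\<And>k. simple_pred F (2 ^ m k) (dyadic T (m k)) (\<xi> k)"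
    "(\<lambda>k. l2_dist T H (simple_proc (2 ^ m k) (dyadic T (m k)) (\<xi> k))) \<longlonglongrightarrow> 0"
proof -
  have Hm: "(\<lambda>z. H (fst z) (snd z)) \<in> borel_measurable (pred_sigma M F)"
    using H unfolding predictable_def by (simp add: case_prod_beta')
  note Hp[measurable] = predictable_measurable[OF H]
  have "approximable T (\<lambda>z. H (fst z) (snd z))"
  proof (rule approximable_predictable[OF T Hm])
    show "(\<integral>\<^sup>+z. ennreal ((norm (H (fst z) (snd z)))\<^sup>2) \<partial>prod_meas T) < \<infinity>"
      using fin by (subst nn_integral_prod_meas) simp_all
  qed
  define Q where "Q k m \<xi> \<longleftrightarrow> simple_pred F (2 ^ m) (dyadic T m) \<xi> \<and> (\<integral>\<^sup>+z. ennreal ((norm (H (fst z) (snd z) -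
     simple_proc (2 ^ m) (dyadic T m) \<xi> (fst z) (snd z)))\<^sup>2) \<partial>prod_meas T) < ennreal (1 / real (Suc k))" for k m \<xi>
  have "\<forall>k. \<exists>m \<xi>. Q k m \<xi>"
    using \<open>approximable T _\<close> unfolding approximable_def Q_def by simp
  then obtain m \<xi> where Q: "\<And>k. Q k (m k) (\<xi> k)" by metis
  have *: "\<And>k. simple_pred F (2 ^ m k) (dyadic T (m k)) (\<xi> k)"
    "\<And>k. (\<integral>\<^sup>+z. ennreal ((norm (H (fst z) (snd z) - simple_proc (2 ^ m k) (dyadic T (m k)) (\<xi> k) (fst z) (snd z)))\<^sup>2) \<partial>prod_meas T) < ennreal (1 / real (Suc k))"
    using Q by (auto simp: Q_def)
  have "(\<lambda>k. l2_dist T H (simple_proc (2 ^ m k) (dyadic T (m k)) (\<xi> k))) \<longlonglongrightarrow> 0"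
  proof (rule tendsto_sandwich[OF _ _ tendsto_const])
    have "(\<lambda>k. 1 / real (Suc k)) \<longlonglongrightarrow> 0" by (rule LIMSEQ_Suc[OF lim_1_over_n])
    then show "(\<lambda>k. ennreal (1 / real (Suc k))) \<longlonglongrightarrow> 0" using tendsto_ennrealI[of _ 0] by simp
    show "\<forall>\<^sub>F k in sequentially. l2_dist T H (simple_proc (2 ^ m k) (dyadic T (m k)) (\<xi> k)) \<le> ennreal (1 / real (Suc k))"
      using *(2) by (intro always_eventually allI) (simp add: l2_dist_eq[OF Hp simple_proc_measurable[OF *(1)]] less_imp_le)
  qed simp
  then show ?thesis using that *(1) by blast
qed

end

section \<open>The Ito integral\<close>

lemma ennreal_tendsto_0_double:
  fixes a b :: "nat \<Rightarrow> ennreal"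
  assumes "a \<longlonglongrightarrow> 0" "b \<longlonglongrightarrow> 0"
  shows "(\<lambda>k. 2 * a k + 2 * b k) \<longlonglongrightarrow> 0"
proof -
  have "(\<lambda>k. 2 * a k + 2 * b k) \<longlonglongrightarrow> 2 * 0 + 2 * 0"
    using assms by (intro tendsto_add ennreal_tendsto_cmult) auto
  then show ?thesis by simp
qed

lemma ennreal_tendsto_0_le:
  fixes a b :: "nat \<Rightarrow> ennreal"
  assumes "a \<longlonglongrightarrow> 0" "\<And>k. b k \<le> a k"
  shows "b \<longlonglongrightarrow> 0"
  by (rule tendsto_sandwich[OF _ _ tendsto_const assms(1)]) (use assms(2) in auto)

definition l2_lim :: "'a measure \<Rightarrow> (nat \<Rightarrow> 'a \<Rightarrow> real) \<Rightarrow> ('a \<Rightarrow> real) \<Rightarrow> bool" where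
  "l2_lim M f g \<longleftrightarrow> (\<forall>k. sq_integrable M (f k)) \<and> sq_integrable M g \<and> (\<lambda>k. \<integral>x. (f k x - g x)\<^sup>2 \<partial>M) \<longlonglongrightarrow> 0"

lemma l2_limD:
  assumes "l2_lim M f g"
  shows "sq_integrable M (f k)" "sq_integrable M g" "(\<lambda>k. \<integral>x. (f k x - g x)\<^sup>2 \<partial>M) \<longlonglongrightarrow> 0"
  using assms by (auto simp: l2_lim_def)

lemma integral_sq_add_le:
  assumes "sq_integrable M f" "sq_integrable M g"
  shows "(\<integral>x. (f x + g x)\<^sup>2 \<partial>M) \<le> 2 * (\<integral>x. (f x)\<^sup>2 \<partial>M) + 2 * (\<integral>x. (g x)\<^sup>2 \<partial>M)"
proof -
  note 1 = sq_integrableD(2)[OF assms(1)] and 2 = sq_integrableD(2)[OF assms(2)]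
  have "(\<integral>x. (f x + g x)\<^sup>2 \<partial>M) \<le> (\<integral>x. 2 * (f x)\<^sup>2 + 2 * (g x)\<^sup>2 \<partial>M)"
    using 1 2 sq_integrableD(2)[OF sq_integrable_add[OF assms]] norm_add_sq_le[of "f _" "g _"]
    by (intro integral_mono) auto
  then show ?thesis using 1 2 by simp
qed

lemma l2_lim_add:
  assumes "l2_lim M f f'" "l2_lim M g g'"
  shows "l2_lim M (\<lambda>k x. f k x + g k x) (\<lambda>x. f' x + g' x)"
  unfolding l2_lim_def
proof (intro conjI allI)
  note 1 = l2_limD[OF assms(1)] and 2 = l2_limD[OF assms(2)]
  show "sq_integrable M (\<lambda>x. f k x + g k x)" for k by (rule sq_integrable_add[OF 1(1) 2(1)])
  show "sq_integrable M (\<lambda>x. f' x + g' x)" by (rule sq_integrable_add[OF 1(2) 2(2)])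
  have "(\<lambda>k. 2 * (\<integral>x. (f k x - f' x)\<^sup>2 \<partial>M) + 2 * (\<integral>x. (g k x - g' x)\<^sup>2 \<partial>M)) \<longlonglongrightarrow> 2 * 0 + 2 * 0"
    by (intro tendsto_intros 1 2)
  then have l: "(\<lambda>k. 2 * (\<integral>x. (f k x - f' x)\<^sup>2 \<partial>M) + 2 * (\<integral>x. (g k x - g' x)\<^sup>2 \<partial>M)) \<longlonglongrightarrow> 0" by simp
  show "(\<lambda>k. \<integral>x. (f k x + g k x - (f' x + g' x))\<^sup>2 \<partial>M) \<longlonglongrightarrow> 0"
  proof (rule tendsto_sandwich[OF _ _ tendsto_const l])
    show "\<forall>\<^sub>F k in sequentially. (\<integral>x. (f k x + g k x - (f' x + g' x))\<^sup>2 \<partial>M) \<le> 2 * (\<integral>x. (f k x - f' x)\<^sup>2 \<partial>M) + 2 * (\<integral>x. (g k x - g' x)\<^sup>2 \<partial>M)"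
      using integral_sq_add_le[OF sq_integrable_diff[OF 1(1) 1(2)] sq_integrable_diff[OF 2(1) 2(2)]]
      by (intro always_eventually allI) (simp add: algebra_simps)
  qed simp
qed

lemma l2_lim_cmult:
  assumes "l2_lim M f f'"
  shows "l2_lim M (\<lambda>k x. c * f k x) (\<lambda>x. c * f' x)"
  unfolding l2_lim_def
proof (intro conjI allI)
  note 1 = l2_limD[OF assms(1)]
  show "sq_integrable M (\<lambda>x. c * f k x)" for k by (rule sq_integrable_cmult[OF 1(1)])
  show "sq_integrable M (\<lambda>x. c * f' x)" by (rule sq_integrable_cmult[OF 1(2)])
  have "(\<lambda>k. c\<^sup>2 * (\<integral>x. (f k x - f' x)\<^sup>2 \<partial>M)) \<longlonglongrightarrow> c\<^sup>2 * 0" by (intro tendsto_intros 1)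
  moreover have "(\<integral>x. (c * f k x - c * f' x)\<^sup>2 \<partial>M) = c\<^sup>2 * (\<integral>x. (f k x - f' x)\<^sup>2 \<partial>M)" for k
    by (simp add: right_diff_distrib[symmetric] power_mult_distrib)
  ultimately show "(\<lambda>k. \<integral>x. (c * f k x - c * f' x)\<^sup>2 \<partial>M) \<longlonglongrightarrow> 0" by simp
qed

lemma l2_lim_diff:
  assumes "l2_lim M f f'" "l2_lim M g g'"
  shows "l2_lim M (\<lambda>k x. f k x - g k x) (\<lambda>x. f' x - g' x)"
  using l2_lim_add[OF assms(1) l2_lim_cmult[OF assms(2), of "-1"]] by simp

text \<open>Young's inequality with a free weight \<open>e\<close> plays the role of Cauchy-Schwarz:
  no square roots appear, and the weight is chosen afterwards to balance the two terms.\<close>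

lemma abs_integral_mult_le:
  assumes "sq_integrable M g" "sq_integrable M h" "0 < e"
  shows "(\<integral>x. \<bar>g x * h x\<bar> \<partial>M) \<le> e * (\<integral>x. (g x)\<^sup>2 \<partial>M) + (\<integral>x. (h x)\<^sup>2 \<partial>M) / e"
proof -
  have am: "\<bar>a * b\<bar> \<le> e * a\<^sup>2 + b\<^sup>2 / e" for a b :: real
  proof -
    have "0 \<le> (e * \<bar>a\<bar> - \<bar>b\<bar>)\<^sup>2" by simp
    then have "2 * (e * (\<bar>a\<bar> * \<bar>b\<bar>)) \<le> e\<^sup>2 * a\<^sup>2 + b\<^sup>2" by (simp add: power2_diff power_mult_distrib)
    moreover have "0 \<le> e * (\<bar>a\<bar> * \<bar>b\<bar>)" using assms(3) by simp
    ultimately have "e * (\<bar>a\<bar> * \<bar>b\<bar>) \<le> e\<^sup>2 * a\<^sup>2 + b\<^sup>2" by linarith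
    then show ?thesis using assms(3) by (simp add: abs_mult field_simps power2_eq_square)
  qed
  have "(\<integral>x. \<bar>g x * h x\<bar> \<partial>M) \<le> (\<integral>x. e * (g x)\<^sup>2 + (h x)\<^sup>2 / e \<partial>M)"
    using assms am by (intro integral_mono integrable_abs sq_integrable_mult) (auto simp: sq_integrable_def)
  also have "\<dots> = e * (\<integral>x. (g x)\<^sup>2 \<partial>M) + (\<integral>x. (h x)\<^sup>2 \<partial>M) / e"
    using assms by (simp add: sq_integrable_def)
  finally show ?thesis .
qed

lemma l2_lim_abs_mult:
  assumes "l2_lim M f f'" "sq_integrable M g"
  shows "(\<lambda>k. \<integral>x. \<bar>g x * (f k x - f' x)\<bar> \<partial>M) \<longlonglongrightarrow> 0"
proof (rule LIMSEQ_I)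
  note 1 = l2_limD[OF assms(1)]
  fix r :: real assume r: "0 < r"
  \<comment> \<open>The summand 1 avoids division by zero. With e = r / (2 G) the first term is at
    most r / 2, and the second is below r / 2 for large k.\<close>
  define G where "G = (\<integral>x. (g x)\<^sup>2 \<partial>M) + 1"
  have G: "G > 0" by (simp add: G_def add_nonneg_pos)
  define e where "e = r / (2 * G)"
  have e: "0 < e" using r G by (simp add: e_def)
  obtain N where N: "\<And>k. k \<ge> N \<Longrightarrow> norm ((\<integral>x. (f k x - f' x)\<^sup>2 \<partial>M) - 0) < e * (r / 2)"
    using LIMSEQ_D[OF 1(3), of "e * (r / 2)"] e r by auto
  show "\<exists>N. \<forall>k\<ge>N. norm ((\<integral>x. \<bar>g x * (f k x - f' x)\<bar> \<partial>M) - 0) < r"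
  proof (intro exI allI impI)
    fix k assume k: "k \<ge> N"
    have "(\<integral>x. \<bar>g x * (f k x - f' x)\<bar> \<partial>M) \<le> e * (\<integral>x. (g x)\<^sup>2 \<partial>M) + (\<integral>x. (f k x - f' x)\<^sup>2 \<partial>M) / e"
      by (rule abs_integral_mult_le[OF assms(2) sq_integrable_diff[OF 1(1,2)] e])
    also have "\<dots> < r / 2 + r / 2"
    proof (rule add_le_less_mono)
      have "e * (\<integral>x. (g x)\<^sup>2 \<partial>M) \<le> e * G" using e by (simp add: G_def)
      then show "e * (\<integral>x. (g x)\<^sup>2 \<partial>M) \<le> r / 2" using G by (simp add: e_def)
      show "(\<integral>x. (f k x - f' x)\<^sup>2 \<partial>M) / e < r / 2"
        using N[OF k] e by (simp add: field_simps)
    qed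
    finally show "norm ((\<integral>x. \<bar>g x * (f k x - f' x)\<bar> \<partial>M) - 0) < r" by simp
  qed
qed

lemma l2_lim_mult:
  assumes "l2_lim M f f'" "sq_integrable M g"
  shows "(\<lambda>k. \<integral>x. g x * f k x \<partial>M) \<longlonglongrightarrow> (\<integral>x. g x * f' x \<partial>M)"
proof (rule Lim_transform2[OF tendsto_const])
  note 1 = l2_limD[OF assms(1)]
  have "(\<integral>x. g x * f' x \<partial>M) - (\<integral>x. g x * f k x \<partial>M) = - (\<integral>x. g x * (f k x - f' x) \<partial>M)" for k
    using sq_integrable_mult[OF assms(2) 1(1)] sq_integrable_mult[OF assms(2) 1(2)]
    by (simp add: right_diff_distrib)
  moreover have "(\<lambda>k. - (\<integral>x. g x * (f k x - f' x) \<partial>M)) \<longlonglongrightarrow> - 0"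
    by (intro tendsto_minus Lim_null_comparison[OF _ l2_lim_abs_mult[OF assms]] always_eventually allI)
      (rule order_trans[OF integral_norm_bound], simp)
  ultimately show "(\<lambda>k. (\<integral>x. g x * f' x \<partial>M) - (\<integral>x. g x * f k x \<partial>M)) \<longlonglongrightarrow> 0" by simp
qed

text \<open>Expanding around the limit writes the square as a vanishing term plus a pairing with the
  fixed function \<open>f'\<close>.\<close>

lemma l2_lim_square:
  assumes "l2_lim M f f'"
  shows "(\<lambda>k. \<integral>x. (f k x)\<^sup>2 \<partial>M) \<longlonglongrightarrow> (\<integral>x. (f' x)\<^sup>2 \<partial>M)"
proof -
  note 1 = l2_limD[OF assms(1)]
  have "(\<integral>x. (f k x)\<^sup>2 \<partial>M) = (\<integral>x. (f k x - f' x)\<^sup>2 \<partial>M) + 2 * (\<integral>x. f' x * f k x \<partial>M) - (\<integral>x. (f' x)\<^sup>2 \<partial>M)" for k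
  proof -
    have "(\<integral>x. (f k x)\<^sup>2 \<partial>M) = (\<integral>x. (f k x - f' x)\<^sup>2 + 2 * (f' x * f k x) - (f' x)\<^sup>2 \<partial>M)"
      by (rule Bochner_Integration.integral_cong) (auto simp: power2_eq_square algebra_simps)
    then show ?thesis
      using sq_integrableD(2)[OF sq_integrable_diff[OF 1(1)[of k] 1(2)]] sq_integrable_mult[OF 1(2) 1(1)[of k]] sq_integrableD(2)[OF 1(2)]
      by simp
  qed
  moreover have "(\<lambda>k. (\<integral>x. (f k x - f' x)\<^sup>2 \<partial>M) + 2 * (\<integral>x. f' x * f k x \<partial>M) - (\<integral>x. (f' x)\<^sup>2 \<partial>M)) \<longlonglongrightarrow>
     0 + 2 * (\<integral>x. f' x * f' x \<partial>M) - (\<integral>x. (f' x)\<^sup>2 \<partial>M)"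
    by (intro tendsto_intros 1 l2_lim_mult[OF assms 1(2)])
  ultimately show ?thesis by (simp add: power2_eq_square)
qed

section \<open>Existence and uniqueness of the L^2 limit\<close>

context brownian
begin

definition l2_sq :: "('a \<Rightarrow> real) \<Rightarrow> ennreal" where
  "l2_sq f = (\<integral>\<^sup>+\<omega>. ennreal ((f \<omega>)\<^sup>2) \<partial>M)"

lemma l2_sq_diff_triangle:
  assumes [measurable]: "f \<in> borel_measurable M" "g \<in> borel_measurable M" "h \<in> borel_measurable M"
  shows "l2_sq (\<lambda>\<omega>. f \<omega> - h \<omega>) \<le> 2 * l2_sq (\<lambda>\<omega>. f \<omega> - g \<omega>) + 2 * l2_sq (\<lambda>\<omega>. g \<omega> - h \<omega>)"
proof -
  have "(\<integral>\<^sup>+z. ennreal ((norm ((f z - g z) + (g z - h z)))\<^sup>2) \<partial>M) \<le>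
    2 * (\<integral>\<^sup>+z. ennreal ((norm (f z - g z))\<^sup>2) \<partial>M) + 2 * (\<integral>\<^sup>+z. ennreal ((norm (g z - h z))\<^sup>2) \<partial>M)"
    by (rule nn_integral_sq_add_le) measurable
  then show ?thesis by (simp add: l2_sq_def)
qed

lemma l2_sq_commute: "l2_sq (\<lambda>\<omega>. f \<omega> - g \<omega>) = l2_sq (\<lambda>\<omega>. g \<omega> - f \<omega>)"
  by (simp add: l2_sq_def power2_commute)

lemma l2_sq_eq: "sq_integrable M f \<Longrightarrow> l2_sq f = ennreal (expectation (\<lambda>\<omega>. (f \<omega>)\<^sup>2))"
  unfolding l2_sq_def by (rule nn_integral_eq_integral) (auto simp: sq_integrable_def)

lemma sq_integrable_l2_sq: "f \<in> borel_measurable M \<Longrightarrow> l2_sq f < \<infinity> \<Longrightarrow> sq_integrable M f"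
  unfolding l2_sq_def sq_integrable_def by (auto intro!: integrableI_nonneg)

lemma l2_sq_0_AE:
  assumes [measurable]: "f \<in> borel_measurable M" "g \<in> borel_measurable M" and "l2_sq (\<lambda>\<omega>. f \<omega> - g \<omega>) = 0"
  shows "AE \<omega> in M. f \<omega> = g \<omega>"
proof -
  have "AE \<omega> in M. ennreal ((f \<omega> - g \<omega>)\<^sup>2) = 0"
    using assms(3) unfolding l2_sq_def by (subst (asm) nn_integral_0_iff_AE) measurable
  then show ?thesis by (rule AE_mp) (auto intro!: AE_I2 simp: ennreal_eq_0_iff)
qed

text \<open>Square integrability of the limit need not be supplied: one index at finite distance
  already forces it.\<close>

lemma l2_limI:
  assumes "\<And>k. sq_integrable M (f k)" and [measurable]: "g \<in> borel_measurable M"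
    and lim: "(\<lambda>k. l2_sq (\<lambda>\<omega>. f k \<omega> - g \<omega>)) \<longlonglongrightarrow> 0"
  shows "l2_lim M f g"
proof -
  note [measurable] = sq_integrableD(1)[OF assms(1)]
  have "\<forall>\<^sub>F k in sequentially. l2_sq (\<lambda>\<omega>. f k \<omega> - g \<omega>) < 1"
    using order_tendstoD(2)[OF lim, of 1] by simp
  then obtain k where "l2_sq (\<lambda>\<omega>. f k \<omega> - g \<omega>) < 1" by (auto simp: eventually_sequentially)
  then have "l2_sq (\<lambda>\<omega>. f k \<omega> - g \<omega>) < \<infinity>" using ennreal_one_less_top by (auto elim: less_trans)
  then have "sq_integrable M (\<lambda>\<omega>. f k \<omega> - g \<omega>)" by (intro sq_integrable_l2_sq) measurable
  from sq_integrable_diff[OF assms(1)[of k] this] have g: "sq_integrable M g" by simp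
  have "l2_sq (\<lambda>\<omega>. f k \<omega> - g \<omega>) = ennreal (expectation (\<lambda>\<omega>. (f k \<omega> - g \<omega>)\<^sup>2))" for k
    by (rule l2_sq_eq[OF sq_integrable_diff[OF assms(1) g]])
  then have "(\<lambda>k. ennreal (expectation (\<lambda>\<omega>. (f k \<omega> - g \<omega>)\<^sup>2))) \<longlonglongrightarrow> ennreal 0" using lim by simp
  then have "(\<lambda>k. expectation (\<lambda>\<omega>. (f k \<omega> - g \<omega>)\<^sup>2)) \<longlonglongrightarrow> 0"
    by (subst (asm) tendsto_ennreal_iff) auto
  then show ?thesis using assms(1) g by (simp add: l2_lim_def)
qed

lemma simple_int_measurable_F:
  assumes "simple_pred F n \<tau> \<xi>" "0 \<le> t"
  shows "simple_int W n \<tau> \<xi> t \<in> borel_measurable (F t)"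
proof -
  note g = simple_adapted_grid[OF assms]
  have "simple_int W n \<tau> \<xi> t = grid_sum n (\<lambda>k. min t (\<tau> k)) (\<lambda>k \<omega>. if \<tau> k \<le> t then \<xi> k \<omega> else 0)"
    using g(2) by auto
  moreover have "\<dots> \<in> borel_measurable (F (min t (\<tau> n)))" using grid_sum_measurable_F[OF g(1)] by simp
  ultimately show ?thesis using measurable_F_mono[of _ "min t (\<tau> n)" borel t] by simp
qed

lemma simple_int_measurable:
  "simple_pred F n \<tau> \<xi> \<Longrightarrow> 0 \<le> t \<Longrightarrow> simple_int W n \<tau> \<xi> t \<in> borel_measurable M"
  using simple_int_measurable_F measurable_F_M by blast

lemma sq_integrable_simple_int:
  assumes "simple_pred F n \<tau> \<xi>" "0 \<le> t"
  shows "sq_integrable M (simple_int W n \<tau> \<xi> t)"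
proof -
  note g = simple_adapted_grid[OF assms]
  have "simple_int W n \<tau> \<xi> t = grid_sum n (\<lambda>k. min t (\<tau> k)) (\<lambda>k \<omega>. if \<tau> k \<le> t then \<xi> k \<omega> else 0)"
    using g(2) by auto
  then show ?thesis using sq_integrable_grid_sum[OF g(1)] by simp
qed

text \<open>On a common refinement the difference of two simple processes is again simple, so the
  isometry applies to it.\<close>

lemma simple_diff_isometry:
  fixes \<xi> \<xi>' :: "nat \<Rightarrow> 'a \<Rightarrow> real^'d"
  assumes sp: "simple_pred F n \<tau> \<xi>" "simple_pred F n' \<tau>' \<xi>'" and t: "0 \<le> t"
  shows "l2_sq (\<lambda>\<omega>. simple_int W n \<tau> \<xi> t \<omega> - simple_int W n' \<tau>' \<xi>' t \<omega>) =
    l2_dist t (simple_proc n \<tau> \<xi>) (simple_proc n' \<tau>' \<xi>')"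
proof -
  obtain m \<sigma> \<eta> \<eta>' where r: "simple_pred F m \<sigma> \<eta>" "simple_pred F m \<sigma> \<eta>'"
    "simple_proc m \<sigma> \<eta> = simple_proc n \<tau> \<xi>" "simple_proc m \<sigma> \<eta>' = simple_proc n' \<tau>' \<xi>'"
    "simple_int W m \<sigma> \<eta> = simple_int W n \<tau> \<xi>" "simple_int W m \<sigma> \<eta>' = simple_int W n' \<tau>' \<xi>'"
    using simple_common_refinement[OF sp] by metis
  have lin: "linear (\<lambda>x::real^'d. c *\<^sub>R x)" for c by (rule linear_scaleR)
  define \<zeta> where "\<zeta> = (\<lambda>k \<omega>. 1 *\<^sub>R \<eta> k \<omega> + (-1) *\<^sub>R \<eta>' k \<omega>)"
  have sz: "simple_pred F m \<sigma> \<zeta>" unfolding \<zeta>_def by (rule simple_pred_linear[OF lin lin r(1,2)])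
  have i: "simple_int W m \<sigma> \<zeta> t \<omega> = simple_int W n \<tau> \<xi> t \<omega> - simple_int W n' \<tau>' \<xi>' t \<omega>" for \<omega>
    unfolding \<zeta>_def simple_int_linear by (simp add: r)
  have p: "simple_proc m \<sigma> \<zeta> v \<omega> = simple_proc n \<tau> \<xi> v \<omega> - simple_proc n' \<tau>' \<xi>' v \<omega>" for v \<omega>
    unfolding \<zeta>_def by (subst simple_proc_linear[OF lin lin]) (simp add: r)
  show ?thesis using simple_isometry[OF sz t] by (simp add: i p l2_sq_def l2_dist_def)
qed

lemma l2_dist_triangle:
  assumes [measurable]: "(\<lambda>z. H (fst z) (snd z)) \<in> borel_measurable (prod_meas t)"
    "(\<lambda>z. f (fst z) (snd z)) \<in> borel_measurable (prod_meas t)" "(\<lambda>z. g (fst z) (snd z)) \<in> borel_measurable (prod_meas t)"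
  shows "l2_dist t f g \<le> 2 * l2_dist t H f + 2 * l2_dist t H g"
proof -
  have "(\<integral>\<^sup>+z. ennreal ((norm ((f (fst z) (snd z) - H (fst z) (snd z)) + (H (fst z) (snd z) - g (fst z) (snd z))))\<^sup>2) \<partial>prod_meas t) \<le>
    2 * (\<integral>\<^sup>+z. ennreal ((norm (f (fst z) (snd z) - H (fst z) (snd z)))\<^sup>2) \<partial>prod_meas t) +
    2 * (\<integral>\<^sup>+z. ennreal ((norm (H (fst z) (snd z) - g (fst z) (snd z)))\<^sup>2) \<partial>prod_meas t)"
    by (rule nn_integral_sq_add_le) measurable
  then show ?thesis by (simp add: l2_dist_eq norm_minus_commute)
qed

lemma l2_dist_mono: "s \<le> t \<Longrightarrow> l2_dist s f g \<le> l2_dist t f g"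
  unfolding l2_dist_def by (intro nn_integral_mono mult_left_mono) (auto simp: indicator_def)

text \<open>Completeness of L^2 with control of the sigma-algebra: the limit is measurable for
  \<open>F t\<close> itself, not only for its completion. The shape 2 d i + 2 d j of the bound is
  what passing through a common target process yields.\<close>

lemma l2_cauchy_limit:
  assumes fF: "\<And>k. f k \<in> borel_measurable (F t)" and fi: "\<And>k. sq_integrable M (f k)"
    and d: "d \<longlonglongrightarrow> 0" and fd: "\<And>i j. l2_sq (\<lambda>\<omega>. f i \<omega> - f j \<omega>) \<le> 2 * d i + 2 * d j"
  obtains Y where "Y \<in> borel_measurable (F t)" "(\<lambda>k. l2_sq (\<lambda>\<omega>. f k \<omega> - Y \<omega>)) \<longlonglongrightarrow> 0"
proof -
  note [measurable] = sq_integrableD(1)[OF fi]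
  have cau: "\<exists>N. \<forall>i\<ge>N. \<forall>j\<ge>N. (\<integral>\<omega>. norm (f i \<omega> - f j \<omega>) \<partial>M) < e" if e: "0 < e" for e
  proof -
    have "0 < ennreal (e\<^sup>2 / 16)" using e by simp
    then have "\<forall>\<^sub>F k in sequentially. d k < ennreal ((e\<^sup>2 / 4) / 4)" using order_tendstoD(2)[OF d] by simp
    then obtain N where N: "\<And>k. k \<ge> N \<Longrightarrow> d k < ennreal ((e\<^sup>2 / 4) / 4)" by (auto simp: eventually_sequentially)
    show ?thesis
    proof (intro exI allI impI)
      fix i j assume ij: "i \<ge> N" "j \<ge> N"
      have "l2_sq (\<lambda>\<omega>. f i \<omega> - f j \<omega>) < ennreal (e\<^sup>2 / 4)"
        using fd[of i j] ennreal_double_sum_less[OF N[OF ij(1)] N[OF ij(2)]] e by simp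
      then have sq: "expectation (\<lambda>\<omega>. (f i \<omega> - f j \<omega>)\<^sup>2) < e\<^sup>2 / 4"
        using e by (simp add: l2_sq_eq[OF sq_integrable_diff[OF fi fi]] ennreal_less_iff)
      \<comment> \<open>Pairing with the constant 1 and weight e / 2 turns the L^2 bound e^2 / 4
        into the L^1 bound e.\<close>
      have "expectation (\<lambda>\<omega>. \<bar>1 * (f i \<omega> - f j \<omega>)\<bar>) \<le> (e / 2) * expectation (\<lambda>\<omega>. 1\<^sup>2) + expectation (\<lambda>\<omega>. (f i \<omega> - f j \<omega>)\<^sup>2) / (e / 2)"
        by (rule abs_integral_mult_le[OF sq_integrable_const sq_integrable_diff[OF fi fi]]) (use e in simp)
      also have "\<dots> < e / 2 + e / 2"
        using sq e by (simp add: prob_space field_simps power2_eq_square)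
      finally show "(\<integral>\<omega>. norm (f i \<omega> - f j \<omega>) \<partial>M) < e" by simp
    qed
  qed
  obtain r where r: "strict_mono r" "AE \<omega> in M. Cauchy (\<lambda>i. f (r i) \<omega>)"
    using cauchy_L1_AE_cauchy_subseq[of M f, OF sq_integrable_integrable[OF fi] cau] by blast
  \<comment> \<open>\<open>lim\<close> is a total function, so \<open>Y\<close> is measurable for
    \<open>F t\<close> everywhere, although the subsequence converges only almost
    everywhere.\<close>
  define Y where "Y \<omega> = lim (\<lambda>i. f (r i) \<omega>)" for \<omega>
  have YF: "Y \<in> borel_measurable (F t)" unfolding Y_def by (rule borel_measurable_lim_metric[OF fF])
  note [measurable] = measurable_F_M[OF YF]
  have le: "l2_sq (\<lambda>\<omega>. f k \<omega> - Y \<omega>) \<le> 2 * d k" for k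
  proof -
    have "l2_sq (\<lambda>\<omega>. f k \<omega> - Y \<omega>) = (\<integral>\<^sup>+\<omega>. liminf (\<lambda>i. ennreal ((f k \<omega> - f (r i) \<omega>)\<^sup>2)) \<partial>M)"
      unfolding l2_sq_def
    proof (rule nn_integral_cong_AE, rule AE_mp[OF r(2)], intro AE_I2 impI)
      fix \<omega> assume "Cauchy (\<lambda>i. f (r i) \<omega>)"
      then have "(\<lambda>i. f (r i) \<omega>) \<longlonglongrightarrow> Y \<omega>"
        unfolding Y_def by (simp add: Cauchy_convergent_iff convergent_LIMSEQ_iff)
      then have "(\<lambda>i. ennreal ((f k \<omega> - f (r i) \<omega>)\<^sup>2)) \<longlonglongrightarrow> ennreal ((f k \<omega> - Y \<omega>)\<^sup>2)"
        by (intro tendsto_intros)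
      from lim_imp_Liminf[OF sequentially_bot this]
      show "ennreal ((f k \<omega> - Y \<omega>)\<^sup>2) = liminf (\<lambda>i. ennreal ((f k \<omega> - f (r i) \<omega>)\<^sup>2))" by simp
    qed
    \<comment> \<open>Fatou along the subsequence: mutual distances control the distance to the
      limit, and the contribution of d (r i) disappears.\<close>
    also have "\<dots> \<le> liminf (\<lambda>i. l2_sq (\<lambda>\<omega>. f k \<omega> - f (r i) \<omega>))"
      unfolding l2_sq_def by (rule nn_integral_liminf) measurable
    also have "\<dots> \<le> liminf (\<lambda>i. 2 * d k + 2 * d (r i))"
      by (intro Liminf_mono always_eventually allI fd)
    also have "\<dots> = 2 * d k"
    proof -
      have "(\<lambda>i. 2 * d k + 2 * d (r i)) \<longlonglongrightarrow> 2 * d k + 2 * 0"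
        using LIMSEQ_subseq_LIMSEQ[OF d r(1)] by (intro tendsto_add tendsto_const ennreal_tendsto_cmult) (auto simp: o_def)
      then show ?thesis using lim_imp_Liminf[OF sequentially_bot] by fastforce
    qed
    finally show ?thesis .
  qed
  have "(\<lambda>k. l2_sq (\<lambda>\<omega>. f k \<omega> - Y \<omega>)) \<longlonglongrightarrow> 0"
    by (rule ennreal_tendsto_0_le[OF ennreal_tendsto_0_double[OF d tendsto_const[of 0]]]) (use le in auto)
  then show ?thesis using that YF by blast
qed

text \<open>\<open>ito_int\<close> is chosen by \<open>SOME\<close>, with its own unknown
  approximating sequence. The isometry compares that sequence with any other one converging to the
  same integrand, so every choice agrees almost surely with the limit along the given
  sequence.\<close>

theorem ito_int_limit:
  fixes \<xi> :: "nat \<Rightarrow> nat \<Rightarrow> 'a \<Rightarrow> real^'d"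
  assumes t: "0 \<le> t" and H [measurable]: "(\<lambda>z. H (fst z) (snd z)) \<in> borel_measurable (prod_meas t)"
    and sp: "\<And>k. simple_pred F (n k) (\<tau> k) (\<xi> k)"
    and lim: "(\<lambda>k. l2_dist t H (simple_proc (n k) (\<tau> k) (\<xi> k))) \<longlonglongrightarrow> 0"
  shows "l2_lim M (\<lambda>k. simple_int W (n k) (\<tau> k) (\<xi> k) t) (ito_int M F W H t)"
    and "\<exists>Y\<in>borel_measurable (F t). AE \<omega> in M. ito_int M F W H t \<omega> = Y \<omega>"
proof -
  define f where "f k = simple_int W (n k) (\<tau> k) (\<xi> k) t" for k
  define d where "d k = l2_dist t H (simple_proc (n k) (\<tau> k) (\<xi> k))" for k
  have fM[measurable]: "f k \<in> borel_measurable M" for k unfolding f_def by (rule simple_int_measurable[OF sp t])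
  have fi: "sq_integrable M (f k)" for k unfolding f_def by (rule sq_integrable_simple_int[OF sp t])
  have fd: "l2_sq (\<lambda>\<omega>. f i \<omega> - f j \<omega>) \<le> 2 * d i + 2 * d j" for i j
    unfolding f_def d_def simple_diff_isometry[OF sp sp t]
    by (rule l2_dist_triangle[OF H simple_proc_measurable[OF sp] simple_proc_measurable[OF sp]])
  have d: "d \<longlonglongrightarrow> 0" using lim by (simp add: d_def[abs_def])
  obtain Y where Y: "Y \<in> borel_measurable (F t)" "(\<lambda>k. l2_sq (\<lambda>\<omega>. f k \<omega> - Y \<omega>)) \<longlonglongrightarrow> 0"
    using l2_cauchy_limit[OF simple_int_measurable_F[OF sp t, folded f_def] fi d fd] by blast
  note YM[measurable] = measurable_F_M[OF Y(1)]
  define P where "P X \<longleftrightarrow> X \<in> borel_measurable M \<and>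
     (\<exists>ns \<tau>s \<xi>s. (\<forall>k. simple_pred F (ns k) (\<tau>s k) (\<xi>s k)) \<and>
       (\<lambda>k. \<integral>\<^sup>+\<omega>. (\<integral>\<^sup>+s\<in>{0..t}. ennreal ((norm (H s \<omega> - simple_proc (ns k) (\<tau>s k) (\<xi>s k) s \<omega>))\<^sup>2) \<partial>lborel) \<partial>M)
          \<longlonglongrightarrow> 0 \<and>
       (\<lambda>k. \<integral>\<^sup>+\<omega>. ennreal ((simple_int W (ns k) (\<tau>s k) (\<xi>s k) t \<omega> - X \<omega>)\<^sup>2) \<partial>M) \<longlonglongrightarrow> 0)" for X
  have "P Y"
    unfolding P_def using Y(2) sp lim YM unfolding l2_dist_def l2_sq_def f_def by blast
  \<comment> \<open>The limit \<open>Y\<close> along the given sequence shows that there is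
    something to choose.\<close>
  then have "P (SOME X. P X)" by (rule someI[of P Y])
  moreover have "(SOME X. P X) = ito_int M F W H t" unfolding ito_int_def P_def ..
  ultimately have "P (ito_int M F W H t)" by simp
  then obtain n' \<tau>' \<xi>' where IM[measurable]: "ito_int M F W H t \<in> borel_measurable M"
    and sp': "\<And>k. simple_pred F (n' k) (\<tau>' k) (\<xi>' k)"
    and lim': "(\<lambda>k. l2_dist t H (simple_proc (n' k) (\<tau>' k) (\<xi>' k))) \<longlonglongrightarrow> 0"
    and i': "(\<lambda>k. l2_sq (\<lambda>\<omega>. simple_int W (n' k) (\<tau>' k) (\<xi>' k) t \<omega> - ito_int M F W H t \<omega>)) \<longlonglongrightarrow> 0"
    unfolding P_def l2_dist_def l2_sq_def by blast
  \<comment> \<open>Both integrand sequences approach \<open>H\<close>, hence each other; the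
    isometry transfers this to the integrals.\<close>
  have dd: "(\<lambda>k. l2_sq (\<lambda>\<omega>. f k \<omega> - simple_int W (n' k) (\<tau>' k) (\<xi>' k) t \<omega>)) \<longlonglongrightarrow> 0"
  proof (rule ennreal_tendsto_0_le[OF ennreal_tendsto_0_double[OF d lim']])
    show "l2_sq (\<lambda>\<omega>. f k \<omega> - simple_int W (n' k) (\<tau>' k) (\<xi>' k) t \<omega>) \<le> 2 * d k + 2 * l2_dist t H (simple_proc (n' k) (\<tau>' k) (\<xi>' k))" for k
      unfolding f_def d_def simple_diff_isometry[OF sp sp' t]
      by (rule l2_dist_triangle[OF H simple_proc_measurable[OF sp] simple_proc_measurable[OF sp']])
  qed
  note [measurable] = simple_int_measurable[OF sp' t]
  have fl: "(\<lambda>k. l2_sq (\<lambda>\<omega>. f k \<omega> - ito_int M F W H t \<omega>)) \<longlonglongrightarrow> 0"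
    by (rule ennreal_tendsto_0_le[OF ennreal_tendsto_0_double[OF dd i']], rule l2_sq_diff_triangle) measurable
  show "l2_lim M (\<lambda>k. simple_int W (n k) (\<tau> k) (\<xi> k) t) (ito_int M F W H t)"
    using l2_limI[of f, OF fi IM fl] by (simp add: f_def[abs_def])
  have "(\<lambda>k::nat. l2_sq (\<lambda>\<omega>. ito_int M F W H t \<omega> - Y \<omega>)) \<longlonglongrightarrow> 0"
  proof (rule ennreal_tendsto_0_le[OF ennreal_tendsto_0_double[OF fl Y(2)]])
    fix k
    show "l2_sq (\<lambda>\<omega>. ito_int M F W H t \<omega> - Y \<omega>) \<le> 2 * l2_sq (\<lambda>\<omega>. f k \<omega> - ito_int M F W H t \<omega>) + 2 * l2_sq (\<lambda>\<omega>. f k \<omega> - Y \<omega>)"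
      unfolding l2_sq_commute[of "f k" "ito_int M F W H t"] by (rule l2_sq_diff_triangle) measurable
  qed
  then have "l2_sq (\<lambda>\<omega>. ito_int M F W H t \<omega> - Y \<omega>) = 0" by (simp add: LIMSEQ_const_iff)
  then have "AE \<omega> in M. ito_int M F W H t \<omega> = Y \<omega>" by (intro l2_sq_0_AE) measurable
  then show "\<exists>Y\<in>borel_measurable (F t). AE \<omega> in M. ito_int M F W H t \<omega> = Y \<omega>" using Y(1) by blast
qed

section \<open>Martingale property of simple and Ito integrals\<close>

lemma real_martingale_add:
  assumes "real_martingale M F X" "real_martingale M F Y"
  shows "real_martingale M F (\<lambda>t \<omega>. a * X t \<omega> + b * Y t \<omega>)"
  unfolding real_martingale_def
proof (intro conjI allI impI)
  fix t :: real assume t: "0 \<le> t"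
  then have i: "integrable M (X t)" "integrable M (Y t)"
    using assms by (auto simp: real_martingale_def)
  then show "integrable M (\<lambda>\<omega>. a * X t \<omega> + b * Y t \<omega>)" by simp
  obtain X' Y' where "X' \<in> borel_measurable (F t)" "AE \<omega> in M. X t \<omega> = X' \<omega>"
    "Y' \<in> borel_measurable (F t)" "AE \<omega> in M. Y t \<omega> = Y' \<omega>"
    using assms t unfolding real_martingale_def by blast
  then show "\<exists>Ya\<in>borel_measurable (F t). AE \<omega> in M. a * X t \<omega> + b * Y t \<omega> = Ya \<omega>"
    by (intro bexI[of _ "\<lambda>\<omega>. a * X' \<omega> + b * Y' \<omega>"]) auto
next
  fix s t :: real assume st: "0 \<le> s" "s \<le> t"
  then have i: "integrable M (X t)" "integrable M (Y t)"
    using assms by (auto simp: real_martingale_def)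
  have c: "AE \<omega> in M. real_cond_exp M (F s) (X t) \<omega> = X s \<omega>" "AE \<omega> in M. real_cond_exp M (F s) (Y t) \<omega> = Y s \<omega>"
    using assms st by (auto simp: real_martingale_def)
  interpret S: sigma_finite_subalgebra M "F s" by (rule sigma_finite_subalgebra_F)
  have "AE \<omega> in M. real_cond_exp M (F s) (\<lambda>\<omega>. a * X t \<omega> + b * Y t \<omega>) \<omega> =
     real_cond_exp M (F s) (\<lambda>\<omega>. a * X t \<omega>) \<omega> + real_cond_exp M (F s) (\<lambda>\<omega>. b * Y t \<omega>) \<omega>"
    using i by (intro S.real_cond_exp_add) auto
  with c S.real_cond_exp_cmult[OF i(1), of a] S.real_cond_exp_cmult[OF i(2), of b]
  show "AE \<omega> in M. real_cond_exp M (F s) (\<lambda>\<omega>. a * X t \<omega> + b * Y t \<omega>) \<omega> = a * X s \<omega> + b * Y s \<omega>"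
    by eventually_elim simp
qed

lemma grid_sum_mult:
  assumes ag: "adapted_grid n s \<xi>" and g: "g \<in> borel_measurable (F (s 0))" "integrable M g"
  shows "integrable M (\<lambda>\<omega>. g \<omega> * grid_sum n s \<xi> \<omega>)" "expectation (\<lambda>\<omega>. g \<omega> * grid_sum n s \<xi> \<omega>) = 0"
proof -
  note a = adapted_gridD[OF ag]
  have 1: "integrable M (\<lambda>\<omega>. g \<omega> * (\<xi> k \<omega> \<bullet> (W (s (Suc k)) \<omega> - W (s k) \<omega>)))"
    "expectation (\<lambda>\<omega>. g \<omega> * (\<xi> k \<omega> \<bullet> (W (s (Suc k)) \<omega> - W (s k) \<omega>))) = 0" if k: "k < n" for k
  proof -
    have gk: "g \<in> borel_measurable (F (s k))" using measurable_F_mono[OF g(1)] a(5)[of 0 k] k by simp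
    have sk: "0 \<le> s k" "s k \<le> s (Suc k)" using a(1,2)[of k] k by auto
    note ik = inner_increment[OF sk gk g(2) a(3)[OF k] a(4)[OF k] a(3)[OF k] a(4)[OF k]]
    show "integrable M (\<lambda>\<omega>. g \<omega> * (\<xi> k \<omega> \<bullet> (W (s (Suc k)) \<omega> - W (s k) \<omega>)))"
      "expectation (\<lambda>\<omega>. g \<omega> * (\<xi> k \<omega> \<bullet> (W (s (Suc k)) \<omega> - W (s k) \<omega>))) = 0"
      by (fact ik(1), fact ik(2))
  qed
  show "integrable M (\<lambda>\<omega>. g \<omega> * grid_sum n s \<xi> \<omega>)" "expectation (\<lambda>\<omega>. g \<omega> * grid_sum n s \<xi> \<omega>) = 0"
    unfolding grid_sum_def sum_distrib_left using 1 by (auto simp: Bochner_Integration.integral_sum)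
qed

text \<open>The increment of the integral between a and b is a grid sum on the partition clamped to
  [a, b]. Every grid point is then at least a, so a multiplier known at time a is known on every
  cell.\<close>

lemma simple_int_increment_mult:
  assumes sp: "simple_pred F n \<tau> \<xi>" and ab: "0 \<le> a" "a \<le> b"
    and g: "g \<in> borel_measurable (F a)" "integrable M g"
  shows "expectation (\<lambda>\<omega>. g \<omega> * (simple_int W n \<tau> \<xi> b \<omega> - simple_int W n \<tau> \<xi> a \<omega>)) = 0"
proof -
  have \<tau>: "\<And>i. i < n \<Longrightarrow> \<tau> i < \<tau> (Suc i)" "0 \<le> \<tau> 0"
    and \<xi>: "\<And>i. i < n \<Longrightarrow> \<xi> i \<in> borel_measurable (F (\<tau> i))" "\<And>i. i < n \<Longrightarrow> bounded (range (\<xi> i))"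
    using sp by (auto simp: simple_pred_def)
  \<comment> \<open>Cells before a or after b become empty. As before, coefficients from beyond b
    are replaced by 0 because they are not yet known at time b.\<close>
  define s where "s k = max a (min b (\<tau> k))" for k
  define \<eta> where "\<eta> k \<omega> = (if \<tau> k \<le> b then \<xi> k \<omega> else 0)" for k \<omega>
  have ag: "adapted_grid n s \<eta>"
    unfolding adapted_grid_def
  proof (intro conjI allI impI)
    show "0 \<le> s 0" using ab by (simp add: s_def)
    fix k assume k: "k < n"
    show "s k \<le> s (Suc k)" using \<tau>(1)[OF k] by (auto simp: s_def min_def max_def)
    show "\<eta> k \<in> borel_measurable (F (s k))"
    proof (cases "\<tau> k \<le> b")
      case True
      then have "\<tau> k \<le> s k" by (simp add: s_def)
      then show ?thesis using measurable_F_mono[OF \<xi>(1)[OF k]] True by (simp add: \<eta>_def[abs_def])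
    qed (simp add: \<eta>_def[abs_def])
    show "bounded (range (\<eta> k))" using \<xi>(2)[OF k] by (cases "\<tau> k \<le> b") (simp_all add: \<eta>_def[abs_def])
  qed
  have "simple_int W n \<tau> \<xi> b \<omega> - simple_int W n \<tau> \<xi> a \<omega> = grid_sum n s \<eta> \<omega>" for \<omega>
    unfolding simple_int_def grid_sum_def sum_subtractf[symmetric]
  proof (rule sum.cong[OF refl])
    fix k assume "k \<in> {..<n}"
    then have "\<tau> k < \<tau> (Suc k)" using \<tau>(1) by simp
    have *: "W (min b x) \<omega> - W (min a x) \<omega> = W (max a (min b x)) \<omega> - W a \<omega>" for x
      using ab by (cases "x \<le> a"; cases "x \<le> b") (auto simp: min_def max_def)
    have "\<xi> k \<omega> \<bullet> (W (min b (\<tau> (Suc k))) \<omega> - W (min b (\<tau> k)) \<omega>) - \<xi> k \<omega> \<bullet> (W (min a (\<tau> (Suc k))) \<omega> - W (min a (\<tau> k)) \<omega>) =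
      \<xi> k \<omega> \<bullet> ((W (min b (\<tau> (Suc k))) \<omega> - W (min a (\<tau> (Suc k))) \<omega>) - (W (min b (\<tau> k)) \<omega> - W (min a (\<tau> k)) \<omega>))"
      by (simp add: inner_diff_right)
    also have "\<dots> = \<xi> k \<omega> \<bullet> (W (s (Suc k)) \<omega> - W (s k) \<omega>)"
      unfolding * by (simp add: s_def)
    also have "\<dots> = \<eta> k \<omega> \<bullet> (W (s (Suc k)) \<omega> - W (s k) \<omega>)"
      using \<open>\<tau> k < \<tau> (Suc k)\<close> by (auto simp: \<eta>_def s_def)
    finally show "\<xi> k \<omega> \<bullet> (W (min b (\<tau> (Suc k))) \<omega> - W (min b (\<tau> k)) \<omega>) - \<xi> k \<omega> \<bullet> (W (min a (\<tau> (Suc k))) \<omega> - W (min a (\<tau> k)) \<omega>) =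
      \<eta> k \<omega> \<bullet> (W (s (Suc k)) \<omega> - W (s k) \<omega>)" .
  qed
  moreover have "g \<in> borel_measurable (F (s 0))" using measurable_F_mono[OF g(1)] by (simp add: s_def)
  ultimately show ?thesis using grid_sum_mult(2)[OF ag _ g(2)] by simp
qed

definition l2_pred :: "(real \<Rightarrow> 'a \<Rightarrow> real^'d) \<Rightarrow> bool" where
  "l2_pred H \<longleftrightarrow> predictable M F H \<and>
     (\<forall>t\<ge>0. (\<integral>\<^sup>+\<omega>. (\<integral>\<^sup>+s\<in>{0..t}. ennreal ((norm (H s \<omega>))\<^sup>2) \<partial>lborel) \<partial>M) < \<infinity>)"

text \<open>One sequence chosen on [0, T] serves all earlier times, since the distance grows with
  the horizon. The martingale property needs this: the integrals at s and at t must be approximated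
  by the same integrands.\<close>

lemma l2_pred_approx:
  assumes H: "l2_pred H" and T: "0 < T"
  obtains m \<xi> where "\<And>k. simple_pred F (2 ^ m k) (dyadic T (m k)) (\<xi> k)"
    "\<And>t. t \<le> T \<Longrightarrow> (\<lambda>k. l2_dist t H (simple_proc (2 ^ m k) (dyadic T (m k)) (\<xi> k))) \<longlonglongrightarrow> 0"
    "\<And>t. 0 \<le> t \<Longrightarrow> t \<le> T \<Longrightarrow> l2_lim M (\<lambda>k. simple_int W (2 ^ m k) (dyadic T (m k)) (\<xi> k) t) (ito_int M F W H t)"
proof -
  have Hp: "predictable M F H" and fin: "(\<integral>\<^sup>+\<omega>. (\<integral>\<^sup>+s\<in>{0..T}. ennreal ((norm (H s \<omega>))\<^sup>2) \<partial>lborel) \<partial>M) < \<infinity>"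
    using H T by (auto simp: l2_pred_def)
  obtain m \<xi> where 1: "\<And>k. simple_pred F (2 ^ m k) (dyadic T (m k)) (\<xi> k)"
    "(\<lambda>k. l2_dist T H (simple_proc (2 ^ m k) (dyadic T (m k)) (\<xi> k))) \<longlonglongrightarrow> 0"
    using dyadic_simple_dense[OF T Hp fin] by blast
  have 2: "(\<lambda>k. l2_dist t H (simple_proc (2 ^ m k) (dyadic T (m k)) (\<xi> k))) \<longlonglongrightarrow> 0" if "t \<le> T" for t
    by (rule ennreal_tendsto_0_le[OF 1(2)]) (rule l2_dist_mono[OF that])
  show ?thesis
    by (rule that[OF 1(1) 2 ito_int_limit(1)[OF _ predictable_measurable[OF Hp] 1(1) 2]])
qed

lemma ito_int_adapted:
  assumes H: "l2_pred H" and t: "0 \<le> t"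
  shows "\<exists>Y\<in>borel_measurable (F t). AE \<omega> in M. ito_int M F W H t \<omega> = Y \<omega>"
    and "sq_integrable M (ito_int M F W H t)"
proof -
  have Hp: "predictable M F H" using H by (simp add: l2_pred_def)
  \<comment> \<open>The horizon t + 1 is used because dyadic grids need a positive length, while t
    may be 0.\<close>
  have T: "0 < t + 1" "t \<le> t + 1" using t by auto
  obtain m \<xi> where 1: "\<And>k. simple_pred F (2 ^ m k) (dyadic (t + 1) (m k)) (\<xi> k)"
    "\<And>u. u \<le> t + 1 \<Longrightarrow> (\<lambda>k. l2_dist u H (simple_proc (2 ^ m k) (dyadic (t + 1) (m k)) (\<xi> k))) \<longlonglongrightarrow> 0"
    "\<And>u. 0 \<le> u \<Longrightarrow> u \<le> t + 1 \<Longrightarrow> l2_lim M (\<lambda>k. simple_int W (2 ^ m k) (dyadic (t + 1) (m k)) (\<xi> k) u) (ito_int M F W H u)"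
    by (fact l2_pred_approx[OF H T(1)])
  note i = ito_int_limit[OF t predictable_measurable[OF Hp] 1(1) 1(2)[OF T(2)]]
  show "\<exists>Y\<in>borel_measurable (F t). AE \<omega> in M. ito_int M F W H t \<omega> = Y \<omega>" by (rule i(2))
  show "sq_integrable M (ito_int M F W H t)" by (rule l2_limD(2)[OF i(1)])
qed

text \<open>For A in \<open>F s\<close> the increments of the simple integrals are orthogonal to the
  indicator of A, and this survives the L^2 limit. The chosen version at time s is adapted only up
  to a null set, so conditional expectation is characterised through the adapted version
  \<open>Y\<close>.\<close>

lemma ito_int_martingale:
  assumes H: "l2_pred H"
  shows "real_martingale M F (ito_int M F W H)"
  unfolding real_martingale_def
proof (intro conjI allI impI)
  fix t :: real assume t: "0 \<le> t"
  show "integrable M (ito_int M F W H t)" by (rule sq_integrable_integrable[OF ito_int_adapted(2)[OF H t]])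
  show "\<exists>Y\<in>borel_measurable (F t). AE \<omega> in M. ito_int M F W H t \<omega> = Y \<omega>" by (rule ito_int_adapted(1)[OF H t])
next
  fix s t :: real assume st: "0 \<le> s" "s \<le> t"
  interpret S: sigma_finite_subalgebra M "F s" by (rule sigma_finite_subalgebra_F)
  obtain Y where Y: "Y \<in> borel_measurable (F s)" "AE \<omega> in M. ito_int M F W H s \<omega> = Y \<omega>"
    using ito_int_adapted(1)[OF H st(1)] by blast
  have t: "0 \<le> t" and T: "0 < t + 1" using st by auto
  let ?X = "ito_int M F W H"
  note iX = ito_int_adapted(2)[OF H st(1)] ito_int_adapted(2)[OF H t]
  note [measurable] = sq_integrableD(1)[OF iX(1)] sq_integrableD(1)[OF iX(2)] measurable_F_M[OF Y(1)]
  obtain m \<xi> where 1: "\<And>k. simple_pred F (2 ^ m k) (dyadic (t + 1) (m k)) (\<xi> k)"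
    "\<And>u. u \<le> t + 1 \<Longrightarrow> (\<lambda>k. l2_dist u H (simple_proc (2 ^ m k) (dyadic (t + 1) (m k)) (\<xi> k))) \<longlonglongrightarrow> 0"
    "\<And>u. 0 \<le> u \<Longrightarrow> u \<le> t + 1 \<Longrightarrow> l2_lim M (\<lambda>k. simple_int W (2 ^ m k) (dyadic (t + 1) (m k)) (\<xi> k) u) (?X u)"
    by (fact l2_pred_approx[OF H T])
  have l: "l2_lim M (\<lambda>k \<omega>. simple_int W (2 ^ m k) (dyadic (t + 1) (m k)) (\<xi> k) t \<omega> - simple_int W (2 ^ m k) (dyadic (t + 1) (m k)) (\<xi> k) s \<omega>)
      (\<lambda>\<omega>. ?X t \<omega> - ?X s \<omega>)"
    by (rule l2_lim_diff[OF 1(3) 1(3)]) (use st in auto)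
  have Yi: "integrable M Y"
    using sq_integrable_integrable[OF iX(1)] Y(2) by (subst (asm) integrable_cong_AE[where g=Y]) auto
  have "AE \<omega> in M. real_cond_exp M (F s) (?X t) \<omega> = Y \<omega>"
  proof (rule S.real_cond_exp_charact[OF _ sq_integrable_integrable[OF iX(2)] Yi Y(1)])
    fix A assume A: "A \<in> sets (F s)"
    then have AM[measurable]: "A \<in> sets M" using sets_F_le by auto
    have gs: "sq_integrable M (indicator A)"
      unfolding sq_integrable_def by (auto intro!: integrable_const_bound[where B=1] simp: indicator_def)
    have gF: "indicator A \<in> borel_measurable (F s)" using A by (intro borel_measurable_indicator)
    have "(\<lambda>k. expectation (\<lambda>\<omega>. indicator A \<omega> * (simple_int W (2 ^ m k) (dyadic (t + 1) (m k)) (\<xi> k) t \<omega> - simple_int W (2 ^ m k) (dyadic (t + 1) (m k)) (\<xi> k) s \<omega>)))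
      \<longlonglongrightarrow> expectation (\<lambda>\<omega>. indicator A \<omega> * (?X t \<omega> - ?X s \<omega>))"
      by (rule l2_lim_mult[OF l gs])
    moreover have "expectation (\<lambda>\<omega>. indicator A \<omega> * (simple_int W (2 ^ m k) (dyadic (t + 1) (m k)) (\<xi> k) t \<omega> - simple_int W (2 ^ m k) (dyadic (t + 1) (m k)) (\<xi> k) s \<omega>)) = 0" for k
      by (rule simple_int_increment_mult[OF 1(1) st gF sq_integrable_integrable[OF gs]])
    ultimately have "expectation (\<lambda>\<omega>. indicator A \<omega> * (?X t \<omega> - ?X s \<omega>)) = 0" by (simp add: LIMSEQ_const_iff)
    then have "expectation (\<lambda>\<omega>. indicator A \<omega> * ?X t \<omega>) = expectation (\<lambda>\<omega>. indicator A \<omega> * ?X s \<omega>)"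
      using sq_integrable_mult[OF gs iX(1)] sq_integrable_mult[OF gs iX(2)] by (simp add: right_diff_distrib)
    also have "\<dots> = expectation (\<lambda>\<omega>. indicator A \<omega> * Y \<omega>)"
      by (rule integral_cong_AE) (use Y(2) in auto)
    finally show "(\<integral>x\<in>A. ?X t x \<partial>M) = (\<integral>x\<in>A. Y x \<partial>M)"
      by (simp add: set_lebesgue_integral_def)
  qed
  with Y(2) show "AE \<omega> in M. real_cond_exp M (F s) (?X t) \<omega> = ?X s \<omega>"
    by eventually_elim simp
qed

lemma simple_int_martingale:
  assumes sp: "simple_pred F n \<tau> \<xi>"
  shows "real_martingale M F (simple_int W n \<tau> \<xi>)"
  unfolding real_martingale_def
proof (intro conjI allI impI)
  fix t :: real assume t: "0 \<le> t"
  show "integrable M (simple_int W n \<tau> \<xi> t)" by (rule sq_integrable_integrable[OF sq_integrable_simple_int[OF sp t]])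
  show "\<exists>Y\<in>borel_measurable (F t). AE \<omega> in M. simple_int W n \<tau> \<xi> t \<omega> = Y \<omega>"
    using simple_int_measurable_F[OF sp t] by (intro bexI[of _ "simple_int W n \<tau> \<xi> t"]) auto
next
  fix s t :: real assume st: "0 \<le> s" "s \<le> t"
  interpret S: sigma_finite_subalgebra M "F s" by (rule sigma_finite_subalgebra_F)
  have t: "0 \<le> t" using st by simp
  let ?X = "simple_int W n \<tau> \<xi>"
  note iX = sq_integrable_simple_int[OF sp st(1)] sq_integrable_simple_int[OF sp t]
  show "AE \<omega> in M. real_cond_exp M (F s) (?X t) \<omega> = ?X s \<omega>"
  proof (rule S.real_cond_exp_charact[OF _ sq_integrable_integrable[OF iX(2)] sq_integrable_integrable[OF iX(1)] simple_int_measurable_F[OF sp st(1)]])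
    fix A assume A: "A \<in> sets (F s)"
    then have AM[measurable]: "A \<in> sets M" using sets_F_le by auto
    have gs: "sq_integrable M (indicator A)"
      unfolding sq_integrable_def by (auto intro!: integrable_const_bound[where B=1] simp: indicator_def)
    have gF: "indicator A \<in> borel_measurable (F s)" using A by (intro borel_measurable_indicator)
    have "expectation (\<lambda>\<omega>. indicator A \<omega> * (?X t \<omega> - ?X s \<omega>)) = 0"
      by (rule simple_int_increment_mult[OF sp st gF sq_integrable_integrable[OF gs]])
    then have "expectation (\<lambda>\<omega>. indicator A \<omega> * ?X t \<omega>) = expectation (\<lambda>\<omega>. indicator A \<omega> * ?X s \<omega>)"
      using sq_integrable_mult[OF gs iX(1)] sq_integrable_mult[OF gs iX(2)] by (simp add: right_diff_distrib)
    then show "(\<integral>x\<in>A. ?X t x \<partial>M) = (\<integral>x\<in>A. ?X s x \<partial>M)"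
      by (simp add: set_lebesgue_integral_def)
  qed
qed

text \<open>Conditioning at time a turns the mixed moment of \<open>Z a\<close> and
  \<open>Z b\<close> into the second moment of \<open>Z a\<close>. The adapted version
  \<open>Y\<close> replaces \<open>Z a\<close> where measurability for \<open>F a\<close> is
  required.\<close>

lemma martingale_increment_sq:
  assumes mart: "real_martingale M F Z" and sq: "\<And>s. 0 \<le> s \<Longrightarrow> sq_integrable M (Z s)" and ab: "0 \<le> a" "a \<le> b"
  shows "expectation (\<lambda>\<omega>. (Z b \<omega> - Z a \<omega>)\<^sup>2) = expectation (\<lambda>\<omega>. (Z b \<omega>)\<^sup>2) - expectation (\<lambda>\<omega>. (Z a \<omega>)\<^sup>2)"
proof -
  interpret S: sigma_finite_subalgebra M "F a" by (rule sigma_finite_subalgebra_F)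
  have b: "0 \<le> b" using ab by simp
  note sa = sq[OF ab(1)] and sb = sq[OF b]
  obtain Y where Y: "Y \<in> borel_measurable (F a)" "AE \<omega> in M. Z a \<omega> = Y \<omega>"
    using mart ab unfolding real_martingale_def by blast
  have c: "AE \<omega> in M. real_cond_exp M (F a) (Z b) \<omega> = Z a \<omega>" using mart ab by (auto simp: real_martingale_def)
  note [measurable] = measurable_F_M[OF Y(1)] sq_integrableD(1)[OF sa] sq_integrableD(1)[OF sb]
  have "integrable M (\<lambda>\<omega>. Z a \<omega> * Z b \<omega>)" by (rule sq_integrable_mult[OF sa sb])
  moreover have "AE \<omega> in M. Z a \<omega> * Z b \<omega> = Y \<omega> * Z b \<omega>" using Y(2) by eventually_elim simp
  ultimately have i: "integrable M (\<lambda>\<omega>. Y \<omega> * Z b \<omega>)"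
    by (subst integrable_cong_AE[where g="\<lambda>\<omega>. Z a \<omega> * Z b \<omega>"]) (auto elim: AE_mp)
  have "expectation (\<lambda>\<omega>. Z a \<omega> * Z b \<omega>) = expectation (\<lambda>\<omega>. Y \<omega> * Z b \<omega>)"
    by (rule integral_cong_AE) (use Y(2) in auto)
  also have "\<dots> = expectation (\<lambda>\<omega>. Y \<omega> * real_cond_exp M (F a) (Z b) \<omega>)"
    using S.real_cond_exp_intg(2)[OF i Y(1)] by simp
  also have "\<dots> = expectation (\<lambda>\<omega>. (Z a \<omega>)\<^sup>2)"
  proof (rule integral_cong_AE)
    show "AE \<omega> in M. Y \<omega> * real_cond_exp M (F a) (Z b) \<omega> = (Z a \<omega>)\<^sup>2"
      using Y(2) c by eventually_elim (simp add: power2_eq_square)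
    show "(\<lambda>\<omega>. Y \<omega> * real_cond_exp M (F a) (Z b) \<omega>) \<in> borel_measurable M"
      by (intro borel_measurable_times borel_measurable_cond_exp2) measurable
  qed measurable
  finally have e: "expectation (\<lambda>\<omega>. Z a \<omega> * Z b \<omega>) = expectation (\<lambda>\<omega>. (Z a \<omega>)\<^sup>2)" .
  have "expectation (\<lambda>\<omega>. (Z b \<omega> - Z a \<omega>)\<^sup>2) = expectation (\<lambda>\<omega>. (Z b \<omega>)\<^sup>2 - 2 * (Z a \<omega> * Z b \<omega>) + (Z a \<omega>)\<^sup>2)"
    by (simp add: power2_diff algebra_simps)
  also have "\<dots> = expectation (\<lambda>\<omega>. (Z b \<omega>)\<^sup>2) - 2 * expectation (\<lambda>\<omega>. Z a \<omega> * Z b \<omega>) + expectation (\<lambda>\<omega>. (Z a \<omega>)\<^sup>2)"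
    using sq_integrable_mult[OF sa sb] sa sb by (simp add: sq_integrable_def)
  finally show ?thesis using e by simp
qed

text \<open>The bound depends on the final time only, not on the partition; this uniformity drives
  the passage to the limit in the quadratic variation.\<close>

lemma martingale_sum_increments_sq:
  assumes mart: "real_martingale M F Z" and sq: "\<And>s. 0 \<le> s \<Longrightarrow> sq_integrable M (Z s)"
    and s: "0 \<le> s 0" "\<And>k. k < n \<Longrightarrow> s k \<le> s (Suc k)"
  shows "(\<Sum>k<n. expectation (\<lambda>\<omega>. (Z (s (Suc k)) \<omega> - Z (s k) \<omega>)\<^sup>2)) \<le> expectation (\<lambda>\<omega>. (Z (s n) \<omega>)\<^sup>2)"
proof -
  have s0: "0 \<le> s k" if "k \<le> n" for k
    using that by (induction k) (use s in \<open>auto intro: order_trans\<close>)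
  have "(\<Sum>k<n. expectation (\<lambda>\<omega>. (Z (s (Suc k)) \<omega> - Z (s k) \<omega>)\<^sup>2)) =
     (\<Sum>k<n. expectation (\<lambda>\<omega>. (Z (s (Suc k)) \<omega>)\<^sup>2) - expectation (\<lambda>\<omega>. (Z (s k) \<omega>)\<^sup>2))"
    using s0 s(2) by (intro sum.cong martingale_increment_sq[OF mart sq]) auto
  also have "\<dots> = expectation (\<lambda>\<omega>. (Z (s n) \<omega>)\<^sup>2) - expectation (\<lambda>\<omega>. (Z (s 0) \<omega>)\<^sup>2)"
    by (rule sum_lessThan_telescope)
  also have "\<dots> \<le> expectation (\<lambda>\<omega>. (Z (s n) \<omega>)\<^sup>2)" by simp
  finally show ?thesis .
qed

end

section \<open>Quadratic variation\<close>

lemma (in finite_measure) L1_conv_in_prob: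
  assumes [measurable]: "\<And>n. integrable M (f n)" "integrable M g" and lim: "(\<lambda>n. \<integral>x. \<bar>f n x - g x\<bar> \<partial>M) \<longlonglongrightarrow> 0"
  shows "conv_in_prob M f g"
  unfolding conv_in_prob_def
proof (intro allI impI)
  fix \<epsilon> :: real assume e: "0 < \<epsilon>"
  have "(\<lambda>n. (1 / \<epsilon>) * (\<integral>x. \<bar>f n x - g x\<bar> \<partial>M)) \<longlonglongrightarrow> (1 / \<epsilon>) * 0" by (intro tendsto_intros lim)
  then have l: "(\<lambda>n. (1 / \<epsilon>) * (\<integral>x. \<bar>f n x - g x\<bar> \<partial>M)) \<longlonglongrightarrow> 0" by simp
  show "(\<lambda>n. measure M {x \<in> space M. \<bar>f n x - g x\<bar> > \<epsilon>}) \<longlonglongrightarrow> 0"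
  proof (rule tendsto_sandwich[OF _ _ tendsto_const l])
    have "measure M {x \<in> space M. \<bar>f n x - g x\<bar> > \<epsilon>} \<le> (1 / \<epsilon>) * (\<integral>x. \<bar>f n x - g x\<bar> \<partial>M)" for n
    proof -
      have "measure M {x \<in> space M. \<bar>f n x - g x\<bar> > \<epsilon>} \<le> measure M {x \<in> space M. \<epsilon> \<le> \<bar>f n x - g x\<bar>}"
        using assms(1)[of n] assms(2) by (intro finite_measure_mono) auto
      also have "\<dots> \<le> (\<integral>x. \<bar>f n x - g x\<bar> \<partial>M) / \<epsilon>"
        using assms(1)[of n] assms(2) e by (intro integral_Markov_inequality_measure[where A="{}"]) auto
      finally show ?thesis by simp
    qed
    then show "\<forall>\<^sub>F n in sequentially. measure M {x \<in> space M. \<bar>f n x - g x\<bar> > \<epsilon>} \<le> (1 / \<epsilon>) * (\<integral>x. \<bar>f n x - g x\<bar> \<partial>M)" by simp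
  qed simp
qed

lemma simple_int_at_grid:
  assumes "\<And>i. i < n \<Longrightarrow> \<tau> i < \<tau> (Suc i)" "j \<le> n"
  shows "simple_int W n \<tau> \<xi> (\<tau> j) \<omega> = (\<Sum>i<j. \<xi> i \<omega> \<bullet> (W (\<tau> (Suc i)) \<omega> - W (\<tau> i) \<omega>))"
proof -
  have le: "\<tau> i \<le> \<tau> k \<longleftrightarrow> i \<le> k" if "i \<le> n" "k \<le> n" for i k
    by (rule strict_chain_le_iff[of n \<tau>, OF assms(1)]) (use that in auto)
  have "simple_int W n \<tau> \<xi> (\<tau> j) \<omega> = (\<Sum>i<n. if i < j then \<xi> i \<omega> \<bullet> (W (\<tau> (Suc i)) \<omega> - W (\<tau> i) \<omega>) else 0)"
    unfolding simple_int_def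
  proof (rule sum.cong[OF refl])
    fix i assume "i \<in> {..<n}"
    then have i: "i < n" by simp
    show "\<xi> i \<omega> \<bullet> (W (min (\<tau> j) (\<tau> (Suc i))) \<omega> - W (min (\<tau> j) (\<tau> i)) \<omega>) = (if i < j then \<xi> i \<omega> \<bullet> (W (\<tau> (Suc i)) \<omega> - W (\<tau> i) \<omega>) else 0)"
    proof (cases "i < j")
      case True
      then have "\<tau> (Suc i) \<le> \<tau> j" "\<tau> i \<le> \<tau> j" using le[of "Suc i" j] le[of i j] i assms(2) by auto
      then show ?thesis using True by (simp add: min_absorb2)
    next
      case False
      then have "\<tau> j \<le> \<tau> (Suc i)" "\<tau> j \<le> \<tau> i" using le[of j "Suc i"] le[of j i] i assms(2) by auto
      then show ?thesis using False by (simp add: min_absorb1)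
    qed
  qed
  also have "\<dots> = (\<Sum>i\<in>{..<n} \<inter> {i. i < j}. \<xi> i \<omega> \<bullet> (W (\<tau> (Suc i)) \<omega> - W (\<tau> i) \<omega>))"
    by (simp add: sum.inter_restrict)
  also have "{..<n} \<inter> {i. i < j} = {..<j}" using assms(2) by auto
  finally show ?thesis .
qed

lemma dyadic_cov_dyadic:
  "dyadic_cov X Y t n \<omega> = (\<Sum>k<2 ^ n. (X (dyadic t n (Suc k)) \<omega> - X (dyadic t n k) \<omega>) * (Y (dyadic t n (Suc k)) \<omega> - Y (dyadic t n k) \<omega>))"
  by (simp add: dyadic_cov_def dyadic_def)

section \<open>Squared increments and their compensators\<close>

context brownian
begin

lemma simple_proc_bounded:
  assumes "simple_pred F n \<tau> \<xi>"
  obtains R where "0 \<le> R" "\<And>v \<omega>. norm (simple_proc n \<tau> \<xi> v \<omega>) \<le> R"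
proof -
  have "\<forall>i<n. \<exists>R. \<forall>\<omega>. norm (\<xi> i \<omega>) \<le> R" using assms by (auto simp: simple_pred_def bounded_iff)
  then obtain R where R: "\<And>i \<omega>. i < n \<Longrightarrow> norm (\<xi> i \<omega>) \<le> R i" by metis
  have R0: "0 \<le> R i" if "i < n" for i using R[OF that, of undefined] norm_ge_zero order_trans by blast
  have "norm (simple_proc n \<tau> \<xi> v \<omega>) \<le> (\<Sum>i<n. R i)" for v \<omega>
    unfolding simple_proc_def using R R0 by (intro sum_norm_le) (auto simp: indicator_def)
  moreover have "0 \<le> (\<Sum>i<n. R i)" using R0 by (auto intro: sum_nonneg)
  ultimately show ?thesis using that by blast
qed

text \<open>The \<open>d k\<close> are martingale differences: given the past, the squared increment
  has mean (s (Suc k) - s k) |\<xi> k|^2. Their variances therefore add, and each is of second order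
  in the cell length. In the constant, 3 d^2 comes from the fourth moment of the increment and 1
  from the compensator.\<close>

lemma grid_square_deviation:
  assumes ag: "adapted_grid n s \<xi>" and R: "0 \<le> R" "\<And>k \<omega>. k < n \<Longrightarrow> norm (\<xi> k \<omega>) \<le> R"
  defines "d \<equiv> \<lambda>k \<omega>. (\<xi> k \<omega> \<bullet> (W (s (Suc k)) \<omega> - W (s k) \<omega>))\<^sup>2 - (s (Suc k) - s k) * (norm (\<xi> k \<omega>))\<^sup>2"
  shows "j \<le> n \<Longrightarrow> sq_integrable M (\<lambda>\<omega>. \<Sum>k<j. d k \<omega>)"
    and "j \<le> n \<Longrightarrow> expectation (\<lambda>\<omega>. (\<Sum>k<j. d k \<omega>)\<^sup>2) \<le> (\<Sum>k<j. R ^ 4 * (3 * (real CARD('d))\<^sup>2 + 1) * (s (Suc k) - s k)\<^sup>2)"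
proof -
  note a = adapted_gridD[OF ag]
  define c where "c = R ^ 4 * (3 * (real CARD('d))\<^sup>2 + 1)"
  have dF: "d k \<in> borel_measurable (F (s j))" if "k < j" "j \<le> n" for k j
  proof -
    have k: "k < n" "Suc k \<le> j" "k \<le> j" using that by auto
    note [measurable] = measurable_F_mono[OF a(3)[OF k(1)] a(5)[OF k(3) that(2)]]
    have [measurable]: "W (s (Suc k)) \<in> borel_measurable (F (s j))" "W (s k) \<in> borel_measurable (F (s j))"
      using k a that by (auto intro!: W_measurable_F)
    show ?thesis unfolding d_def by measurable
  qed
  have dM[measurable]: "d k \<in> borel_measurable M" if "k < n" for k
    using measurable_F_M[OF dF[of k "Suc k"]] that by simp
  have d1: "sq_integrable M (d k) \<and> expectation (\<lambda>\<omega>. (d k \<omega>)\<^sup>2) \<le> c * (s (Suc k) - s k)\<^sup>2" if k: "k < n" for k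
  proof -
    let ?D = "\<lambda>\<omega>. W (s (Suc k)) \<omega> - W (s k) \<omega>"
    have sk: "0 \<le> s k" "s k \<le> s (Suc k)" using a(1,2)[of k] k by auto
    let ?b = "\<lambda>\<omega>. R ^ 4 * norm (?D \<omega>) ^ 4 + R ^ 4 * (s (Suc k) - s k)\<^sup>2"
    have le: "(d k \<omega>)\<^sup>2 \<le> ?b \<omega>" for \<omega>
    proof -
      have sub: "(x - y)\<^sup>2 \<le> x\<^sup>2 + y\<^sup>2" if "0 \<le> x" "0 \<le> y" for x y :: real
        using that by (simp add: power2_diff)
      have "(d k \<omega>)\<^sup>2 \<le> ((\<xi> k \<omega> \<bullet> ?D \<omega>)\<^sup>2)\<^sup>2 + ((s (Suc k) - s k) * (norm (\<xi> k \<omega>))\<^sup>2)\<^sup>2"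
        unfolding d_def using sk by (intro sub) auto
      also have "((\<xi> k \<omega> \<bullet> ?D \<omega>)\<^sup>2)\<^sup>2 \<le> R ^ 4 * norm (?D \<omega>) ^ 4"
      proof -
        have "\<bar>\<xi> k \<omega> \<bullet> ?D \<omega>\<bar> \<le> R * norm (?D \<omega>)"
          using Cauchy_Schwarz_ineq2[of "\<xi> k \<omega>" "?D \<omega>"] mult_right_mono[OF R(2)[OF k], of "norm (?D \<omega>)" \<omega>] by simp
        then have "\<bar>\<xi> k \<omega> \<bullet> ?D \<omega>\<bar> ^ 4 \<le> (R * norm (?D \<omega>)) ^ 4" by (intro power_mono) auto
        then show ?thesis by (simp add: power_mult_distrib)
      qed
      also have "((s (Suc k) - s k) * (norm (\<xi> k \<omega>))\<^sup>2)\<^sup>2 \<le> R ^ 4 * (s (Suc k) - s k)\<^sup>2"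
      proof -
        have "norm (\<xi> k \<omega>) ^ 4 \<le> R ^ 4" using R(2)[OF k] by (intro power_mono) auto
        then have "(s (Suc k) - s k)\<^sup>2 * norm (\<xi> k \<omega>) ^ 4 \<le> (s (Suc k) - s k)\<^sup>2 * R ^ 4" by (intro mult_left_mono) auto
        then show ?thesis by (simp add: power_mult_distrib mult.commute)
      qed
      finally show ?thesis by simp
    qed
    have ib: "integrable M ?b" using increment_norm_4(1)[OF sk] by simp
    have i: "integrable M (\<lambda>\<omega>. (d k \<omega>)\<^sup>2)"
      by (rule Bochner_Integration.integrable_bound[OF ib]) (use dM[OF k] le in \<open>auto intro: order_trans[OF _ abs_ge_self]\<close>)
    have "expectation (\<lambda>\<omega>. (d k \<omega>)\<^sup>2) \<le> expectation ?b" by (rule integral_mono[OF i ib le])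
    also have "\<dots> = R ^ 4 * expectation (\<lambda>\<omega>. norm (?D \<omega>) ^ 4) + R ^ 4 * (s (Suc k) - s k)\<^sup>2"
      using increment_norm_4(1)[OF sk] by (simp add: prob_space)
    also have "\<dots> \<le> R ^ 4 * (3 * (real CARD('d))\<^sup>2 * (s (Suc k) - s k)\<^sup>2) + R ^ 4 * (s (Suc k) - s k)\<^sup>2"
      using increment_norm_4(2)[OF sk] R(1) by (intro add_right_mono mult_left_mono) auto
    also have "\<dots> = c * (s (Suc k) - s k)\<^sup>2" by (simp add: c_def algebra_simps)
    finally show ?thesis using i dM[OF k] by (simp add: sq_integrable_def)
  qed
  show sqi: "sq_integrable M (\<lambda>\<omega>. \<Sum>k<j. d k \<omega>)" if "j \<le> n" for j
    using d1 that by (intro sq_integrable_sum) auto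
  have "expectation (\<lambda>\<omega>. (\<Sum>k<j. d k \<omega>)\<^sup>2) \<le> (\<Sum>k<j. c * (s (Suc k) - s k)\<^sup>2)" if "j \<le> n" for j
    using that
  proof (induction j)
    case (Suc j)
    then have j: "j < n" "j \<le> n" by auto
    let ?G = "\<lambda>\<omega>. \<Sum>k<j. d k \<omega>" and ?D = "\<lambda>\<omega>. W (s (Suc j)) \<omega> - W (s j) \<omega>"
    have sj: "0 \<le> s j" "s j \<le> s (Suc j)" using a(1,2)[of j] j by auto
    have GF: "?G \<in> borel_measurable (F (s j))" using dF j by (intro borel_measurable_sum) auto
    have Gi: "integrable M ?G" by (rule sq_integrable_integrable[OF sqi[OF j(2)]])
    note ii = inner_increment[OF sj GF Gi a(3)[OF j(1)] a(4)[OF j(1)] a(3)[OF j(1)] a(4)[OF j(1)]]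
    note [measurable] = measurable_F_M[OF a(3)[OF j(1)]]
    have iG: "integrable M (\<lambda>\<omega>. ?G \<omega> * (\<xi> j \<omega> \<bullet> \<xi> j \<omega>))"
    proof (rule integrable_mult_bounded[OF Gi, where B="R\<^sup>2"])
      show "\<bar>\<xi> j x \<bullet> \<xi> j x\<bar> \<le> R\<^sup>2" for x
        using power_mono[OF R(2)[OF j(1), of x], of 2] by (simp add: power2_norm_eq_inner[symmetric] abs_of_nonneg)
    qed measurable
    \<comment> \<open>The earlier sum is known at \<open>s j\<close>, so the compensator cancels the
      squared increment exactly and the cross term has mean 0.\<close>
    have "expectation (\<lambda>\<omega>. ?G \<omega> * d j \<omega>) = expectation (\<lambda>\<omega>. ?G \<omega> * ((\<xi> j \<omega> \<bullet> ?D \<omega>) * (\<xi> j \<omega> \<bullet> ?D \<omega>)) - (s (Suc j) - s j) * (?G \<omega> * (\<xi> j \<omega> \<bullet> \<xi> j \<omega>)))"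
      unfolding d_def by (intro Bochner_Integration.integral_cong) (auto simp: power2_norm_eq_inner power2_eq_square[of "_ \<bullet> _"] right_diff_distrib)
    also have "\<dots> = 0" using ii(3,4) iG by simp
    finally have 0: "expectation (\<lambda>\<omega>. ?G \<omega> * d j \<omega>) = 0" .
    have "expectation (\<lambda>\<omega>. (\<Sum>k<Suc j. d k \<omega>)\<^sup>2) = expectation (\<lambda>\<omega>. (?G \<omega>)\<^sup>2 + (d j \<omega>)\<^sup>2 + 2 * (?G \<omega> * d j \<omega>))"
      by (simp add: power2_sum mult.assoc)
    also have "\<dots> = expectation (\<lambda>\<omega>. (?G \<omega>)\<^sup>2) + expectation (\<lambda>\<omega>. (d j \<omega>)\<^sup>2) + 2 * expectation (\<lambda>\<omega>. ?G \<omega> * d j \<omega>)"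
      using sqi[OF j(2)] d1[OF j(1)] sq_integrable_mult[OF sqi[OF j(2)], of "d j"] by (simp add: sq_integrable_def)
    also have "\<dots> \<le> (\<Sum>k<Suc j. c * (s (Suc k) - s k)\<^sup>2)"
      using Suc.IH[OF j(2)] d1[OF j(1)] 0 by simp
    finally show ?case .
  qed simp
  then show "j \<le> n \<Longrightarrow> expectation (\<lambda>\<omega>. (\<Sum>k<j. d k \<omega>)\<^sup>2) \<le> (\<Sum>k<j. R ^ 4 * (3 * (real CARD('d))\<^sup>2 + 1) * (s (Suc k) - s k)\<^sup>2)"
    by (simp add: c_def)
qed

text \<open>The bracket at time t of the integral of \<open>J\<close>, defined path by path.
  Integration over a restricted measure fits Fubini on \<open>prod_meas\<close>.\<close>

definition energy :: "real \<Rightarrow> (real \<Rightarrow> 'a \<Rightarrow> real^'d) \<Rightarrow> 'a \<Rightarrow> real" where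
  "energy t J \<omega> = (\<integral>v. (norm (J v \<omega>))\<^sup>2 \<partial>restrict_space lborel {0..t})"

lemma energy_simple:
  assumes T: "0 < t" and sp: "simple_pred F (2 ^ m) (dyadic t m) \<xi>"
  shows "energy t (simple_proc (2 ^ m) (dyadic t m) \<xi>) \<omega> =
    (\<Sum>k<2 ^ m. (dyadic t m (Suc k) - dyadic t m k) * (norm (\<xi> k \<omega>))\<^sup>2)"
proof -
  let ?p = "simple_proc (2 ^ m) (dyadic t m) \<xi>"
  have le: "dyadic t m k \<le> t" if "k \<le> 2 ^ m" for k
    using T that by (simp add: dyadic_def field_simps)
  have [measurable]: "(\<lambda>v. ?p v \<omega>) \<in> borel_measurable (restrict_space lborel {0..t})"
    unfolding simple_proc_def by (rule measurable_restrict_space1) measurable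
  have "energy t ?p \<omega> = enn2real (\<integral>\<^sup>+v. ennreal ((norm (?p v \<omega>))\<^sup>2) \<partial>restrict_space lborel {0..t})"
    unfolding energy_def by (rule integral_eq_nn_integral) auto
  also have "(\<integral>\<^sup>+v. ennreal ((norm (?p v \<omega>))\<^sup>2) \<partial>restrict_space lborel {0..t}) = (\<integral>\<^sup>+v\<in>{0..t}. ennreal ((norm (?p v \<omega>))\<^sup>2) \<partial>lborel)"
    by (rule nn_integral_restrict_space) simp
  also have "\<dots> = ennreal (\<Sum>k<2 ^ m. (min t (dyadic t m (Suc k)) - min t (dyadic t m k)) * (norm (if dyadic t m k \<le> t then \<xi> k \<omega> else 0))\<^sup>2)"
    by (rule simple_proc_norm_integral[OF sp]) (use T in simp)
  also have "(\<Sum>k<2 ^ m. (min t (dyadic t m (Suc k)) - min t (dyadic t m k)) * (norm (if dyadic t m k \<le> t then \<xi> k \<omega> else 0))\<^sup>2) =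
     (\<Sum>k<2 ^ m. (dyadic t m (Suc k) - dyadic t m k) * (norm (\<xi> k \<omega>))\<^sup>2)"
    by (intro sum.cong refl) (simp add: le min_absorb2)
  finally show ?thesis
    using dyadic_less[OF T, of m] by (simp add: sum_nonneg less_imp_le)
qed

text \<open>L^2 convergence of the integrands makes their squared norms converge in L^1 of the
  product space; Fubini then bounds the expected difference of the energies.\<close>

lemma energy_limit:
  assumes Jm [measurable]: "(\<lambda>z. J (fst z) (snd z)) \<in> borel_measurable (prod_meas t)"
    and fin: "(\<integral>\<^sup>+\<omega>. (\<integral>\<^sup>+v\<in>{0..t}. ennreal ((norm (J v \<omega>))\<^sup>2) \<partial>lborel) \<partial>M) < \<infinity>"
    and sp: "\<And>k. simple_pred F (n k) (\<tau> k) (\<xi> k)"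
    and lim: "(\<lambda>k. l2_dist t J (simple_proc (n k) (\<tau> k) (\<xi> k))) \<longlonglongrightarrow> 0"
  shows "integrable M (energy t J)" "\<And>k. integrable M (energy t (simple_proc (n k) (\<tau> k) (\<xi> k)))"
    and "(\<lambda>k. expectation (\<lambda>\<omega>. \<bar>energy t (simple_proc (n k) (\<tau> k) (\<xi> k)) \<omega> - energy t J \<omega>\<bar>)) \<longlonglongrightarrow> 0"
proof -
  let ?\<mu> = "prod_meas t"
  interpret PS: pair_sigma_finite "restrict_space lborel {0..t}" M by (rule pair_sigma_finite_prod_meas)
  define p where "p k = simple_proc (n k) (\<tau> k) (\<xi> k)" for k
  have pm[measurable]: "(\<lambda>z. p k (fst z) (snd z)) \<in> borel_measurable ?\<mu>" for k
    unfolding p_def by (rule simple_proc_measurable[OF sp])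
  define a where "a z = norm (J (fst z) (snd z))" for z
  define b where "b k z = norm (p k (fst z) (snd z))" for k z
  have am[measurable]: "a \<in> borel_measurable ?\<mu>" "b k \<in> borel_measurable ?\<mu>" for k
    unfolding a_def[abs_def] b_def[abs_def] by measurable
  have "(\<integral>\<^sup>+z. ennreal ((a z)\<^sup>2) \<partial>?\<mu>) < \<infinity>"
    using fin by (subst nn_integral_prod_meas) (simp_all add: a_def)
  then have sa: "sq_integrable ?\<mu> a"
    unfolding sq_integrable_def by (auto intro!: integrableI_nonneg)
  have l2: "l2_dist t J (p k) = (\<integral>\<^sup>+z. ennreal ((norm (J (fst z) (snd z) - p k (fst z) (snd z)))\<^sup>2) \<partial>?\<mu>)" for k
    by (rule l2_dist_eq) measurable
  have sb: "sq_integrable ?\<mu> (b k)" for k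
  proof -
    obtain R where R: "0 \<le> R" "\<And>v \<omega>. norm (p k v \<omega>) \<le> R" using simple_proc_bounded[OF sp] unfolding p_def by metis
    have "emeasure ?\<mu> (space ?\<mu>) < \<infinity>"
    proof -
      have "emeasure ?\<mu> (space ?\<mu>) = (\<integral>\<^sup>+z. 1 \<partial>?\<mu>)" by simp
      also have "\<dots> = (\<integral>\<^sup>+\<omega>. (\<integral>\<^sup>+v\<in>{0..t}. 1 \<partial>lborel) \<partial>M)" by (rule nn_integral_prod_meas) simp
      also have "\<dots> < \<infinity>" by (simp add: emeasure_lborel_Icc_eq emeasure_space_1 less_top[symmetric])
      finally show ?thesis .
    qed
    then have "finite_measure ?\<mu>" by (intro finite_measureI) auto
    then show ?thesis
      unfolding sq_integrable_def
      by (intro conjI finite_measure.integrable_const_bound[where B="R\<^sup>2"]) (auto simp: b_def R intro!: power_mono)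
  qed
  have lim0: "(\<lambda>k. \<integral>z. (b k z - a z)\<^sup>2 \<partial>?\<mu>) \<longlonglongrightarrow> 0"
  proof -
    have "ennreal (\<integral>z. (b k z - a z)\<^sup>2 \<partial>?\<mu>) \<le> l2_dist t J (p k)" for k
    proof -
      have "ennreal (\<integral>z. (b k z - a z)\<^sup>2 \<partial>?\<mu>) = (\<integral>\<^sup>+z. ennreal ((b k z - a z)\<^sup>2) \<partial>?\<mu>)"
        using sq_integrableD(2)[OF sq_integrable_diff[OF sb sa]] by (intro nn_integral_eq_integral[symmetric]) auto
      also have "\<dots> \<le> l2_dist t J (p k)"
        unfolding l2
      proof (intro nn_integral_mono ennreal_leI)
        fix z
        have "\<bar>b k z - a z\<bar> \<le> norm (J (fst z) (snd z) - p k (fst z) (snd z))"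
          unfolding a_def b_def using norm_triangle_ineq3 by (metis norm_minus_commute)
        then have "\<bar>b k z - a z\<bar>\<^sup>2 \<le> (norm (J (fst z) (snd z) - p k (fst z) (snd z)))\<^sup>2" by (intro power_mono) auto
        then show "(b k z - a z)\<^sup>2 \<le> (norm (J (fst z) (snd z) - p k (fst z) (snd z)))\<^sup>2" by simp
      qed
      finally show ?thesis .
    qed
    then have "(\<lambda>k. ennreal (\<integral>z. (b k z - a z)\<^sup>2 \<partial>?\<mu>)) \<longlonglongrightarrow> ennreal 0"
      using ennreal_tendsto_0_le[OF lim] by (simp add: p_def)
    then show ?thesis by (subst (asm) tendsto_ennreal_iff) auto
  qed
  have ll: "l2_lim ?\<mu> b a" using sa sb lim0 by (simp add: l2_lim_def)
  \<comment> \<open>The expansion b^2 - a^2 = (b - a)^2 + 2 a (b - a) pairs the vanishing difference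
    with the fixed function \<open>a\<close> only.\<close>
  have L1: "(\<lambda>k. \<integral>z. \<bar>(b k z)\<^sup>2 - (a z)\<^sup>2\<bar> \<partial>?\<mu>) \<longlonglongrightarrow> 0"
  proof (rule tendsto_sandwich[OF _ _ tendsto_const])
    have "(\<lambda>k. (\<integral>z. (b k z - a z)\<^sup>2 \<partial>?\<mu>) + 2 * (\<integral>z. \<bar>a z * (b k z - a z)\<bar> \<partial>?\<mu>)) \<longlonglongrightarrow> 0 + 2 * 0"
      by (intro tendsto_intros lim0 l2_lim_abs_mult[OF ll sa])
    then show "(\<lambda>k. (\<integral>z. (b k z - a z)\<^sup>2 \<partial>?\<mu>) + 2 * (\<integral>z. \<bar>a z * (b k z - a z)\<bar> \<partial>?\<mu>)) \<longlonglongrightarrow> 0" by simp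
    show "\<forall>\<^sub>F k in sequentially. (\<integral>z. \<bar>(b k z)\<^sup>2 - (a z)\<^sup>2\<bar> \<partial>?\<mu>) \<le> (\<integral>z. (b k z - a z)\<^sup>2 \<partial>?\<mu>) + 2 * (\<integral>z. \<bar>a z * (b k z - a z)\<bar> \<partial>?\<mu>)"
    proof (intro always_eventually allI)
      fix k
      note d = sq_integrable_diff[OF sb[of k] sa]
      have "(\<integral>z. \<bar>(b k z)\<^sup>2 - (a z)\<^sup>2\<bar> \<partial>?\<mu>) \<le> (\<integral>z. (b k z - a z)\<^sup>2 + 2 * \<bar>a z * (b k z - a z)\<bar> \<partial>?\<mu>)"
      proof (rule integral_mono)
        show "integrable ?\<mu> (\<lambda>z. \<bar>(b k z)\<^sup>2 - (a z)\<^sup>2\<bar>)" using sa sb by (auto simp: sq_integrable_def)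
        show "integrable ?\<mu> (\<lambda>z. (b k z - a z)\<^sup>2 + 2 * \<bar>a z * (b k z - a z)\<bar>)"
          using d sq_integrable_mult[OF sa d] by (simp add: sq_integrable_def)
        fix z
        have "(b k z)\<^sup>2 - (a z)\<^sup>2 = (b k z - a z)\<^sup>2 + 2 * (a z * (b k z - a z))"
          by (simp add: power2_eq_square algebra_simps)
        then show "\<bar>(b k z)\<^sup>2 - (a z)\<^sup>2\<bar> \<le> (b k z - a z)\<^sup>2 + 2 * \<bar>a z * (b k z - a z)\<bar>"
          using abs_triangle_ineq[of "(b k z - a z)\<^sup>2" "2 * (a z * (b k z - a z))"] by (simp add: abs_mult)
      qed
      also have "\<dots> = (\<integral>z. (b k z - a z)\<^sup>2 \<partial>?\<mu>) + 2 * (\<integral>z. \<bar>a z * (b k z - a z)\<bar> \<partial>?\<mu>)"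
        using d sq_integrable_mult[OF sa d] by (simp add: sq_integrable_def)
      finally show "(\<integral>z. \<bar>(b k z)\<^sup>2 - (a z)\<^sup>2\<bar> \<partial>?\<mu>) \<le> (\<integral>z. (b k z - a z)\<^sup>2 \<partial>?\<mu>) + 2 * (\<integral>z. \<bar>a z * (b k z - a z)\<bar> \<partial>?\<mu>)" .
    qed
  qed simp
  have ia: "integrable (restrict_space lborel {0..t} \<Otimes>\<^sub>M M) (\<lambda>(v, \<omega>). (norm (J v \<omega>))\<^sup>2)"
    using sq_integrableD(2)[OF sa] by (simp add: prod_meas_def a_def case_prod_beta')
  have ib: "integrable (restrict_space lborel {0..t} \<Otimes>\<^sub>M M) (\<lambda>(v, \<omega>). (norm (p k v \<omega>))\<^sup>2)" for k
    using sq_integrableD(2)[OF sb[of k]] by (simp add: prod_meas_def b_def case_prod_beta')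
  show eJ: "integrable M (energy t J)"
    using PS.integrable_snd[OF ia] by (simp add: energy_def[abs_def])
  have ep: "integrable M (energy t (p k))" for k
    using PS.integrable_snd[OF ib] by (simp add: energy_def[abs_def])
  then show "\<And>k. integrable M (energy t (simple_proc (n k) (\<tau> k) (\<xi> k)))" by (simp add: p_def)
  have "(\<lambda>k. expectation (\<lambda>\<omega>. \<bar>energy t (p k) \<omega> - energy t J \<omega>\<bar>)) \<longlonglongrightarrow> 0"
  proof (rule tendsto_sandwich[OF _ _ tendsto_const L1])
    show "\<forall>\<^sub>F k in sequentially. expectation (\<lambda>\<omega>. \<bar>energy t (p k) \<omega> - energy t J \<omega>\<bar>) \<le> (\<integral>z. \<bar>(b k z)\<^sup>2 - (a z)\<^sup>2\<bar> \<partial>?\<mu>)"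
    proof (intro always_eventually allI)
      fix k
      have ic: "integrable (restrict_space lborel {0..t} \<Otimes>\<^sub>M M) (\<lambda>(v, \<omega>). \<bar>(norm (p k v \<omega>))\<^sup>2 - (norm (J v \<omega>))\<^sup>2\<bar>)"
        using Bochner_Integration.integrable_diff[OF ib[of k] ia] by (auto simp: case_prod_beta' dest: integrable_abs)
      have "expectation (\<lambda>\<omega>. \<bar>energy t (p k) \<omega> - energy t J \<omega>\<bar>) \<le>
        expectation (\<lambda>\<omega>. \<integral>v. \<bar>(norm (p k v \<omega>))\<^sup>2 - (norm (J v \<omega>))\<^sup>2\<bar> \<partial>restrict_space lborel {0..t})"
      proof (rule integral_mono_AE)
        show "integrable M (\<lambda>\<omega>. \<bar>energy t (p k) \<omega> - energy t J \<omega>\<bar>)" using ep eJ by simp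
        show "integrable M (\<lambda>\<omega>. \<integral>v. \<bar>(norm (p k v \<omega>))\<^sup>2 - (norm (J v \<omega>))\<^sup>2\<bar> \<partial>restrict_space lborel {0..t})"
          using PS.integrable_snd[OF ic] by simp
        show "AE \<omega> in M. \<bar>energy t (p k) \<omega> - energy t J \<omega>\<bar> \<le> (\<integral>v. \<bar>(norm (p k v \<omega>))\<^sup>2 - (norm (J v \<omega>))\<^sup>2\<bar> \<partial>restrict_space lborel {0..t})"
          using PS.AE_integrable_snd[OF ia] PS.AE_integrable_snd[OF ib[of k]]
        proof eventually_elim
          case (elim \<omega>)
          then have "energy t (p k) \<omega> - energy t J \<omega> = (\<integral>v. (norm (p k v \<omega>))\<^sup>2 - (norm (J v \<omega>))\<^sup>2 \<partial>restrict_space lborel {0..t})"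
            unfolding energy_def by simp
          then show ?case using integral_abs_bound by simp
        qed
      qed
      also have "\<dots> = (\<integral>z. \<bar>(b k z)\<^sup>2 - (a z)\<^sup>2\<bar> \<partial>?\<mu>)"
        using PS.integral_snd[OF ic] by (simp add: prod_meas_def a_def b_def case_prod_beta')
      finally show "expectation (\<lambda>\<omega>. \<bar>energy t (p k) \<omega> - energy t J \<omega>\<bar>) \<le> (\<integral>z. \<bar>(b k z)\<^sup>2 - (a z)\<^sup>2\<bar> \<partial>?\<mu>)" .
    qed
  qed simp
  then show "(\<lambda>k. expectation (\<lambda>\<omega>. \<bar>energy t (simple_proc (n k) (\<tau> k) (\<xi> k)) \<omega> - energy t J \<omega>\<bar>)) \<longlonglongrightarrow> 0"
    by (simp add: p_def)
qed

text \<open>As soon as N is at least m, the process is constant on the cells of level N, and the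
  difference between squared increments and energy is exactly a sum of the martingale differences of
  \<open>grid_square_deviation\<close>.\<close>

lemma dyadic_cov_simple_limit:
  fixes \<xi> :: "nat \<Rightarrow> 'a \<Rightarrow> real^'d"
  assumes t: "0 < t" and sp: "simple_pred F (2 ^ m) (dyadic t m) \<xi>"
  defines "I \<equiv> simple_int W (2 ^ m) (dyadic t m) \<xi>"
  shows "(\<lambda>N. expectation (\<lambda>\<omega>. \<bar>dyadic_cov I I t N \<omega> - energy t (simple_proc (2 ^ m) (dyadic t m) \<xi>) \<omega>\<bar>)) \<longlonglongrightarrow> 0"
proof -
  let ?p = "simple_proc (2 ^ m) (dyadic t m) \<xi>"
  obtain R where R: "0 \<le> R" "\<And>v \<omega>. norm (?p v \<omega>) \<le> R" using simple_proc_bounded[OF sp] by metis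
  define c where "c = R ^ 4 * (3 * (real CARD('d))\<^sup>2 + 1)"
  define S where "S N \<omega> = dyadic_cov I I t N \<omega> - energy t ?p \<omega>" for N \<omega>
  have main: "sq_integrable M (S N) \<and> expectation (\<lambda>\<omega>. (S N \<omega>)\<^sup>2) \<le> c * t\<^sup>2 * (1 / 2) ^ N" if N: "m \<le> N" for N
  proof -
    define \<eta> where "\<eta> = (\<lambda>k. ?p (dyadic t N (Suc k)))"
    note r = dyadic_refine[OF sp N t, folded \<eta>_def]
    have ch: "\<And>i. i < 2 ^ N \<Longrightarrow> dyadic t N i < dyadic t N (Suc i)" by (rule dyadic_less[OF t])
    have ag: "adapted_grid (2 ^ N) (dyadic t N) \<eta>"
      using r(1) by (auto simp: simple_pred_def adapted_grid_def intro: less_imp_le)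
    define d where "d k \<omega> = (\<eta> k \<omega> \<bullet> (W (dyadic t N (Suc k)) \<omega> - W (dyadic t N k) \<omega>))\<^sup>2 - (dyadic t N (Suc k) - dyadic t N k) * (norm (\<eta> k \<omega>))\<^sup>2" for k \<omega>
    have inc: "I (dyadic t N (Suc k)) \<omega> - I (dyadic t N k) \<omega> = \<eta> k \<omega> \<bullet> (W (dyadic t N (Suc k)) \<omega> - W (dyadic t N k) \<omega>)" if "k < 2 ^ N" for k \<omega>
      unfolding I_def r(3)[symmetric]
      using simple_int_at_grid[of "2 ^ N" "dyadic t N" k W \<eta> \<omega>, OF ch] simple_int_at_grid[of "2 ^ N" "dyadic t N" "Suc k" W \<eta> \<omega>, OF ch] that
      by simp
    have SN: "S N \<omega> = (\<Sum>k<2 ^ N. d k \<omega>)" for \<omega>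
    proof -
      have "dyadic_cov I I t N \<omega> = (\<Sum>k<2 ^ N. (\<eta> k \<omega> \<bullet> (W (dyadic t N (Suc k)) \<omega> - W (dyadic t N k) \<omega>))\<^sup>2)"
        unfolding dyadic_cov_dyadic by (intro sum.cong refl) (simp add: inc power2_eq_square)
      moreover have "energy t ?p \<omega> = (\<Sum>k<2 ^ N. (dyadic t N (Suc k) - dyadic t N k) * (norm (\<eta> k \<omega>))\<^sup>2)"
        using energy_simple[OF t r(1), of \<omega>] by (simp add: r(2))
      ultimately show ?thesis by (simp add: S_def d_def sum_subtractf)
    qed
    have "norm (\<eta> k \<omega>) \<le> R" for k \<omega> using R(2) by (simp add: \<eta>_def)
    note g = grid_square_deviation[OF ag R(1) this, of "2 ^ N"]
    have 1: "sq_integrable M (S N)" using g(1) by (simp add: SN[abs_def] d_def)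
    have "expectation (\<lambda>\<omega>. (S N \<omega>)\<^sup>2) \<le> (\<Sum>k<(2::nat) ^ N. c * (dyadic t N (Suc k) - dyadic t N k)\<^sup>2)"
      using g(2) by (simp add: SN d_def c_def)
    also have "\<dots> = (\<Sum>k<(2::nat) ^ N. c * (t / 2 ^ N)\<^sup>2)" by (simp add: dyadic_Suc)
    \<comment> \<open>There are 2^N cells, each contributing c (t / 2^N)^2.\<close>
    also have "\<dots> = c * t\<^sup>2 * (1 / 2) ^ N"
      by (simp add: power2_eq_square power_one_over field_simps)
    finally show ?thesis using 1 by simp
  qed
  show ?thesis
    unfolding S_def[symmetric]
  proof (rule LIMSEQ_I)
    fix e :: real assume e: "0 < e"
    have "(\<lambda>N. c * t\<^sup>2 * (1 / 2) ^ N) \<longlonglongrightarrow> c * t\<^sup>2 * 0" by (intro tendsto_intros) auto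
    then have "\<forall>\<^sub>F N in sequentially. c * t\<^sup>2 * (1 / 2) ^ N < e\<^sup>2 / 4"
      using e by (intro order_tendstoD(2)) auto
    then obtain N0 where N0: "\<And>N. N \<ge> N0 \<Longrightarrow> c * t\<^sup>2 * (1 / 2) ^ N < e\<^sup>2 / 4" by (auto simp: eventually_sequentially)
    show "\<exists>N0. \<forall>N\<ge>N0. norm (expectation (\<lambda>\<omega>. \<bar>S N \<omega>\<bar>) - 0) < e"
    proof (intro exI[of _ "max m N0"] allI impI)
      fix N assume N: "N \<ge> max m N0"
      have 1: "sq_integrable M (S N)" and 2: "expectation (\<lambda>\<omega>. (S N \<omega>)\<^sup>2) < e\<^sup>2 / 4"
        using main[of N] N0[of N] N by auto
      have "expectation (\<lambda>\<omega>. \<bar>1 * S N \<omega>\<bar>) \<le> (e / 2) * expectation (\<lambda>\<omega>. 1\<^sup>2) + expectation (\<lambda>\<omega>. (S N \<omega>)\<^sup>2) / (e / 2)"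
        by (rule abs_integral_mult_le[OF sq_integrable_const 1]) (use e in simp)
      also have "\<dots> < e / 2 + e / 2"
        using 2 e by (simp add: prob_space field_simps power2_eq_square)
      finally show "norm (expectation (\<lambda>\<omega>. \<bar>S N \<omega>\<bar>) - 0) < e" by simp
    qed
  qed
qed

lemma integrable_dyadic_cov:
  assumes "\<And>s. 0 \<le> s \<Longrightarrow> sq_integrable M (X s)" "\<And>s. 0 \<le> s \<Longrightarrow> sq_integrable M (Y s)" "0 \<le> t"
  shows "integrable M (dyadic_cov X Y t N)"
proof -
  have "0 \<le> dyadic t N k" for k using assms(3) by (simp add: dyadic_def)
  then show ?thesis
    unfolding dyadic_cov_dyadic[abs_def]
    using assms by (intro Bochner_Integration.integrable_sum sq_integrable_mult sq_integrable_diff) auto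
qed

text \<open>A difference of squared increments is a product of increments of Z + I and Z - I.
  Young's inequality and the partition-free bound on sums of squared increments give an estimate
  independent of N.\<close>

lemma dyadic_cov_diff_le:
  assumes t: "0 < t" and Z: "real_martingale M F Z" "\<And>s. 0 \<le> s \<Longrightarrow> sq_integrable M (Z s)"
    and I: "real_martingale M F I" "\<And>s. 0 \<le> s \<Longrightarrow> sq_integrable M (I s)" and e: "0 < e"
  shows "expectation (\<lambda>\<omega>. \<bar>dyadic_cov Z Z t N \<omega> - dyadic_cov I I t N \<omega>\<bar>) \<le>
    e * expectation (\<lambda>\<omega>. (Z t \<omega> + I t \<omega>)\<^sup>2) + expectation (\<lambda>\<omega>. (Z t \<omega> - I t \<omega>)\<^sup>2) / e"
proof -
  define s where "s = dyadic t N"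
  have s: "0 \<le> s 0" "\<And>k. k < 2 ^ N \<Longrightarrow> s k \<le> s (Suc k)" "s (2 ^ N) = t" "\<And>k. 0 \<le> s k"
    using t dyadic_less[OF t, of N] by (auto simp: s_def dyadic_def intro: less_imp_le)
  define P where "P u \<omega> = 1 * Z u \<omega> + 1 * I u \<omega>" for u \<omega>
  define Q where "Q u \<omega> = 1 * Z u \<omega> + (-1) * I u \<omega>" for u \<omega>
  have PQ: "real_martingale M F P" "real_martingale M F Q"
    unfolding P_def[abs_def] Q_def[abs_def] by (rule real_martingale_add[OF Z(1) I(1)])+
  have sPQ: "sq_integrable M (P u)" "sq_integrable M (Q u)" if "0 \<le> u" for u
    unfolding P_def[abs_def] Q_def[abs_def]
    by (intro sq_integrable_add sq_integrable_cmult Z(2) I(2) that)+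
  let ?dP = "\<lambda>k \<omega>. P (s (Suc k)) \<omega> - P (s k) \<omega>" and ?dQ = "\<lambda>k \<omega>. Q (s (Suc k)) \<omega> - Q (s k) \<omega>"
  have sd: "sq_integrable M (?dP k)" "sq_integrable M (?dQ k)" for k
    using sPQ s(4) by (auto intro!: sq_integrable_diff)
  have eq: "dyadic_cov Z Z t N \<omega> - dyadic_cov I I t N \<omega> = (\<Sum>k<2 ^ N. ?dP k \<omega> * ?dQ k \<omega>)" for \<omega>
    unfolding dyadic_cov_dyadic sum_subtractf[symmetric] s_def P_def Q_def
    by (intro sum.cong refl) (simp add: algebra_simps)
  have i: "integrable M (\<lambda>\<omega>. \<bar>?dP k \<omega> * ?dQ k \<omega>\<bar>)" for k
    by (intro integrable_abs sq_integrable_mult sd)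
  have "expectation (\<lambda>\<omega>. \<bar>dyadic_cov Z Z t N \<omega> - dyadic_cov I I t N \<omega>\<bar>) \<le> expectation (\<lambda>\<omega>. \<Sum>k<2 ^ N. \<bar>?dP k \<omega> * ?dQ k \<omega>\<bar>)"
    unfolding eq
    by (intro integral_mono integrable_abs Bochner_Integration.integrable_sum i sq_integrable_mult sd sum_abs)
  also have "\<dots> = (\<Sum>k<2 ^ N. expectation (\<lambda>\<omega>. \<bar>?dP k \<omega> * ?dQ k \<omega>\<bar>))"
    by (rule Bochner_Integration.integral_sum) (rule i)
  also have "\<dots> \<le> (\<Sum>k<2 ^ N. e * expectation (\<lambda>\<omega>. (?dP k \<omega>)\<^sup>2) + expectation (\<lambda>\<omega>. (?dQ k \<omega>)\<^sup>2) / e)"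
    by (intro sum_mono abs_integral_mult_le sd e)
  also have "\<dots> = e * (\<Sum>k<2 ^ N. expectation (\<lambda>\<omega>. (?dP k \<omega>)\<^sup>2)) + (\<Sum>k<2 ^ N. expectation (\<lambda>\<omega>. (?dQ k \<omega>)\<^sup>2)) / e"
    by (simp add: sum.distrib sum_distrib_left sum_divide_distrib)
  also have "\<dots> \<le> e * expectation (\<lambda>\<omega>. (P t \<omega>)\<^sup>2) + expectation (\<lambda>\<omega>. (Q t \<omega>)\<^sup>2) / e"
    using martingale_sum_increments_sq[OF PQ(1) sPQ(1) s(1,2), of "2 ^ N"]
      martingale_sum_increments_sq[OF PQ(2) sPQ(2) s(1,2), of "2 ^ N"] e s(3)
    by (intro add_mono mult_left_mono divide_right_mono) auto
  finally show ?thesis by (simp add: P_def Q_def)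
qed

text \<open>Because \<open>dyadic_cov_diff_le\<close> is uniform in N, the approximant k can be
  fixed before the mesh is refined; the remaining two errors are those of
  \<open>energy_limit\<close> and of \<open>dyadic_cov_simple_limit\<close>.\<close>

theorem quadratic_variation:
  fixes \<xi> :: "nat \<Rightarrow> nat \<Rightarrow> 'a \<Rightarrow> real^'d"
  assumes t: "0 < t" and Jm: "(\<lambda>z. J (fst z) (snd z)) \<in> borel_measurable (prod_meas t)"
    and fin: "(\<integral>\<^sup>+\<omega>. (\<integral>\<^sup>+v\<in>{0..t}. ennreal ((norm (J v \<omega>))\<^sup>2) \<partial>lborel) \<partial>M) < \<infinity>"
    and sp: "\<And>k. simple_pred F (2 ^ m k) (dyadic t (m k)) (\<xi> k)"
    and lim: "(\<lambda>k. l2_dist t J (simple_proc (2 ^ m k) (dyadic t (m k)) (\<xi> k))) \<longlonglongrightarrow> 0"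
    and Z: "real_martingale M F Z" "\<And>s. 0 \<le> s \<Longrightarrow> sq_integrable M (Z s)"
    and l2: "l2_lim M (\<lambda>k. simple_int W (2 ^ m k) (dyadic t (m k)) (\<xi> k) t) (Z t)"
  shows "(\<lambda>N. expectation (\<lambda>\<omega>. \<bar>dyadic_cov Z Z t N \<omega> - energy t J \<omega>\<bar>)) \<longlonglongrightarrow> 0"
proof (rule LIMSEQ_I)
  fix r :: real assume r: "0 < r"
  define I where "I k = simple_int W (2 ^ m k) (dyadic t (m k)) (\<xi> k)" for k
  define p where "p k = simple_proc (2 ^ m k) (dyadic t (m k)) (\<xi> k)" for k
  have t0: "0 \<le> t" using t by simp
  have I: "real_martingale M F (I k)" "\<And>s. 0 \<le> s \<Longrightarrow> sq_integrable M (I k s)" for k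
    unfolding I_def by (rule simple_int_martingale[OF sp], rule sq_integrable_simple_int[OF sp])
  note en = energy_limit[OF Jm fin sp lim, folded p_def]
  have l2': "l2_lim M (\<lambda>k. I k t) (Z t)" using l2 by (simp add: I_def)
  \<comment> \<open>The second moment of Z + I_k converges to that of 2 Z, so it is eventually below
    this bound.\<close>
  define C where "C = expectation (\<lambda>\<omega>. (Z t \<omega> + Z t \<omega>)\<^sup>2) + 1"
  have C: "0 < C" by (simp add: C_def add_nonneg_pos)
  \<comment> \<open>This weight makes the first term of \<open>dyadic_cov_diff_le\<close> at most r
    / 4; k is then taken so large that the second one is too.\<close>
  define e where "e = r / (4 * C)"
  have e: "0 < e" using r C by (simp add: e_def)
  have lZ: "l2_lim M (\<lambda>k. Z t) (Z t)" using Z(2)[OF t0] by (simp add: l2_lim_def)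
  have "\<forall>\<^sub>F k in sequentially. expectation (\<lambda>\<omega>. (Z t \<omega> + I k t \<omega>)\<^sup>2) < C"
    by (rule order_tendstoD(2)[OF l2_lim_square[OF l2_lim_add[OF lZ l2']]]) (simp add: C_def)
  moreover have "\<forall>\<^sub>F k in sequentially. expectation (\<lambda>\<omega>. (I k t \<omega> - Z t \<omega>)\<^sup>2) < e * (r / 4)"
    by (rule order_tendstoD(2)[OF l2_limD(3)[OF l2']]) (use e r in simp)
  moreover have "\<forall>\<^sub>F k in sequentially. expectation (\<lambda>\<omega>. \<bar>energy t (p k) \<omega> - energy t J \<omega>\<bar>) < r / 4"
    by (rule order_tendstoD(2)[OF en(3)]) (use r in simp)
  ultimately have "\<forall>\<^sub>F k in sequentially. expectation (\<lambda>\<omega>. (Z t \<omega> + I k t \<omega>)\<^sup>2) < C \<and>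
      expectation (\<lambda>\<omega>. (I k t \<omega> - Z t \<omega>)\<^sup>2) < e * (r / 4) \<and> expectation (\<lambda>\<omega>. \<bar>energy t (p k) \<omega> - energy t J \<omega>\<bar>) < r / 4"
    by eventually_elim simp
  then obtain k where k: "expectation (\<lambda>\<omega>. (Z t \<omega> + I k t \<omega>)\<^sup>2) < C"
     "expectation (\<lambda>\<omega>. (I k t \<omega> - Z t \<omega>)\<^sup>2) < e * (r / 4)" "expectation (\<lambda>\<omega>. \<bar>energy t (p k) \<omega> - energy t J \<omega>\<bar>) < r / 4"
    by (auto simp: eventually_sequentially)
  have A: "expectation (\<lambda>\<omega>. \<bar>dyadic_cov Z Z t N \<omega> - dyadic_cov (I k) (I k) t N \<omega>\<bar>) \<le> r / 2" for N
  proof -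
    have "expectation (\<lambda>\<omega>. \<bar>dyadic_cov Z Z t N \<omega> - dyadic_cov (I k) (I k) t N \<omega>\<bar>) \<le>
       e * expectation (\<lambda>\<omega>. (Z t \<omega> + I k t \<omega>)\<^sup>2) + expectation (\<lambda>\<omega>. (Z t \<omega> - I k t \<omega>)\<^sup>2) / e"
      by (rule dyadic_cov_diff_le[OF t Z I e])
    also have "\<dots> \<le> r / 4 + r / 4"
    proof (rule add_mono)
      have "e * expectation (\<lambda>\<omega>. (Z t \<omega> + I k t \<omega>)\<^sup>2) \<le> e * C" using k(1) e by simp
      then show "e * expectation (\<lambda>\<omega>. (Z t \<omega> + I k t \<omega>)\<^sup>2) \<le> r / 4" using C by (simp add: e_def)
      show "expectation (\<lambda>\<omega>. (Z t \<omega> - I k t \<omega>)\<^sup>2) / e \<le> r / 4"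
        using k(2) e by (simp add: power2_commute[of "Z t _"] field_simps)
    qed
    finally show ?thesis by simp
  qed
  have "(\<lambda>N. expectation (\<lambda>\<omega>. \<bar>dyadic_cov (I k) (I k) t N \<omega> - energy t (p k) \<omega>\<bar>)) \<longlonglongrightarrow> 0"
    unfolding I_def p_def by (rule dyadic_cov_simple_limit[OF t sp])
  then have "\<forall>\<^sub>F N in sequentially. expectation (\<lambda>\<omega>. \<bar>dyadic_cov (I k) (I k) t N \<omega> - energy t (p k) \<omega>\<bar>) < r / 4"
    by (rule order_tendstoD(2)) (use r in simp)
  then obtain N0 where N0: "\<And>N. N \<ge> N0 \<Longrightarrow> expectation (\<lambda>\<omega>. \<bar>dyadic_cov (I k) (I k) t N \<omega> - energy t (p k) \<omega>\<bar>) < r / 4"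
    by (auto simp: eventually_sequentially)
  show "\<exists>N0. \<forall>N\<ge>N0. norm (expectation (\<lambda>\<omega>. \<bar>dyadic_cov Z Z t N \<omega> - energy t J \<omega>\<bar>) - 0) < r"
  proof (intro exI allI impI)
    fix N assume N: "N \<ge> N0"
    note iD = integrable_dyadic_cov[of Z Z t N, OF Z(2) Z(2) t0] integrable_dyadic_cov[of "I k" "I k" t N, OF I(2) I(2) t0] en(1) en(2)[of k]
    have "expectation (\<lambda>\<omega>. \<bar>dyadic_cov Z Z t N \<omega> - energy t J \<omega>\<bar>) \<le>
      expectation (\<lambda>\<omega>. \<bar>dyadic_cov Z Z t N \<omega> - dyadic_cov (I k) (I k) t N \<omega>\<bar> + \<bar>dyadic_cov (I k) (I k) t N \<omega> - energy t (p k) \<omega>\<bar> + \<bar>energy t (p k) \<omega> - energy t J \<omega>\<bar>)"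
      using iD by (intro integral_mono) auto
    also have "\<dots> = expectation (\<lambda>\<omega>. \<bar>dyadic_cov Z Z t N \<omega> - dyadic_cov (I k) (I k) t N \<omega>\<bar>) + expectation (\<lambda>\<omega>. \<bar>dyadic_cov (I k) (I k) t N \<omega> - energy t (p k) \<omega>\<bar>) + expectation (\<lambda>\<omega>. \<bar>energy t (p k) \<omega> - energy t J \<omega>\<bar>)"
      using iD by simp
    also have "\<dots> < r / 2 + r / 4 + r / 4" using A[of N] N0[OF N] k(3) by linarith
    finally show "norm (expectation (\<lambda>\<omega>. \<bar>dyadic_cov Z Z t N \<omega> - energy t J \<omega>\<bar>) - 0) < r" by simp
  qed
qed

end

section \<open>The layers of Burkholder's function\<close>

text \<open>The formula with \<open>max\<close> and \<open>min\<close> is a single continuous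
  expression covering both sides of the line x + y = c, from which joint measurability and Lipschitz
  bounds can be read off.\<close>

definition bw :: "real \<Rightarrow> real \<Rightarrow> real \<Rightarrow> real" where
  "bw c x y = c\<^sup>2 - 2 * c * x - (max 0 (c - x))\<^sup>2 + (min y (max 0 (c - x)))\<^sup>2"

lemma bw_inside: "0 \<le> y \<Longrightarrow> x + y \<le> c \<Longrightarrow> bw c x y = y\<^sup>2 - x\<^sup>2"
  by (simp add: bw_def min_def max_def power2_eq_square algebra_simps)

lemma bw_outside:
  assumes "0 \<le> y" "c \<le> x + y"
  shows "bw c x y = c\<^sup>2 - 2 * c * x"
proof -
  have "min y (max 0 (c - x)) = max 0 (c - x)" using assms by (intro min_absorb2) auto
  then show ?thesis by (simp add: bw_def)
qed

lemma bw_zero: "0 \<le> c \<Longrightarrow> bw c 0 0 = 0"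
  by (simp add: bw_def)

text \<open>Apart from a linear term, \<open>bw\<close> is built from squares of quantities that
  stay in [0, c], where squaring has Lipschitz constant 2 c. In the variable x there are three such
  contributions, in y only one.\<close>

lemma bw_lipschitz:
  assumes c: "0 \<le> c" and xy: "0 \<le> x" "0 \<le> x'" "0 \<le> y" "0 \<le> y'"
  shows "\<bar>bw c x y - bw c x' y'\<bar> \<le> 6 * c * \<bar>x - x'\<bar> + 2 * c * \<bar>y - y'\<bar>"
proof -
  define g g' where "g = max 0 (c - x)" and "g' = max 0 (c - x')"
  define m m' where "m = min y g" and "m' = min y' g'"
  have g: "0 \<le> g" "g \<le> c" "0 \<le> g'" "g' \<le> c" "\<bar>g - g'\<bar> \<le> \<bar>x - x'\<bar>"
    using c xy by (auto simp: g_def g'_def max_def)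
  have m: "0 \<le> m" "m \<le> c" "0 \<le> m'" "m' \<le> c" "\<bar>m - m'\<bar> \<le> \<bar>y - y'\<bar> + \<bar>x - x'\<bar>"
    using g xy by (auto simp: m_def m'_def min_def)
  have sq: "\<bar>u\<^sup>2 - v\<^sup>2\<bar> \<le> 2 * c * \<bar>u - v\<bar>" if "0 \<le> u" "u \<le> c" "0 \<le> v" "v \<le> c" for u v
  proof -
    have "\<bar>u\<^sup>2 - v\<^sup>2\<bar> = \<bar>u - v\<bar> * \<bar>u + v\<bar>" by (simp add: abs_mult[symmetric] power2_eq_square algebra_simps)
    also have "\<dots> \<le> \<bar>u - v\<bar> * (2 * c)" using that by (intro mult_left_mono) auto
    finally show ?thesis by (simp add: mult.commute)
  qed
  have 1: "\<bar>g\<^sup>2 - g'\<^sup>2\<bar> \<le> 2 * c * \<bar>x - x'\<bar>"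
    using sq[OF g(1-4)] mult_left_mono[OF g(5), of "2 * c"] c by linarith
  have 2: "\<bar>m\<^sup>2 - m'\<^sup>2\<bar> \<le> 2 * c * \<bar>y - y'\<bar> + 2 * c * \<bar>x - x'\<bar>"
    using sq[OF m(1-4)] mult_left_mono[OF m(5), of "2 * c"] c by (simp add: distrib_left)
  have 3: "\<bar>2 * c * x - 2 * c * x'\<bar> = 2 * c * \<bar>x - x'\<bar>"
    using c by (simp add: right_diff_distrib[symmetric] abs_mult)
  have "bw c x y - bw c x' y' = - (2 * c * x - 2 * c * x') - (g\<^sup>2 - g'\<^sup>2) + (m\<^sup>2 - m'\<^sup>2)"
    by (simp add: bw_def g_def g'_def m_def m'_def)
  then show ?thesis using 1 2 3 by linarith
qed

lemma bw_le_outside: "0 \<le> y \<Longrightarrow> bw c x y \<le> c\<^sup>2 - 2 * c * x"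
  by (simp add: bw_def min_def power_mono)

text \<open>The two branches differ by (c - x)^2 - y^2. This is negative between the edge of the
  diamond and the line x = c, so the quadratic branch fails as a majorant only beyond that line, and
  by no more than the square of the overshoot.\<close>

lemma bw_le_inside:
  assumes "0 \<le> x" "0 \<le> y"
  shows "bw c x y \<le> y\<^sup>2 - x\<^sup>2 + (max 0 (x - c))\<^sup>2"
proof (cases "x + y \<le> c")
  case True then show ?thesis using assms by (simp add: bw_inside)
next
  case False
  then have e: "bw c x y = c\<^sup>2 - 2 * c * x" using assms by (intro bw_outside) auto
  show ?thesis
  proof (cases "c \<le> x")
    case True then show ?thesis unfolding e by (simp add: power2_diff)
  next
    case c: False
    then have "(c - x)\<^sup>2 \<le> y\<^sup>2" using False by (intro power_mono) auto
    then show ?thesis unfolding e using c by (simp add: power2_diff)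
  qed
qed

text \<open>Inside the diamond the quadratic expansion is exact up to the last term, outside it \<open>bw\<close> is
  dominated by a function that is concave in \<open>x\<close>.\<close>

lemma bw_step:
  fixes x a y b :: complex
  assumes c: "0 \<le> c"
  defines "i \<equiv> cmod x + cmod y \<le> c"
  shows "bw c (cmod (x + a)) (cmod (y + b)) \<le> bw c (cmod x) (cmod y) +
    (if i then -2 else -2 * c / cmod x) * (x \<bullet> a) + (if i then 2 else 0) * (y \<bullet> b) +
    (if i then (cmod b)\<^sup>2 - (cmod a)\<^sup>2 + (max 0 (cmod (x + a) - c))\<^sup>2 else 0)"
proof (cases i)
  case True
  have "bw c (cmod (x + a)) (cmod (y + b)) \<le> (cmod (y + b))\<^sup>2 - (cmod (x + a))\<^sup>2 + (max 0 (cmod (x + a) - c))\<^sup>2"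
    by (rule bw_le_inside) auto
  moreover have "bw c (cmod x) (cmod y) = (cmod y)\<^sup>2 - (cmod x)\<^sup>2"
    using True by (intro bw_inside) (auto simp: i_def)
  moreover have "(cmod (y + b))\<^sup>2 = (cmod y)\<^sup>2 + 2 * (y \<bullet> b) + (cmod b)\<^sup>2" "(cmod (x + a))\<^sup>2 = (cmod x)\<^sup>2 + 2 * (x \<bullet> a) + (cmod a)\<^sup>2"
    by (simp_all only: power2_norm_eq_inner inner_add_left inner_add_right inner_commute)
  ultimately show ?thesis using True by simp
next
  case False
  have "bw c (cmod (x + a)) (cmod (y + b)) \<le> c\<^sup>2 - 2 * c * cmod (x + a)"
    by (rule bw_le_outside) auto
  moreover have "bw c (cmod x) (cmod y) = c\<^sup>2 - 2 * c * cmod x"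
    using False by (intro bw_outside) (auto simp: i_def)
  \<comment> \<open>The norm lies above its tangent at x, whence no second-order term outside the
    diamond. At x = 0 the slope is 0 by the convention for division, and the bound is
    trivial.\<close>
  moreover have "cmod x + (x \<bullet> a) / cmod x \<le> cmod (x + a)"
  proof (cases "x = 0")
    case False
    have "x \<bullet> (x + a) \<le> cmod x * cmod (x + a)" by (rule norm_cauchy_schwarz)
    then have "(cmod x)\<^sup>2 + x \<bullet> a \<le> cmod x * cmod (x + a)" by (simp add: inner_add_right power2_norm_eq_inner)
    then show ?thesis using False by (simp add: field_simps power2_eq_square)
  qed simp
  then have "2 * c * (cmod x + (x \<bullet> a) / cmod x) \<le> 2 * c * cmod (x + a)" using c by (intro mult_left_mono) auto
  ultimately show ?thesis using False by (simp add: distrib_left)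
qed

text \<open>The overshoot is nonzero only for \<open>c\<close> between |x| and |x + a|, an interval
  of length at most |a|, and there it is at most |a|.\<close>

lemma overshoot_integral:
  fixes x a :: complex
  assumes that: "0 \<le> y"
  shows "(\<integral>\<^sup>+c. ennreal (if cmod x + y \<le> c then (max 0 (cmod (x + a) - c))\<^sup>2 else 0) \<partial>lborel) \<le> ennreal (cmod a ^ 3)"
proof -
  have tri: "cmod (x + a) \<le> cmod x + cmod a" by (rule norm_triangle_ineq)
  have "(\<integral>\<^sup>+c. ennreal (if cmod x + y \<le> c then (max 0 (cmod (x + a) - c))\<^sup>2 else 0) \<partial>lborel) \<le>
     (\<integral>\<^sup>+c. ennreal ((cmod a)\<^sup>2) * indicator {cmod x..cmod x + cmod a} c \<partial>lborel)"
  proof (rule nn_integral_mono)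
    fix c
    show "ennreal (if cmod x + y \<le> c then (max 0 (cmod (x + a) - c))\<^sup>2 else 0) \<le> ennreal ((cmod a)\<^sup>2) * indicator {cmod x..cmod x + cmod a} c"
    proof (cases "cmod x + y \<le> c \<and> c < cmod (x + a)")
      case True
      then have "c \<in> {cmod x..cmod x + cmod a}" "(max 0 (cmod (x + a) - c))\<^sup>2 \<le> (cmod a)\<^sup>2"
        using tri that by (auto intro!: power_mono)
      then show ?thesis using True by (simp add: ennreal_leI)
    next
      case False
      then have "(if cmod x + y \<le> c then (max 0 (cmod (x + a) - c))\<^sup>2 else 0) = 0" by auto
      then show ?thesis by simp
    qed
  qed
  also have "\<dots> = ennreal ((cmod a)\<^sup>2) * ennreal (cmod a)"
    by (simp add: nn_integral_cmult_indicator)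
  also have "\<dots> = ennreal (cmod a ^ 3)" by (simp add: ennreal_mult[symmetric] power3_eq_cube power2_eq_square mult.assoc)
  finally show ?thesis .
qed

lemma borel_measurable_Complex [measurable (raw)]:
  assumes [measurable]: "f \<in> borel_measurable N" "g \<in> borel_measurable N"
  shows "(\<lambda>x. Complex (f x) (g x)) \<in> borel_measurable N"
  unfolding Complex_eq by measurable

lemma bw_measurable [measurable (raw)]:
  assumes [measurable]: "f \<in> borel_measurable N" "g \<in> borel_measurable N" "h \<in> borel_measurable N"
  shows "(\<lambda>x. bw (f x) (g x) (h x)) \<in> borel_measurable N"
  unfolding bw_def by measurable

lemma cmod_Complex_le: "cmod (Complex a b) \<le> \<bar>a\<bar> + \<bar>b\<bar>"
  using cmod_le[of "Complex a b"] by simp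

lemma cmod_Complex_diff_le: "\<bar>cmod (Complex a b) - cmod (Complex a' b')\<bar> \<le> \<bar>a - a'\<bar> + \<bar>b - b'\<bar>"
proof -
  have "\<bar>cmod (Complex a b) - cmod (Complex a' b')\<bar> \<le> cmod (Complex a b - Complex a' b')" by (rule norm_triangle_ineq3)
  also have "Complex a b - Complex a' b' = Complex (a - a') (b - b')" by (simp add: complex_eq_iff)
  finally show ?thesis using cmod_Complex_le[of "a - a'" "b - b'"] by linarith
qed

lemma (in finite_measure) integrable_bw:
  assumes c: "0 \<le> c" and "integrable M f1" "integrable M f2" "integrable M g1" "integrable M g2"
  shows "integrable M (\<lambda>\<omega>. bw c (cmod (Complex (f1 \<omega>) (f2 \<omega>))) (cmod (Complex (g1 \<omega>) (g2 \<omega>))))"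
proof (rule Bochner_Integration.integrable_bound)
  note [measurable] = assms(2-5)[THEN borel_measurable_integrable]
  show "integrable M (\<lambda>\<omega>. 6 * c * (\<bar>f1 \<omega>\<bar> + \<bar>f2 \<omega>\<bar>) + 2 * c * (\<bar>g1 \<omega>\<bar> + \<bar>g2 \<omega>\<bar>))" using assms by simp
  show "(\<lambda>\<omega>. bw c (cmod (Complex (f1 \<omega>) (f2 \<omega>))) (cmod (Complex (g1 \<omega>) (g2 \<omega>)))) \<in> borel_measurable M" by measurable
  have "\<bar>bw c (cmod (Complex x1 x2)) (cmod (Complex y1 y2))\<bar> \<le> 6 * c * (\<bar>x1\<bar> + \<bar>x2\<bar>) + 2 * c * (\<bar>y1\<bar> + \<bar>y2\<bar>)" for x1 x2 y1 y2
  proof -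
    have "\<bar>bw c (cmod (Complex x1 x2)) (cmod (Complex y1 y2)) - bw c 0 0\<bar> \<le> 6 * c * \<bar>cmod (Complex x1 x2) - 0\<bar> + 2 * c * \<bar>cmod (Complex y1 y2) - 0\<bar>"
      by (rule bw_lipschitz[OF c]) auto
    also have "\<dots> \<le> 6 * c * (\<bar>x1\<bar> + \<bar>x2\<bar>) + 2 * c * (\<bar>y1\<bar> + \<bar>y2\<bar>)"
      using c cmod_Complex_le by (intro add_mono mult_left_mono) auto
    finally show ?thesis by (simp add: bw_zero[OF c])
  qed
  then show "AE \<omega> in M. norm (bw c (cmod (Complex (f1 \<omega>) (f2 \<omega>))) (cmod (Complex (g1 \<omega>) (g2 \<omega>)))) \<le> norm (6 * c * (\<bar>f1 \<omega>\<bar> + \<bar>f2 \<omega>\<bar>) + 2 * c * (\<bar>g1 \<omega>\<bar> + \<bar>g2 \<omega>\<bar>))"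
    by (intro AE_I2) (auto intro: order_trans[OF _ abs_ge_self])
qed

lemma (in finite_measure) l2_lim_abs:
  assumes "l2_lim M f f'"
  shows "(\<lambda>k. \<integral>x. \<bar>f k x - f' x\<bar> \<partial>M) \<longlonglongrightarrow> 0"
  using l2_lim_abs_mult[OF assms sq_integrable_const[of 1]] by simp

text \<open>\<open>bw c\<close> grows linearly although its branches are quadratic, so by the
  Lipschitz bound L^1 convergence of the arguments suffices.\<close>

lemma (in finite_measure) bw_limit:
  assumes c: "0 \<le> c" and l: "l2_lim M f1 f1'" "l2_lim M f2 f2'" "l2_lim M g1 g1'" "l2_lim M g2 g2'"
  shows "(\<lambda>k. \<integral>\<omega>. bw c (cmod (Complex (f1 k \<omega>) (f2 k \<omega>))) (cmod (Complex (g1 k \<omega>) (g2 k \<omega>))) \<partial>M) \<longlonglongrightarrow>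
    (\<integral>\<omega>. bw c (cmod (Complex (f1' \<omega>) (f2' \<omega>))) (cmod (Complex (g1' \<omega>) (g2' \<omega>))) \<partial>M)"
proof (rule Lim_transform2[OF tendsto_const])
  note s = l[THEN l2_limD(1), THEN sq_integrable_integrable] l[THEN l2_limD(2), THEN sq_integrable_integrable]
  note iB = integrable_bw[OF c s(1-4)] and iB' = integrable_bw[OF c s(5-8)]
  let ?b = "\<lambda>k. 6 * c * ((\<integral>x. \<bar>f1 k x - f1' x\<bar> \<partial>M) + (\<integral>x. \<bar>f2 k x - f2' x\<bar> \<partial>M)) + 2 * c * ((\<integral>x. \<bar>g1 k x - g1' x\<bar> \<partial>M) + (\<integral>x. \<bar>g2 k x - g2' x\<bar> \<partial>M))"
  let ?B = "\<lambda>k \<omega>. bw c (cmod (Complex (f1 k \<omega>) (f2 k \<omega>))) (cmod (Complex (g1 k \<omega>) (g2 k \<omega>)))"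
  let ?B' = "\<lambda>\<omega>. bw c (cmod (Complex (f1' \<omega>) (f2' \<omega>))) (cmod (Complex (g1' \<omega>) (g2' \<omega>)))"
  have "?b \<longlonglongrightarrow> 6 * c * (0 + 0) + 2 * c * (0 + 0)"
    by (intro tendsto_intros l2_lim_abs l)
  then have b0: "?b \<longlonglongrightarrow> 0" by simp
  show "(\<lambda>k. (\<integral>\<omega>. ?B' \<omega> \<partial>M) - (\<integral>\<omega>. ?B k \<omega> \<partial>M)) \<longlonglongrightarrow> 0"
  proof (rule Lim_null_comparison[OF _ b0], intro always_eventually allI)
    fix k
    have "norm ((\<integral>\<omega>. ?B' \<omega> \<partial>M) - (\<integral>\<omega>. ?B k \<omega> \<partial>M)) = norm (\<integral>\<omega>. ?B k \<omega> - ?B' \<omega> \<partial>M)"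
      using iB[of k k k k] iB' by (simp add: abs_minus_commute)
    also have "\<dots> \<le> (\<integral>\<omega>. \<bar>?B k \<omega> - ?B' \<omega>\<bar> \<partial>M)"
      using integral_norm_bound[of M "\<lambda>\<omega>. ?B k \<omega> - ?B' \<omega>"] by simp
    also have "\<dots> \<le> (\<integral>\<omega>. 6 * c * (\<bar>f1 k \<omega> - f1' \<omega>\<bar> + \<bar>f2 k \<omega> - f2' \<omega>\<bar>) + 2 * c * (\<bar>g1 k \<omega> - g1' \<omega>\<bar> + \<bar>g2 k \<omega> - g2' \<omega>\<bar>) \<partial>M)"
    proof (rule integral_mono)
      show "integrable M (\<lambda>\<omega>. \<bar>?B k \<omega> - ?B' \<omega>\<bar>)" using iB[of k k k k] iB' by simp
      show "integrable M (\<lambda>\<omega>. 6 * c * (\<bar>f1 k \<omega> - f1' \<omega>\<bar> + \<bar>f2 k \<omega> - f2' \<omega>\<bar>) + 2 * c * (\<bar>g1 k \<omega> - g1' \<omega>\<bar> + \<bar>g2 k \<omega> - g2' \<omega>\<bar>))"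
        using s by simp
      fix \<omega>
      have "\<bar>?B k \<omega> - ?B' \<omega>\<bar> \<le> 6 * c * \<bar>cmod (Complex (f1 k \<omega>) (f2 k \<omega>)) - cmod (Complex (f1' \<omega>) (f2' \<omega>))\<bar> + 2 * c * \<bar>cmod (Complex (g1 k \<omega>) (g2 k \<omega>)) - cmod (Complex (g1' \<omega>) (g2' \<omega>))\<bar>"
        by (rule bw_lipschitz[OF c]) auto
      also have "\<dots> \<le> 6 * c * (\<bar>f1 k \<omega> - f1' \<omega>\<bar> + \<bar>f2 k \<omega> - f2' \<omega>\<bar>) + 2 * c * (\<bar>g1 k \<omega> - g1' \<omega>\<bar> + \<bar>g2 k \<omega> - g2' \<omega>\<bar>)"
        using c cmod_Complex_diff_le by (intro add_mono mult_left_mono) auto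
      finally show "\<bar>?B k \<omega> - ?B' \<omega>\<bar> \<le> 6 * c * (\<bar>f1 k \<omega> - f1' \<omega>\<bar> + \<bar>f2 k \<omega> - f2' \<omega>\<bar>) + 2 * c * (\<bar>g1 k \<omega> - g1' \<omega>\<bar> + \<bar>g2 k \<omega> - g2' \<omega>\<bar>)" .
    qed
    also have "\<dots> = ?b k" using s by simp
    finally show "norm ((\<integral>\<omega>. ?B' \<omega> \<partial>M) - (\<integral>\<omega>. ?B k \<omega> \<partial>M)) \<le> ?b k" .
  qed
qed

section \<open>The layer inequality for stochastic integrals\<close>

context brownian
begin

lemma inner_increment_sq:
  assumes s: "0 \<le> s" "s \<le> u" and \<xi>: "\<xi> \<in> borel_measurable (F s)" "bounded (range \<xi>)"
    and g: "g \<in> borel_measurable (F s)" "integrable M g"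
  shows "integrable M (\<lambda>\<omega>. g \<omega> * (\<xi> \<omega> \<bullet> (W u \<omega> - W s \<omega>))\<^sup>2)" "integrable M (\<lambda>\<omega>. g \<omega> * (norm (\<xi> \<omega>))\<^sup>2)"
    and "expectation (\<lambda>\<omega>. g \<omega> * (\<xi> \<omega> \<bullet> (W u \<omega> - W s \<omega>))\<^sup>2) = (u - s) * expectation (\<lambda>\<omega>. g \<omega> * (norm (\<xi> \<omega>))\<^sup>2)"
proof -
  note i = inner_increment[OF s g \<xi> \<xi>]
  show "integrable M (\<lambda>\<omega>. g \<omega> * (\<xi> \<omega> \<bullet> (W u \<omega> - W s \<omega>))\<^sup>2)" using i(3) by (simp add: power2_eq_square)
  show "expectation (\<lambda>\<omega>. g \<omega> * (\<xi> \<omega> \<bullet> (W u \<omega> - W s \<omega>))\<^sup>2) = (u - s) * expectation (\<lambda>\<omega>. g \<omega> * (norm (\<xi> \<omega>))\<^sup>2)"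
    unfolding power2_norm_eq_inner unfolding power2_eq_square by (rule i(4))
  obtain R where R: "\<And>\<omega>. norm (\<xi> \<omega>) \<le> R" using \<xi>(2) by (auto simp: bounded_iff)
  note [measurable] = measurable_F_M[OF \<xi>(1)]
  show "integrable M (\<lambda>\<omega>. g \<omega> * (norm (\<xi> \<omega>))\<^sup>2)"
    by (rule integrable_mult_bounded[OF g(2), where B="R\<^sup>2"]) (auto intro!: power_mono R)
qed

text \<open>One induction serves both ranges of p. With I the indicator of the diamond, the
  second-order term has coefficient I - \<kappa>, which is nonnegative for \<kappa> = 0 and
  nonpositive for \<kappa> = 1; in each case \<open>sub\<close> gives the difference of the squared
  integrands the opposite sign. Only the overshoots remain.\<close>

lemma burkholder_grid:
  assumes ag: "adapted_grid n s h1" "adapted_grid n s h2" "adapted_grid n s j1" "adapted_grid n s j2"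
    and c: "0 \<le> c"
    and sub: "\<And>k \<omega>. k < n \<Longrightarrow> (\<kappa> = 0 \<and> (norm (j1 k \<omega>))\<^sup>2 + (norm (j2 k \<omega>))\<^sup>2 \<le> (norm (h1 k \<omega>))\<^sup>2 + (norm (h2 k \<omega>))\<^sup>2) \<or>
       (\<kappa> = 1 \<and> (norm (h1 k \<omega>))\<^sup>2 + (norm (h2 k \<omega>))\<^sup>2 \<le> (norm (j1 k \<omega>))\<^sup>2 + (norm (j2 k \<omega>))\<^sup>2)"
  defines "P \<equiv> \<lambda>k \<omega>. Complex (grid_sum k s h1 \<omega>) (grid_sum k s h2 \<omega>)"
    and "Q \<equiv> \<lambda>k \<omega>. Complex (grid_sum k s j1 \<omega>) (grid_sum k s j2 \<omega>)"
  defines "err \<equiv> \<lambda>k \<omega>. if cmod (P k \<omega>) + cmod (Q k \<omega>) \<le> c then (max 0 (cmod (P (Suc k) \<omega>) - c))\<^sup>2 else 0"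
  shows "j \<le> n \<Longrightarrow> expectation (\<lambda>\<omega>. bw c (cmod (P j \<omega>)) (cmod (Q j \<omega>)) + \<kappa> * ((cmod (P j \<omega>))\<^sup>2 - (cmod (Q j \<omega>))\<^sup>2)) \<le> (\<Sum>k<j. expectation (err k))"
    and "k < n \<Longrightarrow> integrable M (err k)"
proof -
  note a1 = adapted_gridD[OF ag(1)] and a2 = adapted_gridD[OF ag(2)] and b1 = adapted_gridD[OF ag(3)] and b2 = adapted_gridD[OF ag(4)]
  let ?f = "\<lambda>k \<omega>. bw c (cmod (P k \<omega>)) (cmod (Q k \<omega>))"
  have gF: "grid_sum k s h1 \<in> borel_measurable (F (s k))" "grid_sum k s h2 \<in> borel_measurable (F (s k))"
     "grid_sum k s j1 \<in> borel_measurable (F (s k))" "grid_sum k s j2 \<in> borel_measurable (F (s k))" if "k \<le> n" for k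
    using grid_sum_measurable_F ag that by auto
  have PQF: "P k \<in> borel_measurable (F (s k))" "Q k \<in> borel_measurable (F (s k))" if "k \<le> n" for k
    unfolding P_def Q_def using gF[OF that] by measurable
  have sq: "sq_integrable M (grid_sum k s h1)" "sq_integrable M (grid_sum k s h2)" "sq_integrable M (grid_sum k s j1)" "sq_integrable M (grid_sum k s j2)" if "k \<le> n" for k
    using sq_integrable_grid_sum ag that by auto
  have if': "integrable M (?f k)" if "k \<le> n" for k
    unfolding P_def Q_def using sq[OF that] by (intro integrable_bw[OF c] sq_integrable_integrable)
  have cm: "(cmod (P k \<omega>))\<^sup>2 = (grid_sum k s h1 \<omega>)\<^sup>2 + (grid_sum k s h2 \<omega>)\<^sup>2" "(cmod (Q k \<omega>))\<^sup>2 = (grid_sum k s j1 \<omega>)\<^sup>2 + (grid_sum k s j2 \<omega>)\<^sup>2" for k \<omega>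
    by (simp_all add: P_def Q_def cmod_power2)
  have i2: "integrable M (\<lambda>\<omega>. (cmod (P k \<omega>))\<^sup>2)" "integrable M (\<lambda>\<omega>. (cmod (Q k \<omega>))\<^sup>2)" if "k \<le> n" for k
    unfolding cm using sq[OF that] by (auto simp: sq_integrable_def)
  have ierr: "integrable M (err k)" if "k < n" for k
  proof (rule Bochner_Integration.integrable_bound[OF i2(1)[of "Suc k"]])
    have k: "k \<le> n" "Suc k \<le> n" using that by auto
    show "Suc k \<le> n" by fact
    note [measurable] = measurable_F_M[OF PQF(1)[OF k(1)]] measurable_F_M[OF PQF(2)[OF k(1)]] measurable_F_M[OF PQF(1)[OF k(2)]]
    show "err k \<in> borel_measurable M" unfolding err_def by measurable
    have "err k \<omega> \<le> (cmod (P (Suc k) \<omega>))\<^sup>2" "0 \<le> err k \<omega>" for \<omega>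
      unfolding err_def using c by (auto intro!: power_mono)
    then show "AE \<omega> in M. norm (err k \<omega>) \<le> norm ((cmod (P (Suc k) \<omega>))\<^sup>2)" by simp
  qed
  then show "k < n \<Longrightarrow> integrable M (err k)" .
  show "expectation (\<lambda>\<omega>. ?f j \<omega> + \<kappa> * ((cmod (P j \<omega>))\<^sup>2 - (cmod (Q j \<omega>))\<^sup>2)) \<le> (\<Sum>k<j. expectation (err k))" if "j \<le> n"
    using that
  proof (induction j)
    case 0
    have "Complex 0 0 = 0" by (simp add: complex_eq_iff)
    then show ?case by (simp add: P_def Q_def bw_zero[OF c])
  next
    case (Suc k)
    then have k: "k < n" "k \<le> n" "Suc k \<le> n" by auto
    have sk: "0 \<le> s k" "s k \<le> s (Suc k)" using a1(1,2)[of k] k by auto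
    let ?D = "\<lambda>\<omega>. W (s (Suc k)) \<omega> - W (s k) \<omega>"
    \<comment> \<open>The coefficients of \<open>bw_step\<close>, evaluated at the current position:
      \<open>I\<close> of second order, \<open>\<gamma>\<close> and \<open>\<beta>\<close> of first
      order.\<close>
    define I :: "'a \<Rightarrow> real" where "I \<omega> = (if cmod (P k \<omega>) + cmod (Q k \<omega>) \<le> c then 1 else 0)" for \<omega>
    define \<gamma> where "\<gamma> \<omega> = (if cmod (P k \<omega>) + cmod (Q k \<omega>) \<le> c then -2 else -2 * c / cmod (P k \<omega>))" for \<omega>
    define \<beta> :: "'a \<Rightarrow> real" where "\<beta> \<omega> = (if cmod (P k \<omega>) + cmod (Q k \<omega>) \<le> c then 2 else 0)" for \<omega>
    note [measurable] = PQF[OF k(2)] gF[OF k(2)]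
    have mF: "I \<in> borel_measurable (F (s k))" "\<gamma> \<in> borel_measurable (F (s k))" "\<beta> \<in> borel_measurable (F (s k))"
      unfolding I_def[abs_def] \<gamma>_def[abs_def] \<beta>_def[abs_def] by measurable
    note [measurable] = mF
    define A where "A \<omega> = Complex (h1 k \<omega> \<bullet> ?D \<omega>) (h2 k \<omega> \<bullet> ?D \<omega>)" for \<omega>
    define B where "B \<omega> = Complex (j1 k \<omega> \<bullet> ?D \<omega>) (j2 k \<omega> \<bullet> ?D \<omega>)" for \<omega>
    have PS: "P (Suc k) \<omega> = P k \<omega> + A \<omega>" "Q (Suc k) \<omega> = Q k \<omega> + B \<omega>" for \<omega>
      by (simp_all add: P_def Q_def A_def B_def complex_eq_iff)
    have reP: "Re (P k \<omega>) = grid_sum k s h1 \<omega>" "Im (P k \<omega>) = grid_sum k s h2 \<omega>"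
      "Re (Q k \<omega>) = grid_sum k s j1 \<omega>" "Im (Q k \<omega>) = grid_sum k s j2 \<omega>" for \<omega>
      by (simp_all add: P_def Q_def)
    \<comment> \<open>Inside the diamond both positions are bounded by c; outside,
      \<open>\<gamma>\<close> divides by the norm of the position. The first-order coefficients are
      thus bounded, and their products with the increment have mean 0.\<close>
    have bnd: "\<bar>\<gamma> \<omega> * Re (P k \<omega>)\<bar> \<le> 2 * c" "\<bar>\<gamma> \<omega> * Im (P k \<omega>)\<bar> \<le> 2 * c"
       "\<bar>\<beta> \<omega> * Re (Q k \<omega>)\<bar> \<le> 2 * c" "\<bar>\<beta> \<omega> * Im (Q k \<omega>)\<bar> \<le> 2 * c" for \<omega>
    proof -
      have g: "\<bar>\<gamma> \<omega>\<bar> * cmod (P k \<omega>) \<le> 2 * c" "\<bar>\<beta> \<omega>\<bar> * cmod (Q k \<omega>) \<le> 2 * c"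
      proof -
        have "cmod (P k \<omega>) \<le> c" "cmod (Q k \<omega>) \<le> c" if "cmod (P k \<omega>) + cmod (Q k \<omega>) \<le> c"
          using that norm_ge_zero[of "P k \<omega>"] norm_ge_zero[of "Q k \<omega>"] by linarith+
        then show "\<bar>\<gamma> \<omega>\<bar> * cmod (P k \<omega>) \<le> 2 * c" "\<bar>\<beta> \<omega>\<bar> * cmod (Q k \<omega>) \<le> 2 * c"
          unfolding \<gamma>_def \<beta>_def using c by (auto simp: abs_mult)
      qed
      have "\<bar>z\<bar> * \<bar>x\<bar> \<le> \<bar>z\<bar> * y" if "\<bar>x\<bar> \<le> y" for x y z :: real using that by (intro mult_left_mono) auto
      then show "\<bar>\<gamma> \<omega> * Re (P k \<omega>)\<bar> \<le> 2 * c" "\<bar>\<gamma> \<omega> * Im (P k \<omega>)\<bar> \<le> 2 * c"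
       "\<bar>\<beta> \<omega> * Re (Q k \<omega>)\<bar> \<le> 2 * c" "\<bar>\<beta> \<omega> * Im (Q k \<omega>)\<bar> \<le> 2 * c"
        unfolding abs_mult using g abs_Re_le_cmod abs_Im_le_cmod order_trans by meson+
    qed
    have ib: "integrable M g" if "g \<in> borel_measurable (F (s k))" "\<And>\<omega>. \<bar>g \<omega>\<bar> \<le> b" for g :: "'a \<Rightarrow> real" and b
      using measurable_F_M[OF that(1)] that(2) by (intro integrable_const_bound[where B=b]) auto
    have lin: "integrable M (\<lambda>\<omega>. g \<omega> * (\<xi> \<omega> \<bullet> ?D \<omega>))" "expectation (\<lambda>\<omega>. g \<omega> * (\<xi> \<omega> \<bullet> ?D \<omega>)) = 0"
      if "g \<in> borel_measurable (F (s k))" "\<And>\<omega>. \<bar>g \<omega>\<bar> \<le> b" "\<xi> \<in> borel_measurable (F (s k))" "bounded (range \<xi>)" for g \<xi> b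
      using inner_increment(1,2)[OF sk that(1) ib[OF that(1,2)] that(3,4) that(3,4)] by auto
    have II: "\<bar>I \<omega>\<bar> \<le> 1" for \<omega> by (simp add: I_def)
    note hs = a1(3,4)[OF k(1)] a2(3,4)[OF k(1)] b1(3,4)[OF k(1)] b2(3,4)[OF k(1)]
    define L where "L \<omega> = (\<gamma> \<omega> * Re (P k \<omega>)) * (h1 k \<omega> \<bullet> ?D \<omega>) + (\<gamma> \<omega> * Im (P k \<omega>)) * (h2 k \<omega> \<bullet> ?D \<omega>) +
       ((\<beta> \<omega> * Re (Q k \<omega>)) * (j1 k \<omega> \<bullet> ?D \<omega>) + (\<beta> \<omega> * Im (Q k \<omega>)) * (j2 k \<omega> \<bullet> ?D \<omega>))" for \<omega>
    have lm: "(\<lambda>\<omega>. \<gamma> \<omega> * Re (P k \<omega>)) \<in> borel_measurable (F (s k))" "(\<lambda>\<omega>. \<gamma> \<omega> * Im (P k \<omega>)) \<in> borel_measurable (F (s k))"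
      "(\<lambda>\<omega>. \<beta> \<omega> * Re (Q k \<omega>)) \<in> borel_measurable (F (s k))" "(\<lambda>\<omega>. \<beta> \<omega> * Im (Q k \<omega>)) \<in> borel_measurable (F (s k))"
      unfolding reP by measurable
    note l1 = lin[OF lm(1) bnd(1) hs(1,2)] and l2 = lin[OF lm(2) bnd(2) hs(3,4)] and l3 = lin[OF lm(3) bnd(3) hs(5,6)] and l4 = lin[OF lm(4) bnd(4) hs(7,8)]
    have L: "integrable M L" "expectation L = 0"
      unfolding L_def[abs_def] using l1 l2 l3 l4 by simp_all
    have Ii: "integrable M (\<lambda>\<omega>. I \<omega> - \<kappa>)" "(\<lambda>\<omega>. I \<omega> - \<kappa>) \<in> borel_measurable (F (s k))"
      using ib[OF mF(1) II] by simp_all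
    note q1 = inner_increment_sq[OF sk hs(1,2) Ii(2,1)] and q2 = inner_increment_sq[OF sk hs(3,4) Ii(2,1)]
      and q3 = inner_increment_sq[OF sk hs(5,6) Ii(2,1)] and q4 = inner_increment_sq[OF sk hs(7,8) Ii(2,1)]
    \<comment> \<open>The second-order part, with that of the added quadratic already merged into
      the coefficient I - \<kappa>.\<close>
    define S where "S \<omega> = ((I \<omega> - \<kappa>) * (j1 k \<omega> \<bullet> ?D \<omega>)\<^sup>2 + (I \<omega> - \<kappa>) * (j2 k \<omega> \<bullet> ?D \<omega>)\<^sup>2) - ((I \<omega> - \<kappa>) * (h1 k \<omega> \<bullet> ?D \<omega>)\<^sup>2 + (I \<omega> - \<kappa>) * (h2 k \<omega> \<bullet> ?D \<omega>)\<^sup>2)" for \<omega>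
    have iS: "integrable M S" unfolding S_def[abs_def] using q1(1) q2(1) q3(1) q4(1) by simp
    have eS: "expectation S \<le> 0"
    proof -
      let ?E = "\<lambda>\<xi>. expectation (\<lambda>\<omega>. (I \<omega> - \<kappa>) * (norm (\<xi> k \<omega>))\<^sup>2)"
      have "expectation S = (s (Suc k) - s k) * ?E j1 + (s (Suc k) - s k) * ?E j2 - ((s (Suc k) - s k) * ?E h1 + (s (Suc k) - s k) * ?E h2)"
        unfolding S_def[abs_def] using q1(1,3) q2(1,3) q3(1,3) q4(1,3) by simp
      also have "\<dots> = (s (Suc k) - s k) * (?E j1 + ?E j2 - (?E h1 + ?E h2))" by (simp add: algebra_simps)
      also have "\<dots> = (s (Suc k) - s k) * expectation (\<lambda>\<omega>. (I \<omega> - \<kappa>) * (norm (j1 k \<omega>))\<^sup>2 + (I \<omega> - \<kappa>) * (norm (j2 k \<omega>))\<^sup>2 - ((I \<omega> - \<kappa>) * (norm (h1 k \<omega>))\<^sup>2 + (I \<omega> - \<kappa>) * (norm (h2 k \<omega>))\<^sup>2))"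
        using q1(2) q2(2) q3(2) q4(2) by simp
      also have "\<dots> \<le> (s (Suc k) - s k) * expectation (\<lambda>\<omega>. 0)"
      proof (intro mult_left_mono integral_mono)
        show "integrable M (\<lambda>\<omega>. (I \<omega> - \<kappa>) * (norm (j1 k \<omega>))\<^sup>2 + (I \<omega> - \<kappa>) * (norm (j2 k \<omega>))\<^sup>2 - ((I \<omega> - \<kappa>) * (norm (h1 k \<omega>))\<^sup>2 + (I \<omega> - \<kappa>) * (norm (h2 k \<omega>))\<^sup>2))"
          using q1(2) q2(2) q3(2) q4(2) by simp
        fix \<omega>
        have "(I \<omega> - \<kappa>) * (((norm (j1 k \<omega>))\<^sup>2 + (norm (j2 k \<omega>))\<^sup>2) - ((norm (h1 k \<omega>))\<^sup>2 + (norm (h2 k \<omega>))\<^sup>2)) \<le> 0"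
          using sub[OF k(1), of \<omega>] by (auto simp: I_def mult_le_0_iff)
        then show "(I \<omega> - \<kappa>) * (norm (j1 k \<omega>))\<^sup>2 + (I \<omega> - \<kappa>) * (norm (j2 k \<omega>))\<^sup>2 - ((I \<omega> - \<kappa>) * (norm (h1 k \<omega>))\<^sup>2 + (I \<omega> - \<kappa>) * (norm (h2 k \<omega>))\<^sup>2) \<le> 0"
          by (simp add: algebra_simps)
      qed (use sk in auto)
      finally show ?thesis by simp
    qed
    \<comment> \<open>The first-order part of the added quadratic. Its coefficients are the grid
      sums themselves, unbounded but integrable and known at time \<open>s k\<close>.\<close>
    define G where "G \<omega> = 2 * \<kappa> * (grid_sum k s h1 \<omega> * (h1 k \<omega> \<bullet> ?D \<omega>)) + 2 * \<kappa> * (grid_sum k s h2 \<omega> * (h2 k \<omega> \<bullet> ?D \<omega>)) -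
       (2 * \<kappa> * (grid_sum k s j1 \<omega> * (j1 k \<omega> \<bullet> ?D \<omega>)) + 2 * \<kappa> * (grid_sum k s j2 \<omega> * (j2 k \<omega> \<bullet> ?D \<omega>)))" for \<omega>
    note gg = inner_increment(1,2)[OF sk gF(1)[OF k(2)] sq_integrable_integrable[OF sq(1)[OF k(2)]] hs(1,2) hs(1,2)]
        inner_increment(1,2)[OF sk gF(2)[OF k(2)] sq_integrable_integrable[OF sq(2)[OF k(2)]] hs(3,4) hs(3,4)]
        inner_increment(1,2)[OF sk gF(3)[OF k(2)] sq_integrable_integrable[OF sq(3)[OF k(2)]] hs(5,6) hs(5,6)]
        inner_increment(1,2)[OF sk gF(4)[OF k(2)] sq_integrable_integrable[OF sq(4)[OF k(2)]] hs(7,8) hs(7,8)]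
    have G: "integrable M G" "expectation G = 0"
      unfolding G_def[abs_def] using gg by simp_all
    let ?g = "\<lambda>k \<omega>. ?f k \<omega> + \<kappa> * ((cmod (P k \<omega>))\<^sup>2 - (cmod (Q k \<omega>))\<^sup>2)"
    have ig: "integrable M (?g k)" "integrable M (?g (Suc k))"
      using if' i2 k by auto
    have pt: "?g (Suc k) \<omega> \<le> ?g k \<omega> + L \<omega> + S \<omega> + G \<omega> + err k \<omega>" for \<omega>
    proof -
      have "?f (Suc k) \<omega> \<le> ?f k \<omega> + \<gamma> \<omega> * (P k \<omega> \<bullet> A \<omega>) + \<beta> \<omega> * (Q k \<omega> \<bullet> B \<omega>) +
         (if cmod (P k \<omega>) + cmod (Q k \<omega>) \<le> c then (cmod (B \<omega>))\<^sup>2 - (cmod (A \<omega>))\<^sup>2 + (max 0 (cmod (P k \<omega> + A \<omega>) - c))\<^sup>2 else 0)"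
        unfolding PS \<gamma>_def \<beta>_def by (rule bw_step[OF c])
      also have "\<dots> = ?f k \<omega> + L \<omega> + I \<omega> * ((cmod (B \<omega>))\<^sup>2 - (cmod (A \<omega>))\<^sup>2) + err k \<omega>"
        by (simp add: L_def inner_complex_def A_def B_def I_def err_def PS algebra_simps)
      finally have 1: "?f (Suc k) \<omega> \<le> ?f k \<omega> + L \<omega> + I \<omega> * ((cmod (B \<omega>))\<^sup>2 - (cmod (A \<omega>))\<^sup>2) + err k \<omega>" .
      have 2: "\<kappa> * ((cmod (P (Suc k) \<omega>))\<^sup>2 - (cmod (Q (Suc k) \<omega>))\<^sup>2) = \<kappa> * ((cmod (P k \<omega>))\<^sup>2 - (cmod (Q k \<omega>))\<^sup>2) + G \<omega> - \<kappa> * ((cmod (B \<omega>))\<^sup>2 - (cmod (A \<omega>))\<^sup>2)"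
      proof -
        have "\<kappa> * (((p1 + x1)\<^sup>2 + (p2 + x2)\<^sup>2) - ((q1 + y1)\<^sup>2 + (q2 + y2)\<^sup>2)) = \<kappa> * ((p1\<^sup>2 + p2\<^sup>2) - (q1\<^sup>2 + q2\<^sup>2)) +
          (2 * \<kappa> * (p1 * x1) + 2 * \<kappa> * (p2 * x2) - (2 * \<kappa> * (q1 * y1) + 2 * \<kappa> * (q2 * y2))) - \<kappa> * ((y1\<^sup>2 + y2\<^sup>2) - (x1\<^sup>2 + x2\<^sup>2))"
          for p1 p2 q1 q2 x1 x2 y1 y2
          by (simp add: power2_eq_square algebra_simps)
        then show ?thesis
          unfolding cm A_def B_def unfolding cmod_power2 complex.sel grid_sum_simps G_def .
      qed
      have 3: "S \<omega> = (I \<omega> - \<kappa>) * ((cmod (B \<omega>))\<^sup>2 - (cmod (A \<omega>))\<^sup>2)"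
        by (simp add: S_def A_def B_def cmod_power2 algebra_simps)
      show ?thesis using 1 unfolding 2 3 by (simp add: algebra_simps)
    qed
    have "expectation (?g (Suc k)) \<le> expectation (\<lambda>\<omega>. ?g k \<omega> + L \<omega> + S \<omega> + G \<omega> + err k \<omega>)"
      by (rule integral_mono[OF ig(2) _ pt]) (intro Bochner_Integration.integrable_add ig(1) L(1) iS G(1) ierr[OF k(1)])
    also have "\<dots> = expectation (?g k) + expectation L + expectation S + expectation G + expectation (err k)"
      using ig(1) L(1) iS G(1) ierr[OF k(1)] by (simp only: Bochner_Integration.integral_add Bochner_Integration.integrable_add)
    also have "\<dots> \<le> (\<Sum>k<k. expectation (err k)) + expectation (err k)"
      using Suc.IH[OF k(2)] L(2) eS G(2) by linarith
    finally show ?case by simp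
  qed
qed

text \<open>Splitting at the level l gives a^3 \<le> l a^2 + a^4 / l, so second and fourth moments
  control the cube. In the constant, 4 is the square of 2 in |A|^2 \<le> 2 R^2 |D|^2, where D is the
  Brownian increment, and 3 d^2 comes from the fourth moment of D.\<close>

lemma increment_cube_bound:
  assumes s: "0 \<le> s" "s \<le> u" and l: "0 < l" and R: "\<And>\<omega>. norm (h1 \<omega>) \<le> R" "\<And>\<omega>. norm (h2 \<omega>) \<le> R"
    and hm: "h1 \<in> borel_measurable (F s)" "h2 \<in> borel_measurable (F s)"
  shows "(\<integral>\<^sup>+\<omega>. ennreal (cmod (Complex (h1 \<omega> \<bullet> (W u \<omega> - W s \<omega>)) (h2 \<omega> \<bullet> (W u \<omega> - W s \<omega>))) ^ 3) \<partial>M) \<le>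
    ennreal (l * (2 * R\<^sup>2 * (u - s)) + 12 * R ^ 4 * (real CARD('d))\<^sup>2 * (u - s)\<^sup>2 / l)"
proof -
  let ?D = "\<lambda>\<omega>. W u \<omega> - W s \<omega>"
  define A where "A \<omega> = Complex (h1 \<omega> \<bullet> ?D \<omega>) (h2 \<omega> \<bullet> ?D \<omega>)" for \<omega>
  have bd: "bounded (range h1)" "bounded (range h2)" using R by (auto simp: bounded_iff)
  note [measurable] = measurable_F_M[OF hm(1)] measurable_F_M[OF hm(2)]
  have sq: "(cmod (A \<omega>))\<^sup>2 = (h1 \<omega> \<bullet> ?D \<omega>)\<^sup>2 + (h2 \<omega> \<bullet> ?D \<omega>)\<^sup>2" for \<omega> by (simp add: A_def cmod_power2)
  note q1 = inner_increment_sq[OF s hm(1) bd(1) borel_measurable_const integrable_const, of 1]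
  note q2 = inner_increment_sq[OF s hm(2) bd(2) borel_measurable_const integrable_const, of 1]
  have i2: "integrable M (\<lambda>\<omega>. (cmod (A \<omega>))\<^sup>2)" unfolding sq using q1(1) q2(1) by simp
  have e2: "expectation (\<lambda>\<omega>. (cmod (A \<omega>))\<^sup>2) \<le> 2 * R\<^sup>2 * (u - s)"
  proof -
    have n: "expectation (\<lambda>\<omega>. (norm (h \<omega>))\<^sup>2) \<le> R\<^sup>2" if "integrable M (\<lambda>\<omega>. 1 * (norm (h \<omega>))\<^sup>2)" "\<And>\<omega>. norm (h \<omega>) \<le> R" for h :: "'a \<Rightarrow> real^'d"
      using integral_mono[of M "\<lambda>\<omega>. (norm (h \<omega>))\<^sup>2" "\<lambda>_. R\<^sup>2"] that by (simp add: prob_space power_mono)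
    have "expectation (\<lambda>\<omega>. (cmod (A \<omega>))\<^sup>2) = (u - s) * expectation (\<lambda>\<omega>. (norm (h1 \<omega>))\<^sup>2) + (u - s) * expectation (\<lambda>\<omega>. (norm (h2 \<omega>))\<^sup>2)"
      unfolding sq using q1 q2 by simp
    also have "\<dots> \<le> (u - s) * R\<^sup>2 + (u - s) * R\<^sup>2"
      using s n[OF q1(2) R(1)] n[OF q2(2) R(2)] by (intro add_mono mult_left_mono) auto
    finally show ?thesis by (simp add: algebra_simps)
  qed
  have p4: "cmod (A \<omega>) ^ 4 \<le> 4 * R ^ 4 * norm (?D \<omega>) ^ 4" for \<omega>
  proof -
    have ip: "(h \<bullet> d)\<^sup>2 \<le> R\<^sup>2 * (norm d)\<^sup>2" if "norm h \<le> R" for h d :: "real^'d"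
    proof -
      have "\<bar>h \<bullet> d\<bar> \<le> R * norm d" using Cauchy_Schwarz_ineq2[of h d] mult_right_mono[OF that, of "norm d"] by simp
      then have "\<bar>h \<bullet> d\<bar>\<^sup>2 \<le> (R * norm d)\<^sup>2" by (intro power_mono) auto
      then show ?thesis by (simp add: power_mult_distrib)
    qed
    have "(cmod (A \<omega>))\<^sup>2 \<le> 2 * (R\<^sup>2 * (norm (?D \<omega>))\<^sup>2)"
      unfolding sq using ip[OF R(1), of \<omega> "?D \<omega>"] ip[OF R(2), of \<omega> "?D \<omega>"] by linarith
    then have "((cmod (A \<omega>))\<^sup>2)\<^sup>2 \<le> (2 * (R\<^sup>2 * (norm (?D \<omega>))\<^sup>2))\<^sup>2" by (intro power_mono) auto
    then show ?thesis by (simp add: power_mult_distrib)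
  qed
  let ?b = "\<lambda>\<omega>. l * (cmod (A \<omega>))\<^sup>2 + 4 * R ^ 4 * norm (?D \<omega>) ^ 4 / l"
  have ib: "integrable M ?b" using i2 increment_norm_4(1)[OF s] by simp
  have "(\<integral>\<^sup>+\<omega>. ennreal (cmod (A \<omega>) ^ 3) \<partial>M) \<le> (\<integral>\<^sup>+\<omega>. ennreal (?b \<omega>) \<partial>M)"
  proof (intro nn_integral_mono ennreal_leI)
    fix \<omega>
    let ?a = "cmod (A \<omega>)"
    have "?a ^ 3 \<le> l * ?a\<^sup>2 + ?a ^ 4 / l"
    proof (cases "?a \<le> l")
      case True
      then have "?a * ?a\<^sup>2 \<le> l * ?a\<^sup>2" by (intro mult_right_mono) auto
      then show ?thesis using l by (simp add: power3_eq_cube power2_eq_square add_increasing2)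
    next
      case False
      then have "l * ?a ^ 3 \<le> ?a * ?a ^ 3" by (intro mult_right_mono) auto
      also have "\<dots> = ?a ^ 4" by (simp add: numeral_eq_Suc)
      finally have "?a ^ 3 \<le> ?a ^ 4 / l" using l by (simp add: field_simps)
      then show ?thesis using l by (simp add: add_increasing)
    qed
    also have "\<dots> \<le> ?b \<omega>" using p4[of \<omega>] l by (intro add_left_mono divide_right_mono) auto
    finally show "?a ^ 3 \<le> ?b \<omega>" .
  qed
  also have "\<dots> = ennreal (expectation ?b)"
    using l by (intro nn_integral_eq_integral[OF ib]) (auto intro!: AE_I2 add_nonneg_nonneg)
  also have "expectation ?b = l * expectation (\<lambda>\<omega>. (cmod (A \<omega>))\<^sup>2) + 4 * R ^ 4 * expectation (\<lambda>\<omega>. norm (?D \<omega>) ^ 4) / l"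
    using i2 increment_norm_4(1)[OF s] by simp
  also have "ennreal \<dots> \<le> ennreal (l * (2 * R\<^sup>2 * (u - s)) + 4 * R ^ 4 * (3 * (real CARD('d))\<^sup>2 * (u - s)\<^sup>2) / l)"
    using l e2 increment_norm_4(2)[OF s]
    by (intro ennreal_leI add_mono mult_left_mono divide_right_mono) auto
  finally show ?thesis by (simp add: A_def mult.assoc)
qed

text \<open>The left side involves only the terminal values and is unaffected by refinement, whereas
  the integral over c of the accumulated overshoots tends to 0 with the mesh. Its positive part
  hence integrates to 0 over c.\<close>

lemma burkholder_simple:
  fixes h1 h2 j1 j2 :: "nat \<Rightarrow> 'a \<Rightarrow> real^'d"
  assumes t: "0 < t"
    and sp: "simple_pred F (2 ^ m) (dyadic t m) h1" "simple_pred F (2 ^ m) (dyadic t m) h2"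
      "simple_pred F (2 ^ m) (dyadic t m) j1" "simple_pred F (2 ^ m) (dyadic t m) j2"
  defines "p \<equiv> simple_proc (2 ^ m) (dyadic t m)"
  assumes sub: "\<And>v \<omega>. (\<kappa> = 0 \<and> (norm (p j1 v \<omega>))\<^sup>2 + (norm (p j2 v \<omega>))\<^sup>2 \<le> (norm (p h1 v \<omega>))\<^sup>2 + (norm (p h2 v \<omega>))\<^sup>2) \<or>
       (\<kappa> = 1 \<and> (norm (p h1 v \<omega>))\<^sup>2 + (norm (p h2 v \<omega>))\<^sup>2 \<le> (norm (p j1 v \<omega>))\<^sup>2 + (norm (p j2 v \<omega>))\<^sup>2)"
  defines "I \<equiv> \<lambda>\<xi>. simple_int W (2 ^ m) (dyadic t m) \<xi> t"
  defines "P \<equiv> \<lambda>\<omega>. Complex (I h1 \<omega>) (I h2 \<omega>)" and "Q \<equiv> \<lambda>\<omega>. Complex (I j1 \<omega>) (I j2 \<omega>)"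
  shows "AE c in lborel. 0 \<le> c \<longrightarrow> expectation (\<lambda>\<omega>. bw c (cmod (P \<omega>)) (cmod (Q \<omega>)) + \<kappa> * ((cmod (P \<omega>))\<^sup>2 - (cmod (Q \<omega>))\<^sup>2)) \<le> 0"
proof -
  have t0: "0 \<le> t" using t by simp
  define \<phi> where "\<phi> c = expectation (\<lambda>\<omega>. bw c (cmod (P \<omega>)) (cmod (Q \<omega>)) + \<kappa> * ((cmod (P \<omega>))\<^sup>2 - (cmod (Q \<omega>))\<^sup>2))" for c
  have [measurable]: "I h1 \<in> borel_measurable M" "I h2 \<in> borel_measurable M" "I j1 \<in> borel_measurable M" "I j2 \<in> borel_measurable M"
    unfolding I_def using simple_int_measurable[OF _ t0] sp by auto
  have [measurable]: "P \<in> borel_measurable M" "Q \<in> borel_measurable M" unfolding P_def Q_def by measurable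
  have [measurable]: "\<phi> \<in> borel_measurable lborel"
    unfolding \<phi>_def[abs_def] by measurable
  obtain R1 R2 where R12: "0 \<le> R1" "\<And>v \<omega>. norm (p h1 v \<omega>) \<le> R1" "0 \<le> R2" "\<And>v \<omega>. norm (p h2 v \<omega>) \<le> R2"
    using simple_proc_bounded[OF sp(1)] simple_proc_bounded[OF sp(2)] unfolding p_def by metis
  define R where "R = max R1 R2"
  have R: "norm (p h1 v \<omega>) \<le> R" "norm (p h2 v \<omega>) \<le> R" for v \<omega>
    using R12(2,4)[of v \<omega>] by (auto simp: R_def max_def)
  define C where "C = 2 * R\<^sup>2 * t + 12 * R ^ 4 * (real CARD('d))\<^sup>2 * t\<^sup>2"
  have key: "(\<integral>\<^sup>+c. ennreal (\<phi> c) * indicator {0..} c \<partial>lborel) \<le> ennreal (C * (1 / 2) ^ K)" if K: "m \<le> K" for K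
  proof -
    \<comment> \<open>With 2^N cells, the level l = 2^-K is the square root of 2^-N; it balances the
      two terms of \<open>increment_cube_bound\<close>. Each cell then costs at most C 2^-K / 2^N,
      and all of them C 2^-K.\<close>
    define N where "N = 2 * K"
    have N: "m \<le> N" using K by (simp add: N_def)
    define s where "s = dyadic t N"
    define \<eta> where "\<eta> \<xi> = (\<lambda>k. p \<xi> (s (Suc k)))" for \<xi>
    have r: "simple_pred F (2 ^ N) s (\<eta> \<xi>)" "simple_int W (2 ^ N) s (\<eta> \<xi>) = simple_int W (2 ^ m) (dyadic t m) \<xi>"
      if "simple_pred F (2 ^ m) (dyadic t m) \<xi>" for \<xi>
      unfolding \<eta>_def p_def s_def by (rule dyadic_refine(1)[OF that N t], rule dyadic_refine(3)[OF that N t])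
    have ag: "adapted_grid (2 ^ N) s (\<eta> \<xi>)" if "simple_pred F (2 ^ m) (dyadic t m) \<xi>" for \<xi>
      using r(1)[OF that] by (auto simp: simple_pred_def adapted_grid_def intro: less_imp_le)
    have gs: "grid_sum (2 ^ N) s (\<eta> \<xi>) \<omega> = I \<xi> \<omega>" if "simple_pred F (2 ^ m) (dyadic t m) \<xi>" for \<xi> \<omega>
    proof -
      have "simple_int W (2 ^ N) s (\<eta> \<xi>) (s (2 ^ N)) \<omega> = grid_sum (2 ^ N) s (\<eta> \<xi>) \<omega>"
        unfolding grid_sum_def s_def by (rule simple_int_at_grid) (use dyadic_less[OF t] in auto)
      then show ?thesis using r(2)[OF that] by (simp add: I_def s_def)
    qed
    define Pk where "Pk k \<omega> = Complex (grid_sum k s (\<eta> h1) \<omega>) (grid_sum k s (\<eta> h2) \<omega>)" for k \<omega>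
    define Qk where "Qk k \<omega> = Complex (grid_sum k s (\<eta> j1) \<omega>) (grid_sum k s (\<eta> j2) \<omega>)" for k \<omega>
    define err where "err c k \<omega> = (if cmod (Pk k \<omega>) + cmod (Qk k \<omega>) \<le> c then (max 0 (cmod (Pk (Suc k) \<omega>) - c))\<^sup>2 else 0)" for c k \<omega>
    have sub': "(\<kappa> = 0 \<and> (norm (\<eta> j1 k \<omega>))\<^sup>2 + (norm (\<eta> j2 k \<omega>))\<^sup>2 \<le> (norm (\<eta> h1 k \<omega>))\<^sup>2 + (norm (\<eta> h2 k \<omega>))\<^sup>2) \<or>
       (\<kappa> = 1 \<and> (norm (\<eta> h1 k \<omega>))\<^sup>2 + (norm (\<eta> h2 k \<omega>))\<^sup>2 \<le> (norm (\<eta> j1 k \<omega>))\<^sup>2 + (norm (\<eta> j2 k \<omega>))\<^sup>2)" for k \<omega>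
      unfolding \<eta>_def by (rule sub)
    have PQ: "Pk (2 ^ N) \<omega> = P \<omega>" "Qk (2 ^ N) \<omega> = Q \<omega>" for \<omega>
      by (simp_all add: Pk_def Qk_def P_def Q_def gs[OF sp(1)] gs[OF sp(2)] gs[OF sp(3)] gs[OF sp(4)])
    have le: "\<phi> c \<le> (\<Sum>k<2 ^ N. expectation (err c k))" and ie: "\<And>k. k < 2 ^ N \<Longrightarrow> integrable M (err c k)" if "0 \<le> c" for c
      using burkholder_grid[OF ag[OF sp(1)] ag[OF sp(2)] ag[OF sp(3)] ag[OF sp(4)] that sub']
      unfolding Pk_def[symmetric] Qk_def[symmetric] err_def[symmetric, abs_def] PQ[symmetric] \<phi>_def by auto
    have Pm[measurable]: "Pk k \<in> borel_measurable M" "Qk k \<in> borel_measurable M" if "k \<le> 2 ^ N" for k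
    proof -
      have [measurable]: "grid_sum k s (\<eta> \<xi>) \<in> borel_measurable M" if "simple_pred F (2 ^ m) (dyadic t m) \<xi>" for \<xi>
        using measurable_F_M[OF grid_sum_measurable_F[OF ag[OF that] \<open>k \<le> 2 ^ N\<close>]] .
      note [measurable] = this[OF sp(1)] this[OF sp(2)] this[OF sp(3)] this[OF sp(4)]
      show "Pk k \<in> borel_measurable M" "Qk k \<in> borel_measurable M" unfolding Pk_def Qk_def by measurable
    qed
    interpret LM: pair_sigma_finite lborel M by unfold_locales
    have cell: "(\<integral>\<^sup>+c. (\<integral>\<^sup>+\<omega>. ennreal (err c k \<omega>) \<partial>M) \<partial>lborel) \<le> ennreal (C * (1 / 2) ^ K / 2 ^ N)" if k: "k < 2 ^ N" for k
    proof -
      let ?D = "\<lambda>\<omega>. W (s (Suc k)) \<omega> - W (s k) \<omega>"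
      note [measurable] = Pm(1)[OF less_imp_le[OF k]] Pm(2)[OF less_imp_le[OF k]] Pm(1)[OF Suc_leI[OF k]]
      define A where "A \<omega> = Complex (\<eta> h1 k \<omega> \<bullet> ?D \<omega>) (\<eta> h2 k \<omega> \<bullet> ?D \<omega>)" for \<omega>
      have PS: "Pk (Suc k) \<omega> = Pk k \<omega> + A \<omega>" for \<omega>
        by (simp add: Pk_def A_def complex_eq_iff)
      \<comment> \<open>Tonelli brings the integral over c inside, where the overshoot collapses to
        a cube path by path.\<close>
      have "(\<integral>\<^sup>+c. (\<integral>\<^sup>+\<omega>. ennreal (err c k \<omega>) \<partial>M) \<partial>lborel) = (\<integral>\<^sup>+\<omega>. (\<integral>\<^sup>+c. ennreal (err c k \<omega>) \<partial>lborel) \<partial>M)"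
        by (rule LM.Fubini'[symmetric]) (unfold err_def, measurable)
      also have "\<dots> \<le> (\<integral>\<^sup>+\<omega>. ennreal (cmod (A \<omega>) ^ 3) \<partial>M)"
        unfolding err_def PS by (intro nn_integral_mono overshoot_integral) simp
      also have "\<dots> \<le> ennreal ((1 / 2) ^ K * (2 * R\<^sup>2 * (s (Suc k) - s k)) + 12 * R ^ 4 * (real CARD('d))\<^sup>2 * (s (Suc k) - s k)\<^sup>2 / (1 / 2) ^ K)"
        unfolding A_def
      proof (rule increment_cube_bound)
        show "0 \<le> s k" "s k \<le> s (Suc k)" using t by (auto simp: s_def dyadic_def field_simps)
        show "\<eta> h1 k \<in> borel_measurable (F (s k))" "\<eta> h2 k \<in> borel_measurable (F (s k))"
          using adapted_gridD(3)[OF ag[OF sp(1)] k] adapted_gridD(3)[OF ag[OF sp(2)] k] by auto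
      qed (auto simp: \<eta>_def R)
      also have "s (Suc k) - s k = t / 2 ^ N" by (simp add: s_def dyadic_Suc)
      also have "(1 / 2) ^ K * (2 * R\<^sup>2 * (t / 2 ^ N)) + 12 * R ^ 4 * (real CARD('d))\<^sup>2 * (t / 2 ^ N)\<^sup>2 / (1 / 2) ^ K = C * (1 / 2) ^ K / 2 ^ N"
      proof -
        have p: "(2::real) ^ N = 2 ^ K * 2 ^ K" by (simp add: N_def mult_2 power_add)
        show ?thesis unfolding p C_def by (simp add: power_one_over field_simps power2_eq_square)
      qed
      finally show ?thesis .
    qed
    have "(\<integral>\<^sup>+c. ennreal (\<phi> c) * indicator {0..} c \<partial>lborel) \<le> (\<integral>\<^sup>+c. (\<Sum>k<2 ^ N. \<integral>\<^sup>+\<omega>. ennreal (err c k \<omega>) \<partial>M) \<partial>lborel)"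
    proof (rule nn_integral_mono)
      fix c
      show "ennreal (\<phi> c) * indicator {0..} c \<le> (\<Sum>k<2 ^ N. \<integral>\<^sup>+\<omega>. ennreal (err c k \<omega>) \<partial>M)"
      proof (cases "0 \<le> c")
        case True
        have e0: "0 \<le> err c k \<omega>" for k \<omega> by (simp add: err_def)
        have "ennreal (\<phi> c) \<le> ennreal (\<Sum>k<2 ^ N. expectation (err c k))" by (rule ennreal_leI[OF le[OF True]])
        also have "\<dots> = (\<Sum>k<2 ^ N. ennreal (expectation (err c k)))"
          by (rule sum_ennreal[symmetric]) (auto intro!: integral_nonneg_AE e0)
        also have "\<dots> = (\<Sum>k<2 ^ N. \<integral>\<^sup>+\<omega>. ennreal (err c k \<omega>) \<partial>M)"
          using ie[OF True] e0 by (intro sum.cong refl nn_integral_eq_integral[symmetric]) auto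
        finally show ?thesis using True by simp
      qed simp
    qed
    also have "\<dots> = (\<Sum>k<2 ^ N. \<integral>\<^sup>+c. (\<integral>\<^sup>+\<omega>. ennreal (err c k \<omega>) \<partial>M) \<partial>lborel)"
    proof (rule nn_integral_sum)
      fix k :: nat assume "k \<in> {..<2 ^ N}"
      then have k: "k < 2 ^ N" by simp
      note [measurable] = Pm(1)[OF less_imp_le[OF k]] Pm(2)[OF less_imp_le[OF k]] Pm(1)[OF Suc_leI[OF k]]
      show "(\<lambda>c. \<integral>\<^sup>+\<omega>. ennreal (err c k \<omega>) \<partial>M) \<in> borel_measurable lborel" unfolding err_def by measurable
    qed
    also have "\<dots> \<le> (\<Sum>k<(2::nat) ^ N. ennreal (C * (1 / 2) ^ K / 2 ^ N))"
      by (intro sum_mono cell) auto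
    also have "\<dots> = ennreal (\<Sum>k<(2::nat) ^ N. C * (1 / 2) ^ K / 2 ^ N)"
      using t by (intro sum_ennreal) (simp add: C_def)
    also have "\<dots> = ennreal (C * (1 / 2) ^ K)" by simp
    finally show ?thesis .
  qed
  \<comment> \<open>\<open>ennreal\<close> discards negative values, so this integral vanishes
    exactly when \<phi> is nonpositive for almost every c \<ge> 0.\<close>
  have "(\<integral>\<^sup>+c. ennreal (\<phi> c) * indicator {0..} c \<partial>lborel) \<le> 0"
  proof (rule tendsto_lowerbound)
    have "(\<lambda>K. C * (1 / 2) ^ K) \<longlonglongrightarrow> C * 0" by (intro tendsto_intros) auto
    from tendsto_ennrealI[OF this] show "(\<lambda>K. ennreal (C * (1 / 2) ^ K)) \<longlonglongrightarrow> 0" by simp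
    show "\<forall>\<^sub>F K in sequentially. (\<integral>\<^sup>+c. ennreal (\<phi> c) * indicator {0..} c \<partial>lborel) \<le> ennreal (C * (1 / 2) ^ K)"
      using key by (auto simp: eventually_sequentially)
  qed simp
  then have "(\<integral>\<^sup>+c. ennreal (\<phi> c) * indicator {0..} c \<partial>lborel) = 0" by simp
  then have "AE c in lborel. ennreal (\<phi> c) * indicator {0..} c = 0"
    by (subst (asm) nn_integral_0_iff_AE) measurable
  then have "AE c in lborel. 0 \<le> c \<longrightarrow> \<phi> c \<le> 0"
    by (rule AE_mp) (auto intro!: AE_I2 simp: indicator_def ennreal_eq_0_iff split: if_splits)
  then show ?thesis by (simp add: \<phi>_def)
qed

lemma l2_lim_cmod_sq:
  assumes "l2_lim M f f'" "l2_lim M g g'"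
  shows "(\<lambda>k. expectation (\<lambda>\<omega>. (cmod (Complex (f k \<omega>) (g k \<omega>)))\<^sup>2)) \<longlonglongrightarrow> expectation (\<lambda>\<omega>. (cmod (Complex (f' \<omega>) (g' \<omega>)))\<^sup>2)"
    and "integrable M (\<lambda>\<omega>. (cmod (Complex (f k \<omega>) (g k \<omega>)))\<^sup>2)" "integrable M (\<lambda>\<omega>. (cmod (Complex (f' \<omega>) (g' \<omega>)))\<^sup>2)"
proof -
  note s = sq_integrableD(2)[OF l2_limD(1)[OF assms(1)]] sq_integrableD(2)[OF l2_limD(1)[OF assms(2)]]
     sq_integrableD(2)[OF l2_limD(2)[OF assms(1)]] sq_integrableD(2)[OF l2_limD(2)[OF assms(2)]]
  show "integrable M (\<lambda>\<omega>. (cmod (Complex (f k \<omega>) (g k \<omega>)))\<^sup>2)" "integrable M (\<lambda>\<omega>. (cmod (Complex (f' \<omega>) (g' \<omega>)))\<^sup>2)"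
    using s by (simp_all add: cmod_power2)
  show "(\<lambda>k. expectation (\<lambda>\<omega>. (cmod (Complex (f k \<omega>) (g k \<omega>)))\<^sup>2)) \<longlonglongrightarrow> expectation (\<lambda>\<omega>. (cmod (Complex (f' \<omega>) (g' \<omega>)))\<^sup>2)"
    using s tendsto_add[OF l2_lim_square[OF assms(1)] l2_lim_square[OF assms(2)]] by (simp add: cmod_power2)
qed

text \<open>The exceptional values of c form a null set for each k, and countably many of these are
  discarded at once; for every remaining c the expectations converge.\<close>

lemma burkholder_limit:
  fixes h1 h2 j1 j2 :: "nat \<Rightarrow> nat \<Rightarrow> 'a \<Rightarrow> real^'d"
  assumes t: "0 < t"
    and sp: "\<And>k. simple_pred F (2 ^ m k) (dyadic t (m k)) (h1 k)" "\<And>k. simple_pred F (2 ^ m k) (dyadic t (m k)) (h2 k)"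
      "\<And>k. simple_pred F (2 ^ m k) (dyadic t (m k)) (j1 k)" "\<And>k. simple_pred F (2 ^ m k) (dyadic t (m k)) (j2 k)"
  defines "p \<equiv> \<lambda>k. simple_proc (2 ^ m k) (dyadic t (m k))"
  assumes sub: "\<And>k v \<omega>. (\<kappa> = 0 \<and> (norm (p k (j1 k) v \<omega>))\<^sup>2 + (norm (p k (j2 k) v \<omega>))\<^sup>2 \<le> (norm (p k (h1 k) v \<omega>))\<^sup>2 + (norm (p k (h2 k) v \<omega>))\<^sup>2) \<or>
       (\<kappa> = 1 \<and> (norm (p k (h1 k) v \<omega>))\<^sup>2 + (norm (p k (h2 k) v \<omega>))\<^sup>2 \<le> (norm (p k (j1 k) v \<omega>))\<^sup>2 + (norm (p k (j2 k) v \<omega>))\<^sup>2)"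
  defines "I \<equiv> \<lambda>k \<xi>. simple_int W (2 ^ m k) (dyadic t (m k)) \<xi> t"
  assumes l: "l2_lim M (\<lambda>k. I k (h1 k)) P1" "l2_lim M (\<lambda>k. I k (h2 k)) P2" "l2_lim M (\<lambda>k. I k (j1 k)) Q1" "l2_lim M (\<lambda>k. I k (j2 k)) Q2"
  defines "P \<equiv> \<lambda>\<omega>. Complex (P1 \<omega>) (P2 \<omega>)" and "Q \<equiv> \<lambda>\<omega>. Complex (Q1 \<omega>) (Q2 \<omega>)"
  shows "AE c in lborel. 0 \<le> c \<longrightarrow> expectation (\<lambda>\<omega>. bw c (cmod (P \<omega>)) (cmod (Q \<omega>)) + \<kappa> * ((cmod (P \<omega>))\<^sup>2 - (cmod (Q \<omega>))\<^sup>2)) \<le> 0"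
proof -
  define E where "E k c = expectation (\<lambda>\<omega>. bw c (cmod (Complex (I k (h1 k) \<omega>) (I k (h2 k) \<omega>))) (cmod (Complex (I k (j1 k) \<omega>) (I k (j2 k) \<omega>))) +
     \<kappa> * ((cmod (Complex (I k (h1 k) \<omega>) (I k (h2 k) \<omega>)))\<^sup>2 - (cmod (Complex (I k (j1 k) \<omega>) (I k (j2 k) \<omega>)))\<^sup>2))" for k c
  have "AE c in lborel. 0 \<le> c \<longrightarrow> E k c \<le> 0" for k
    unfolding E_def I_def by (rule burkholder_simple[OF t sp]) (use sub[of k] in \<open>simp add: p_def\<close>)
  then have "AE c in lborel. \<forall>k. 0 \<le> c \<longrightarrow> E k c \<le> 0" unfolding AE_all_countable by blast
  then show ?thesis
  proof (rule AE_mp, intro AE_I2 impI)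
    fix c assume le: "\<forall>k. 0 \<le> c \<longrightarrow> E k c \<le> 0" and c: "0 \<le> c"
    note s = l[THEN l2_limD(1), THEN sq_integrable_integrable] l[THEN l2_limD(2), THEN sq_integrable_integrable]
    note q1 = l2_lim_cmod_sq[OF l(1,2)] and q2 = l2_lim_cmod_sq[OF l(3,4)]
    have "(\<lambda>k. expectation (\<lambda>\<omega>. bw c (cmod (Complex (I k (h1 k) \<omega>) (I k (h2 k) \<omega>))) (cmod (Complex (I k (j1 k) \<omega>) (I k (j2 k) \<omega>)))) +
     \<kappa> * (expectation (\<lambda>\<omega>. (cmod (Complex (I k (h1 k) \<omega>) (I k (h2 k) \<omega>)))\<^sup>2) - expectation (\<lambda>\<omega>. (cmod (Complex (I k (j1 k) \<omega>) (I k (j2 k) \<omega>)))\<^sup>2)))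
      \<longlonglongrightarrow> expectation (\<lambda>\<omega>. bw c (cmod (P \<omega>)) (cmod (Q \<omega>))) + \<kappa> * (expectation (\<lambda>\<omega>. (cmod (P \<omega>))\<^sup>2) - expectation (\<lambda>\<omega>. (cmod (Q \<omega>))\<^sup>2))"
      unfolding P_def Q_def by (intro tendsto_intros bw_limit[OF c l] q1(1) q2(1))
    moreover have "E k c = expectation (\<lambda>\<omega>. bw c (cmod (Complex (I k (h1 k) \<omega>) (I k (h2 k) \<omega>))) (cmod (Complex (I k (j1 k) \<omega>) (I k (j2 k) \<omega>)))) +
     \<kappa> * (expectation (\<lambda>\<omega>. (cmod (Complex (I k (h1 k) \<omega>) (I k (h2 k) \<omega>)))\<^sup>2) - expectation (\<lambda>\<omega>. (cmod (Complex (I k (j1 k) \<omega>) (I k (j2 k) \<omega>)))\<^sup>2))" for k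
      unfolding E_def using integrable_bw[OF c s(1)[of k] s(2)[of k] s(3)[of k] s(4)[of k]] q1(2)[of k] q2(2)[of k] by simp
    ultimately have "(\<lambda>k. E k c) \<longlonglongrightarrow> expectation (\<lambda>\<omega>. bw c (cmod (P \<omega>)) (cmod (Q \<omega>))) + \<kappa> * (expectation (\<lambda>\<omega>. (cmod (P \<omega>))\<^sup>2) - expectation (\<lambda>\<omega>. (cmod (Q \<omega>))\<^sup>2))"
      by simp
    then have "expectation (\<lambda>\<omega>. bw c (cmod (P \<omega>)) (cmod (Q \<omega>))) + \<kappa> * (expectation (\<lambda>\<omega>. (cmod (P \<omega>))\<^sup>2) - expectation (\<lambda>\<omega>. (cmod (Q \<omega>))\<^sup>2)) \<le> 0"
      by (rule LIMSEQ_le_const2) (use le c in auto)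
    then show "expectation (\<lambda>\<omega>. bw c (cmod (P \<omega>)) (cmod (Q \<omega>)) + \<kappa> * ((cmod (P \<omega>))\<^sup>2 - (cmod (Q \<omega>))\<^sup>2)) \<le> 0"
      using integrable_bw[OF c s(5-8)] q1(3) q2(3) unfolding P_def Q_def by simp
  qed
qed

end

section \<open>Burkholder's inequality\<close>

text \<open>As a function of w in the place of v, the difference of the two sides vanishes at w = u,
  and its derivative p w (w^(p-2) - m^(p-2)) has the sign of w - u because m is a weighted mean of u
  and w. So w = u is a minimum.\<close>

lemma powr_tangent_bound_gt_2:
  fixes u v p :: real
  assumes p: "2 < p" and uv: "0 < u" "0 < v"
  shows "u powr p - v powr p \<le> p * (((p - 1) * u + v) / p) powr (p - 1) * (u - v)"
proof -
  define m where "m w = ((p - 1) * u + w) / p" for w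
  define f where "f w = p * (u - w) * m w powr (p - 1) - u powr p + w powr p" for w
  have mpos: "0 < m w" if "0 < w" for w using that uv p by (simp add: m_def add_pos_pos)
  have der: "(f has_real_derivative p * w * (w powr (p - 2) - m w powr (p - 2))) (at w)" if w: "0 < w" for w
  proof -
    have m': "(m has_real_derivative 1 / p) (at w)" unfolding m_def[abs_def] using p by (auto intro!: derivative_eq_intros)
    have mp: "((\<lambda>w. m w powr (p - 1)) has_real_derivative (p - 1) * m w powr (p - 1 - real 1) * (1 / p)) (at w)"
      by (rule DERIV_fun_powr[OF m' mpos[OF w]])
    have d1: "((\<lambda>w. p * (u - w)) has_real_derivative - p) (at w)" by (auto intro!: derivative_eq_intros)
    have wp: "((\<lambda>w. w powr p) has_real_derivative p * w powr (p - 1)) (at w)" by (rule has_real_derivative_powr[OF w])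
    have "(f has_real_derivative (- p * m w powr (p - 1) + ((p - 1) * m w powr (p - 1 - real 1) * (1 / p)) * (p * (u - w)) - 0 + p * w powr (p - 1))) (at w)"
      unfolding f_def[abs_def] by (intro DERIV_add DERIV_diff DERIV_mult DERIV_const d1 mp wp)
    then have "(f has_real_derivative (- p * m w powr (p - 1) + p * (u - w) * ((p - 1) * m w powr (p - 1 - 1) * (1 / p)) + p * w powr (p - 1))) (at w)"
      by (simp add: mult_ac)
    moreover have "- p * m w powr (p - 1) + p * (u - w) * ((p - 1) * m w powr (p - 1 - 1) * (1 / p)) + p * w powr (p - 1) = p * w * (w powr (p - 2) - m w powr (p - 2))"
    proof -
      have 1: "m w powr (p - 1) = m w * m w powr (p - 2)" "w powr (p - 1) = w * w powr (p - 2)"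
        using mpos[OF w] w by (simp_all add: powr_mult_base)
      have 2: "p * m w = (p - 1) * u + w" using p by (simp add: m_def)
      have 3: "p - 1 - 1 = p - 2" by simp
      have "- p * (m w * m w powr (p - 2)) + p * (u - w) * ((p - 1) * m w powr (p - 2) * (1 / p)) + p * (w * w powr (p - 2))
        = m w powr (p - 2) * (- (p * m w) + (p - 1) * (u - w)) + p * (w * w powr (p - 2))"
        using p by (simp add: field_simps)
      also have "\<dots> = p * w * (w powr (p - 2) - m w powr (p - 2))"
        unfolding 2 by (simp add: algebra_simps)
      finally show ?thesis unfolding 1 3 .
    qed
    ultimately show ?thesis by simp
  qed
  have fu: "f u = 0" by (simp add: f_def)
  have "0 \<le> f v"
  proof (cases "v \<le> u")
    case True
    have "f u \<le> f v"
    proof (rule DERIV_nonpos_imp_nonincreasing[OF True])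
      fix w assume w: "v \<le> w" "w \<le> u"
      then have w0: "0 < w" using uv by simp
      have "p * w \<le> (p - 1) * u + w" using w p mult_left_mono[of w u "p - 1"] by (simp add: algebra_simps)
      then have "w \<le> m w" using p by (simp add: m_def field_simps)
      then have "w powr (p - 2) \<le> m w powr (p - 2)" using w0 p by (intro powr_mono2) auto
      then have "p * w * (w powr (p - 2) - m w powr (p - 2)) \<le> 0" using w0 p by (intro mult_nonneg_nonpos) auto
      then show "\<exists>y. (f has_real_derivative y) (at w) \<and> y \<le> 0" using der[OF w0] by blast
    qed
    then show ?thesis using fu by simp
  next
    case False
    then have uv': "u \<le> v" by simp
    have "f u \<le> f v"
    proof (rule DERIV_nonneg_imp_nondecreasing[OF uv'])
      fix w assume w: "u \<le> w" "w \<le> v"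
      then have w0: "0 < w" using uv by simp
      have "(p - 1) * u + w \<le> p * w" using w p mult_left_mono[of u w "p - 1"] by (simp add: algebra_simps)
      then have "m w \<le> w" using p by (simp add: m_def field_simps)
      then have "m w powr (p - 2) \<le> w powr (p - 2)" using mpos[OF w0] p by (intro powr_mono2) auto
      then have "0 \<le> p * w * (w powr (p - 2) - m w powr (p - 2))" using w0 p by (intro mult_nonneg_nonneg) auto
      then show "\<exists>y. (f has_real_derivative y) (at w) \<and> 0 \<le> y" using der[OF w0] by blast
    qed
    then show ?thesis using fu by simp
  qed
  then show ?thesis by (simp add: f_def m_def mult_ac)
qed

text \<open>Here u is the moving variable and the mean is weighted the other way. The exponent p - 2
  is negative, so the power is decreasing and the derivative again changes sign from minus to plus
  at w = v.\<close>

lemma powr_tangent_bound_lt_2: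
  fixes u v p :: real
  assumes p: "1 < p" "p < 2" and uv: "0 < u" "0 < v"
  shows "u powr p - v powr p \<le> p * ((u + (p - 1) * v) / p) powr (p - 1) * (u - v)"
proof -
  define m where "m w = (w + (p - 1) * v) / p" for w
  define f where "f w = p * (w - v) * m w powr (p - 1) - w powr p + v powr p" for w
  have mpos: "0 < m w" if "0 < w" for w using that uv p by (simp add: m_def add_pos_pos)
  have der: "(f has_real_derivative p * w * (m w powr (p - 2) - w powr (p - 2))) (at w)" if w: "0 < w" for w
  proof -
    have m': "(m has_real_derivative 1 / p) (at w)" unfolding m_def[abs_def] using p by (auto intro!: derivative_eq_intros)
    have mp: "((\<lambda>w. m w powr (p - 1)) has_real_derivative (p - 1) * m w powr (p - 1 - real 1) * (1 / p)) (at w)"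
      by (rule DERIV_fun_powr[OF m' mpos[OF w]])
    have d1: "((\<lambda>w. p * (w - v)) has_real_derivative p) (at w)" by (auto intro!: derivative_eq_intros)
    have wp: "((\<lambda>w. w powr p) has_real_derivative p * w powr (p - 1)) (at w)" by (rule has_real_derivative_powr[OF w])
    have "(f has_real_derivative (p * m w powr (p - 1) + ((p - 1) * m w powr (p - 1 - real 1) * (1 / p)) * (p * (w - v)) - p * w powr (p - 1) + 0)) (at w)"
      unfolding f_def[abs_def] by (intro DERIV_add DERIV_diff DERIV_mult DERIV_const d1 mp wp)
    then have "(f has_real_derivative (p * m w powr (p - 1) + p * (w - v) * ((p - 1) * m w powr (p - 1 - 1) * (1 / p)) - p * w powr (p - 1))) (at w)"
      by (simp add: mult_ac)
    moreover have "p * m w powr (p - 1) + p * (w - v) * ((p - 1) * m w powr (p - 1 - 1) * (1 / p)) - p * w powr (p - 1) = p * w * (m w powr (p - 2) - w powr (p - 2))"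
    proof -
      have 1: "m w powr (p - 1) = m w * m w powr (p - 2)" "w powr (p - 1) = w * w powr (p - 2)"
        using mpos[OF w] w by (simp_all add: powr_mult_base)
      have 2: "p * m w = w + (p - 1) * v" using p by (simp add: m_def)
      have 3: "p - 1 - 1 = p - 2" by simp
      have "p * (m w * m w powr (p - 2)) + p * (w - v) * ((p - 1) * m w powr (p - 2) * (1 / p)) - p * (w * w powr (p - 2))
        = m w powr (p - 2) * (p * m w + (p - 1) * (w - v)) - p * (w * w powr (p - 2))"
        using p by (simp add: field_simps)
      also have "\<dots> = p * w * (m w powr (p - 2) - w powr (p - 2))"
        unfolding 2 by (simp add: algebra_simps)
      finally show ?thesis unfolding 1 3 .
    qed
    ultimately show ?thesis by simp
  qed
  have fv: "f v = 0" by (simp add: f_def)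
  have "0 \<le> f u"
  proof (cases "u \<le> v")
    case True
    have "f v \<le> f u"
    proof (rule DERIV_nonpos_imp_nonincreasing[OF True])
      fix w assume w: "u \<le> w" "w \<le> v"
      then have w0: "0 < w" using uv by simp
      have "p * w \<le> w + (p - 1) * v" using w p mult_left_mono[of w v "p - 1"] by (simp add: algebra_simps)
      then have "w \<le> m w" using p by (simp add: m_def field_simps)
      then have "m w powr (p - 2) \<le> w powr (p - 2)" using w0 p by (intro powr_mono2') auto
      then have "p * w * (m w powr (p - 2) - w powr (p - 2)) \<le> 0" using w0 p by (intro mult_nonneg_nonpos) auto
      then show "\<exists>y. (f has_real_derivative y) (at w) \<and> y \<le> 0" using der[OF w0] by blast
    qed
    then show ?thesis using fv by simp
  next
    case False
    then have uv': "v \<le> u" by simp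
    have "f v \<le> f u"
    proof (rule DERIV_nonneg_imp_nondecreasing[OF uv'])
      fix w assume w: "v \<le> w" "w \<le> u"
      then have w0: "0 < w" using uv by simp
      have "w + (p - 1) * v \<le> p * w" using w p mult_left_mono[of v w "p - 1"] by (simp add: algebra_simps)
      then have "m w \<le> w" using p by (simp add: m_def field_simps)
      then have "w powr (p - 2) \<le> m w powr (p - 2)" using mpos[OF w0] p by (intro powr_mono2') auto
      then have "0 \<le> p * w * (m w powr (p - 2) - w powr (p - 2))" using w0 p by (intro mult_nonneg_nonneg) auto
      then show "\<exists>y. (f has_real_derivative y) (at w) \<and> 0 \<le> y" using der[OF w0] by blast
    qed
    then show ?thesis using fv by simp
  qed
  then show ?thesis by (simp add: f_def m_def mult_ac)
qed

lemma pstar_gt_2: "2 < p \<Longrightarrow> pstar p = p"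
  by (simp add: pstar_def max_def field_simps)

lemma pstar_lt_2: "1 < p \<Longrightarrow> p < 2 \<Longrightarrow> pstar p = p / (p - 1)"
  by (simp add: pstar_def max_def field_simps)

text \<open>Burkholder's majorant. The tangent bounds are taken at u = y and v = C x; in both ranges
  of p the weighted mean occurring there equals C / (1 + C) times x + y, which is why C is
  \<open>pstar p - 1\<close>.\<close>

lemma burkholder_pointwise:
  fixes x y p :: real
  assumes p: "1 < p" "p \<noteq> 2" and xy: "0 \<le> x" "0 \<le> y"
  defines "C \<equiv> pstar p - 1"
  shows "y powr p - C powr p * x powr p \<le> p * (C / (1 + C)) powr (p - 1) * ((x + y) powr (p - 1) * (y - C * x))"
proof -
  have C: "0 < C" using p by (cases "p < 2") (simp_all add: C_def pstar_lt_2 pstar_gt_2 field_simps)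
  have pos: "y powr p - C powr p * x powr p \<le> p * (C / (1 + C)) powr (p - 1) * ((x + y) powr (p - 1) * (y - C * x))"
    if xy: "0 < x" "0 < y" for x y
  proof -
    have Cx: "0 < C * x" using C xy by simp
    have "y powr p - (C * x) powr p \<le> p * ((C / (1 + C)) * (x + y)) powr (p - 1) * (y - C * x)"
    proof (cases "p < 2")
      case True
      then have Ce: "C = 1 / (p - 1)" using p by (simp add: C_def pstar_lt_2 field_simps)
      have "(y + (p - 1) * (C * x)) / p = (C / (1 + C)) * (x + y)" using p by (simp add: Ce field_simps)
      then show ?thesis using powr_tangent_bound_lt_2[OF p(1) True xy(2) Cx] by simp
    next
      case False
      then have p2: "2 < p" using p by simp
      then have Ce: "C = p - 1" by (simp add: C_def pstar_gt_2)
      have "((p - 1) * y + C * x) / p = (C / (1 + C)) * (x + y)" using p by (simp add: Ce field_simps)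
      then show ?thesis using powr_tangent_bound_gt_2[OF p2 xy(2) Cx] by simp
    qed
    moreover have "((C / (1 + C)) * (x + y)) powr (p - 1) = (C / (1 + C)) powr (p - 1) * (x + y) powr (p - 1)" "(C * x) powr p = C powr p * x powr p"
      by (intro powr_mult; use C xy in simp)+
    ultimately show ?thesis by (simp add: mult_ac)
  qed
  \<comment> \<open>The tangent bounds need strictly positive arguments; the boundary cases follow
    by shifting both arguments by 1 / (n + 1).\<close>
  let ?e = "\<lambda>n. 1 / real (Suc n)"
  have e: "?e \<longlonglongrightarrow> 0" by (rule LIMSEQ_Suc[OF lim_1_over_n])
  have cv: "(\<lambda>n. (z + ?e n) powr q) \<longlonglongrightarrow> z powr q" if "0 \<le> z" "0 < q" for z q
  proof -
    have "(\<lambda>n. (z + ?e n) powr q) \<longlonglongrightarrow> (z + 0) powr q"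
      by (rule tendsto_powr'[OF tendsto_add[OF tendsto_const e] tendsto_const]) (use that in auto)
    then show ?thesis by simp
  qed
  have cv2: "(\<lambda>n. ((x + ?e n) + (y + ?e n)) powr (p - 1)) \<longlonglongrightarrow> (x + y) powr (p - 1)"
  proof -
    have "(\<lambda>n. ((x + ?e n) + (y + ?e n)) powr (p - 1)) \<longlonglongrightarrow> ((x + 0) + (y + 0)) powr (p - 1)"
      by (rule tendsto_powr'[OF tendsto_add[OF tendsto_add[OF tendsto_const e] tendsto_add[OF tendsto_const e]] tendsto_const]) (use xy p in auto)
    then show ?thesis by simp
  qed
  show ?thesis
  proof (rule LIMSEQ_le)
    show "(\<lambda>n. (y + ?e n) powr p - C powr p * (x + ?e n) powr p) \<longlonglongrightarrow> y powr p - C powr p * x powr p"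
      using xy p by (intro tendsto_intros cv) auto
    have "(\<lambda>n. p * (C / (1 + C)) powr (p - 1) * (((x + ?e n) + (y + ?e n)) powr (p - 1) * ((y + ?e n) - C * (x + ?e n)))) \<longlonglongrightarrow>
       p * (C / (1 + C)) powr (p - 1) * ((x + y) powr (p - 1) * ((y + 0) - C * (x + 0)))"
      by (intro tendsto_mult[OF tendsto_const] tendsto_mult[OF cv2] tendsto_diff tendsto_add[OF tendsto_const e])
    then show "(\<lambda>n. p * (C / (1 + C)) powr (p - 1) * (((x + ?e n) + (y + ?e n)) powr (p - 1) * ((y + ?e n) - C * (x + ?e n)))) \<longlonglongrightarrow>
       p * (C / (1 + C)) powr (p - 1) * ((x + y) powr (p - 1) * (y - C * x))" by simp
    show "\<exists>N. \<forall>n\<ge>N. (y + ?e n) powr p - C powr p * (x + ?e n) powr p \<le> p * (C / (1 + C)) powr (p - 1) * (((x + ?e n) + (y + ?e n)) powr (p - 1) * ((y + ?e n) - C * (x + ?e n)))"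
      using xy by (intro exI[of _ 0] allI impI pos) (auto intro: add_nonneg_pos)
  qed
qed

section \<open>Integrating the layers against powers of c\<close>

lemma has_bochner_integral_lborel_nonneg:
  fixes f :: "real \<Rightarrow> real"
  assumes [measurable]: "f \<in> borel_measurable borel" "S \<in> sets borel" and nn: "\<And>x. x \<in> S \<Longrightarrow> 0 \<le> f x"
    and I: "(f has_integral I) S"
  shows "has_bochner_integral lborel (\<lambda>x. indicator S x * f x) I"
proof (rule has_bochner_integral_nn_integral)
  show "(\<lambda>x. indicator S x * f x) \<in> borel_measurable lborel" by measurable
  show "AE x in lborel. 0 \<le> indicator S x * f x" using nn by (auto simp: indicator_def)
  show I0: "0 \<le> I" by (rule has_integral_nonneg[OF I nn])
  have "((\<lambda>x. indicator S x * f x) has_integral I) UNIV"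
  proof -
    have "(\<lambda>x. indicator S x * f x) = (\<lambda>x. if x \<in> S then f x else 0)" by (auto simp: indicator_def)
    then show ?thesis using I has_integral_restrict_UNIV[of S f I] by simp
  qed
  then show "(\<integral>\<^sup>+x. ennreal (indicator S x * f x) \<partial>lborel) = ennreal I"
    using nn by (intro nn_integral_has_integral_lborel) (auto simp: indicator_def)
qed

lemma powr_integral_from_0:
  fixes a r :: real
  assumes "-1 < a" "0 \<le> r"
  shows "has_bochner_integral lborel (\<lambda>c. indicator {0..r} c * c powr a) (r powr (a + 1) / (a + 1))"
  by (rule has_bochner_integral_lborel_nonneg[OF _ _ _ has_integral_powr_from_0[OF assms]]) auto

lemma powr_integral_to_inf:
  fixes e r :: real
  assumes "e < -1" "0 < r"
  shows "has_bochner_integral lborel (\<lambda>c. indicator {r..} c * c powr e) (- (r powr (e + 1)) / (e + 1))"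
  by (rule has_bochner_integral_lborel_nonneg[OF _ _ _ has_integral_powr_to_inf[OF assms]]) auto

text \<open>Near 0 the layer is of order c, so the weighted integral converges because p > 1; beyond
  x + y it is constant in c, so it converges because p < 2. The first claim is the domination for
  Fubini, the second identifies Burkholder's function up to a factor.\<close>

lemma bw_integral_lt_2:
  fixes x y p :: real
  assumes p: "1 < p" "p < 2" and xy: "0 \<le> x" "0 \<le> y"
  defines "r \<equiv> x + y"
  defines "g \<equiv> \<lambda>c. indicator {0<..} c * (c powr (p - 3) * bw c x y)"
  shows "(\<integral>\<^sup>+c. ennreal \<bar>g c\<bar> \<partial>lborel) \<le> ennreal ((1 / p + 2 / (p - 1) + 1 / (2 - p)) * r powr p)"
    and "(\<integral>c. g c \<partial>lborel) = 2 / (p * (2 - p)) * (r powr (p - 1) * (y - x / (p - 1)))"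
proof -
  have "(\<integral>\<^sup>+c. ennreal \<bar>g c\<bar> \<partial>lborel) \<le> ennreal ((1 / p + 2 / (p - 1) + 1 / (2 - p)) * r powr p) \<and>
     (\<integral>c. g c \<partial>lborel) = 2 / (p * (2 - p)) * (r powr (p - 1) * (y - x / (p - 1)))"
  proof (cases "r = 0")
    case True
    then have "x = 0" "y = 0" using xy by (auto simp: r_def)
    then have "g c = 0" for c by (simp add: g_def bw_zero indicator_def)
    then show ?thesis using True by simp
  next
    case False
    then have r: "0 < r" using xy by (simp add: r_def)
    have h1: "has_bochner_integral lborel (\<lambda>c. indicator {0..r} c * c powr (p - 1)) (r powr p / p)"
      using powr_integral_from_0[of "p - 1" r] p r by simp
    have h2: "has_bochner_integral lborel (\<lambda>c. indicator {0..r} c * c powr (p - 2)) (r powr (p - 1) / (p - 1))"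
      using powr_integral_from_0[of "p - 2" r] p r by simp
    have h3: "has_bochner_integral lborel (\<lambda>c. indicator {r..} c * c powr (p - 3)) (r powr (p - 2) / (2 - p))"
    proof -
      have e1: "p - 3 + 1 = p - 2" by simp
      have e2: "- a / (p - 2) = a / (2 - p)" for a using p by (simp add: field_simps)
      have "p - 3 < -1" using p by simp
      from powr_integral_to_inf[OF this r] show ?thesis unfolding e1 e2 .
    qed
    have pw: "c powr (p - 3) * c\<^sup>2 = c powr (p - 1)" "c powr (p - 3) * c = c powr (p - 2)" if "0 < c" for c
    proof -
      have "c powr (p - 3) * c\<^sup>2 = c powr (p - 3) * c powr 2" using that by (simp add: powr_numeral)
      then show "c powr (p - 3) * c\<^sup>2 = c powr (p - 1)" by (simp add: powr_add[symmetric])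
      have "c powr (p - 3) * c = c powr (p - 3) * c powr 1" using that by simp
      then show "c powr (p - 3) * c = c powr (p - 2)" unfolding powr_add[symmetric] by simp
    qed
    define J where "J c = indicator {0..r} c * c powr (p - 1) - 2 * x * (indicator {0..r} c * c powr (p - 2)) + (y\<^sup>2 - x\<^sup>2) * (indicator {r..} c * c powr (p - 3))" for c
    define J' where "J' c = indicator {0..r} c * c powr (p - 1) + 2 * r * (indicator {0..r} c * c powr (p - 2)) + r\<^sup>2 * (indicator {r..} c * c powr (p - 3))" for c
    have gJ: "g c = J c" if cn: "c \<noteq> 0" "c \<noteq> r" for c
    proof -
      consider "c < 0" | "0 < c" "c < r" | "r < c" using cn by linarith
      then show ?thesis
      proof cases
        case 1 then show ?thesis using r by (simp add: g_def J_def)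
      next
        case 2
        then have bo: "bw c x y = c\<^sup>2 - 2 * c * x" using xy by (intro bw_outside) (auto simp: r_def)
        have "g c = c powr (p - 3) * c\<^sup>2 - 2 * x * (c powr (p - 3) * c)" using 2 unfolding g_def bo by (simp add: algebra_simps)
        then show ?thesis using 2 pw[of c] by (simp add: J_def)
      next
        case 3
        then have "bw c x y = y\<^sup>2 - x\<^sup>2" using xy by (intro bw_inside) (auto simp: r_def)
        then show ?thesis using 3 r by (simp add: g_def J_def)
      qed
    qed
    \<comment> \<open>The explicit pieces overlap at their common end r, and 0 lies outside the
      domain of \<open>g\<close>; both points are null.\<close>
    have ae: "AE c in lborel. g c = J c"
      using AE_lborel_singleton[of 0] AE_lborel_singleton[of r] by eventually_elim (rule gJ)
    have HJ: "has_bochner_integral lborel J (r powr p / p - 2 * x * (r powr (p - 1) / (p - 1)) + (y\<^sup>2 - x\<^sup>2) * (r powr (p - 2) / (2 - p)))"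
      unfolding J_def[abs_def] by (intro has_bochner_integral_add has_bochner_integral_diff has_bochner_integral_mult_right h1 h2 h3)
    have HJ': "has_bochner_integral lborel J' (r powr p / p + 2 * r * (r powr (p - 1) / (p - 1)) + r\<^sup>2 * (r powr (p - 2) / (2 - p)))"
      unfolding J'_def[abs_def] by (intro has_bochner_integral_add has_bochner_integral_mult_right h1 h2 h3)
    have J'0: "0 \<le> J' c" for c using r by (auto simp: J'_def indicator_def)
    have le: "\<bar>J c\<bar> \<le> J' c" for c
    proof -
      have a: "\<bar>y\<^sup>2 - x\<^sup>2\<bar> \<le> r\<^sup>2" using xy by (simp add: r_def power2_eq_square abs_le_iff algebra_simps)
      have b: "\<bar>2 * x\<bar> \<le> 2 * r" using xy by (simp add: r_def)
      have "\<bar>J c\<bar> \<le> \<bar>indicator {0..r} c * c powr (p - 1)\<bar> + \<bar>2 * x * (indicator {0..r} c * c powr (p - 2))\<bar> + \<bar>(y\<^sup>2 - x\<^sup>2) * (indicator {r..} c * c powr (p - 3))\<bar>"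
        unfolding J_def by linarith
      also have "\<dots> \<le> J' c"
        unfolding J'_def abs_mult[of "2 * x"] abs_mult[of "y\<^sup>2 - x\<^sup>2"]
        using a b r by (intro add_mono mult_mono) (auto simp: indicator_def)
      finally show ?thesis .
    qed
    have [measurable]: "g \<in> borel_measurable lborel" unfolding g_def by measurable
    have [measurable]: "J \<in> borel_measurable lborel" "J' \<in> borel_measurable lborel"
      using HJ HJ' by (auto simp: has_bochner_integral_iff)
    have "(\<integral>\<^sup>+c. ennreal \<bar>g c\<bar> \<partial>lborel) \<le> (\<integral>\<^sup>+c. ennreal (J' c) \<partial>lborel)"
      using ae by (intro nn_integral_mono_AE) (auto elim!: eventually_mono intro!: ennreal_leI le)
    also have "\<dots> = ennreal (r powr p / p + 2 * r * (r powr (p - 1) / (p - 1)) + r\<^sup>2 * (r powr (p - 2) / (2 - p)))"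
      using HJ' J'0 by (subst nn_integral_eq_integral) (auto simp: has_bochner_integral_iff)
    also have "r powr p / p + 2 * r * (r powr (p - 1) / (p - 1)) + r\<^sup>2 * (r powr (p - 2) / (2 - p)) = (1 / p + 2 / (p - 1) + 1 / (2 - p)) * r powr p"
    proof -
      have "r * r powr (p - 1) = r powr p" using r by (simp add: powr_mult_base)
      moreover have "r\<^sup>2 * r powr (p - 2) = r powr p"
      proof -
        have "r\<^sup>2 * r powr (p - 2) = r powr 2 * r powr (p - 2)" using r by (simp add: powr_numeral)
        then show ?thesis by (simp add: powr_add[symmetric])
      qed
      ultimately show ?thesis by (simp add: algebra_simps)
    qed
    finally have A: "(\<integral>\<^sup>+c. ennreal \<bar>g c\<bar> \<partial>lborel) \<le> ennreal ((1 / p + 2 / (p - 1) + 1 / (2 - p)) * r powr p)" .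
    have "(\<integral>c. g c \<partial>lborel) = (\<integral>c. J c \<partial>lborel)" by (rule integral_cong_AE) (use ae in auto)
    also have "\<dots> = r powr p / p - 2 * x * (r powr (p - 1) / (p - 1)) + (y\<^sup>2 - x\<^sup>2) * (r powr (p - 2) / (2 - p))"
      using HJ by (simp add: has_bochner_integral_iff)
    also have "\<dots> = r powr (p - 1) * (r / p - 2 * x / (p - 1) + (y - x) / (2 - p))"
    proof -
      have 1: "r powr p = r * r powr (p - 1)" "r powr (p - 1) = r * r powr (p - 2)" using r by (simp_all add: powr_mult_base)
      have 2: "y\<^sup>2 - x\<^sup>2 = r * (y - x)" by (simp add: r_def power2_eq_square algebra_simps)
      have 3: "(y\<^sup>2 - x\<^sup>2) * (r powr (p - 2) / (2 - p)) = r powr (p - 1) * ((y - x) / (2 - p))"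
        unfolding 2 1(2) by (simp add: field_simps)
      show ?thesis unfolding 3 unfolding 1(1) by (simp add: algebra_simps)
    qed
    \<comment> \<open>A partial fraction identity in p, after substituting r = x + y.\<close>
    also have "r / p - 2 * x / (p - 1) + (y - x) / (2 - p) = 2 / (p * (2 - p)) * (y - x / (p - 1))"
      using p by (simp add: r_def divide_simps) (simp add: algebra_simps)
    finally show ?thesis using A by (simp add: mult_ac)
  qed
  then show "(\<integral>\<^sup>+c. ennreal \<bar>g c\<bar> \<partial>lborel) \<le> ennreal ((1 / p + 2 / (p - 1) + 1 / (2 - p)) * r powr p)"
    "(\<integral>c. g c \<partial>lborel) = 2 / (p * (2 - p)) * (r powr (p - 1) * (y - x / (p - 1)))" by auto
qed

text \<open>The combined layer is (y - c)^2 - x^2 for c up to x + y and 0 beyond. Without truncation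
  its integral is a multiple of Burkholder's function. Stopping at R leaves a bound that needs only
  second moments, while the lower estimate survives with y counted only when y \<le> R.\<close>

lemma bw_integral_gt_2:
  fixes x y p R :: real
  assumes p: "2 < p" and xy: "0 \<le> x" "0 \<le> y" and R: "0 < R"
  defines "r \<equiv> x + y"
  defines "g \<equiv> \<lambda>c. indicator {0<..R} c * (c powr (p - 3) * (bw c y x + (y\<^sup>2 - x\<^sup>2)))"
  shows "(\<integral>\<^sup>+c. ennreal \<bar>g c\<bar> \<partial>lborel) \<le> ennreal (R powr (p - 2) / (p - 2) * r\<^sup>2)"
    and "2 / (p * (p - 1) * (p - 2)) / (p * ((p - 1) / p) powr (p - 1)) * ((if y \<le> R then y powr p else 0) - (p - 1) powr p * x powr p) \<le> (\<integral>c. g c \<partial>lborel)"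
proof -
  have v_out: "bw c y x + (y\<^sup>2 - x\<^sup>2) = (y - c)\<^sup>2 - x\<^sup>2" if "c \<le> r" for c
    using bw_outside[of x c y] xy that by (simp add: r_def power2_diff add.commute)
  have v_in: "bw c y x + (y\<^sup>2 - x\<^sup>2) = 0" if "r \<le> c" for c
    using bw_inside[of x y c] xy that by (simp add: r_def add.commute)
  have r0: "0 \<le> r" using xy by (simp add: r_def)
  have [measurable]: "g \<in> borel_measurable lborel" unfolding g_def by measurable
  have hR: "has_bochner_integral lborel (\<lambda>c. r\<^sup>2 * (indicator {0..R} c * c powr (p - 3))) (r\<^sup>2 * (R powr (p - 2) / (p - 2)))"
    using has_bochner_integral_mult_right[OF powr_integral_from_0[of "p - 3" R], of "r\<^sup>2"] p R by simp
  have gb: "\<bar>g c\<bar> \<le> r\<^sup>2 * (indicator {0..R} c * c powr (p - 3))" for c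
  proof (cases "0 < c \<and> c \<le> R")
    case True
    have "\<bar>bw c y x + (y\<^sup>2 - x\<^sup>2)\<bar> \<le> r\<^sup>2"
    proof (cases "c \<le> r")
      case c: True
      have "\<bar>y - c\<bar> \<le> r" using c True xy by (auto simp: r_def abs_le_iff)
      then have "(y - c)\<^sup>2 \<le> r\<^sup>2" using power_mono[of "\<bar>y - c\<bar>" r 2] by simp
      moreover have "x\<^sup>2 \<le> r\<^sup>2" using xy by (intro power_mono) (auto simp: r_def)
      moreover have "0 \<le> x\<^sup>2" "0 \<le> (y - c)\<^sup>2" by simp_all
      ultimately show ?thesis unfolding v_out[OF c] abs_le_iff by linarith
    qed (simp add: v_in)
    then have "c powr (p - 3) * \<bar>bw c y x + (y\<^sup>2 - x\<^sup>2)\<bar> \<le> c powr (p - 3) * r\<^sup>2" by (intro mult_left_mono) auto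
    then show ?thesis using True by (simp add: g_def abs_mult mult_ac)
  next
    case False
    then have "g c = 0" by (auto simp: g_def indicator_def)
    then show ?thesis by simp
  qed
  have gi: "integrable lborel g"
    by (rule Bochner_Integration.integrable_bound[where f="\<lambda>c. r\<^sup>2 * (indicator {0..R} c * c powr (p - 3))"])
      (use hR gb in \<open>auto simp: has_bochner_integral_iff intro: order_trans[OF _ abs_ge_self]\<close>)
  have "(\<integral>\<^sup>+c. ennreal \<bar>g c\<bar> \<partial>lborel) \<le> (\<integral>\<^sup>+c. ennreal (r\<^sup>2 * (indicator {0..R} c * c powr (p - 3))) \<partial>lborel)"
    by (intro nn_integral_mono ennreal_leI gb)
  also have "\<dots> = ennreal (r\<^sup>2 * (R powr (p - 2) / (p - 2)))"
    using hR by (subst nn_integral_eq_integral) (auto simp: has_bochner_integral_iff)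
  finally show "(\<integral>\<^sup>+c. ennreal \<bar>g c\<bar> \<partial>lborel) \<le> ennreal (R powr (p - 2) / (p - 2) * r\<^sup>2)" by (simp add: mult.commute)
  \<comment> \<open>\<open>b\<close> is the factor produced by the integration over c,
    \<open>a\<close> the constant of \<open>burkholder_pointwise\<close>, where C / (1 + C) = (p -
    1) / p.\<close>
  define b where "b = 2 / (p * (p - 1) * (p - 2))"
  define a where "a = p * ((p - 1) / p) powr (p - 1)"
  have ab: "0 < b" "0 < a" using p by (simp_all add: b_def a_def)
  have "b / a * ((if y \<le> R then y powr p else 0) - (p - 1) powr p * x powr p) \<le> (\<integral>c. g c \<partial>lborel)"
  \<comment> \<open>If R < y - x, the layer is nonnegative on all of (0, R], while y > R makes the
    left side nonpositive. Otherwise truncation removes only values of c at which the layer is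
    nonpositive, so it can only increase the integral.\<close>
  proof (cases "R < y - x")
    case True
    have "0 \<le> g c" for c
    proof (cases "0 < c \<and> c \<le> R")
      case c: True
      then have cr: "c \<le> r" using True xy by (simp add: r_def)
      have "x\<^sup>2 \<le> (y - c)\<^sup>2" using c True xy by (intro power_mono) auto
      then show ?thesis unfolding g_def v_out[OF cr] by simp
    next
      case False
      then have "g c = 0" by (auto simp: g_def indicator_def)
      then show ?thesis by simp
    qed
    then have "0 \<le> (\<integral>c. g c \<partial>lborel)" by simp
    moreover have "\<not> y \<le> R" using True xy by simp
    ultimately show ?thesis using ab by (simp add: mult_nonneg_nonpos order_trans[of _ 0])
  next
    case False
    define G where "G c = (y\<^sup>2 - x\<^sup>2) * (indicator {0..r} c * c powr (p - 3)) - 2 * y * (indicator {0..r} c * c powr (p - 2)) + indicator {0..r} c * c powr (p - 1)" for c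
    have HG: "has_bochner_integral lborel G ((y\<^sup>2 - x\<^sup>2) * (r powr (p - 2) / (p - 2)) - 2 * y * (r powr (p - 1) / (p - 1)) + r powr p / p)"
      unfolding G_def[abs_def]
      using powr_integral_from_0[of "p - 3" r] powr_integral_from_0[of "p - 2" r] powr_integral_from_0[of "p - 1" r] p r0
      by (intro has_bochner_integral_add has_bochner_integral_diff has_bochner_integral_mult_right) auto
    have pw: "c powr (p - 3) * c\<^sup>2 = c powr (p - 1)" "c powr (p - 3) * c = c powr (p - 2)" if "0 < c" for c
    proof -
      have "c powr (p - 3) * c\<^sup>2 = c powr (p - 3) * c powr 2" using that by (simp add: powr_numeral)
      then show "c powr (p - 3) * c\<^sup>2 = c powr (p - 1)" by (simp add: powr_add[symmetric])
      have "c powr (p - 3) * c = c powr (p - 3) * c powr 1" using that by simp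
      then show "c powr (p - 3) * c = c powr (p - 2)" unfolding powr_add[symmetric] by simp
    qed
    have Ge: "G c = indicator {0<..r} c * (c powr (p - 3) * ((y - c)\<^sup>2 - x\<^sup>2))" for c
    proof (cases "0 < c \<and> c \<le> r")
      case True
      have "c powr (p - 3) * ((y - c)\<^sup>2 - x\<^sup>2) = (y\<^sup>2 - x\<^sup>2) * c powr (p - 3) - 2 * y * (c powr (p - 3) * c) + c powr (p - 3) * c\<^sup>2"
        by (simp add: power2_eq_square algebra_simps)
      then show ?thesis using True pw[of c] by (simp add: G_def)
    next
      case False
      then show ?thesis by (auto simp: G_def indicator_def)
    qed
    have "G c \<le> g c" for c
    proof (cases "0 < c \<and> c \<le> r")
      case c: True
      show ?thesis
      proof (cases "c \<le> R")
        case True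
        then show ?thesis using c unfolding Ge g_def by (simp add: v_out)
      next
        \<comment> \<open>Here c exceeds R, which is at least y - x, and is at most x + y, so c is
          within x of y.\<close>
        case cR: False
        then have "\<bar>y - c\<bar> \<le> x" using c False by (auto simp: r_def abs_le_iff)
        then have "(y - c)\<^sup>2 \<le> x\<^sup>2" using power_mono[of "\<bar>y - c\<bar>" x 2] by simp
        then have "c powr (p - 3) * ((y - c)\<^sup>2 - x\<^sup>2) \<le> 0" by (intro mult_nonneg_nonpos) auto
        then show ?thesis using c cR unfolding Ge g_def by simp
      qed
    next
      case c: False
      then have "G c = 0" unfolding Ge by (auto simp: indicator_def)
      moreover have "g c = 0" using c v_in[of c] unfolding g_def by (cases "c \<le> r") (auto simp: indicator_def)
      ultimately show ?thesis by simp
    qed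
    then have "(\<integral>c. G c \<partial>lborel) \<le> (\<integral>c. g c \<partial>lborel)"
      using HG gi by (intro integral_mono) (auto simp: has_bochner_integral_iff)
    moreover have "(\<integral>c. G c \<partial>lborel) = b * (r powr (p - 1) * (y - (p - 1) * x))"
    proof -
      have "(\<integral>c. G c \<partial>lborel) = (y\<^sup>2 - x\<^sup>2) * (r powr (p - 2) / (p - 2)) - 2 * y * (r powr (p - 1) / (p - 1)) + r powr p / p"
        using HG by (simp add: has_bochner_integral_iff)
      also have "\<dots> = r powr (p - 1) * ((y - x) / (p - 2) - 2 * y / (p - 1) + r / p)"
      proof -
        have 1: "r powr p = r * r powr (p - 1)" "r powr (p - 1) = r * r powr (p - 2)" using r0 by (simp_all add: powr_mult_base)
        have 2: "y\<^sup>2 - x\<^sup>2 = r * (y - x)" by (simp add: r_def power2_eq_square algebra_simps)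
        have 3: "(y\<^sup>2 - x\<^sup>2) * (r powr (p - 2) / (p - 2)) = r powr (p - 1) * ((y - x) / (p - 2))"
          unfolding 2 1(2) by (simp add: field_simps)
        show ?thesis unfolding 3 unfolding 1(1) by (simp add: algebra_simps)
      qed
      also have "(y - x) / (p - 2) - 2 * y / (p - 1) + r / p = b * (y - (p - 1) * x)"
        using p by (simp add: r_def b_def divide_simps) (simp add: algebra_simps)
      finally show ?thesis by (simp add: mult_ac)
    qed
    moreover have "b / a * ((if y \<le> R then y powr p else 0) - (p - 1) powr p * x powr p) \<le> b * (r powr (p - 1) * (y - (p - 1) * x))"
    proof -
      have "y powr p - (p - 1) powr p * x powr p \<le> a * (r powr (p - 1) * (y - (p - 1) * x))"
        using burkholder_pointwise[of p x y] p xy by (simp add: pstar_gt_2 a_def r_def)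
      then have "(if y \<le> R then y powr p else 0) - (p - 1) powr p * x powr p \<le> a * (r powr (p - 1) * (y - (p - 1) * x))"
        by (auto intro: order_trans[rotated])
      then have "b / a * ((if y \<le> R then y powr p else 0) - (p - 1) powr p * x powr p) \<le> b / a * (a * (r powr (p - 1) * (y - (p - 1) * x)))"
        using ab by (intro mult_left_mono) auto
      then show ?thesis using ab by simp
    qed
    ultimately show ?thesis by simp
  qed
  then show "2 / (p * (p - 1) * (p - 2)) / (p * ((p - 1) / p) powr (p - 1)) * ((if y \<le> R then y powr p else 0) - (p - 1) powr p * x powr p) \<le> (\<integral>c. g c \<partial>lborel)"
    by (simp add: a_def b_def)
qed

text \<open>A sign known only for almost every c is enough once the order of integration may be
  exchanged.\<close>

lemma (in prob_space) fubini_nonpos: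
  fixes G :: "real \<Rightarrow> 'a \<Rightarrow> real"
  assumes [measurable]: "(\<lambda>(c, \<omega>). G c \<omega>) \<in> borel_measurable (lborel \<Otimes>\<^sub>M M)"
    and fin: "(\<integral>\<^sup>+\<omega>. (\<integral>\<^sup>+c. ennreal \<bar>G c \<omega>\<bar> \<partial>lborel) \<partial>M) < \<infinity>"
    and le: "AE c in lborel. expectation (\<lambda>\<omega>. G c \<omega>) \<le> 0"
  shows "integrable M (\<lambda>\<omega>. \<integral>c. G c \<omega> \<partial>lborel)" "expectation (\<lambda>\<omega>. \<integral>c. G c \<omega> \<partial>lborel) \<le> 0"
proof -
  interpret LM: pair_sigma_finite lborel M by unfold_locales
  have i: "integrable (lborel \<Otimes>\<^sub>M M) (\<lambda>(c, \<omega>). G c \<omega>)"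
  proof (rule integrableI_bounded)
    have "(\<integral>\<^sup>+z. ennreal (norm (case z of (c, \<omega>) \<Rightarrow> G c \<omega>)) \<partial>(lborel \<Otimes>\<^sub>M M)) = (\<integral>\<^sup>+\<omega>. (\<integral>\<^sup>+c. ennreal \<bar>G c \<omega>\<bar> \<partial>lborel) \<partial>M)"
      by (subst LM.nn_integral_snd[symmetric]) (auto simp: case_prod_beta')
    then show "(\<integral>\<^sup>+z. ennreal (norm (case z of (c, \<omega>) \<Rightarrow> G c \<omega>)) \<partial>(lborel \<Otimes>\<^sub>M M)) < \<infinity>" using fin by simp
  qed measurable
  show "integrable M (\<lambda>\<omega>. \<integral>c. G c \<omega> \<partial>lborel)" by (rule LM.integrable_snd[OF i])
  have "expectation (\<lambda>\<omega>. \<integral>c. G c \<omega> \<partial>lborel) = (\<integral>c. expectation (\<lambda>\<omega>. G c \<omega>) \<partial>lborel)"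
    by (rule LM.Fubini_integral[OF i])
  also have "\<dots> \<le> 0"
  proof -
    have "0 \<le> (\<integral>c. - expectation (\<lambda>\<omega>. G c \<omega>) \<partial>lborel)" by (rule integral_nonneg_AE) (use le in auto)
    then show ?thesis by simp
  qed
  finally show "expectation (\<lambda>\<omega>. \<integral>c. G c \<omega> \<partial>lborel) \<le> 0" .
qed

section \<open>From the layer inequality to L^p bounds\<close>

context prob_space
begin

text \<open>Below 2 all moments in question are finite, so the pointwise majorant is integrated
  directly: it is a nonnegative multiple of the integral of the layers, whose expectation is
  nonpositive.\<close>

lemma burkholder_lp_lt_2:
  fixes P Q :: "'a \<Rightarrow> complex"
  assumes [measurable]: "P \<in> borel_measurable M" "Q \<in> borel_measurable M"
    and i2: "integrable M (\<lambda>\<omega>. (cmod (P \<omega>))\<^sup>2)" "integrable M (\<lambda>\<omega>. (cmod (Q \<omega>))\<^sup>2)"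
    and p: "1 < p" "p < 2"
    and h: "AE c in lborel. 0 \<le> c \<longrightarrow> expectation (\<lambda>\<omega>. bw c (cmod (P \<omega>)) (cmod (Q \<omega>))) \<le> 0"
  shows "(\<integral>\<^sup>+\<omega>. ennreal (cmod (Q \<omega>) powr p) \<partial>M) \<le> ennreal ((pstar p - 1) powr p) * (\<integral>\<^sup>+\<omega>. ennreal (cmod (P \<omega>) powr p) \<partial>M)"
proof -
  let ?x = "\<lambda>\<omega>. cmod (P \<omega>)" and ?y = "\<lambda>\<omega>. cmod (Q \<omega>)"
  define C where "C = pstar p - 1"
  have Ce: "C = 1 / (p - 1)" using p by (simp add: C_def pstar_lt_2 field_simps)
  \<comment> \<open>Second moments control the p-th moments because p < 2.\<close>
  have pw: "z powr p \<le> 1 + z\<^sup>2" if "0 \<le> z" for z :: real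
  proof (cases "z \<le> 1")
    case True
    then have "z powr p \<le> 1" using that p by (intro powr_le1) auto
    then show ?thesis by (simp add: add_increasing2)
  next
    case False
    then have "z powr p \<le> z powr 2" using p by (intro powr_mono) auto
    then show ?thesis using False by (simp add: powr_numeral)
  qed
  have sq: "sq_integrable M ?x" "sq_integrable M ?y" using i2 by (auto simp: sq_integrable_def)
  have ip: "integrable M (\<lambda>\<omega>. z \<omega> powr p)" if z: "sq_integrable M z" "\<And>\<omega>. 0 \<le> z \<omega>" for z
  proof (rule Bochner_Integration.integrable_bound[where f="\<lambda>\<omega>. 1 + (z \<omega>)\<^sup>2"])
    note [measurable] = sq_integrableD(1)[OF z(1)]
    show "integrable M (\<lambda>\<omega>. 1 + (z \<omega>)\<^sup>2)" using sq_integrableD(2)[OF z(1)] by simp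
    show "(\<lambda>\<omega>. z \<omega> powr p) \<in> borel_measurable M" by measurable
    show "AE \<omega> in M. norm (z \<omega> powr p) \<le> norm (1 + (z \<omega>)\<^sup>2)" using pw[OF z(2)] by (intro AE_I2) (simp add: abs_of_nonneg)
  qed
  define r where "r \<omega> = ?x \<omega> + ?y \<omega>" for \<omega>
  have ir: "integrable M (\<lambda>\<omega>. r \<omega> powr p)"
    unfolding r_def by (rule ip) (auto intro: sq_integrable_add sq)
  define K where "K = 1 / p + 2 / (p - 1) + 1 / (2 - p)"
  have K: "0 \<le> K" using p by (simp add: K_def)
  define G where "G c \<omega> = indicator {0<..} c * (c powr (p - 3) * bw c (?x \<omega>) (?y \<omega>))" for c \<omega>
  have b: "(\<integral>\<^sup>+c. ennreal \<bar>G c \<omega>\<bar> \<partial>lborel) \<le> ennreal (K * r \<omega> powr p)"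
    "(\<integral>c. G c \<omega> \<partial>lborel) = 2 / (p * (2 - p)) * (r \<omega> powr (p - 1) * (?y \<omega> - ?x \<omega> / (p - 1)))" for \<omega>
    unfolding G_def K_def r_def using bw_integral_lt_2[OF p, of "?x \<omega>" "?y \<omega>"] by auto
  have Gm: "(\<lambda>(c, \<omega>). G c \<omega>) \<in> borel_measurable (lborel \<Otimes>\<^sub>M M)" unfolding G_def by measurable
    have "(\<integral>\<^sup>+\<omega>. (\<integral>\<^sup>+c. ennreal \<bar>G c \<omega>\<bar> \<partial>lborel) \<partial>M) \<le> (\<integral>\<^sup>+\<omega>. ennreal (K * r \<omega> powr p) \<partial>M)"
      by (intro nn_integral_mono b)
    also have "\<dots> = ennreal (expectation (\<lambda>\<omega>. K * r \<omega> powr p))"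
      using ir K by (intro nn_integral_eq_integral) auto
    finally have Gf: "(\<integral>\<^sup>+\<omega>. (\<integral>\<^sup>+c. ennreal \<bar>G c \<omega>\<bar> \<partial>lborel) \<partial>M) < \<infinity>" by (simp add: le_less_trans)
  have Gl: "AE c in lborel. expectation (\<lambda>\<omega>. G c \<omega>) \<le> 0"
      using h by (rule AE_mp) (auto intro!: AE_I2 simp: G_def indicator_def mult_nonneg_nonpos)
  note f = fubini_nonpos[OF Gm Gf Gl]
  \<comment> \<open>The constant of \<open>burkholder_pointwise\<close> times the reciprocal of the
    factor in \<open>bw_integral_lt_2\<close>.\<close>
  define a where "a = p * (C / (1 + C)) powr (p - 1) * (p * (2 - p) / 2)"
  have a: "0 \<le> a" using p by (simp add: a_def)
  have le: "?y \<omega> powr p - C powr p * ?x \<omega> powr p \<le> a * (\<integral>c. G c \<omega> \<partial>lborel)" for \<omega>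
  proof -
    have "?y \<omega> powr p - C powr p * ?x \<omega> powr p \<le> p * (C / (1 + C)) powr (p - 1) * (r \<omega> powr (p - 1) * (?y \<omega> - C * ?x \<omega>))"
      unfolding C_def r_def using p by (intro burkholder_pointwise) auto
    also have "\<dots> = a * (\<integral>c. G c \<omega> \<partial>lborel)"
    proof -
      have 1: "p * (2 - p) / 2 * (2 / (p * (2 - p))) = 1" using p by simp
      have 2: "(k * c) * (d * X) = k * X" if "c * d = 1" for k c d X :: real
        using that by (metis mult.assoc mult.left_commute mult_1)
      have 3: "?x \<omega> / (p - 1) = C * ?x \<omega>" by (simp add: Ce)
      show ?thesis unfolding b(2) a_def 2[OF 1] 3 ..
    qed
    finally show ?thesis .
  qed
  have iy: "integrable M (\<lambda>\<omega>. ?y \<omega> powr p)" and ix: "integrable M (\<lambda>\<omega>. ?x \<omega> powr p)" by (rule ip[OF sq(2)] ip[OF sq(1)], simp)+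
  have "expectation (\<lambda>\<omega>. ?y \<omega> powr p) - C powr p * expectation (\<lambda>\<omega>. ?x \<omega> powr p) = expectation (\<lambda>\<omega>. ?y \<omega> powr p - C powr p * ?x \<omega> powr p)"
    using ix iy by simp
  also have "\<dots> \<le> expectation (\<lambda>\<omega>. a * (\<integral>c. G c \<omega> \<partial>lborel))"
    using ix iy f(1) le by (intro integral_mono) auto
  also have "\<dots> \<le> 0" using f(2) a by (simp add: mult_nonneg_nonpos)
  finally have fin: "expectation (\<lambda>\<omega>. ?y \<omega> powr p) \<le> C powr p * expectation (\<lambda>\<omega>. ?x \<omega> powr p)" by simp
  have "(\<integral>\<^sup>+\<omega>. ennreal (?y \<omega> powr p) \<partial>M) = ennreal (expectation (\<lambda>\<omega>. ?y \<omega> powr p))"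
    using iy by (intro nn_integral_eq_integral) auto
  also have "\<dots> \<le> ennreal (C powr p * expectation (\<lambda>\<omega>. ?x \<omega> powr p))" by (rule ennreal_leI[OF fin])
  also have "\<dots> = ennreal (C powr p) * ennreal (expectation (\<lambda>\<omega>. ?x \<omega> powr p))" by (simp add: ennreal_mult)
  also have "ennreal (expectation (\<lambda>\<omega>. ?x \<omega> powr p)) = (\<integral>\<^sup>+\<omega>. ennreal (?x \<omega> powr p) \<partial>M)"
    using ix by (intro nn_integral_eq_integral[symmetric]) auto
  finally show ?thesis by (simp add: C_def)
qed

text \<open>Only second moments of \<open>Q\<close> are available at the start, so the estimate is
  first made for \<open>Q\<close> where its modulus is at most R, with a bound independent of R. If
  the right side is infinite nothing is to be shown, the constant being positive.\<close>

lemma burkholder_lp_gt_2: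
  fixes P Q :: "'a \<Rightarrow> complex"
  assumes [measurable]: "P \<in> borel_measurable M" "Q \<in> borel_measurable M"
    and i2: "integrable M (\<lambda>\<omega>. (cmod (P \<omega>))\<^sup>2)" "integrable M (\<lambda>\<omega>. (cmod (Q \<omega>))\<^sup>2)"
    and p: "2 < p"
    and h: "AE c in lborel. 0 \<le> c \<longrightarrow> expectation (\<lambda>\<omega>. bw c (cmod (Q \<omega>)) (cmod (P \<omega>)) + ((cmod (Q \<omega>))\<^sup>2 - (cmod (P \<omega>))\<^sup>2)) \<le> 0"
  shows "(\<integral>\<^sup>+\<omega>. ennreal (cmod (Q \<omega>) powr p) \<partial>M) \<le> ennreal ((pstar p - 1) powr p) * (\<integral>\<^sup>+\<omega>. ennreal (cmod (P \<omega>) powr p) \<partial>M)"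
proof (cases "(\<integral>\<^sup>+\<omega>. ennreal (cmod (P \<omega>) powr p) \<partial>M) < \<infinity>")
  case False
  then have "(\<integral>\<^sup>+\<omega>. ennreal (cmod (P \<omega>) powr p) \<partial>M) = \<infinity>" by (simp add: less_top[symmetric])
  moreover have "0 < ennreal ((pstar p - 1) powr p)" using p by (simp add: pstar_gt_2)
  ultimately show ?thesis by (simp add: ennreal_mult_top)
next
  case fin: True
  let ?x = "\<lambda>\<omega>. cmod (P \<omega>)" and ?y = "\<lambda>\<omega>. cmod (Q \<omega>)"
  have ix: "integrable M (\<lambda>\<omega>. ?x \<omega> powr p)" using fin by (intro integrableI_nonneg) auto
  have sq: "sq_integrable M ?x" "sq_integrable M ?y" using i2 by (auto simp: sq_integrable_def)
  define r where "r \<omega> = ?x \<omega> + ?y \<omega>" for \<omega>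
  have ir: "integrable M (\<lambda>\<omega>. (r \<omega>)\<^sup>2)"
    unfolding r_def by (rule sq_integrableD(2)[OF sq_integrable_add[OF sq]])
  have main: "(\<integral>\<^sup>+\<omega>. ennreal (if ?y \<omega> \<le> R then ?y \<omega> powr p else 0) \<partial>M) \<le> ennreal ((p - 1) powr p) * (\<integral>\<^sup>+\<omega>. ennreal (?x \<omega> powr p) \<partial>M)"
    if R: "0 < R" for R
  proof -
    define G where "G c \<omega> = indicator {0<..R} c * (c powr (p - 3) * (bw c (?y \<omega>) (?x \<omega>) + ((?y \<omega>)\<^sup>2 - (?x \<omega>)\<^sup>2)))" for c \<omega>
    define a where "a = 2 / (p * (p - 1) * (p - 2)) / (p * ((p - 1) / p) powr (p - 1))"
    have a: "0 < a" using p by (simp add: a_def)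
    define K where "K = R powr (p - 2) / (p - 2)"
    have K: "0 \<le> K" using p by (simp add: K_def)
    have b: "(\<integral>\<^sup>+c. ennreal \<bar>G c \<omega>\<bar> \<partial>lborel) \<le> ennreal (K * (r \<omega>)\<^sup>2)"
      "a * ((if ?y \<omega> \<le> R then ?y \<omega> powr p else 0) - (p - 1) powr p * ?x \<omega> powr p) \<le> (\<integral>c. G c \<omega> \<partial>lborel)" for \<omega>
      unfolding G_def K_def r_def a_def using bw_integral_gt_2[OF p _ _ R, of "?x \<omega>" "?y \<omega>"] by auto
    have Gm: "(\<lambda>(c, \<omega>). G c \<omega>) \<in> borel_measurable (lborel \<Otimes>\<^sub>M M)" unfolding G_def by measurable
      have "(\<integral>\<^sup>+\<omega>. (\<integral>\<^sup>+c. ennreal \<bar>G c \<omega>\<bar> \<partial>lborel) \<partial>M) \<le> (\<integral>\<^sup>+\<omega>. ennreal (K * (r \<omega>)\<^sup>2) \<partial>M)"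
        by (intro nn_integral_mono b)
      also have "\<dots> = ennreal (expectation (\<lambda>\<omega>. K * (r \<omega>)\<^sup>2))"
        using ir K by (intro nn_integral_eq_integral) auto
      finally have Gf: "(\<integral>\<^sup>+\<omega>. (\<integral>\<^sup>+c. ennreal \<bar>G c \<omega>\<bar> \<partial>lborel) \<partial>M) < \<infinity>" by (simp add: le_less_trans)
    have Gl: "AE c in lborel. expectation (\<lambda>\<omega>. G c \<omega>) \<le> 0"
        using h by (rule AE_mp) (auto intro!: AE_I2 simp: G_def indicator_def mult_nonneg_nonpos)
    note f = fubini_nonpos[OF Gm Gf Gl]
    have iy: "integrable M (\<lambda>\<omega>. if ?y \<omega> \<le> R then ?y \<omega> powr p else 0)"
      using R p by (intro integrable_const_bound[where B="R powr p"]) (auto intro!: powr_mono2)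
    have "a * (expectation (\<lambda>\<omega>. if ?y \<omega> \<le> R then ?y \<omega> powr p else 0) - (p - 1) powr p * expectation (\<lambda>\<omega>. ?x \<omega> powr p)) =
       expectation (\<lambda>\<omega>. a * ((if ?y \<omega> \<le> R then ?y \<omega> powr p else 0) - (p - 1) powr p * ?x \<omega> powr p))"
      using ix iy by simp
    also have "\<dots> \<le> expectation (\<lambda>\<omega>. \<integral>c. G c \<omega> \<partial>lborel)"
      using ix iy f(1) b(2) by (intro integral_mono) auto
    also have "\<dots> \<le> 0" by (rule f(2))
    finally have le: "expectation (\<lambda>\<omega>. if ?y \<omega> \<le> R then ?y \<omega> powr p else 0) \<le> (p - 1) powr p * expectation (\<lambda>\<omega>. ?x \<omega> powr p)"
      using a by (simp add: mult_le_0_iff)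
    have "(\<integral>\<^sup>+\<omega>. ennreal (if ?y \<omega> \<le> R then ?y \<omega> powr p else 0) \<partial>M) = ennreal (expectation (\<lambda>\<omega>. if ?y \<omega> \<le> R then ?y \<omega> powr p else 0))"
      using iy by (intro nn_integral_eq_integral) auto
    also have "\<dots> \<le> ennreal ((p - 1) powr p * expectation (\<lambda>\<omega>. ?x \<omega> powr p))" by (rule ennreal_leI[OF le])
    also have "\<dots> = ennreal ((p - 1) powr p) * ennreal (expectation (\<lambda>\<omega>. ?x \<omega> powr p))" by (simp add: ennreal_mult)
    also have "ennreal (expectation (\<lambda>\<omega>. ?x \<omega> powr p)) = (\<integral>\<^sup>+\<omega>. ennreal (?x \<omega> powr p) \<partial>M)"
      using ix by (intro nn_integral_eq_integral[symmetric]) auto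
    finally show ?thesis .
  qed
  \<comment> \<open>The truncated powers increase to the full one, so monotone convergence removes
    the level R.\<close>
  define f where "f n \<omega> = ennreal (if ?y \<omega> \<le> real (Suc n) then ?y \<omega> powr p else 0)" for n \<omega>
  have inc: "incseq f"
    unfolding incseq_def le_fun_def f_def by (auto intro!: ennreal_leI)
  have "(\<integral>\<^sup>+\<omega>. ennreal (?y \<omega> powr p) \<partial>M) \<le> (\<integral>\<^sup>+\<omega>. (SUP n. f n \<omega>) \<partial>M)"
  proof (rule nn_integral_mono)
    fix \<omega>
    obtain n where "?y \<omega> \<le> real n" using real_arch_simple by blast
    then have "ennreal (?y \<omega> powr p) = f n \<omega>" by (simp add: f_def)
    then show "ennreal (?y \<omega> powr p) \<le> (SUP n. f n \<omega>)" by (metis SUP_upper UNIV_I)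
  qed
  also have "\<dots> = (SUP n. \<integral>\<^sup>+\<omega>. f n \<omega> \<partial>M)"
    by (rule nn_integral_monotone_convergence_SUP[OF inc]) (unfold f_def, measurable)
  also have "\<dots> \<le> ennreal ((p - 1) powr p) * (\<integral>\<^sup>+\<omega>. ennreal (?x \<omega> powr p) \<partial>M)"
    unfolding f_def by (intro SUP_least main) simp
  finally show ?thesis using p by (simp add: pstar_gt_2)
qed

text \<open>As c tends to 0 the layer disappears and only the quadratic remains. A positive
  difference of second moments would make the expression positive for all small c, on a set of
  positive measure.\<close>

lemma burkholder_lp_eq_2:
  fixes P Q :: "'a \<Rightarrow> complex"
  assumes [measurable]: "P \<in> borel_measurable M" "Q \<in> borel_measurable M"
    and i2: "integrable M (\<lambda>\<omega>. (cmod (P \<omega>))\<^sup>2)" "integrable M (\<lambda>\<omega>. (cmod (Q \<omega>))\<^sup>2)"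
    and h: "AE c in lborel. 0 \<le> c \<longrightarrow> expectation (\<lambda>\<omega>. bw c (cmod (Q \<omega>)) (cmod (P \<omega>)) + ((cmod (Q \<omega>))\<^sup>2 - (cmod (P \<omega>))\<^sup>2)) \<le> 0"
  shows "expectation (\<lambda>\<omega>. (cmod (Q \<omega>))\<^sup>2) \<le> expectation (\<lambda>\<omega>. (cmod (P \<omega>))\<^sup>2)"
proof (rule ccontr)
  assume neg: "\<not> ?thesis"
  define D where "D = expectation (\<lambda>\<omega>. (cmod (Q \<omega>))\<^sup>2) - expectation (\<lambda>\<omega>. (cmod (P \<omega>))\<^sup>2)"
  have D: "0 < D" using neg by (simp add: D_def)
  have i1: "integrable M (\<lambda>\<omega>. cmod (P \<omega>))" "integrable M (\<lambda>\<omega>. cmod (Q \<omega>))"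
    using i2 by (auto intro!: sq_integrable_integrable simp: sq_integrable_def)
  define K where "K = 6 * expectation (\<lambda>\<omega>. cmod (Q \<omega>)) + 2 * expectation (\<lambda>\<omega>. cmod (P \<omega>))"
  have K: "0 \<le> K" by (simp add: K_def)
  \<comment> \<open>The expected layer is at least - c K, and c K < D for c below this threshold;
    the summand 1 covers K = 0.\<close>
  define \<delta> where "\<delta> = D / (K + 1)"
  have \<delta>: "0 < \<delta>" using D K by (simp add: \<delta>_def)
  have pos: "0 < expectation (\<lambda>\<omega>. bw c (cmod (Q \<omega>)) (cmod (P \<omega>)) + ((cmod (Q \<omega>))\<^sup>2 - (cmod (P \<omega>))\<^sup>2))" if c: "c \<in> {0<..<\<delta>}" for c
  proof -
    have bb: "\<bar>bw c (cmod (Q \<omega>)) (cmod (P \<omega>))\<bar> \<le> c * (6 * cmod (Q \<omega>) + 2 * cmod (P \<omega>))" for \<omega>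
      using bw_lipschitz[of c "cmod (Q \<omega>)" 0 "cmod (P \<omega>)" 0] c by (simp add: bw_zero algebra_simps)
    have ib: "integrable M (\<lambda>\<omega>. bw c (cmod (Q \<omega>)) (cmod (P \<omega>)))"
      by (rule Bochner_Integration.integrable_bound[where f="\<lambda>\<omega>. c * (6 * cmod (Q \<omega>) + 2 * cmod (P \<omega>))"])
        (use i1 bb in \<open>auto intro: order_trans[OF _ abs_ge_self]\<close>)
    have "- (c * K) = expectation (\<lambda>\<omega>. - (c * (6 * cmod (Q \<omega>) + 2 * cmod (P \<omega>))))"
      using i1 by (simp add: K_def)
    also have "\<dots> \<le> expectation (\<lambda>\<omega>. bw c (cmod (Q \<omega>)) (cmod (P \<omega>)))"
      using i1 ib bb by (intro integral_mono) (auto simp: abs_le_iff minus_le_iff)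
    finally have "- (c * K) \<le> expectation (\<lambda>\<omega>. bw c (cmod (Q \<omega>)) (cmod (P \<omega>)))" .
    moreover have "c * K < D"
    proof -
      have "c * K \<le> c * (K + 1)" using c by simp
      also have "\<dots> < D" using c K by (simp add: \<delta>_def field_simps)
      finally show ?thesis .
    qed
    moreover have "expectation (\<lambda>\<omega>. bw c (cmod (Q \<omega>)) (cmod (P \<omega>)) + ((cmod (Q \<omega>))\<^sup>2 - (cmod (P \<omega>))\<^sup>2)) = expectation (\<lambda>\<omega>. bw c (cmod (Q \<omega>)) (cmod (P \<omega>))) + D"
      using ib i2 by (simp add: D_def)
    ultimately show ?thesis by simp
  qed
  have "AE c in lborel. c \<notin> {0<..<\<delta>}"
    using h by (rule AE_mp) (use pos in \<open>force intro!: AE_I2\<close>)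
  then have "{0<..<\<delta>} \<in> null_sets lborel" by (subst (asm) AE_iff_null_sets[symmetric]) auto
  then show False using \<delta> by (auto simp: null_sets_def)
qed

theorem burkholder_lp:
  fixes P Q :: "'a \<Rightarrow> complex"
  assumes PQ [measurable]: "P \<in> borel_measurable M" "Q \<in> borel_measurable M"
    and i2: "integrable M (\<lambda>\<omega>. (cmod (P \<omega>))\<^sup>2)" "integrable M (\<lambda>\<omega>. (cmod (Q \<omega>))\<^sup>2)"
    and p: "1 < p"
    and h0: "AE c in lborel. 0 \<le> c \<longrightarrow> expectation (\<lambda>\<omega>. bw c (cmod (P \<omega>)) (cmod (Q \<omega>))) \<le> 0"
    and h1: "AE c in lborel. 0 \<le> c \<longrightarrow> expectation (\<lambda>\<omega>. bw c (cmod (Q \<omega>)) (cmod (P \<omega>)) + ((cmod (Q \<omega>))\<^sup>2 - (cmod (P \<omega>))\<^sup>2)) \<le> 0"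
  shows "(\<integral>\<^sup>+\<omega>. ennreal (cmod (Q \<omega>) powr p) \<partial>M) \<le> ennreal ((pstar p - 1) powr p) * (\<integral>\<^sup>+\<omega>. ennreal (cmod (P \<omega>) powr p) \<partial>M)"
proof -
  consider "p < 2" | "2 < p" | "p = 2" by linarith
  then show ?thesis
  proof cases
    case 1 then show ?thesis using burkholder_lp_lt_2[OF PQ i2 p _ h0] by simp
  next
    case 2 then show ?thesis using burkholder_lp_gt_2[OF PQ i2 _ h1] by simp
  next
    case 3
    have "pstar 2 = 2" by (simp add: pstar_def)
    moreover have "ennreal (expectation (\<lambda>\<omega>. (cmod (Q \<omega>))\<^sup>2)) \<le> ennreal (expectation (\<lambda>\<omega>. (cmod (P \<omega>))\<^sup>2))"
      by (rule ennreal_leI[OF burkholder_lp_eq_2[OF PQ i2 h1]])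
    moreover have "(\<integral>\<^sup>+\<omega>. ennreal (cmod (Z \<omega>) powr 2) \<partial>M) = ennreal (expectation (\<lambda>\<omega>. (cmod (Z \<omega>))\<^sup>2))" if "integrable M (\<lambda>\<omega>. (cmod (Z \<omega>))\<^sup>2)" for Z :: "'a \<Rightarrow> complex"
      using that by (subst nn_integral_eq_integral[symmetric]) (auto simp: powr_numeral)
    ultimately show ?thesis using 3 i2 by simp
  qed
qed

end

section \<open>Averaging over directions\<close>

lemma nn_integral_reflect:
  fixes f :: "real \<Rightarrow> ennreal"
  assumes [measurable]: "f \<in> borel_measurable borel"
  shows "(\<integral>\<^sup>+x. f (a - x) \<partial>lborel) = (\<integral>\<^sup>+x. f x \<partial>lborel)"
  using nn_integral_real_affine[of f "-1" a] by simp

lemma nn_integral_shift: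
  fixes f :: "real \<Rightarrow> ennreal"
  assumes [measurable]: "f \<in> borel_measurable borel"
  shows "(\<integral>\<^sup>+x. f (a + x) \<partial>lborel) = (\<integral>\<^sup>+x. f x \<partial>lborel)"
  using nn_integral_real_affine[of f 1 a] by simp

text \<open>The portion that the shift pushes below 0 re-enters at the upper end of the
  period.\<close>

lemma nn_integral_periodic:
  fixes h :: "real \<Rightarrow> ennreal"
  assumes [measurable]: "h \<in> borel_measurable borel" and per: "\<And>x. h (x + T) = h x" and a: "0 \<le> a" "a \<le> T"
  shows "(\<integral>\<^sup>+x. h (x - a) * indicator {0..<T} x \<partial>lborel) = (\<integral>\<^sup>+x. h x * indicator {0..<T} x \<partial>lborel)"
proof -
  have "(\<integral>\<^sup>+x. h (x - a) * indicator {0..<T} x \<partial>lborel) = (\<integral>\<^sup>+x. h (x - a) * indicator {0..<a} x + h (x - a) * indicator {a..<T} x \<partial>lborel)"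
    using a by (intro nn_integral_cong) (auto simp: indicator_def)
  also have "\<dots> = (\<integral>\<^sup>+x. h (x - a) * indicator {0..<a} x \<partial>lborel) + (\<integral>\<^sup>+x. h (x - a) * indicator {a..<T} x \<partial>lborel)"
    by (intro nn_integral_add) measurable
  also have "(\<integral>\<^sup>+x. h (x - a) * indicator {0..<a} x \<partial>lborel) = (\<integral>\<^sup>+x. h x * indicator {T - a..<T} x \<partial>lborel)"
  proof -
    have "(\<integral>\<^sup>+x. h x * indicator {T - a..<T} x \<partial>lborel) = (\<integral>\<^sup>+x. h (T - a + x) * indicator {T - a..<T} (T - a + x) \<partial>lborel)"
      by (rule nn_integral_shift[symmetric]) measurable
    also have "\<dots> = (\<integral>\<^sup>+x. h (x - a) * indicator {0..<a} x \<partial>lborel)"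
    proof (rule nn_integral_cong)
      fix x
      have "h (T - a + x) = h (x - a)" using per[of "x - a"] by (simp add: algebra_simps)
      then show "h (T - a + x) * indicator {T - a..<T} (T - a + x) = h (x - a) * indicator {0..<a} x"
        by (auto simp: indicator_def)
    qed
    finally show ?thesis by simp
  qed
  also have "(\<integral>\<^sup>+x. h (x - a) * indicator {a..<T} x \<partial>lborel) = (\<integral>\<^sup>+x. h x * indicator {0..<T - a} x \<partial>lborel)"
  proof -
    have "(\<integral>\<^sup>+x. h (x - a) * indicator {a..<T} x \<partial>lborel) = (\<integral>\<^sup>+x. h ((a + x) - a) * indicator {a..<T} (a + x) \<partial>lborel)"
      by (rule nn_integral_shift[symmetric]) measurable
    also have "\<dots> = (\<integral>\<^sup>+x. h x * indicator {0..<T - a} x \<partial>lborel)"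
      by (rule nn_integral_cong) (auto simp: indicator_def)
    finally show ?thesis .
  qed
  also have "(\<integral>\<^sup>+x. h x * indicator {T - a..<T} x \<partial>lborel) + (\<integral>\<^sup>+x. h x * indicator {0..<T - a} x \<partial>lborel) =
      (\<integral>\<^sup>+x. h x * indicator {T - a..<T} x + h x * indicator {0..<T - a} x \<partial>lborel)"
    by (intro nn_integral_add[symmetric]) measurable
  also have "\<dots> = (\<integral>\<^sup>+x. h x * indicator {0..<T} x \<partial>lborel)"
    using a by (intro nn_integral_cong) (auto simp: indicator_def)
  finally show ?thesis .
qed

text \<open>The substitution of (sin x)^2 for the variable of the Beta integral produces the factor
  2 sin x cos x, which cancels the exponent -1/2 of the first factor and raises the cosine to the
  power p.\<close>

lemma nn_integral_cos_powr_quarter: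
  fixes p :: real
  assumes p: "0 < p"
  shows "(\<integral>\<^sup>+x. ennreal (2 * \<bar>cos x\<bar> powr p) * indicator {0..pi / 2} x \<partial>lborel) = ennreal (Beta (1 / 2) ((p + 1) / 2))"
proof -
  define f :: "real \<Rightarrow> real" where "f t = t powr (1 / 2 - 1) * (1 - t) powr ((p + 1) / 2 - 1)" for t
  have [measurable]: "f \<in> borel_measurable borel" unfolding f_def by measurable
  have f0: "0 \<le> f t" for t by (simp add: f_def)
  have Bp: "(f has_integral Beta (1 / 2) ((p + 1) / 2)) {0..1}"
    unfolding f_def by (rule has_integral_Beta_real) (use p in auto)
  have "has_bochner_integral lborel (\<lambda>t. indicator {0..1} t * f t) (Beta (1 / 2) ((p + 1) / 2))"
    by (rule has_bochner_integral_lborel_nonneg[OF _ _ _ Bp]) (auto simp: f0)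
  then have "(\<integral>\<^sup>+t. ennreal (indicator {0..1} t * f t) \<partial>lborel) = ennreal (Beta (1 / 2) ((p + 1) / 2))"
    using f0 by (subst nn_integral_eq_integral) (auto simp: has_bochner_integral_iff)
  then have "ennreal (Beta (1 / 2) ((p + 1) / 2)) = (\<integral>\<^sup>+t. ennreal (f t * indicator {(sin 0)\<^sup>2..(sin (pi / 2))\<^sup>2} t) \<partial>lborel)"
    by (simp add: mult.commute)
  also have "\<dots> = (\<integral>\<^sup>+x. ennreal (f ((sin x)\<^sup>2) * (2 * sin x * cos x) * indicator {0..pi / 2} x) \<partial>lborel)"
  proof (rule nn_integral_substitution)
    show "((\<lambda>x. (sin x)\<^sup>2) has_real_derivative 2 * sin x * cos x) (at x)" for x :: real
      by (auto intro!: derivative_eq_intros)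
    show "continuous_on {0..pi / 2} (\<lambda>x. 2 * sin x * cos x :: real)" by (intro continuous_intros)
    show "0 \<le> 2 * sin x * cos x" if "x \<in> {0..pi / 2}" for x
      using that by (intro mult_nonneg_nonneg) (auto intro: sin_ge_zero cos_ge_zero)
    show "set_borel_measurable borel {(sin 0)\<^sup>2..(sin (pi / 2))\<^sup>2} f" unfolding set_borel_measurable_def by measurable
  qed simp
  also have "\<dots> = (\<integral>\<^sup>+x. ennreal (2 * \<bar>cos x\<bar> powr p) * indicator {0..pi / 2} x \<partial>lborel)"
  proof (rule nn_integral_cong_AE)
    \<comment> \<open>The point 0 has to be excluded: the transformed integrand is 0 there because
      sin 0 = 0, while the right side is 2.\<close>
    have "AE x in lborel. x \<noteq> (0::real)" by (rule AE_lborel_singleton)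
    then show "AE x in lborel. ennreal (f ((sin x)\<^sup>2) * (2 * sin x * cos x) * indicator {0..pi / 2} x) = ennreal (2 * \<bar>cos x\<bar> powr p) * indicator {0..pi / 2} x"
    proof (rule AE_mp, intro AE_I2 impI)
      fix x :: real assume x0: "x \<noteq> 0"
      show "ennreal (f ((sin x)\<^sup>2) * (2 * sin x * cos x) * indicator {0..pi / 2} x) = ennreal (2 * \<bar>cos x\<bar> powr p) * indicator {0..pi / 2} x"
      proof (cases "x \<in> {0..pi / 2}")
        case True
        then have x: "0 < x" "x \<le> pi / 2" using x0 by auto
        have s: "0 < sin x" using x by (intro sin_gt_zero) (auto simp: pi_half_less_two intro: le_less_trans)
        have c: "0 \<le> cos x" using x by (intro cos_ge_zero) auto
        have e1: "((sin x)\<^sup>2) powr (1 / 2 - 1) = 1 / sin x"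
        proof -
          have "((sin x)\<^sup>2) powr (1 / 2 - 1) = (sin x powr 2) powr (- 1 / 2)" using s by (simp add: powr_numeral)
          also have "\<dots> = sin x powr (- 1)" by (simp add: powr_powr)
          also have "\<dots> = 1 / sin x" using s by (simp add: powr_minus_divide)
          finally show ?thesis .
        qed
        have e2: "(1 - (sin x)\<^sup>2) powr ((p + 1) / 2 - 1) * cos x = cos x powr p"
        proof (cases "cos x = 0")
          case True then show ?thesis by simp
        next
          case False
          then have c': "0 < cos x" using c by simp
          have "1 - (sin x)\<^sup>2 = cos x powr 2" using c' by (simp add: cos_squared_eq[symmetric] powr_numeral)
          then have "(1 - (sin x)\<^sup>2) powr ((p + 1) / 2 - 1) = cos x powr (2 * ((p + 1) / 2 - 1))" by (simp only: powr_powr)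
          also have "2 * ((p + 1) / 2 - 1) = p - 1" by (simp add: field_simps)
          finally have "(1 - (sin x)\<^sup>2) powr ((p + 1) / 2 - 1) = cos x powr (p - 1)" .
          then show ?thesis using c' by (simp add: powr_mult_base mult.commute)
        qed
        have "f ((sin x)\<^sup>2) * (2 * sin x * cos x) = 2 * ((sin x)\<^sup>2 powr (1 / 2 - 1) * sin x) * ((1 - (sin x)\<^sup>2) powr ((p + 1) / 2 - 1) * cos x)"
          by (simp add: f_def mult_ac)
        also have "\<dots> = 2 * cos x powr p" unfolding e1 e2 using s by simp
        finally have "f ((sin x)\<^sup>2) * (2 * sin x * cos x) = 2 * cos x powr p" .
        then show ?thesis using True c by (simp only: indicator_simps mult_1_right abs_of_nonneg)
      qed simp
    qed
  qed
  finally show ?thesis by simp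
qed

text \<open>Since Gamma (1 / 2) is the square root of pi, the p-th power of the constant is a Beta
  value divided by pi, the mean of |cos|^p over a half period.\<close>

lemma Cp2_powr: "0 < p \<Longrightarrow> pi * Cp2 p powr p = Beta (1 / 2) ((p + 1) / 2)"
proof -
  assume p: "0 < p"
  have g: "0 < Gamma ((p + 1) / 2)" "0 < Gamma ((p + 2) / 2)" using p by (auto intro!: Gamma_real_pos)
  have "Cp2 p powr p = Gamma ((p + 1) / 2) / (sqrt pi * Gamma ((p + 2) / 2))"
    unfolding Cp2_def using p g by (simp add: powr_powr)
  moreover have "Beta (1 / 2) ((p + 1) / 2) = sqrt pi * Gamma ((p + 1) / 2) / Gamma ((p + 2) / 2)"
    unfolding Beta_def by (simp add: Gamma_one_half_real add_divide_distrib[symmetric] algebra_simps)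
  moreover have "pi = sqrt pi * sqrt pi" by simp
  ultimately show ?thesis
    by (metis (no_types, lifting) mult.assoc mult_divide_mult_cancel_left_if nonzero_mult_div_cancel_left
        pi_gt_zero real_sqrt_gt_zero less_irrefl times_divide_eq_right)
qed

lemma nn_integral_abs_cos_powr:
  fixes p :: real
  assumes p: "0 < p"
  shows "(\<integral>\<^sup>+x. ennreal (\<bar>cos x\<bar> powr p) * indicator {0..<pi} x \<partial>lborel) = ennreal (pi * Cp2 p powr p)"
proof -
  define h where "h x = ennreal (\<bar>cos x\<bar> powr p)" for x
  have [measurable]: "h \<in> borel_measurable borel" unfolding h_def by measurable
  have "(\<integral>\<^sup>+x. h x * indicator {0..<pi} x \<partial>lborel) = (\<integral>\<^sup>+x. h x * indicator {0..pi / 2} x + h x * indicator {pi / 2..pi} x \<partial>lborel)"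
  proof (rule nn_integral_cong_AE)
    show "AE x in lborel. h x * indicator {0..<pi} x = h x * indicator {0..pi / 2} x + h x * indicator {pi / 2..pi} x"
      using AE_lborel_singleton[of pi] AE_lborel_singleton[of "pi / 2"]
      by eventually_elim (auto simp: indicator_def)
  qed
  also have "\<dots> = (\<integral>\<^sup>+x. h x * indicator {0..pi / 2} x \<partial>lborel) + (\<integral>\<^sup>+x. h x * indicator {pi / 2..pi} x \<partial>lborel)"
    by (rule nn_integral_add) measurable
  also have "(\<integral>\<^sup>+x. h x * indicator {pi / 2..pi} x \<partial>lborel) = (\<integral>\<^sup>+x. h (pi - x) * indicator {pi / 2..pi} (pi - x) \<partial>lborel)"
    by (rule nn_integral_reflect[symmetric]) measurable
  also have "\<dots> = (\<integral>\<^sup>+x. h x * indicator {0..pi / 2} x \<partial>lborel)"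
    by (rule nn_integral_cong) (auto simp: h_def indicator_def cos_diff)
  also have "(\<integral>\<^sup>+x. h x * indicator {0..pi / 2} x \<partial>lborel) + (\<integral>\<^sup>+x. h x * indicator {0..pi / 2} x \<partial>lborel) =
      (\<integral>\<^sup>+x. h x * indicator {0..pi / 2} x + h x * indicator {0..pi / 2} x \<partial>lborel)"
    by (rule nn_integral_add[symmetric]) measurable
  also have "\<dots> = (\<integral>\<^sup>+x. ennreal (2 * \<bar>cos x\<bar> powr p) * indicator {0..pi / 2} x \<partial>lborel)"
  proof (rule nn_integral_cong)
    fix x
    have "ennreal (2 * \<bar>cos x\<bar> powr p) = h x + h x" unfolding h_def by (subst ennreal_plus[symmetric]) simp_all
    then show "h x * indicator {0..pi / 2} x + h x * indicator {0..pi / 2} x = ennreal (2 * \<bar>cos x\<bar> powr p) * indicator {0..pi / 2} x"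
      by (simp add: distrib_right)
  qed
  also have "\<dots> = ennreal (Beta (1 / 2) ((p + 1) / 2))" by (rule nn_integral_cos_powr_quarter[OF p])
  finally show ?thesis by (simp add: Cp2_powr[OF p] h_def)
qed

text \<open>In polar form the component of z in direction x is |z| cos (x - Arg z); since |cos| has
  period pi, the phase does not affect the integral over a half period.\<close>

lemma circle_average:
  fixes p :: real and z :: complex
  assumes p: "0 < p"
  shows "(\<integral>\<^sup>+x. ennreal (\<bar>cos x * Re z + sin x * Im z\<bar> powr p) * indicator {0..<pi} x \<partial>lborel) = ennreal (cmod z powr p) * ennreal (pi * Cp2 p powr p)"
proof -
  obtain a where a: "0 \<le> a" "a \<le> pi" "\<And>x. \<bar>cos x * Re z + sin x * Im z\<bar> = cmod z * \<bar>cos (x - a)\<bar>"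
  proof -
    define b where "b = Arg z"
    have b: "-pi < b" "b \<le> pi" using Arg_bounded[of z] by (auto simp: b_def)
    have z: "z = rcis (cmod z) b" by (simp add: b_def rcis_cmod_Arg)
    have e: "\<bar>cos x * Re z + sin x * Im z\<bar> = cmod z * \<bar>cos (x - b)\<bar>" for x
    proof -
      have "Re z = cmod z * cos b" "Im z = cmod z * sin b" using z by (metis Re_rcis, metis Im_rcis)
      then have "cos x * Re z + sin x * Im z = cmod z * cos (x - b)" by (simp add: cos_diff algebra_simps)
      then show ?thesis by (simp add: abs_mult)
    qed
    show thesis
    proof (cases "0 \<le> b")
      case True then show ?thesis using b e that by blast
    next
      \<comment> \<open>A negative argument is raised by pi, which |cos| does not notice.\<close>
      case False
      have "\<bar>cos (x - (b + pi))\<bar> = \<bar>cos (x - b)\<bar>" for x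
        using cos_periodic_pi2[of "x - (b + pi)"] by (simp add: algebra_simps)
      then show ?thesis using False b e by (intro that[of "b + pi"]) auto
    qed
  qed
  define h where "h x = ennreal (\<bar>cos x\<bar> powr p)" for x
  have [measurable]: "h \<in> borel_measurable borel" unfolding h_def by measurable
  have "(\<integral>\<^sup>+x. ennreal (\<bar>cos x * Re z + sin x * Im z\<bar> powr p) * indicator {0..<pi} x \<partial>lborel) =
     (\<integral>\<^sup>+x. ennreal (cmod z powr p) * (h (x - a) * indicator {0..<pi} x) \<partial>lborel)"
    unfolding a(3) by (intro nn_integral_cong) (simp add: h_def powr_mult ennreal_mult mult.assoc)
  also have "\<dots> = ennreal (cmod z powr p) * (\<integral>\<^sup>+x. h (x - a) * indicator {0..<pi} x \<partial>lborel)"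
    by (rule nn_integral_cmult) measurable
  also have "(\<integral>\<^sup>+x. h (x - a) * indicator {0..<pi} x \<partial>lborel) = (\<integral>\<^sup>+x. h x * indicator {0..<pi} x \<partial>lborel)"
    by (rule nn_integral_periodic[OF _ _ a(1,2)]) (simp_all add: h_def)
  also have "\<dots> = ennreal (pi * Cp2 p powr p)" unfolding h_def by (rule nn_integral_abs_cos_powr[OF p])
  finally show ?thesis .
qed

text \<open>The constants are obtained before the measure and the functions are given, so the same
  pair serves every index of an approximating sequence.\<close>

lemma nn_integral_linear_sq_le:
  fixes f g :: "real^'d \<Rightarrow> real^'d::finite"
  assumes "linear f" "linear g"
  obtains a b :: real where "\<And>N u v. u \<in> borel_measurable N \<Longrightarrow> v \<in> borel_measurable N \<Longrightarrow>
    (\<integral>\<^sup>+z. ennreal ((norm (f (u z) + g (v z)))\<^sup>2) \<partial>N) \<le> ennreal a * (\<integral>\<^sup>+z. ennreal ((norm (u z))\<^sup>2) \<partial>N) + ennreal b * (\<integral>\<^sup>+z. ennreal ((norm (v z))\<^sup>2) \<partial>N)"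
proof -
  obtain B B' where B: "0 < B" "\<And>x. norm (f x) \<le> B * norm x" "0 < B'" "\<And>x. norm (g x) \<le> B' * norm x"
    using linear_bounded_pos[OF assms(1)] linear_bounded_pos[OF assms(2)] by metis
  have "(\<integral>\<^sup>+z. ennreal ((norm (f (u z) + g (v z)))\<^sup>2) \<partial>N) \<le> ennreal (2 * B\<^sup>2) * (\<integral>\<^sup>+z. ennreal ((norm (u z))\<^sup>2) \<partial>N) + ennreal (2 * B'\<^sup>2) * (\<integral>\<^sup>+z. ennreal ((norm (v z))\<^sup>2) \<partial>N)"
    if [measurable]: "u \<in> borel_measurable N" "v \<in> borel_measurable N" for N u v
  proof -
    have "(norm (f x + g y))\<^sup>2 \<le> 2 * B\<^sup>2 * (norm x)\<^sup>2 + 2 * B'\<^sup>2 * (norm y)\<^sup>2" for x y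
    proof -
      have "(norm (f x))\<^sup>2 \<le> (B * norm x)\<^sup>2" "(norm (g y))\<^sup>2 \<le> (B' * norm y)\<^sup>2" using B by (auto intro!: power_mono)
      then show ?thesis using norm_add_sq_le[of "f x" "g y"] by (simp add: power_mult_distrib)
    qed
    then have "(\<integral>\<^sup>+z. ennreal ((norm (f (u z) + g (v z)))\<^sup>2) \<partial>N) \<le> (\<integral>\<^sup>+z. ennreal (2 * B\<^sup>2) * ennreal ((norm (u z))\<^sup>2) + ennreal (2 * B'\<^sup>2) * ennreal ((norm (v z))\<^sup>2) \<partial>N)"
      by (intro nn_integral_mono) (simp add: ennreal_mult[symmetric] ennreal_plus[symmetric] del: ennreal_plus)
    also have "\<dots> = ennreal (2 * B\<^sup>2) * (\<integral>\<^sup>+z. ennreal ((norm (u z))\<^sup>2) \<partial>N) + ennreal (2 * B'\<^sup>2) * (\<integral>\<^sup>+z. ennreal ((norm (v z))\<^sup>2) \<partial>N)"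
      by (subst nn_integral_add) (simp_all add: nn_integral_cmult)
    finally show ?thesis .
  qed
  then show ?thesis using that by blast
qed

section \<open>Conformal pairs\<close>

text \<open>Polarisation: both defining relations are quadratic in x, and evaluating them at h + k
  leaves the mixed terms.\<close>

lemma conformal_pair_inner:
  assumes "conformal_pair A B"
  shows "(A *v h) \<bullet> (A *v k) = (B *v h) \<bullet> (B *v k)" "(A *v h) \<bullet> (B *v k) = - ((A *v k) \<bullet> (B *v h))"
proof -
  have 1: "(A *v x) \<bullet> (A *v x) = (B *v x) \<bullet> (B *v x)" "(A *v x) \<bullet> (B *v x) = 0" for x
    using assms by (auto simp: conformal_pair_def power2_norm_eq_inner[symmetric])
  have "(A *v (h + k)) \<bullet> (A *v (h + k)) = (B *v (h + k)) \<bullet> (B *v (h + k))" by (rule 1)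
  then show "(A *v h) \<bullet> (A *v k) = (B *v h) \<bullet> (B *v k)"
    using 1(1)[of h] 1(1)[of k]
    by (simp add: matrix_vector_right_distrib inner_add_left inner_add_right inner_commute[of "A *v k" "A *v h"] inner_commute[of "B *v k" "B *v h"])
  have "(A *v (h + k)) \<bullet> (B *v (h + k)) = 0" by (rule 1)
  then show "(A *v h) \<bullet> (B *v k) = - ((A *v k) \<bullet> (B *v h))"
    using 1(2)[of h] 1(2)[of k]
    by (simp add: matrix_vector_right_distrib inner_add_left inner_add_right)
qed

text \<open>The vectors A h - B k and A k + B h are the real and imaginary parts of (A + i B)(h + i
  k). For a conformal pair they are orthogonal and of equal length, so all directions on the circle
  see the same norm.\<close>

lemma conformal_pair_norm:
  fixes A B :: "real^'b^'b::finite"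
  assumes cp: "conformal_pair A B"
  shows "(norm (\<alpha> *\<^sub>R (A *v h - B *v k) + \<beta> *\<^sub>R (A *v k + B *v h)))\<^sup>2 = (\<alpha>\<^sup>2 + \<beta>\<^sup>2) * (norm (A *v h - B *v k))\<^sup>2"
proof -
  let ?u = "A *v h - B *v k" and ?v = "A *v k + B *v h"
  have 0: "(A *v x) \<bullet> (B *v x) = 0" "(B *v x) \<bullet> (A *v x) = 0" for x
    using cp by (auto simp: conformal_pair_def inner_commute)
  note c = conformal_pair_inner[OF cp]
  have uv: "?u \<bullet> ?v = 0"
    using c(1)[of h k] by (simp add: inner_add_right inner_diff_left 0 inner_commute[of "B *v k" "B *v h"])
  have vv: "?v \<bullet> ?v = ?u \<bullet> ?u"
    using c(1)[of h h] c(1)[of k k] c(2)[of h k]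
    by (simp add: inner_add_right inner_add_left inner_diff_left inner_diff_right inner_commute[of "B *v h" "A *v k"] inner_commute[of "B *v k" "A *v h"])
  have "(norm (\<alpha> *\<^sub>R u + \<beta> *\<^sub>R v))\<^sup>2 = \<alpha> * \<alpha> * (u \<bullet> u) + 2 * \<alpha> * \<beta> * (u \<bullet> v) + \<beta> * \<beta> * (v \<bullet> v)" for u v :: "real^'b"
    unfolding power2_norm_eq_inner inner_add_left inner_add_right inner_scaleR_left inner_scaleR_right
    by (simp add: inner_commute[of v u] algebra_simps)
  from this[of ?u ?v] show ?thesis unfolding uv vv power2_norm_eq_inner by (simp add: power2_eq_square algebra_simps)
qed

text \<open>The source of sqrt 2 in the final constant: two contractions are subtracted, and |a -
  b|^2 \<le> 2 |a|^2 + 2 |b|^2.\<close>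

lemma conformal_pair_norm_le:
  assumes "op_norm A \<le> 1" "op_norm B \<le> 1"
  shows "(norm (A *v h - B *v k))\<^sup>2 \<le> 2 * ((norm h)\<^sup>2 + (norm k)\<^sup>2)"
proof -
  have le: "norm (C *v x) \<le> norm x" if "op_norm C \<le> 1" for C :: "real^'n^'n" and x
  proof -
    have "norm (C *v x) \<le> onorm ((*v) C) * norm x" by (rule onorm[OF matrix_vector_mul_bounded_linear])
    also have "\<dots> \<le> 1 * norm x" using that by (intro mult_right_mono) (auto simp: op_norm_def)
    finally show ?thesis by simp
  qed
  have "(norm (A *v h))\<^sup>2 \<le> (norm h)\<^sup>2" "(norm (B *v k))\<^sup>2 \<le> (norm k)\<^sup>2"
    using le[OF assms(1)] le[OF assms(2)] by (auto intro!: power_mono)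
  moreover have "(norm (A *v h - B *v k))\<^sup>2 \<le> 2 * (norm (A *v h))\<^sup>2 + 2 * (norm (B *v k))\<^sup>2"
    using norm_add_sq_le[of "A *v h" "- (B *v k)"] by simp
  ultimately have "(norm (A *v h - B *v k))\<^sup>2 \<le> 2 * (norm h)\<^sup>2 + 2 * (norm k)\<^sup>2"
    by (meson add_mono mult_left_mono order_trans zero_le_numeral)
  then show ?thesis by simp
qed

lemma lp_norm_le:
  assumes c: "0 < c" and p: "1 < p"
    and le: "(\<integral>\<^sup>+\<omega>. ennreal (cmod (f \<omega>) powr p) \<partial>M) \<le> ennreal (c powr p) * (\<integral>\<^sup>+\<omega>. ennreal (cmod (g \<omega>) powr p) \<partial>M)"
  shows "lp_norm M p f \<le> ennreal c * lp_norm M p g"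
proof -
  define I where "I = (\<integral>\<^sup>+\<omega>. ennreal (cmod (f \<omega>) powr p) \<partial>M)"
  define J where "J = (\<integral>\<^sup>+\<omega>. ennreal (cmod (g \<omega>) powr p) \<partial>M)"
  show ?thesis
  proof (cases "J = \<infinity>")
    case True
    then have "lp_norm M p g = \<infinity>" by (simp add: lp_norm_def J_def)
    then show ?thesis using c by (simp add: ennreal_mult_top)
  next
    case False
    then obtain j where j: "J = ennreal j" "0 \<le> j" by (cases J) auto
    have IJ: "I \<le> ennreal (c powr p * j)" using le j by (simp add: I_def[symmetric] J_def[symmetric] ennreal_mult)
    then obtain i where i: "I = ennreal i" "0 \<le> i" by (cases I) (auto simp: top_unique)
    have ij: "i \<le> c powr p * j" using IJ i j by (simp add: ennreal_le_iff)
    have "i powr (1 / p) \<le> (c powr p * j) powr (1 / p)" using ij i p by (intro powr_mono2) auto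
    also have "\<dots> = c * j powr (1 / p)" using c p j by (simp add: powr_mult powr_powr)
    finally have "ennreal (i powr (1 / p)) \<le> ennreal c * ennreal (j powr (1 / p))"
      using c by (simp add: ennreal_mult[symmetric] ennreal_leI)
    moreover have "lp_norm M p f = ennreal (i powr (1 / p))" "lp_norm M p g = ennreal (j powr (1 / p))"
      using i j by (simp_all add: lp_norm_def I_def[symmetric] J_def[symmetric])
    ultimately show ?thesis by simp
  qed
qed

section \<open>The conformal transform as a family of Ito integrals\<close>

context brownian
begin

lemma l2_pred_linear:
  assumes fg: "linear f" "linear g" and H: "l2_pred H" and K: "l2_pred K"
  shows "l2_pred (\<lambda>s \<omega>. f (H s \<omega>) + g (K s \<omega>))"
proof -
  have [measurable]: "f \<in> borel_measurable borel" "g \<in> borel_measurable borel"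
    using fg by (auto intro!: borel_measurable_continuous_onI linear_continuous_on simp: linear_conv_bounded_linear)
  have Hp: "predictable M F H" "predictable M F K" using H K by (auto simp: l2_pred_def)
  have [measurable]: "(\<lambda>z. H (fst z) (snd z)) \<in> borel_measurable (pred_sigma M F)" "(\<lambda>z. K (fst z) (snd z)) \<in> borel_measurable (pred_sigma M F)"
    using Hp unfolding predictable_def by (simp_all add: case_prod_beta')
  obtain a b :: real where ab: "\<And>(N :: (real \<times> 'a) measure) u v. u \<in> borel_measurable N \<Longrightarrow> v \<in> borel_measurable N \<Longrightarrow>
    (\<integral>\<^sup>+z. ennreal ((norm (f (u z) + g (v z)))\<^sup>2) \<partial>N) \<le> ennreal a * (\<integral>\<^sup>+z. ennreal ((norm (u z))\<^sup>2) \<partial>N) + ennreal b * (\<integral>\<^sup>+z. ennreal ((norm (v z))\<^sup>2) \<partial>N)"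
    by (fact nn_integral_linear_sq_le[OF fg])
  show ?thesis
    unfolding l2_pred_def
  proof (intro conjI allI impI)
    show "predictable M F (\<lambda>s \<omega>. f (H s \<omega>) + g (K s \<omega>))"
      unfolding predictable_def case_prod_beta' by measurable
    fix t :: real assume t: "0 \<le> t"
    note [measurable] = predictable_measurable[OF Hp(1), of t] predictable_measurable[OF Hp(2), of t]
    have fin: "(\<integral>\<^sup>+z. ennreal ((norm (H (fst z) (snd z)))\<^sup>2) \<partial>prod_meas t) < \<infinity>" "(\<integral>\<^sup>+z. ennreal ((norm (K (fst z) (snd z)))\<^sup>2) \<partial>prod_meas t) < \<infinity>"
      using H K t by (simp_all add: nn_integral_prod_meas l2_pred_def)
    have "(\<integral>\<^sup>+\<omega>. (\<integral>\<^sup>+s\<in>{0..t}. ennreal ((norm (f (H s \<omega>) + g (K s \<omega>)))\<^sup>2) \<partial>lborel) \<partial>M) =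
      (\<integral>\<^sup>+z. ennreal ((norm (f (H (fst z) (snd z)) + g (K (fst z) (snd z))))\<^sup>2) \<partial>prod_meas t)"
      by (subst nn_integral_prod_meas) simp_all
    also have "\<dots> \<le> ennreal a * (\<integral>\<^sup>+z. ennreal ((norm (H (fst z) (snd z)))\<^sup>2) \<partial>prod_meas t) + ennreal b * (\<integral>\<^sup>+z. ennreal ((norm (K (fst z) (snd z)))\<^sup>2) \<partial>prod_meas t)"
      by (rule ab) measurable
    also have "\<dots> < \<infinity>" using fin by (simp add: ennreal_mult_less_top)
    finally show "(\<integral>\<^sup>+\<omega>. (\<integral>\<^sup>+s\<in>{0..t}. ennreal ((norm (f (H s \<omega>) + g (K s \<omega>)))\<^sup>2) \<partial>lborel) \<partial>M) < \<infinity>" .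
  qed
qed

text \<open>Both approximants are moved to the finer of their two levels. On a common grid any
  linear combination of them is again simple, and inequalities between integrands can be checked
  pointwise.\<close>

lemma joint_approx:
  assumes H: "l2_pred H" "l2_pred K" and T: "0 < T"
  obtains m \<xi> \<zeta> where "\<And>k. simple_pred F (2 ^ m k) (dyadic T (m k)) (\<xi> k)" "\<And>k. simple_pred F (2 ^ m k) (dyadic T (m k)) (\<zeta> k)"
    "(\<lambda>k. l2_dist T H (simple_proc (2 ^ m k) (dyadic T (m k)) (\<xi> k))) \<longlonglongrightarrow> 0"
    "(\<lambda>k. l2_dist T K (simple_proc (2 ^ m k) (dyadic T (m k)) (\<zeta> k))) \<longlonglongrightarrow> 0"
proof -
  have Hp: "predictable M F H" "predictable M F K" using H by (auto simp: l2_pred_def)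
  have fin: "(\<integral>\<^sup>+\<omega>. (\<integral>\<^sup>+s\<in>{0..T}. ennreal ((norm (H s \<omega>))\<^sup>2) \<partial>lborel) \<partial>M) < \<infinity>"
    "(\<integral>\<^sup>+\<omega>. (\<integral>\<^sup>+s\<in>{0..T}. ennreal ((norm (K s \<omega>))\<^sup>2) \<partial>lborel) \<partial>M) < \<infinity>"
    using H T by (simp_all add: l2_pred_def)
  obtain m1 \<xi> where 1: "\<And>k. simple_pred F (2 ^ m1 k) (dyadic T (m1 k)) (\<xi> k)"
    "(\<lambda>k. l2_dist T H (simple_proc (2 ^ m1 k) (dyadic T (m1 k)) (\<xi> k))) \<longlonglongrightarrow> 0"
    by (fact dyadic_simple_dense[OF T Hp(1) fin(1)])
  obtain m2 \<zeta> where 2: "\<And>k. simple_pred F (2 ^ m2 k) (dyadic T (m2 k)) (\<zeta> k)"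
    "(\<lambda>k. l2_dist T K (simple_proc (2 ^ m2 k) (dyadic T (m2 k)) (\<zeta> k))) \<longlonglongrightarrow> 0"
    by (fact dyadic_simple_dense[OF T Hp(2) fin(2)])
  define m where "m k = max (m1 k) (m2 k)" for k
  have m: "m1 k \<le> m k" "m2 k \<le> m k" for k by (auto simp: m_def)
  define \<xi>' where "\<xi>' k = (\<lambda>i. simple_proc (2 ^ m1 k) (dyadic T (m1 k)) (\<xi> k) (dyadic T (m k) (Suc i)))" for k
  define \<zeta>' where "\<zeta>' k = (\<lambda>i. simple_proc (2 ^ m2 k) (dyadic T (m2 k)) (\<zeta> k) (dyadic T (m k) (Suc i)))" for k
  note r1 = dyadic_refine[OF 1(1) m(1) T, folded \<xi>'_def] and r2 = dyadic_refine[OF 2(1) m(2) T, folded \<zeta>'_def]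
  show ?thesis
    by (rule that[of m \<xi>' \<zeta>']) (simp_all add: r1 r2 1(2) 2(2))
qed

lemma linear_approx_dist:
  assumes fg: "linear f" "linear g" and H: "l2_pred H" "l2_pred K"
    and sp: "\<And>k. simple_pred F (n k) (\<tau> k) (\<xi> k)" "\<And>k. simple_pred F (n k) (\<tau> k) (\<zeta> k)"
    and lim: "(\<lambda>k. l2_dist T H (simple_proc (n k) (\<tau> k) (\<xi> k))) \<longlonglongrightarrow> 0" "(\<lambda>k. l2_dist T K (simple_proc (n k) (\<tau> k) (\<zeta> k))) \<longlonglongrightarrow> 0"
    and t: "t \<le> T"
  shows "(\<lambda>k. l2_dist t (\<lambda>s \<omega>. f (H s \<omega>) + g (K s \<omega>)) (simple_proc (n k) (\<tau> k) (\<lambda>i \<omega>. f (\<xi> k i \<omega>) + g (\<zeta> k i \<omega>)))) \<longlonglongrightarrow> 0"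
proof -
  have [measurable]: "f \<in> borel_measurable borel" "g \<in> borel_measurable borel"
    using fg by (auto intro!: borel_measurable_continuous_onI linear_continuous_on simp: linear_conv_bounded_linear)
  have Hp: "predictable M F H" "predictable M F K" using H by (auto simp: l2_pred_def)
  obtain a b :: real where ab: "\<And>(N :: (real \<times> 'a) measure) u v. u \<in> borel_measurable N \<Longrightarrow> v \<in> borel_measurable N \<Longrightarrow>
    (\<integral>\<^sup>+z. ennreal ((norm (f (u z) + g (v z)))\<^sup>2) \<partial>N) \<le> ennreal a * (\<integral>\<^sup>+z. ennreal ((norm (u z))\<^sup>2) \<partial>N) + ennreal b * (\<integral>\<^sup>+z. ennreal ((norm (v z))\<^sup>2) \<partial>N)"
    by (fact nn_integral_linear_sq_le[OF fg])
  let ?p = "\<lambda>k \<xi>. simple_proc (n k) (\<tau> k) \<xi>"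
  let ?d1 = "\<lambda>k. l2_dist T H (?p k (\<xi> k))" and ?d2 = "\<lambda>k. l2_dist T K (?p k (\<zeta> k))"
  have "l2_dist T (\<lambda>s \<omega>. f (H s \<omega>) + g (K s \<omega>)) (?p k (\<lambda>i \<omega>. f (\<xi> k i \<omega>) + g (\<zeta> k i \<omega>))) \<le> ennreal a * ?d1 k + ennreal b * ?d2 k" for k
  proof -
    note [measurable] = predictable_measurable[OF Hp(1), of T] predictable_measurable[OF Hp(2), of T]
      simple_proc_measurable[OF sp(1)[of k], of T] simple_proc_measurable[OF sp(2)[of k], of T]
    have "l2_dist T (\<lambda>s \<omega>. f (H s \<omega>) + g (K s \<omega>)) (?p k (\<lambda>i \<omega>. f (\<xi> k i \<omega>) + g (\<zeta> k i \<omega>))) =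
      l2_dist T (\<lambda>s \<omega>. f (H s \<omega>) + g (K s \<omega>)) (\<lambda>s \<omega>. f (?p k (\<xi> k) s \<omega>) + g (?p k (\<zeta> k) s \<omega>))"
      by (simp add: l2_dist_def simple_proc_linear[OF fg])
    also have "\<dots> = (\<integral>\<^sup>+z. ennreal ((norm (f (H (fst z) (snd z)) + g (K (fst z) (snd z)) - (f (?p k (\<xi> k) (fst z) (snd z)) + g (?p k (\<zeta> k) (fst z) (snd z)))))\<^sup>2) \<partial>prod_meas T)"
      by (rule l2_dist_eq) measurable
    also have "\<dots> = (\<integral>\<^sup>+z. ennreal ((norm (f (H (fst z) (snd z) - ?p k (\<xi> k) (fst z) (snd z)) + g (K (fst z) (snd z) - ?p k (\<zeta> k) (fst z) (snd z))))\<^sup>2) \<partial>prod_meas T)"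
      by (simp add: linear_diff[OF fg(1)] linear_diff[OF fg(2)] algebra_simps)
    also have "\<dots> \<le> ennreal a * (\<integral>\<^sup>+z. ennreal ((norm (H (fst z) (snd z) - ?p k (\<xi> k) (fst z) (snd z)))\<^sup>2) \<partial>prod_meas T) + ennreal b * (\<integral>\<^sup>+z. ennreal ((norm (K (fst z) (snd z) - ?p k (\<zeta> k) (fst z) (snd z)))\<^sup>2) \<partial>prod_meas T)"
      by (rule ab) measurable
    also have "\<dots> = ennreal a * ?d1 k + ennreal b * ?d2 k"
      by (simp add: l2_dist_eq)
    finally show ?thesis .
  qed
  then have le: "l2_dist t (\<lambda>s \<omega>. f (H s \<omega>) + g (K s \<omega>)) (?p k (\<lambda>i \<omega>. f (\<xi> k i \<omega>) + g (\<zeta> k i \<omega>))) \<le> ennreal a * ?d1 k + ennreal b * ?d2 k" for k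
    using l2_dist_mono[OF t] order_trans by blast
  have "(\<lambda>k. ennreal a * ?d1 k + ennreal b * ?d2 k) \<longlonglongrightarrow> ennreal a * 0 + ennreal b * 0"
    by (intro tendsto_add ennreal_tendsto_cmult lim) auto
  then have "(\<lambda>k. ennreal a * ?d1 k + ennreal b * ?d2 k) \<longlonglongrightarrow> 0" by simp
  then show ?thesis by (rule ennreal_tendsto_0_le) (rule le)
qed

lemma linear_approx_lim:
  assumes fg: "linear f" "linear g" and H: "l2_pred H" "l2_pred K"
    and sp: "\<And>k. simple_pred F (n k) (\<tau> k) (\<xi> k)" "\<And>k. simple_pred F (n k) (\<tau> k) (\<zeta> k)"
    and lim: "(\<lambda>k. l2_dist T H (simple_proc (n k) (\<tau> k) (\<xi> k))) \<longlonglongrightarrow> 0" "(\<lambda>k. l2_dist T K (simple_proc (n k) (\<tau> k) (\<zeta> k))) \<longlonglongrightarrow> 0"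
    and t: "0 \<le> t" "t \<le> T"
  shows "l2_lim M (\<lambda>k. simple_int W (n k) (\<tau> k) (\<lambda>i \<omega>. f (\<xi> k i \<omega>) + g (\<zeta> k i \<omega>)) t) (ito_int M F W (\<lambda>s \<omega>. f (H s \<omega>) + g (K s \<omega>)) t)"
proof (rule ito_int_limit(1)[OF t(1)])
  show "(\<lambda>z. f (H (fst z) (snd z)) + g (K (fst z) (snd z))) \<in> borel_measurable (prod_meas t)"
    using predictable_measurable[of "\<lambda>s \<omega>. f (H s \<omega>) + g (K s \<omega>)" t] l2_pred_linear[OF fg H] by (simp add: l2_pred_def)
  show "simple_pred F (n k) (\<tau> k) (\<lambda>i \<omega>. f (\<xi> k i \<omega>) + g (\<zeta> k i \<omega>))" for k
    by (rule simple_pred_linear[OF fg sp])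
  show "(\<lambda>k. l2_dist t (\<lambda>s \<omega>. f (H s \<omega>) + g (K s \<omega>)) (simple_proc (n k) (\<tau> k) (\<lambda>i \<omega>. f (\<xi> k i \<omega>) + g (\<zeta> k i \<omega>)))) \<longlonglongrightarrow> 0"
    by (rule linear_approx_dist[OF fg H sp lim t(2)])
qed


text \<open>Time 0 is treated apart because dyadic grids need a positive horizon. Simple integrals
  vanish there, hence so does their L^2 limit, almost surely.\<close>

lemma ito_int_at_0:
  assumes H: "l2_pred H"
  shows "AE \<omega> in M. ito_int M F W H 0 \<omega> = 0"
proof -
  obtain m \<xi> where 1: "\<And>k. simple_pred F (2 ^ m k) (dyadic 1 (m k)) (\<xi> k)"
    "\<And>t. t \<le> 1 \<Longrightarrow> (\<lambda>k. l2_dist t H (simple_proc (2 ^ m k) (dyadic 1 (m k)) (\<xi> k))) \<longlonglongrightarrow> 0"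
    "\<And>t. 0 \<le> t \<Longrightarrow> t \<le> 1 \<Longrightarrow> l2_lim M (\<lambda>k. simple_int W (2 ^ m k) (dyadic 1 (m k)) (\<xi> k) t) (ito_int M F W H t)"
    by (fact l2_pred_approx[OF H zero_less_one])
  have "simple_int W (2 ^ m k) (dyadic 1 (m k)) (\<xi> k) 0 = (\<lambda>\<omega>. 0)" for k
    by (rule ext) (simp add: simple_int_def dyadic_def)
  then have "l2_lim M (\<lambda>k \<omega>. 0) (ito_int M F W H 0)" using 1(3)[of 0] by simp
  then have "expectation (\<lambda>\<omega>. (ito_int M F W H 0 \<omega>)\<^sup>2) = 0" and sq: "sq_integrable M (ito_int M F W H 0)"
    by (auto simp: l2_lim_def LIMSEQ_const_iff)
  then have "AE \<omega> in M. (ito_int M F W H 0 \<omega>)\<^sup>2 = 0"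
    using sq_integrableD(2)[OF sq] by (subst (asm) integral_nonneg_eq_0_iff_AE) auto
  then show ?thesis by simp
qed

text \<open>The component \<alpha> X + \<beta> Y. Points of the unit circle enter in the averaging,
  (1, 1) and (1, -1) in the polarisation of the covariation.\<close>

definition conf_X :: "real^'d^'d \<Rightarrow> real^'d^'d \<Rightarrow> (real \<Rightarrow> 'a \<Rightarrow> real^'d) \<Rightarrow> (real \<Rightarrow> 'a \<Rightarrow> real^'d) \<Rightarrow> real \<Rightarrow> real \<Rightarrow> real \<Rightarrow> 'a \<Rightarrow> real" where
  "conf_X A B H K \<alpha> \<beta> t \<omega> = \<alpha> * (mat_ito M F W A H t \<omega> - mat_ito M F W B K t \<omega>) + \<beta> * (mat_ito M F W A K t \<omega> + mat_ito M F W B H t \<omega>)"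

text \<open>The integrand of \<open>conf_X\<close> is this map at (\<alpha>, \<beta>) applied to
  \<open>H\<close> plus the same map at (\<beta>, - \<alpha>) applied to \<open>K\<close>; the
  quarter turn is multiplication of \<open>K\<close> by i.\<close>

definition conf_f :: "real^'d^'d \<Rightarrow> real^'d^'d \<Rightarrow> real \<Rightarrow> real \<Rightarrow> real^'d \<Rightarrow> real^'d" where
  "conf_f A B \<alpha> \<beta> x = \<alpha> *\<^sub>R (A *v x) + \<beta> *\<^sub>R (B *v x)"

lemma linear_conf_f: "linear (conf_f A B \<alpha> \<beta>)"
  unfolding conf_f_def[abs_def] by (intro linear_compose_add linear_compose_scale_right matrix_vector_mul_linear)

lemma conf_f_sum: "conf_f A B \<alpha> \<beta> h + conf_f A B \<beta> (- \<alpha>) k = \<alpha> *\<^sub>R (A *v h - B *v k) + \<beta> *\<^sub>R (A *v k + B *v h)"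
  by (simp add: conf_f_def algebra_simps)

lemma mat_ito_l2:
  assumes "l2_pred H"
  shows "l2_pred (\<lambda>s \<omega>. A *v H s \<omega>)"
  using l2_pred_linear[OF matrix_vector_mul_linear[of A] linear_zero assms assms] by simp

lemma conf_X_martingale:
  assumes H: "l2_pred H" "l2_pred K"
  shows "real_martingale M F (conf_X A B H K \<alpha> \<beta>)" "0 \<le> s \<Longrightarrow> sq_integrable M (conf_X A B H K \<alpha> \<beta> s)"
proof -
  have m: "real_martingale M F (mat_ito M F W C L)" "0 \<le> s \<Longrightarrow> sq_integrable M (mat_ito M F W C L s)" if "l2_pred L" for C L s
    unfolding mat_ito_def using ito_int_martingale[OF mat_ito_l2[OF that]] ito_int_adapted(2)[OF mat_ito_l2[OF that]] by auto
  have "real_martingale M F (\<lambda>t \<omega>. \<alpha> * (1 * mat_ito M F W A H t \<omega> + (-1) * mat_ito M F W B K t \<omega>) + \<beta> * (1 * mat_ito M F W A K t \<omega> + 1 * mat_ito M F W B H t \<omega>))"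
    by (intro real_martingale_add m H)
  then show "real_martingale M F (conf_X A B H K \<alpha> \<beta>)" by (simp add: conf_X_def[abs_def])
  show "0 \<le> s \<Longrightarrow> sq_integrable M (conf_X A B H K \<alpha> \<beta> s)"
    unfolding conf_X_def[abs_def] by (intro sq_integrable_add sq_integrable_cmult sq_integrable_diff m H)
qed

text \<open>Linearity is used at the level of simple integrals: the combined integrals split into
  the four matrix transforms, each of which converges separately.\<close>

lemma conf_X_lim:
  assumes H: "l2_pred H" "l2_pred K"
    and sp: "\<And>k. simple_pred F (n k) (\<tau> k) (\<xi> k)" "\<And>k. simple_pred F (n k) (\<tau> k) (\<zeta> k)"
    and lim: "(\<lambda>k. l2_dist t H (simple_proc (n k) (\<tau> k) (\<xi> k))) \<longlonglongrightarrow> 0" "(\<lambda>k. l2_dist t K (simple_proc (n k) (\<tau> k) (\<zeta> k))) \<longlonglongrightarrow> 0"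
    and t: "0 \<le> t"
  shows "l2_lim M (\<lambda>k. simple_int W (n k) (\<tau> k) (\<lambda>i \<omega>. conf_f A B \<alpha> \<beta> (\<xi> k i \<omega>) + conf_f A B \<beta> (- \<alpha>) (\<zeta> k i \<omega>)) t) (conf_X A B H K \<alpha> \<beta> t)"
proof -
  let ?I = "\<lambda>k \<xi>. simple_int W (n k) (\<tau> k) \<xi> t"
  have lH: "l2_lim M (\<lambda>k. ?I k (\<lambda>i \<omega>. C *v \<xi> k i \<omega>)) (mat_ito M F W C H t)" for C
    using linear_approx_lim[OF matrix_vector_mul_linear[of C] linear_zero H sp lim t order_refl] by (simp add: mat_ito_def)
  have lK: "l2_lim M (\<lambda>k. ?I k (\<lambda>i \<omega>. C *v \<zeta> k i \<omega>)) (mat_ito M F W C K t)" for C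
    using linear_approx_lim[OF linear_zero matrix_vector_mul_linear[of C] H sp lim t order_refl] by (simp add: mat_ito_def)
  have "l2_lim M (\<lambda>k \<omega>. \<alpha> * (?I k (\<lambda>i \<omega>. A *v \<xi> k i \<omega>) \<omega> - ?I k (\<lambda>i \<omega>. B *v \<zeta> k i \<omega>) \<omega>) + \<beta> * (?I k (\<lambda>i \<omega>. A *v \<zeta> k i \<omega>) \<omega> + ?I k (\<lambda>i \<omega>. B *v \<xi> k i \<omega>) \<omega>)) (conf_X A B H K \<alpha> \<beta> t)"
    unfolding conf_X_def[abs_def] by (intro l2_lim_add l2_lim_cmult l2_lim_diff lH lK)
  moreover have "?I k (\<lambda>i \<omega>. conf_f A B \<alpha> \<beta> (\<xi> k i \<omega>) + conf_f A B \<beta> (- \<alpha>) (\<zeta> k i \<omega>)) = (\<lambda>\<omega>. \<alpha> * (?I k (\<lambda>i \<omega>. A *v \<xi> k i \<omega>) \<omega> - ?I k (\<lambda>i \<omega>. B *v \<zeta> k i \<omega>) \<omega>) + \<beta> * (?I k (\<lambda>i \<omega>. A *v \<zeta> k i \<omega>) \<omega> + ?I k (\<lambda>i \<omega>. B *v \<xi> k i \<omega>) \<omega>))" for k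
    by (rule ext) (unfold conf_f_sum simple_int_def inner_add_left inner_diff_left inner_scaleR_left sum.distrib sum_subtractf sum_distrib_left[symmetric], rule refl)
  ultimately show ?thesis by simp
qed

lemma conf_X_quadratic_variation:
  fixes A B :: "real^'d^'d" and \<alpha> \<beta> :: real
  assumes H: "l2_pred H" "l2_pred K" and t: "0 < t"
  defines "J \<equiv> \<lambda>s \<omega>. \<alpha> *\<^sub>R (A *v H s \<omega> - B *v K s \<omega>) + \<beta> *\<^sub>R (A *v K s \<omega> + B *v H s \<omega>)"
  shows "(\<lambda>N. expectation (\<lambda>\<omega>. \<bar>dyadic_cov (conf_X A B H K \<alpha> \<beta>) (conf_X A B H K \<alpha> \<beta>) t N \<omega> - energy t J \<omega>\<bar>)) \<longlonglongrightarrow> 0"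
    and "integrable M (energy t J)"
proof -
  obtain m \<xi> \<zeta> where a: "\<And>k. simple_pred F (2 ^ m k) (dyadic t (m k)) (\<xi> k)" "\<And>k. simple_pred F (2 ^ m k) (dyadic t (m k)) (\<zeta> k)"
    "(\<lambda>k. l2_dist t H (simple_proc (2 ^ m k) (dyadic t (m k)) (\<xi> k))) \<longlonglongrightarrow> 0"
    "(\<lambda>k. l2_dist t K (simple_proc (2 ^ m k) (dyadic t (m k)) (\<zeta> k))) \<longlonglongrightarrow> 0"
    by (fact joint_approx[OF H t])
  let ?f = "conf_f A B \<alpha> \<beta>" and ?g = "conf_f A B \<beta> (- \<alpha>)"
  have J: "J = (\<lambda>s \<omega>. ?f (H s \<omega>) + ?g (K s \<omega>))" unfolding J_def conf_f_sum ..
  have lJ: "l2_pred J" unfolding J by (rule l2_pred_linear[OF linear_conf_f linear_conf_f H])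
  have Jm: "(\<lambda>z. J (fst z) (snd z)) \<in> borel_measurable (prod_meas t)" and
    fin: "(\<integral>\<^sup>+\<omega>. (\<integral>\<^sup>+v\<in>{0..t}. ennreal ((norm (J v \<omega>))\<^sup>2) \<partial>lborel) \<partial>M) < \<infinity>"
    using lJ t predictable_measurable[of J t] by (auto simp: l2_pred_def)
  have sp: "simple_pred F (2 ^ m k) (dyadic t (m k)) (\<lambda>i \<omega>. ?f (\<xi> k i \<omega>) + ?g (\<zeta> k i \<omega>))" for k
    by (rule simple_pred_linear[OF linear_conf_f linear_conf_f a(1,2)])
  have lim: "(\<lambda>k. l2_dist t J (simple_proc (2 ^ m k) (dyadic t (m k)) (\<lambda>i \<omega>. ?f (\<xi> k i \<omega>) + ?g (\<zeta> k i \<omega>)))) \<longlonglongrightarrow> 0"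
    unfolding J by (rule linear_approx_dist[OF linear_conf_f linear_conf_f H a order_refl])
  show "(\<lambda>N. expectation (\<lambda>\<omega>. \<bar>dyadic_cov (conf_X A B H K \<alpha> \<beta>) (conf_X A B H K \<alpha> \<beta>) t N \<omega> - energy t J \<omega>\<bar>)) \<longlonglongrightarrow> 0"
    by (rule quadratic_variation[OF t Jm fin sp lim conf_X_martingale[OF H] conf_X_lim[OF H a less_imp_le[OF t]]])
  show "integrable M (energy t J)" by (rule energy_limit(1)[OF Jm fin sp lim])
qed

text \<open>By conformality the bracket of \<alpha> X + \<beta> Y is \<alpha>^2 + \<beta>^2 times
  that of X. The directions (1, 0) and (0, 1) therefore share a bracket, and so do (1, 1) and (1,
  -1), which makes the covariation vanish by polarisation.\<close>

lemma conf_X_conformal: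
  assumes H: "l2_pred H" "l2_pred K" and cp: "conformal_pair A B" and t: "0 < t"
  shows "\<exists>V\<in>borel_measurable M. conv_in_prob M (dyadic_cov (conf_X A B H K 1 0) (conf_X A B H K 1 0) t) V \<and>
    conv_in_prob M (dyadic_cov (conf_X A B H K 0 1) (conf_X A B H K 0 1) t) V \<and>
    conv_in_prob M (dyadic_cov (conf_X A B H K 1 0) (conf_X A B H K 0 1) t) (\<lambda>_. 0)"
proof -
  define J where "J = (\<lambda>\<alpha> \<beta> s \<omega>. \<alpha> *\<^sub>R (A *v H s \<omega> - B *v K s \<omega>) + \<beta> *\<^sub>R (A *v K s \<omega> + B *v H s \<omega>))"
  let ?Z = "conf_X A B H K"
  have t0: "0 \<le> t" using t by simp
  have q: "(\<lambda>N. expectation (\<lambda>\<omega>. \<bar>dyadic_cov (?Z \<alpha> \<beta>) (?Z \<alpha> \<beta>) t N \<omega> - energy t (J \<alpha> \<beta>) \<omega>\<bar>)) \<longlonglongrightarrow> 0" "integrable M (energy t (J \<alpha> \<beta>))" for \<alpha> \<beta>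
    unfolding J_def by (rule conf_X_quadratic_variation[OF H t])+
  have en: "energy t (J \<alpha> \<beta>) \<omega> = (\<alpha>\<^sup>2 + \<beta>\<^sup>2) * energy t (J 1 0) \<omega>" for \<alpha> \<beta> \<omega>
    unfolding energy_def J_def conformal_pair_norm[OF cp] by simp
  have iZ: "integrable M (dyadic_cov (?Z \<alpha> \<beta>) (?Z \<gamma> \<delta>) t N)" for \<alpha> \<beta> \<gamma> \<delta> N
    by (intro integrable_dyadic_cov conf_X_martingale H t0)
  \<comment> \<open>Polarisation holds exactly for the dyadic sums, before any limit is
    taken.\<close>
  have cross: "dyadic_cov (?Z 1 0) (?Z 0 1) t N \<omega> = (dyadic_cov (?Z 1 1) (?Z 1 1) t N \<omega> - dyadic_cov (?Z 1 (-1)) (?Z 1 (-1)) t N \<omega>) / 4" for N \<omega>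
  proof -
    have e: "?Z 1 1 s \<omega> = ?Z 1 0 s \<omega> + ?Z 0 1 s \<omega>" "?Z 1 (-1) s \<omega> = ?Z 1 0 s \<omega> - ?Z 0 1 s \<omega>" for s
      by (simp_all add: conf_X_def)
    have id: "((a + b) - (a' + b')) * ((a + b) - (a' + b')) - ((a - b) - (a' - b')) * ((a - b) - (a' - b')) = 4 * ((a - a') * (b - b'))" for a b a' b' :: real
      by (simp add: algebra_simps)
    show ?thesis unfolding dyadic_cov_dyadic e sum_subtractf[symmetric] id by (simp add: sum_distrib_left[symmetric])
  qed
  have 1: "conv_in_prob M (dyadic_cov (?Z 1 0) (?Z 1 0) t) (energy t (J 1 0))"
    by (rule L1_conv_in_prob[OF iZ q(2) q(1)])
  have 2: "conv_in_prob M (dyadic_cov (?Z 0 1) (?Z 0 1) t) (energy t (J 1 0))"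
    using L1_conv_in_prob[OF iZ q(2) q(1), of 0 1] en[of 0 1] by (simp add: fun_eq_iff[of "energy t (J 0 1)"])
  have 3: "conv_in_prob M (dyadic_cov (?Z 1 0) (?Z 0 1) t) (\<lambda>_. 0)"
  proof (rule L1_conv_in_prob[OF iZ])
    let ?D = "\<lambda>\<beta> N. expectation (\<lambda>\<omega>. \<bar>dyadic_cov (?Z 1 \<beta>) (?Z 1 \<beta>) t N \<omega> - energy t (J 1 \<beta>) \<omega>\<bar>)"
    have "(\<lambda>N. ?D 1 N + ?D (-1) N) \<longlonglongrightarrow> 0 + 0" by (intro tendsto_add q(1))
    then have l: "(\<lambda>N. ?D 1 N + ?D (-1) N) \<longlonglongrightarrow> 0" by simp
    show "(\<lambda>N. expectation (\<lambda>\<omega>. \<bar>dyadic_cov (?Z 1 0) (?Z 0 1) t N \<omega> - 0\<bar>)) \<longlonglongrightarrow> 0"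
    proof (rule tendsto_sandwich[OF _ _ tendsto_const l], simp, intro always_eventually allI)
      fix N
      have "expectation (\<lambda>\<omega>. \<bar>dyadic_cov (?Z 1 0) (?Z 0 1) t N \<omega> - 0\<bar>) \<le> expectation (\<lambda>\<omega>. \<bar>dyadic_cov (?Z 1 1) (?Z 1 1) t N \<omega> - energy t (J 1 1) \<omega>\<bar> + \<bar>dyadic_cov (?Z 1 (-1)) (?Z 1 (-1)) t N \<omega> - energy t (J 1 (-1)) \<omega>\<bar>)"
      proof (rule integral_mono)
        show "integrable M (\<lambda>\<omega>. \<bar>dyadic_cov (?Z 1 0) (?Z 0 1) t N \<omega> - 0\<bar>)" using iZ by simp
        show "integrable M (\<lambda>\<omega>. \<bar>dyadic_cov (?Z 1 1) (?Z 1 1) t N \<omega> - energy t (J 1 1) \<omega>\<bar> + \<bar>dyadic_cov (?Z 1 (-1)) (?Z 1 (-1)) t N \<omega> - energy t (J 1 (-1)) \<omega>\<bar>)"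
          using iZ q(2) by simp
        show "\<bar>dyadic_cov (?Z 1 0) (?Z 0 1) t N \<omega> - 0\<bar> \<le> \<bar>dyadic_cov (?Z 1 1) (?Z 1 1) t N \<omega> - energy t (J 1 1) \<omega>\<bar> + \<bar>dyadic_cov (?Z 1 (-1)) (?Z 1 (-1)) t N \<omega> - energy t (J 1 (-1)) \<omega>\<bar>" for \<omega>
        proof -
          have "energy t (J 1 1) \<omega> = energy t (J 1 (-1)) \<omega>" using en[of 1 1 \<omega>] en[of 1 "-1" \<omega>] by simp
          moreover have "\<bar>(x - y) / 4 - 0\<bar> \<le> \<bar>x - e\<bar> + \<bar>y - e\<bar>" for x y e :: real
          proof -
            have "\<bar>x - y\<bar> \<le> \<bar>x - e\<bar> + \<bar>y - e\<bar>" using abs_triangle_ineq4[of "x - e" "y - e"] by simp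
            moreover have "\<bar>(x - y) / 4 - 0\<bar> \<le> \<bar>x - y\<bar>" by simp
            ultimately show ?thesis by (rule order_trans[rotated])
          qed
          ultimately show ?thesis unfolding cross by metis
        qed
      qed
      also have "\<dots> = ?D 1 N + ?D (-1) N" using iZ q(2) by simp
      finally show "expectation (\<lambda>\<omega>. \<bar>dyadic_cov (?Z 1 0) (?Z 0 1) t N \<omega> - 0\<bar>) \<le> ?D 1 N + ?D (-1) N" .
    qed
  qed simp
  show ?thesis using 1 2 3 q(2)[of 1 0] by (intro bexI[of _ "energy t (J 1 0)"]) auto
qed

text \<open>Scaling the direction by 1 / sqrt 2 makes the integrand pointwise dominated by that of M
  + i N, so the differentially subordinate case applies; sqrt 2 is restored at the end.\<close>

lemma conf_X_burkholder:
  assumes H: "l2_pred H" "l2_pred K" and cp: "conformal_pair A B" and op: "op_norm A \<le> 1" "op_norm B \<le> 1"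
    and t: "0 < t" and p: "1 < p" and ab: "\<alpha>\<^sup>2 + \<beta>\<^sup>2 = 1"
  shows "(\<integral>\<^sup>+\<omega>. ennreal (\<bar>conf_X A B H K \<alpha> \<beta> t \<omega>\<bar> powr p) \<partial>M) \<le>
    ennreal ((sqrt 2 * (pstar p - 1)) powr p) * (\<integral>\<^sup>+\<omega>. ennreal (cmod (Complex (ito_int M F W H t \<omega>) (ito_int M F W K t \<omega>)) powr p) \<partial>M)"
proof -
  \<comment> \<open>The squares of the scaled direction sum to 1 / 2, which cancels the factor 2 of
    \<open>conformal_pair_norm_le\<close>.\<close>
  define a b where "a = \<alpha> / sqrt 2" and "b = \<beta> / sqrt 2"
  have ab2: "a\<^sup>2 + b\<^sup>2 = 1 / 2" using ab by (simp add: a_def b_def power_divide add_divide_distrib[symmetric])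
  obtain m \<xi> \<zeta> where ap: "\<And>k. simple_pred F (2 ^ m k) (dyadic t (m k)) (\<xi> k)" "\<And>k. simple_pred F (2 ^ m k) (dyadic t (m k)) (\<zeta> k)"
    "(\<lambda>k. l2_dist t H (simple_proc (2 ^ m k) (dyadic t (m k)) (\<xi> k))) \<longlonglongrightarrow> 0"
    "(\<lambda>k. l2_dist t K (simple_proc (2 ^ m k) (dyadic t (m k)) (\<zeta> k))) \<longlonglongrightarrow> 0"
    by (fact joint_approx[OF H t])
  have t0: "0 \<le> t" using t by simp
  let ?f = "conf_f A B a b" and ?g = "conf_f A B b (- a)"
  define \<eta> where "\<eta> k = (\<lambda>i \<omega>. ?f (\<xi> k i \<omega>) + ?g (\<zeta> k i \<omega>))" for k
  \<comment> \<open>The real process is viewed as a complex one; this is its imaginary part.\<close>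
  define z0 where "z0 = (\<lambda>(i::nat) (\<omega>::'a). 0 :: real^'d)"
  have s\<eta>: "simple_pred F (2 ^ m k) (dyadic t (m k)) (\<eta> k)" for k
    unfolding \<eta>_def by (rule simple_pred_linear[OF linear_conf_f linear_conf_f ap(1,2)])
  have so: "simple_pred F (2 ^ m k) (dyadic t (m k)) z0" for k
    using dyadic_less[OF t, of "m k"] by (simp add: simple_pred_def z0_def)
  let ?p = "\<lambda>k. simple_proc (2 ^ m k) (dyadic t (m k))"
  have po: "?p k z0 v \<omega> = 0" for k v \<omega> by (simp add: simple_proc_def z0_def)
  have p\<eta>: "(norm (?p k (\<eta> k) v \<omega>))\<^sup>2 \<le> (norm (?p k (\<xi> k) v \<omega>))\<^sup>2 + (norm (?p k (\<zeta> k) v \<omega>))\<^sup>2" for k v \<omega>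
  proof -
    have "?p k (\<eta> k) v \<omega> = ?f (?p k (\<xi> k) v \<omega>) + ?g (?p k (\<zeta> k) v \<omega>)"
      unfolding \<eta>_def by (rule simple_proc_linear[OF linear_conf_f linear_conf_f])
    then have "(norm (?p k (\<eta> k) v \<omega>))\<^sup>2 = (1 / 2) * (norm (A *v (?p k (\<xi> k) v \<omega>) - B *v (?p k (\<zeta> k) v \<omega>)))\<^sup>2"
      unfolding conf_f_sum by (simp only: conformal_pair_norm[OF cp] ab2)
    also have "\<dots> \<le> (1 / 2) * (2 * ((norm (?p k (\<xi> k) v \<omega>))\<^sup>2 + (norm (?p k (\<zeta> k) v \<omega>))\<^sup>2))"
      by (intro mult_left_mono conformal_pair_norm_le[OF op]) simp
    finally show ?thesis by simp
  qed
  have lH: "l2_lim M (\<lambda>k. simple_int W (2 ^ m k) (dyadic t (m k)) (\<xi> k) t) (ito_int M F W H t)"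
    using H by (intro ito_int_limit(1)[OF t0 _ ap(1,3)] predictable_measurable) (simp add: l2_pred_def)
  have lK: "l2_lim M (\<lambda>k. simple_int W (2 ^ m k) (dyadic t (m k)) (\<zeta> k) t) (ito_int M F W K t)"
    using H by (intro ito_int_limit(1)[OF t0 _ ap(2,4)] predictable_measurable) (simp add: l2_pred_def)
  have l\<eta>: "l2_lim M (\<lambda>k. simple_int W (2 ^ m k) (dyadic t (m k)) (\<eta> k) t) (conf_X A B H K a b t)"
    unfolding \<eta>_def by (rule conf_X_lim[OF H ap t0])
  have lo: "l2_lim M (\<lambda>k. simple_int W (2 ^ m k) (dyadic t (m k)) z0 t) (\<lambda>\<omega>. 0)"
  proof -
    have "simple_int W (2 ^ m k) (dyadic t (m k)) z0 t = (\<lambda>\<omega>. 0)" for k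
      by (rule ext) (simp add: simple_int_def z0_def)
    then show ?thesis by (simp add: l2_lim_def)
  qed
  let ?P = "\<lambda>\<omega>. Complex (ito_int M F W H t \<omega>) (ito_int M F W K t \<omega>)" and ?Q = "\<lambda>\<omega>. Complex (conf_X A B H K a b t \<omega>) 0"
  \<comment> \<open>With \<kappa> = 0 the dominating pair (H, K) takes the first slot, as required
    for p < 2.\<close>
  have h0: "AE c in lborel. 0 \<le> c \<longrightarrow> expectation (\<lambda>\<omega>. bw c (cmod (?P \<omega>)) (cmod (?Q \<omega>)) + 0 * ((cmod (?P \<omega>))\<^sup>2 - (cmod (?Q \<omega>))\<^sup>2)) \<le> 0"
    by (rule burkholder_limit[OF t ap(1,2) s\<eta> so _ lH lK l\<eta> lo]) (use p\<eta> po in simp)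
  \<comment> \<open>With \<kappa> = 1 the slots are exchanged and the quadratic is added, as
    required for p \<ge> 2.\<close>
  have h1: "AE c in lborel. 0 \<le> c \<longrightarrow> expectation (\<lambda>\<omega>. bw c (cmod (?Q \<omega>)) (cmod (?P \<omega>)) + 1 * ((cmod (?Q \<omega>))\<^sup>2 - (cmod (?P \<omega>))\<^sup>2)) \<le> 0"
    by (rule burkholder_limit[OF t s\<eta> so ap(1,2) _ l\<eta> lo lH lK]) (use p\<eta> po in simp)
  note [measurable] = sq_integrableD(1)[OF l2_limD(2)[OF lH]] sq_integrableD(1)[OF l2_limD(2)[OF lK]] sq_integrableD(1)[OF l2_limD(2)[OF l\<eta>]]
  have "(\<integral>\<^sup>+\<omega>. ennreal (cmod (?Q \<omega>) powr p) \<partial>M) \<le> ennreal ((pstar p - 1) powr p) * (\<integral>\<^sup>+\<omega>. ennreal (cmod (?P \<omega>) powr p) \<partial>M)"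
    by (rule burkholder_lp[OF _ _ l2_lim_cmod_sq(3)[OF lH lK] l2_lim_cmod_sq(3)[OF l\<eta> lo] p]) (use h0 h1 in simp_all)
  then have main: "(\<integral>\<^sup>+\<omega>. ennreal (\<bar>conf_X A B H K a b t \<omega>\<bar> powr p) \<partial>M) \<le> ennreal ((pstar p - 1) powr p) * (\<integral>\<^sup>+\<omega>. ennreal (cmod (?P \<omega>) powr p) \<partial>M)"
    by (simp add: cmod_def)
  have pos: "0 \<le> pstar p - 1" using p by (simp add: pstar_def max_def)
  have sc: "conf_X A B H K \<alpha> \<beta> t \<omega> = sqrt 2 * conf_X A B H K a b t \<omega>" for \<omega>
    by (simp add: conf_X_def a_def b_def distrib_left)
  have "(\<integral>\<^sup>+\<omega>. ennreal (\<bar>conf_X A B H K \<alpha> \<beta> t \<omega>\<bar> powr p) \<partial>M) = (\<integral>\<^sup>+\<omega>. ennreal (sqrt 2 powr p) * ennreal (\<bar>conf_X A B H K a b t \<omega>\<bar> powr p) \<partial>M)"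
    unfolding sc by (simp add: abs_mult powr_mult ennreal_mult)
  also have "\<dots> = ennreal (sqrt 2 powr p) * (\<integral>\<^sup>+\<omega>. ennreal (\<bar>conf_X A B H K a b t \<omega>\<bar> powr p) \<partial>M)"
    by (rule nn_integral_cmult) measurable
  also have "\<dots> \<le> ennreal (sqrt 2 powr p) * (ennreal ((pstar p - 1) powr p) * (\<integral>\<^sup>+\<omega>. ennreal (cmod (?P \<omega>) powr p) \<partial>M))"
    by (rule mult_left_mono[OF main]) simp
  also have "\<dots> = ennreal ((sqrt 2 * (pstar p - 1)) powr p) * (\<integral>\<^sup>+\<omega>. ennreal (cmod (?P \<omega>) powr p) \<partial>M)"
    using pos by (simp add: powr_mult ennreal_mult mult.assoc)
  finally show ?thesis .
qed

text \<open>The bound is the same for every direction. Integrated over a half circle, the left side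
  becomes pi \<open>Cp2 p powr p\<close> times the p-th moment of the modulus, and the right side
  gains the length pi.\<close>

lemma conf_X_lp_norm:
  assumes H: "l2_pred H" "l2_pred K" and cp: "conformal_pair A B" and op: "op_norm A \<le> 1" "op_norm B \<le> 1"
    and t: "0 \<le> t" and p: "1 < p"
  shows "lp_norm M p (\<lambda>\<omega>. Complex (conf_X A B H K 1 0 t \<omega>) (conf_X A B H K 0 1 t \<omega>)) \<le>
    ennreal (sqrt 2 / Cp2 p * (pstar p - 1)) * lp_norm M p (\<lambda>\<omega>. Complex (ito_int M F W H t \<omega>) (ito_int M F W K t \<omega>))"
proof -
  let ?Z = "\<lambda>\<omega>. Complex (conf_X A B H K 1 0 t \<omega>) (conf_X A B H K 0 1 t \<omega>)"
  let ?N = "\<lambda>\<omega>. Complex (ito_int M F W H t \<omega>) (ito_int M F W K t \<omega>)"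
  have C: "0 < Cp2 p"
  proof -
    have "0 < Gamma ((p + 1) / 2)" "0 < Gamma ((p + 2) / 2)" using p by (auto intro!: Gamma_real_pos)
    then show ?thesis by (simp add: Cp2_def)
  qed
  have ps: "0 < pstar p - 1" using p by (simp add: pstar_def max_def field_simps)
  define d where "d = sqrt 2 * (pstar p - 1)"
  have d: "0 < d" using ps by (simp add: d_def)
  have c: "0 < d / Cp2 p" using C d by simp
  have "(\<integral>\<^sup>+\<omega>. ennreal (cmod (?Z \<omega>) powr p) \<partial>M) \<le> ennreal ((d / Cp2 p) powr p) * (\<integral>\<^sup>+\<omega>. ennreal (cmod (?N \<omega>) powr p) \<partial>M)"
  \<comment> \<open>The directional bound rests on dyadic grids of [0, t], so it needs t > 0; at
    time 0 the left side vanishes almost surely.\<close>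
  proof (cases "t = 0")
    case True
    have z: "AE \<omega> in M. mat_ito M F W L G 0 \<omega> = 0" if "l2_pred G" for L G
      unfolding mat_ito_def by (rule ito_int_at_0[OF mat_ito_l2[OF that]])
    have "AE \<omega> in M. ennreal (cmod (?Z \<omega>) powr p) = 0"
      using z[OF H(1), of A] z[OF H(1), of B] z[OF H(2), of A] z[OF H(2), of B]
      by eventually_elim (simp add: True conf_X_def cmod_def)
    then have "(\<integral>\<^sup>+\<omega>. ennreal (cmod (?Z \<omega>) powr p) \<partial>M) = (\<integral>\<^sup>+\<omega>. 0 \<partial>M)" by (rule nn_integral_cong_AE)
    then show ?thesis by simp
  next
    case False
    then have t': "0 < t" using t by simp
    define I where "I = (\<integral>\<^sup>+\<omega>. ennreal (cmod (?N \<omega>) powr p) \<partial>M)"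
    have [measurable]: "conf_X A B H K \<alpha> \<beta> t \<in> borel_measurable M" for \<alpha> \<beta>
      by (rule sq_integrableD(1)[OF conf_X_martingale(2)[OF H t]])
    interpret LM: pair_sigma_finite lborel M by unfold_locales
    let ?h = "\<lambda>x \<omega>. ennreal (\<bar>cos x * Re (?Z \<omega>) + sin x * Im (?Z \<omega>)\<bar> powr p) * indicator {0..<pi} x"
    \<comment> \<open>\<open>circle_average\<close> is applied at each sample point, and Tonelli
      then isolates one direction at a time.\<close>
    have "ennreal (pi * Cp2 p powr p) * (\<integral>\<^sup>+\<omega>. ennreal (cmod (?Z \<omega>) powr p) \<partial>M) = (\<integral>\<^sup>+\<omega>. ennreal (cmod (?Z \<omega>) powr p) * ennreal (pi * Cp2 p powr p) \<partial>M)"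
      by (subst nn_integral_multc) (simp_all add: mult.commute)
    also have "\<dots> = (\<integral>\<^sup>+\<omega>. (\<integral>\<^sup>+x. ?h x \<omega> \<partial>lborel) \<partial>M)"
      by (rule nn_integral_cong, rule circle_average[symmetric]) (use p in simp)
    also have "\<dots> = (\<integral>\<^sup>+x. (\<integral>\<^sup>+\<omega>. ?h x \<omega> \<partial>M) \<partial>lborel)"
      by (rule LM.Fubini') measurable
    also have "\<dots> \<le> (\<integral>\<^sup>+x. (ennreal (d powr p) * I) * indicator {0..<pi} x \<partial>lborel)"
    proof (rule nn_integral_mono)
      fix x :: real
      have "conf_X A B H K (cos x) (sin x) t \<omega> = cos x * Re (?Z \<omega>) + sin x * Im (?Z \<omega>)" for \<omega>
        by (simp add: conf_X_def)
      then have "(\<integral>\<^sup>+\<omega>. ennreal (\<bar>cos x * Re (?Z \<omega>) + sin x * Im (?Z \<omega>)\<bar> powr p) \<partial>M) \<le> ennreal (d powr p) * I"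
        using conf_X_burkholder[OF H cp op t' p, of "cos x" "sin x"] by (simp add: d_def I_def)
      moreover have "(\<integral>\<^sup>+\<omega>. ?h x \<omega> \<partial>M) = (\<integral>\<^sup>+\<omega>. ennreal (\<bar>cos x * Re (?Z \<omega>) + sin x * Im (?Z \<omega>)\<bar> powr p) \<partial>M) * indicator {0..<pi} x"
        by (rule nn_integral_multc) measurable
      ultimately show "(\<integral>\<^sup>+\<omega>. ?h x \<omega> \<partial>M) \<le> (ennreal (d powr p) * I) * indicator {0..<pi} x"
        by (simp add: mult_right_mono)
    qed
    also have "\<dots> = (ennreal (d powr p) * I) * ennreal pi"
      by (subst nn_integral_cmult_indicator) simp_all
    finally have le: "ennreal (pi * Cp2 p powr p) * (\<integral>\<^sup>+\<omega>. ennreal (cmod (?Z \<omega>) powr p) \<partial>M) \<le> (ennreal (d powr p) * I) * ennreal pi" .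
    define s where "s = pi * Cp2 p powr p"
    have s: "0 < s" using C by (simp add: s_def)
    have "(\<integral>\<^sup>+\<omega>. ennreal (cmod (?Z \<omega>) powr p) \<partial>M) = ennreal (1 / s) * (ennreal s * (\<integral>\<^sup>+\<omega>. ennreal (cmod (?Z \<omega>) powr p) \<partial>M))"
      using s by (simp add: mult.assoc[symmetric] ennreal_mult[symmetric])
    also have "\<dots> \<le> ennreal (1 / s) * ((ennreal (d powr p) * I) * ennreal pi)"
      using le unfolding s_def by (intro mult_left_mono) auto
    also have "\<dots> = ennreal (1 / s * d powr p * pi) * I"
    proof -
      have "ennreal (1 / s * d powr p * pi) = ennreal (1 / s) * ennreal (d powr p) * ennreal pi"
        using s by (simp only: ennreal_mult mult_nonneg_nonneg divide_nonneg_pos zero_le_one powr_ge_zero pi_ge_zero)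
      then show ?thesis by (simp only: mult_ac)
    qed
    also have "1 / s * d powr p * pi = (d / Cp2 p) powr p"
      using C d by (simp add: s_def powr_divide)
    finally show ?thesis by (simp add: I_def)
  qed
  from lp_norm_le[OF c p this] show ?thesis by (simp add: d_def)
qed

end

theorem theorem6p6:
  fixes M :: "'a measure"
    and W :: "real \<Rightarrow> 'a \<Rightarrow> real^'d::finite"
    and H K :: "real \<Rightarrow> 'a \<Rightarrow> real^'d"
    and A B :: "real^'d^'d"
    and p :: real
  defines "F \<equiv> nat_filt M W"
  defines "MN \<equiv> (\<lambda>t \<omega>. Complex (ito_int M F W H t \<omega>) (ito_int M F W K t \<omega>))"
  defines "X \<equiv> (\<lambda>t \<omega>. mat_ito M F W A H t \<omega> - mat_ito M F W B K t \<omega>)"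
  defines "Y \<equiv> (\<lambda>t \<omega>. mat_ito M F W A K t \<omega> + mat_ito M F W B H t \<omega>)"
  defines "Z \<equiv> (\<lambda>t \<omega>. Complex (X t \<omega>) (Y t \<omega>))"
  assumes "prob_space M"
    and "brownian_motion M W"
    and "predictable M F H" and "predictable M F K"
    and "\<forall>t\<ge>0. (\<integral>\<^sup>+\<omega>. (\<integral>\<^sup>+s\<in>{0..t}. ennreal ((norm (H s \<omega>))\<^sup>2 + (norm (K s \<omega>))\<^sup>2) \<partial>lborel) \<partial>M) < \<infinity>"
    and "conformal_pair A B"
    and "op_norm A = op_norm B" and "op_norm A \<le> 1"
  shows "conformal_martingale M F Z \<and>
    (\<forall>t\<ge>0. 1 < p \<longrightarrow>
       lp_norm M p (Z t) \<le> ennreal (sqrt 2 / Cp2 p * (pstar p - 1)) * lp_norm M p (MN t))"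
proof -
  interpret brownian M W using assms(6,7) by (simp add: brownian_def brownian_axioms_def)
  \<comment> \<open>The joint energy bounds the energies of \<open>H\<close> and of \<open>K\<close>
    separately.\<close>
  have fin: "(\<integral>\<^sup>+\<omega>. (\<integral>\<^sup>+s\<in>{0..t}. ennreal ((norm (H s \<omega>))\<^sup>2) \<partial>lborel) \<partial>M) < \<infinity>"
    "(\<integral>\<^sup>+\<omega>. (\<integral>\<^sup>+s\<in>{0..t}. ennreal ((norm (K s \<omega>))\<^sup>2) \<partial>lborel) \<partial>M) < \<infinity>" if t: "0 \<le> t" for t
  proof -
    let ?I = "\<integral>\<^sup>+\<omega>. (\<integral>\<^sup>+s\<in>{0..t}. ennreal ((norm (H s \<omega>))\<^sup>2 + (norm (K s \<omega>))\<^sup>2) \<partial>lborel) \<partial>M"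
    have I: "?I < \<infinity>" using assms(10) t by blast
    have "(\<integral>\<^sup>+\<omega>. (\<integral>\<^sup>+s\<in>{0..t}. ennreal ((norm (H s \<omega>))\<^sup>2) \<partial>lborel) \<partial>M) \<le> ?I"
      by (intro nn_integral_mono mult_right_mono ennreal_leI) auto
    then show "(\<integral>\<^sup>+\<omega>. (\<integral>\<^sup>+s\<in>{0..t}. ennreal ((norm (H s \<omega>))\<^sup>2) \<partial>lborel) \<partial>M) < \<infinity>" using I by (rule le_less_trans)
    have "(\<integral>\<^sup>+\<omega>. (\<integral>\<^sup>+s\<in>{0..t}. ennreal ((norm (K s \<omega>))\<^sup>2) \<partial>lborel) \<partial>M) \<le> ?I"
      by (intro nn_integral_mono mult_right_mono ennreal_leI) auto
    then show "(\<integral>\<^sup>+\<omega>. (\<integral>\<^sup>+s\<in>{0..t}. ennreal ((norm (K s \<omega>))\<^sup>2) \<partial>lborel) \<partial>M) < \<infinity>" using I by (rule le_less_trans)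
  qed
  have H: "l2_pred H" "l2_pred K"
    using assms(8,9) fin unfolding l2_pred_def F_def by auto
  have op: "op_norm A \<le> 1" "op_norm B \<le> 1" using assms(12,13) by auto
  have X: "X = conf_X A B H K 1 0" and Y: "Y = conf_X A B H K 0 1"
    by (simp_all add: X_def Y_def F_def conf_X_def fun_eq_iff)
  have "complex_martingale M F Z"
    unfolding complex_martingale_def Z_def X Y F_def using conf_X_martingale(1)[OF H] by simp
  moreover have "conformal M Z"
    unfolding conformal_def Let_def
  proof (intro allI impI)
    fix t :: real assume t: "0 \<le> t"
    show "\<exists>V\<in>borel_measurable M. conv_in_prob M (dyadic_cov (\<lambda>s \<omega>. Re (Z s \<omega>)) (\<lambda>s \<omega>. Re (Z s \<omega>)) t) V \<and>
        conv_in_prob M (dyadic_cov (\<lambda>s \<omega>. Im (Z s \<omega>)) (\<lambda>s \<omega>. Im (Z s \<omega>)) t) V \<and>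
        conv_in_prob M (dyadic_cov (\<lambda>s \<omega>. Re (Z s \<omega>)) (\<lambda>s \<omega>. Im (Z s \<omega>)) t) (\<lambda>_. 0)"
    \<comment> \<open>At t = 0 all sampling points coincide, so every dyadic sum is 0 and the zero
      bracket serves.\<close>
    proof (cases "t = 0")
      case True
      then show ?thesis
        by (intro bexI[of _ "\<lambda>_. 0"]) (simp_all add: conv_in_prob_def dyadic_cov_def)
    next
      case False
      then show ?thesis
        using conf_X_conformal[OF H assms(11), of t] t unfolding Z_def X Y by simp
    qed
  qed
  moreover have "lp_norm M p (Z t) \<le> ennreal (sqrt 2 / Cp2 p * (pstar p - 1)) * lp_norm M p (MN t)" if "0 \<le> t" "1 < p" for t
    using conf_X_lp_norm[OF H assms(11) op that] unfolding Z_def X Y MN_def F_def .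
  ultimately show ?thesis unfolding conformal_martingale_def by blast
qed

end
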